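(* Let $\Omega\subset\mathbb{R}^d$ ($d\ge 2$) be a polytopal domain, and let $(\mathcal{M}_h)_{h\in\mathcal H}=(\mathcal{T}_h,\mathcal{F}_h)_{h\in\mathcal H}$ be a family of polytopal meshes of $\Omega$ such that every element $T\in\mathcal{T}_h$, $h\in\mathcal H$, is connected by star-shaped sets with a parameter $\varrho>0$ independent of $h$. Let $k,l\in\mathbb{N}$ with $l\ge k-1$, and for each $T\in\mathcal{T}_h$ let $\mathrm{s}_T$ be a symmetric positive semi-definite bilinear form on $\underline{U}_T^{k,l}$ satisfying the conditions (S1), (S2), (S3), (S4) listed in the context. Let $\mathrm{A}_h$ be the statically condensed bilinear form defined in the context. For each interior face $F\in\mathcal{F}_h^{\mathrm i}$, denote by $T_F^+,T_F^-$ the two elements on each side of $F$, and define the characteristic lengths $H_{\mathcal{F}_h,\min}$ and $H_{\mathcal{F}_h,\max}$ by $$H_{\mathcal{F}_h,\min}=\min_{F\in\mathcal{F}_h^{\mathrm i}}\left(h_{T_F^+}+h_{T_F^-}\right),\qquad H_{\mathcal{F}_h,\max}^{-1}=\max_{F\in\mathcal{F}_h^{\mathrm i}}\left(h_{T_F^+}^{-1}+h_{T_F^-}^{-1}\right).$$ For each $F\in\mathcal{F}_h^{\mathrm i}$ choose a basis of $\mathbb{P}^k(F)$ that is orthonormal for the $L^2(F)$-inner product, and let $\mathbf{A}_h$ be the matrix of $\mathrm{A}_h$ in the resulting basis of $\mathbb{P}^k_0(\mathcal{F}_h)$. Then there is a constant $C>0$, depending only on $\Omega$, $d$ and $\varrho$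 (and the constant $C_*$ of (S3)--(S4), which itself depends only on $\varrho$ and $d$), and in particular independent of $h$, $k$, $l$, of the number of faces of the elements and of the diameters of the faces, such that the minimal eigenvalue, the maximal eigenvalue and the condition number of $\mathbf{A}_h$ satisfy $$\lambda_{\min}(\mathbf{A}_h)\ge C^{-1} H_{\mathcal{F}_h,\min},\qquad \lambda_{\max}(\mathbf{A}_h)\le C (k+1)^2 H_{\mathcal{F}_h,\max}^{-1},\qquad \kappa(\mathbf{A}_h)\le C (k+1)^2 H_{\mathcal{F}_h,\max}^{-1}H_{\mathcal{F}_h,\min}^{-1}.$$
   Context: **Notation.** $(\cdot,\cdot)_X$ and $\|\cdot\|_X$ are the $L^2$-inner product and norm on $X$ (scalar- or vector-valued functions, natural measure of $X$). $h_X$ is the diameter of $X$. $\mathbb{N}$ contains $0$. $\mathbb{P}^\ell(X)$ is the space of polynomials of total degree $\le\ell$ on $X$, where $X$ is an element ($d$ variables) or a face ($d-1$ variables). $\pi_X^{0,\ell}$ is the $L^2(X)$-orthogonal projector onto $\mathbb{P}^\ell(X)$. **Meshes.** $\mathcal{H}\subset(0,\infty)$ is a countable set whose unique cluster point is $0$. For $h\in\mathcal H$, $\mathcal{T}_h$ is a finite set of disjoint open polytopes with $\overline\Omega=\bigcup_{T\in\mathcal{T}_h}\overline T$ and $h=\max_{T\in\mathcal{T}_h}h_T$; $\mathcal{F}_h$ is a finite set of disjoint flat faces (relatively open polytopal subsets of hyperplanes) with $\bigcup_{T}\partial T=\bigcup_{F\in\mathcal{F}_h}\overline F$, each face being contained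 either in $\partial T\cap\partial T'$ for two distinct elements $T,T'$ (interior faces, forming $\mathcal{F}_h^{\mathrm i}$) or in $\partial T\cap\partial\Omega$ for one element $T$ (boundary faces, forming $\mathcal{F}_h^{\mathrm b}$). $\mathcal{F}_T=\{F\in\mathcal{F}_h: F\subset\partial T\}$, and $\boldsymbol n_{\partial T}$ is the piecewise constant outer unit normal on $\partial T$. A set $T$ is connected by star-shaped sets with parameter $\varrho$ if it is a union of at most $1/\varrho$ sets, each star-shaped with respect to every point of a ball of radius $\varrho h_T$, and such that any two of these sets can be joined by a chain of sets of the collection in which consecutive sets have an intersection containing a ball of radius $\varrho h_T$. **Local spaces.** $\mathbb{P}^k(\mathcal{F}_T)=\{v\in L^1(\partial T): v|_F\in\mathbb{P}^k(F)\ \forall F\in\mathcal{F}_T\}$, and $\pi_{\partial T}^{0,k}$ is defined by $(\pi_{\partial T}^{0,k}v)|_F=\pi_F^{0,k}v$ for $F\in\mathcal{F}_T$. $\underline U_T^{k,l}=\mathbb{P}^l(T)\times\mathbb{P}^k(\mathcal{F}_T)$, with elements $\underline v_T=(v_T,v_{\partial T})$. The interpolator is $\underline I_T^{k,l}v=(\pi_T^{0,l}v,\pi_{\partial T}^{0,k}v)$ for $v\in H^1(T)$. Set $\|\underline v_T\|_{1,T}^2=\|\nabla v_T\|_T^2+h_T^{-1}\|v_{\partial T}-v_T\|_{\partial T}^2$. **Potential reconstruction.** $\mathrm p_T^{k+1}:\underline U_T^{k,l}\to\mathbb{P}^{k+1}(T)$ is defined by $(\nabla\mathrm p_T^{k+1}\underline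 v_T,\nabla w)_T=-(v_T,\Delta w)_T+(v_{\partial T},\nabla w\cdot\boldsymbol n_{\partial T})_{\partial T}$ for all $w\in\mathbb{P}^{k+1}(T)$, and $(v_T-\mathrm p_T^{k+1}\underline v_T,1)_T=0$. Set $\delta_{\partial T}^k\underline v_T=\pi_{\partial T}^{0,k}(\mathrm p_T^{k+1}\underline v_T-v_{\partial T})$. **Bilinear form and conditions on $\mathrm{s}_T$.** $\mathrm a_T(\underline u_T,\underline v_T)=(\nabla\mathrm p_T^{k+1}\underline u_T,\nabla\mathrm p_T^{k+1}\underline v_T)_T+\mathrm s_T(\underline u_T,\underline v_T)$, with: - (S1) $C_{\mathrm a}^{-1}\|\underline v_T\|_{1,T}^2\le\mathrm a_T(\underline v_T,\underline v_T)\le C_{\mathrm a}\|\underline v_T\|_{1,T}^2$ for all $\underline v_T\in\underline U_T^{k,l}$, with $C_{\mathrm a}>0$ possibly depending on $l,k,\varrho,d$ but not on $h_T$; - (S2) $\mathrm s_T(\underline v_T,\underline I_T^{k,l}w)=0$ for all $\underline v_T\in\underline U_T^{k,l}$, $w\in\mathbb{P}^{k+1}(T)$; - (S3) $\|\nabla\mathrm p_T^{k+1}\underline v_T\|_T^2+h_T^{-1}\|\delta_{\partial T}^k\underline v_T\|_{\partial T}^2\le C_*\,\mathrm a_T(\underline v_T,\underline v_T)$ for all $\underline v_T\in\underline U_T^{k,l}$; - (S4) $\mathrm a_T(\underline v_{T,\partial},\underline v_{T,\partial})\le C_*\big(\|\nabla\mathrm p_T^{k+1}\underline v_{T,\partial}\|_T^2+h_T^{-1}\|\delta_{\partial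 T}^k\underline v_{T,\partial}\|_{\partial T}^2\big)$ for all $\underline v_{T,\partial}=(0,v_{\partial T})\in\underline U_T^{k,l}$; where $C_*>0$ depends only on $\varrho$ and $d$ (not on $l,k,h$). **Statically condensed form.** $\mathcal S_T:\mathbb{P}^k(\mathcal{F}_T)\to\mathbb{P}^l(T)$ is the linear map defined by $\mathrm a_T((\mathcal S_Tu_{\partial T},0),(v_T,0))=-\mathrm a_T((0,u_{\partial T}),(v_T,0))$ for all $v_T\in\mathbb{P}^l(T)$. Let $\mathbb{P}^k_0(\mathcal{F}_h)=\{u_{\mathcal{F}_h}=(u_F)_{F\in\mathcal{F}_h}: u_F\in\mathbb{P}^k(F)\ \forall F\in\mathcal{F}_h,\ u_F=0\text{ if }F\subset\partial\Omega\}$, and for $T\in\mathcal{T}_h$ let $u_{\partial T}$ be given by $u_{\partial T}|_F=u_F$, $F\in\mathcal{F}_T$. Then $$\mathrm A_h(u_{\mathcal{F}_h},v_{\mathcal{F}_h})=\sum_{T\in\mathcal{T}_h}\mathrm a_T((\mathcal S_Tu_{\partial T},u_{\partial T}),(0,v_{\partial T})),\qquad u_{\mathcal{F}_h},v_{\mathcal{F}_h}\in\mathbb{P}^k_0(\mathcal{F}_h).$$ $\kappa(\mathbf A_h)=\lambda_{\max}(\mathbf A_h)/\lambda_{\min}(\mathbf A_h)$ is the $\ell^2$-condition number of the symmetric matrix $\mathbf A_h$. *)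

theory Defs
  imports
    "HOL-Analysis.Analysis"
    "HOL-Library.Function_Algebras"
    "HOL-Library.Disjoint_Sets"
    "Jordan_Normal_Form.Char_Poly"
begin

no_notation Matrix.scalar_prod (infix \<open>\<bullet>\<close> 70)

text \<open>Function spaces are real vector spaces with pointwise operations; together with the product
  instance this makes \<open>span\<close> and the vector operations available for the hybrid spaces below.\<close>

instantiation "fun" :: (type, real_vector) real_vector
begin

definition scaleR_fun :: "real \<Rightarrow> ('a \<Rightarrow> 'b) \<Rightarrow> 'a \<Rightarrow> 'b" where
  "scaleR_fun c f = (\<lambda>x. c *\<^sub>R f x)"

instance
  by standard (auto simp: scaleR_fun_def fun_eq_iff scaleR_add_right scaleR_add_left)

end


section \<open>Polytopal meshes\<close>

text \<open>A polytopal set of dimension \<open>m\<close> is the interior, relative to its affine hull, of a finite union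
  of convex polytopes; neither convexity nor simple connectedness is required. For \<open>m = DIM('a)\<close> it is
  an open subset of the whole space, without slits.\<close>

definition polytopal_set :: "int \<Rightarrow> 'a::euclidean_space set \<Rightarrow> bool" where
  "polytopal_set m X \<longleftrightarrow>
     (\<exists>\<P>. finite \<P> \<and> (\<forall>P\<in>\<P>. polytope P) \<and> X = rel_interior (\<Union>\<P>)) \<and> aff_dim X = m"

definition polytopal_domain :: "'a::euclidean_space set \<Rightarrow> bool" where
  "polytopal_domain \<Omega> \<longleftrightarrow> polytopal_set (int DIM('a)) \<Omega> \<and> connected \<Omega>"

definition interior_faces :: "'a::euclidean_space set set \<Rightarrow> 'a set set \<Rightarrow> 'a set set" where
  "interior_faces \<T> \<F> =
     {F \<in> \<F>. \<exists>T\<in>\<T>. \<exists>T'\<in>\<T>. T \<noteq> T' \<and> F \<subseteq> frontier T \<inter> frontier T'}"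

definition boundary_faces ::
  "'a::euclidean_space set \<Rightarrow> 'a set set \<Rightarrow> 'a set set \<Rightarrow> 'a set set" where
  "boundary_faces \<Omega> \<T> \<F> = {F \<in> \<F>. \<exists>T\<in>\<T>. F \<subseteq> frontier T \<inter> frontier \<Omega>}"

definition faces_of :: "'a::euclidean_space set set \<Rightarrow> 'a set \<Rightarrow> 'a set set" where
  "faces_of \<F> T = {F \<in> \<F>. F \<subseteq> frontier T}"

definition polytopal_mesh ::
  "'a::euclidean_space set \<Rightarrow> real \<Rightarrow> 'a set set \<Rightarrow> 'a set set \<Rightarrow> bool" where
  "polytopal_mesh \<Omega> h \<T> \<F> \<longleftrightarrow>
     finite \<T> \<and> disjoint \<T> \<and> (\<forall>T\<in>\<T>. polytopal_set (int DIM('a)) T) \<and>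
     closure \<Omega> = (\<Union>T\<in>\<T>. closure T) \<and>
     h = Max (diameter ` \<T>) \<and>
     finite \<F> \<and> disjoint \<F> \<and> (\<forall>F\<in>\<F>. polytopal_set (int DIM('a) - 1) F) \<and>
     (\<Union>T\<in>\<T>. frontier T) = (\<Union>F\<in>\<F>. closure F) \<and>
     \<F> = interior_faces \<T> \<F> \<union> boundary_faces \<Omega> \<T> \<F>"

definition star_shaped_ball :: "real \<Rightarrow> 'a::euclidean_space set \<Rightarrow> bool" where
  "star_shaped_ball r S \<longleftrightarrow>
     (\<exists>c. \<forall>y\<in>ball c r. y \<in> S \<and> (\<forall>z\<in>S. closed_segment y z \<subseteq> S))"

definition connected_by_star_shaped :: "real \<Rightarrow> 'a::euclidean_space set \<Rightarrow> bool" where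
  "connected_by_star_shaped \<rho> T \<longleftrightarrow>
     (\<exists>\<S>. finite \<S> \<and> real (card \<S>) \<le> 1 / \<rho> \<and> T = \<Union>\<S> \<and>
        (\<forall>S\<in>\<S>. star_shaped_ball (\<rho> * diameter T) S) \<and>
        (\<forall>S\<in>\<S>. \<forall>S'\<in>\<S>.
           (\<lambda>A B. A \<in> \<S> \<and> B \<in> \<S> \<and> (\<exists>c. ball c (\<rho> * diameter T) \<subseteq> A \<inter> B))\<^sup>*\<^sup>* S S'))"

definition polytopal_mesh_family ::
  "'a::euclidean_space set \<Rightarrow> real \<Rightarrow> real set \<Rightarrow> (real \<Rightarrow> 'a set set) \<Rightarrow> (real \<Rightarrow> 'a set set) \<Rightarrow> bool"
where
  "polytopal_mesh_family \<Omega> \<rho> \<H> \<T> \<F> \<longleftrightarrow>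
     \<H> \<subseteq> {0<..} \<and> countable \<H> \<and> (\<forall>x. x islimpt \<H> \<longleftrightarrow> x = 0) \<and>
     (\<forall>h\<in>\<H>. polytopal_mesh \<Omega> h (\<T> h) (\<F> h) \<and> (\<forall>T\<in>\<T> h. connected_by_star_shaped \<rho> T))"

definition H_min :: "'a::euclidean_space set set \<Rightarrow> 'a set set \<Rightarrow> real" where
  "H_min \<T> \<F> = Min {diameter T + diameter T' | T T' F.
     F \<in> interior_faces \<T> \<F> \<and> T \<in> \<T> \<and> T' \<in> \<T> \<and> T \<noteq> T' \<and> F \<subseteq> frontier T \<inter> frontier T'}"

definition H_max :: "'a::euclidean_space set set \<Rightarrow> 'a set set \<Rightarrow> real" where
  "H_max \<T> \<F> = inverse (Max {inverse (diameter T) + inverse (diameter T') | T T' F.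
     F \<in> interior_faces \<T> \<F> \<and> T \<in> \<T> \<and> T' \<in> \<T> \<and> T \<noteq> T' \<and> F \<subseteq> frontier T \<inter> frontier T'})"


section \<open>Measures, polynomials and projections on elements and faces\<close>

text \<open>An orthonormal basis of the direction space of (the hyperplane spanned by) a flat face.\<close>

definition face_dirs :: "'a::euclidean_space set \<Rightarrow> 'a set" where
  "face_dirs F = (SOME B. pairwise Linear_Algebra.orthogonal B \<and> (\<forall>b\<in>B. norm b = 1) \<and>
     span B = span {x - y | x y. x \<in> F \<and> y \<in> F})"

text \<open>The surface measure on the hyperplane of \<open>F\<close>: the image of the \<open>(d-1)\<close>-dimensional Lebesgue
  measure under an isometric parametrization of that hyperplane. It does not depend on the choices of
  origin and orthonormal basis.\<close>

definition face_measure :: "'a::euclidean_space set \<Rightarrow> 'a measure" where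
  "face_measure F = distr (\<Pi>\<^sub>M b\<in>face_dirs F. lborel) borel
     (\<lambda>c. (SOME a. a \<in> F) + (\<Sum>b\<in>face_dirs F. c b *\<^sub>R b))"

text \<open>The codomain is generic so that gradients are covered as well.\<close>

definition elem_inner :: "'a::euclidean_space set \<Rightarrow> ('a \<Rightarrow> 'b::real_inner) \<Rightarrow> ('a \<Rightarrow> 'b) \<Rightarrow> real" where
  "elem_inner T f g = (LINT x:T|lborel. f x \<bullet> g x)"

definition face_inner :: "'a::euclidean_space set \<Rightarrow> ('a \<Rightarrow> real) \<Rightarrow> ('a \<Rightarrow> real) \<Rightarrow> real" where
  "face_inner F f g = (LINT x:F|face_measure F. f x \<bullet> g x)"

text \<open>A function on the boundary of an element with set of faces \<open>\<G>\<close> is given by the family of its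
  restrictions to the faces in \<open>\<G>\<close>, which cover the boundary up to a null set.\<close>

definition bdry_inner ::
  "'a::euclidean_space set set \<Rightarrow> ('a set \<Rightarrow> 'a \<Rightarrow> real) \<Rightarrow> ('a set \<Rightarrow> 'a \<Rightarrow> real) \<Rightarrow> real" where
  "bdry_inner \<G> v w = (\<Sum>F\<in>\<G>. face_inner F (v F) (w F))"

definition elem_norm :: "'a::euclidean_space set \<Rightarrow> ('a \<Rightarrow> 'b::real_inner) \<Rightarrow> real" where
  "elem_norm T f = sqrt (elem_inner T f f)"

definition bdry_norm :: "'a::euclidean_space set set \<Rightarrow> ('a set \<Rightarrow> 'a \<Rightarrow> real) \<Rightarrow> real" where
  "bdry_norm \<G> v = sqrt (bdry_inner \<G> v v)"

text \<open>Polynomials of total degree at most \<open>m\<close> in the Cartesian coordinates \<open>x \<bullet> b\<close>, \<open>b \<in> B\<close>.\<close>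

definition polys_in :: "'a::euclidean_space set \<Rightarrow> nat \<Rightarrow> ('a \<Rightarrow> real) set" where
  "polys_in B m = span {(\<lambda>x. \<Prod>b\<in>B. (x \<bullet> b) ^ \<alpha> b) | \<alpha>. (\<Sum>b\<in>B. \<alpha> b) \<le> m}"

text \<open>A polynomial on an element (a nonempty open set) is identified with the corresponding polynomial
  function on the whole space. A polynomial in \<open>d - 1\<close> variables on a face \<open>F\<close> is identified with
  its extension that is constant in the direction normal to \<open>F\<close>. Both identifications are
  one-to-one.\<close>

definition elem_polys :: "nat \<Rightarrow> ('a::euclidean_space \<Rightarrow> real) set" where
  "elem_polys m = polys_in Basis m"

definition face_polys :: "'a::euclidean_space set \<Rightarrow> nat \<Rightarrow> ('a \<Rightarrow> real) set" where
  "face_polys F m = polys_in (face_dirs F) m"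

definition bdry_polys :: "'a::euclidean_space set set \<Rightarrow> nat \<Rightarrow> ('a set \<Rightarrow> 'a \<Rightarrow> real) set" where
  "bdry_polys \<G> k = {v. (\<forall>F\<in>\<G>. v F \<in> face_polys F k) \<and> (\<forall>F. F \<notin> \<G> \<longrightarrow> v F = 0)}"

definition elem_proj :: "'a::euclidean_space set \<Rightarrow> nat \<Rightarrow> ('a \<Rightarrow> real) \<Rightarrow> 'a \<Rightarrow> real" where
  "elem_proj T l f =
     (THE q. q \<in> elem_polys l \<and> (\<forall>r\<in>elem_polys l. elem_inner T q r = elem_inner T f r))"

definition face_proj :: "'a::euclidean_space set \<Rightarrow> nat \<Rightarrow> ('a \<Rightarrow> real) \<Rightarrow> 'a \<Rightarrow> real" where
  "face_proj F k f =
     (THE q. q \<in> face_polys F k \<and> (\<forall>r\<in>face_polys F k. face_inner F q r = face_inner F f r))"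

definition bdry_proj ::
  "'a::euclidean_space set set \<Rightarrow> nat \<Rightarrow> ('a set \<Rightarrow> 'a \<Rightarrow> real) \<Rightarrow> 'a set \<Rightarrow> 'a \<Rightarrow> real" where
  "bdry_proj \<G> k v = (\<lambda>F. if F \<in> \<G> then face_proj F k (v F) else 0)"

definition grad :: "('a::euclidean_space \<Rightarrow> real) \<Rightarrow> 'a \<Rightarrow> 'a" where
  "grad f x = (THE D. GDERIV f x :> D)"

definition laplacian :: "('a::euclidean_space \<Rightarrow> real) \<Rightarrow> 'a \<Rightarrow> real" where
  "laplacian f x = (\<Sum>b\<in>Basis. grad (\<lambda>y. grad f y \<bullet> b) x \<bullet> b)"

definition is_outer_normal :: "'a::euclidean_space set \<Rightarrow> 'a set \<Rightarrow> 'a \<Rightarrow> 'a \<Rightarrow> bool" where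
  "is_outer_normal T F x n \<longleftrightarrow> norm n = 1 \<and> (\<forall>y\<in>F. \<forall>z\<in>F. n \<bullet> (y - z) = 0) \<and>
     (\<exists>e>0. \<forall>t\<in>{0<..<e}. x - t *\<^sub>R n \<in> T \<and> x + t *\<^sub>R n \<notin> T)"

text \<open>At most one vector satisfies \<open>is_outer_normal\<close>. It can fail to exist on a null set of points of
  \<open>F\<close> only (where lower-dimensional parts of the boundary of \<open>T\<close> meet \<open>F\<close>); the value there is
  set to zero.\<close>

definition outer_normal :: "'a::euclidean_space set \<Rightarrow> 'a set \<Rightarrow> 'a \<Rightarrow> 'a" where
  "outer_normal T F x =
     (if \<exists>n. is_outer_normal T F x n then THE n. is_outer_normal T F x n else 0)"


section \<open>Local hybrid spaces and potential reconstruction\<close>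

text \<open>In the following, \<open>\<G>\<close> is the set of faces of the element \<open>T\<close>.\<close>

type_synonym 'a hybrid = "('a \<Rightarrow> real) \<times> ('a set \<Rightarrow> 'a \<Rightarrow> real)"

definition hybrid_space :: "'a::euclidean_space set set \<Rightarrow> nat \<Rightarrow> nat \<Rightarrow> 'a hybrid set" where
  "hybrid_space \<G> k l = elem_polys l \<times> bdry_polys \<G> k"

definition interpolate ::
  "'a::euclidean_space set \<Rightarrow> 'a set set \<Rightarrow> nat \<Rightarrow> nat \<Rightarrow> ('a \<Rightarrow> real) \<Rightarrow> 'a hybrid" where
  "interpolate T \<G> k l v = (elem_proj T l v, bdry_proj \<G> k (\<lambda>F. v))"

definition hybrid_norm_sq :: "'a::euclidean_space set \<Rightarrow> 'a set set \<Rightarrow> 'a hybrid \<Rightarrow> real" where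
  "hybrid_norm_sq T \<G> v =
     (elem_norm T (grad (fst v)))\<^sup>2 +
     inverse (diameter T) * (bdry_norm \<G> (\<lambda>F x. snd v F x - fst v x))\<^sup>2"

definition potential ::
  "'a::euclidean_space set \<Rightarrow> 'a set set \<Rightarrow> nat \<Rightarrow> 'a hybrid \<Rightarrow> 'a \<Rightarrow> real" where
  "potential T \<G> k v = (THE p. p \<in> elem_polys (k + 1) \<and>
     (\<forall>w\<in>elem_polys (k + 1).
        elem_inner T (grad p) (grad w) =
          - elem_inner T (fst v) (laplacian w) +
          bdry_inner \<G> (snd v) (\<lambda>F x. grad w x \<bullet> outer_normal T F x)) \<and>
     elem_inner T (\<lambda>x. fst v x - p x) (\<lambda>x. 1) = 0)"

definition bdry_difference ::
  "'a::euclidean_space set \<Rightarrow> 'a set set \<Rightarrow> nat \<Rightarrow> 'a hybrid \<Rightarrow> 'a set \<Rightarrow> 'a \<Rightarrow> real" where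
  "bdry_difference T \<G> k v = bdry_proj \<G> k (\<lambda>F x. potential T \<G> k v x - snd v F x)"


section \<open>Local bilinear forms and conditions on the stabilization\<close>

definition symmetric_psd_bilinear_on ::
  "'v::real_vector set \<Rightarrow> ('v \<Rightarrow> 'v \<Rightarrow> real) \<Rightarrow> bool" where
  "symmetric_psd_bilinear_on V s \<longleftrightarrow>
     (\<forall>u\<in>V. \<forall>v\<in>V. \<forall>w\<in>V. \<forall>a b. s (a *\<^sub>R u + b *\<^sub>R v) w = a * s u w + b * s v w) \<and>
     (\<forall>u\<in>V. \<forall>v\<in>V. s u v = s v u) \<and>
     (\<forall>u\<in>V. 0 \<le> s u u)"

definition local_form ::
  "'a::euclidean_space set \<Rightarrow> 'a set set \<Rightarrow> nat \<Rightarrow> ('a hybrid \<Rightarrow> 'a hybrid \<Rightarrow> real) \<Rightarrow>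
   'a hybrid \<Rightarrow> 'a hybrid \<Rightarrow> real" where
  "local_form T \<G> k s u v =
     elem_inner T (grad (potential T \<G> k u)) (grad (potential T \<G> k v)) + s u v"

definition stab_S1 ::
  "real \<Rightarrow> 'a::euclidean_space set \<Rightarrow> 'a set set \<Rightarrow> nat \<Rightarrow> nat \<Rightarrow> ('a hybrid \<Rightarrow> 'a hybrid \<Rightarrow> real) \<Rightarrow> bool"
where
  "stab_S1 Ca T \<G> k l s \<longleftrightarrow> (\<forall>v\<in>hybrid_space \<G> k l.
     inverse Ca * hybrid_norm_sq T \<G> v \<le> local_form T \<G> k s v v \<and>
     local_form T \<G> k s v v \<le> Ca * hybrid_norm_sq T \<G> v)"

definition stab_S2 ::
  "'a::euclidean_space set \<Rightarrow> 'a set set \<Rightarrow> nat \<Rightarrow> nat \<Rightarrow> ('a hybrid \<Rightarrow> 'a hybrid \<Rightarrow> real) \<Rightarrow> bool"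
where
  "stab_S2 T \<G> k l s \<longleftrightarrow> (\<forall>v\<in>hybrid_space \<G> k l. \<forall>w\<in>elem_polys (k + 1).
     s v (interpolate T \<G> k l w) = 0)"

definition stab_S3 ::
  "real \<Rightarrow> 'a::euclidean_space set \<Rightarrow> 'a set set \<Rightarrow> nat \<Rightarrow> nat \<Rightarrow> ('a hybrid \<Rightarrow> 'a hybrid \<Rightarrow> real) \<Rightarrow> bool"
where
  "stab_S3 Cs T \<G> k l s \<longleftrightarrow> (\<forall>v\<in>hybrid_space \<G> k l.
     (elem_norm T (grad (potential T \<G> k v)))\<^sup>2 +
     inverse (diameter T) * (bdry_norm \<G> (bdry_difference T \<G> k v))\<^sup>2
       \<le> Cs * local_form T \<G> k s v v)"

definition stab_S4 ::
  "real \<Rightarrow> 'a::euclidean_space set \<Rightarrow> 'a set set \<Rightarrow> nat \<Rightarrow> nat \<Rightarrow> ('a hybrid \<Rightarrow> 'a hybrid \<Rightarrow> real) \<Rightarrow> bool"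
where
  "stab_S4 Cs T \<G> k l s \<longleftrightarrow> (\<forall>v\<in>hybrid_space \<G> k l. fst v = 0 \<longrightarrow>
     local_form T \<G> k s v v \<le>
       Cs * ((elem_norm T (grad (potential T \<G> k v)))\<^sup>2 +
             inverse (diameter T) * (bdry_norm \<G> (bdry_difference T \<G> k v))\<^sup>2))"


section \<open>Static condensation\<close>

definition condense ::
  "'a::euclidean_space set \<Rightarrow> 'a set set \<Rightarrow> nat \<Rightarrow> nat \<Rightarrow> ('a hybrid \<Rightarrow> 'a hybrid \<Rightarrow> real) \<Rightarrow>
   ('a set \<Rightarrow> 'a \<Rightarrow> real) \<Rightarrow> 'a \<Rightarrow> real" where
  "condense T \<G> k l s u = (THE w. w \<in> elem_polys l \<and>
     (\<forall>v\<in>elem_polys l. local_form T \<G> k s (w, 0) (v, 0) = - local_form T \<G> k s (0, u) (v, 0)))"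

definition face_space ::
  "'a::euclidean_space set \<Rightarrow> 'a set set \<Rightarrow> nat \<Rightarrow> ('a set \<Rightarrow> 'a \<Rightarrow> real) set" where
  "face_space \<Omega> \<F> k = {u \<in> bdry_polys \<F> k. \<forall>F\<in>\<F>. F \<subseteq> frontier \<Omega> \<longrightarrow> u F = 0}"

definition restrict_faces ::
  "'a set set \<Rightarrow> ('a set \<Rightarrow> 'a \<Rightarrow> real) \<Rightarrow> 'a set \<Rightarrow> 'a \<Rightarrow> real" where
  "restrict_faces \<G> u = (\<lambda>F. if F \<in> \<G> then u F else 0)"

text \<open>The form is meant for arguments in \<open>face_space \<Omega> \<F> k\<close>.\<close>

definition condensed_form ::
  "'a::euclidean_space set set \<Rightarrow> 'a set set \<Rightarrow> nat \<Rightarrow> nat \<Rightarrow>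
   ('a set \<Rightarrow> 'a hybrid \<Rightarrow> 'a hybrid \<Rightarrow> real) \<Rightarrow>
   ('a set \<Rightarrow> 'a \<Rightarrow> real) \<Rightarrow> ('a set \<Rightarrow> 'a \<Rightarrow> real) \<Rightarrow> real" where
  "condensed_form \<T> \<F> k l s u v =
     (\<Sum>T\<in>\<T>. let \<G> = faces_of \<F> T; u' = restrict_faces \<G> u; v' = restrict_faces \<G> v in
        local_form T \<G> k (s T) (condense T \<G> k l (s T) u', u') (0, v'))"

text \<open>Linear independence of \<open>B\<close> is a consequence of orthonormality.\<close>

definition orthonormal_face_basis ::
  "'a::euclidean_space set \<Rightarrow> nat \<Rightarrow> ('a \<Rightarrow> real) set \<Rightarrow> bool" where
  "orthonormal_face_basis F k B \<longleftrightarrow> span B = face_polys F k \<and>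
     (\<forall>b\<in>B. \<forall>c\<in>B. face_inner F b c = (if b = c then 1 else 0))"

text \<open>The list \<open>bs\<close> enumerates, in an arbitrary order, the basis of \<open>face_space\<close> whose members
  vanish on all faces but one interior face \<open>F\<close>, where they coincide with a member of \<open>B F\<close>.\<close>

definition enumerates_face_basis ::
  "'a::euclidean_space set set \<Rightarrow> 'a set set \<Rightarrow> ('a set \<Rightarrow> ('a \<Rightarrow> real) set) \<Rightarrow>
   ('a set \<Rightarrow> 'a \<Rightarrow> real) list \<Rightarrow> bool" where
  "enumerates_face_basis \<T> \<F> B bs \<longleftrightarrow> distinct bs \<and>
     set bs = {(\<lambda>G. if G = F then b else 0) | F b. F \<in> interior_faces \<T> \<F> \<and> b \<in> B F}"

definition matrix_of_form :: "('v \<Rightarrow> 'v \<Rightarrow> real) \<Rightarrow> 'v list \<Rightarrow> real Matrix.mat" where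
  "matrix_of_form a bs = Matrix.mat (length bs) (length bs) (\<lambda>(i, j). a (bs ! j) (bs ! i))"

definition lambda_min :: "real Matrix.mat \<Rightarrow> real" where
  "lambda_min A = Min {c. eigenvalue A c}"

definition lambda_max :: "real Matrix.mat \<Rightarrow> real" where
  "lambda_max A = Max {c. eigenvalue A c}"

definition condition_number :: "real Matrix.mat \<Rightarrow> real" where
  "condition_number A = lambda_max A / lambda_min A"

end

theory Submission
  imports Defs
begin


text \<open>For coordinates with respect to \<open>L\<^sup>2\<close>-orthonormal bases of the faces, the Rayleigh quotient of the
  matrix is the condensed form of a face function \<open>u\<close> divided by the sum of the squared \<open>L\<^sup>2\<close>-norms of
  \<open>u\<close> on the interior faces. So the form has to be compared with this sum from above and from below.

  \<^bold>\<open>Upper bound.\<close> Static condensation minimizes the local energy for given boundary values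
  (\<open>condensed_energy_le\<close>), so the function \<open>(0, u)\<close> may be inserted on each element, and (S4) reduces
  its energy to its potential \<open>p\<close>. Testing the definition of \<open>p\<close> with \<open>p\<close> itself expresses the energy of
  \<open>p\<close> by a boundary integral of \<open>u\<close> times a normal derivative, which is absorbed by the trace inequality
  \<open>gradient_trace\<close> with constant \<open>(k + 1)\<^sup>2 / h\<close>. That inequality is one-dimensional: on a ray from
  the center of a star-shaped piece to the boundary, a polynomial of degree \<open>k\<close> is a univariate
  polynomial \<open>q\<close>, whose value at the end of \<open>[0, 1]\<close> is at most \<open>k + 1\<close> times its \<open>L\<^sup>2\<close>-norm
  (\<open>poly_endpoint_bound_0\<close>). The cones spanned by the faces and the center do not overlap, and their
  heights are at least \<open>\<rho> h\<close>, so that neither the number nor the size of the faces matters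
  (\<open>star_shaped_trace\<close>).

  \<^bold>\<open>Lower bound.\<close> By (S3), the energy controls the gradients of the potentials \<open>p T\<close> and the projected
  differences of \<open>p T\<close> and \<open>u F\<close>. The projection is harmless, because it reproduces \<open>u F\<close> and
  constants, and \<open>p T\<close> minus a suitable constant is small by the Poincare inequality on \<open>T\<close>
  (\<open>poincare_connected_by_star_shaped\<close>, \<open>potential_boundary_gap\<close>). The \<open>L\<^sup>2\<close>-norm of the potentials is
  controlled by integrating the squares \<open>(p T)\<^sup>2\<close> along parallel rays until they leave the domain. Where
  a ray crosses an interior face, the jump between the two squares is split at the common value
  \<open>(u F)\<^sup>2\<close>, which is zero on boundary faces. After integration over all starting points of rays
  (\<open>broken_poincare\<close>), the terms that contain \<open>p T\<close> without derivative have a small factor and are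
  absorbed (\<open>broken_potential_bound\<close>). A trace inequality without dependence on the degree then gives
  the norms of \<open>u\<close> on the faces, weighted by the diameters of the elements.

  In both directions an interior face collects the weights of its two elements, which is where the
  two characteristic lengths come from. The combinatorial geometry of the mesh is handled by a finite
  hyperplane arrangement that resolves the elements, the faces and the domain: almost every line in a
  direction parallel to none of the hyperplanes crosses only one of them at a time, and there
  at most two elements meet.\<close>


section \<open>Positive semi-definite forms\<close>

lemma psd_form_mono:
  "symmetric_psd_bilinear_on V s \<Longrightarrow> U \<subseteq> V \<Longrightarrow> symmetric_psd_bilinear_on U s"
  unfolding symmetric_psd_bilinear_on_def by blast

lemma psd_form_sym:
  "symmetric_psd_bilinear_on V s \<Longrightarrow> u \<in> V \<Longrightarrow> v \<in> V \<Longrightarrow> s u v = s v u"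
  unfolding symmetric_psd_bilinear_on_def by blast

lemma psd_form_nonneg: "symmetric_psd_bilinear_on V s \<Longrightarrow> u \<in> V \<Longrightarrow> 0 \<le> s u u"
  unfolding symmetric_psd_bilinear_on_def by blast

lemma psd_form_lincomb_left:
  "symmetric_psd_bilinear_on V s \<Longrightarrow> u \<in> V \<Longrightarrow> v \<in> V \<Longrightarrow> w \<in> V \<Longrightarrow>
    s (a *\<^sub>R u + b *\<^sub>R v) w = a * s u w + b * s v w"
  unfolding symmetric_psd_bilinear_on_def by blast

context
  fixes V :: "'v::real_vector set" and s
  assumes V: "subspace V" and s: "symmetric_psd_bilinear_on V s"
begin

lemma psd_form_lincomb_right:
  "u \<in> V \<Longrightarrow> v \<in> V \<Longrightarrow> w \<in> V \<Longrightarrow> s w (a *\<^sub>R u + b *\<^sub>R v) = a * s w u + b * s w v"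
  using psd_form_lincomb_left[OF s, of u v w a b] psd_form_sym[OF s] V
  by (metis (no_types, lifting) subspace_add subspace_scale)

lemma psd_form_add_left: "u \<in> V \<Longrightarrow> v \<in> V \<Longrightarrow> w \<in> V \<Longrightarrow> s (u + v) w = s u w + s v w"
  using psd_form_lincomb_left[OF s, of u v w 1 1] by simp

lemma psd_form_add_right: "u \<in> V \<Longrightarrow> v \<in> V \<Longrightarrow> w \<in> V \<Longrightarrow> s w (u + v) = s w u + s w v"
  using psd_form_lincomb_right[of u v w 1 1] by simp

lemma psd_form_diff_left: "u \<in> V \<Longrightarrow> v \<in> V \<Longrightarrow> w \<in> V \<Longrightarrow> s (u - v) w = s u w - s v w"
  using psd_form_lincomb_left[OF s, of u v w 1 "-1"] by simp

lemma psd_form_diff_right: "u \<in> V \<Longrightarrow> v \<in> V \<Longrightarrow> w \<in> V \<Longrightarrow> s w (u - v) = s w u - s w v"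
  using psd_form_lincomb_right[of u v w 1 "-1"] by simp

lemma psd_form_scale_left: "u \<in> V \<Longrightarrow> w \<in> V \<Longrightarrow> s (a *\<^sub>R u) w = a * s u w"
  using psd_form_lincomb_left[OF s, of u u w a 0] by simp

lemma psd_form_scale_right: "u \<in> V \<Longrightarrow> w \<in> V \<Longrightarrow> s w (a *\<^sub>R u) = a * s w u"
  using psd_form_lincomb_right[of u u w a 0] by simp

text \<open>Otherwise adding a suitable multiple of \<open>v\<close> to \<open>u\<close> would make the quadratic form negative.\<close>

lemma psd_form_kernel:
  assumes "u \<in> V" "v \<in> V" "s v v = 0"
  shows "s u v = 0"
proof (rule ccontr)
  assume ne: "s u v \<noteq> 0"
  define c where "c = - (s u u + 1) / (2 * s u v)"
  have cv: "c *\<^sub>R v \<in> V"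
    using V assms(2) by (simp add: subspace_scale)
  have mem: "u + c *\<^sub>R v \<in> V"
    using V assms(1) cv by (simp add: subspace_add)
  have "s (u + c *\<^sub>R v) (u + c *\<^sub>R v) = s u u + c * s u v + (c * s v u + c * (c * s v v))"
    using assms cv mem by (simp add: psd_form_add_left psd_form_add_right psd_form_scale_left psd_form_scale_right algebra_simps)
  also have "\<dots> = s u u + 2 * (c * s u v)"
    using psd_form_sym[OF s assms(1,2)] assms(3) by simp
  also have "\<dots> = -1"
    using ne by (simp add: c_def field_simps)
  finally show False
    using psd_form_nonneg[OF s mem] by simp
qed

lemma psd_form_sum_right:
  "finite I \<Longrightarrow> (\<And>i. i \<in> I \<Longrightarrow> f i \<in> V) \<Longrightarrow> u \<in> V \<Longrightarrow> s u (\<Sum>i\<in>I. f i) = (\<Sum>i\<in>I. s u (f i))"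
proof (induction I rule: finite_induct)
  case empty
  then show ?case using psd_form_scale_right[of 0 u 0] V by (simp add: subspace_0)
next
  case (insert i I)
  then show ?case using V by (simp add: psd_form_add_right subspace_sum)
qed

lemma psd_form_sum_left:
  "finite I \<Longrightarrow> (\<And>i. i \<in> I \<Longrightarrow> f i \<in> V) \<Longrightarrow> u \<in> V \<Longrightarrow> s (\<Sum>i\<in>I. f i) u = (\<Sum>i\<in>I. s (f i) u)"
proof (induction I rule: finite_induct)
  case empty
  then show ?case using psd_form_scale_left[of 0 u 0] V by (simp add: subspace_0)
next
  case (insert i I)
  then show ?case using V by (simp add: psd_form_add_left subspace_sum)
qed

end

text \<open>A Riesz representation theorem for semi-definite forms: functionals vanishing on the kernel of the
  form are represented. The induction is Gram-Schmidt orthogonalization: the new vector minus the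
  representer of its own pairing with the smaller space is orthogonal to that space.\<close>

lemma psd_form_riesz:
  assumes "finite S" and "symmetric_psd_bilinear_on (span S) s"
    and "\<And>u v a b. u \<in> span S \<Longrightarrow> v \<in> span S \<Longrightarrow> L (a *\<^sub>R u + b *\<^sub>R v) = a * L u + b * (L v :: real)"
    and "\<And>v. v \<in> span S \<Longrightarrow> s v v = 0 \<Longrightarrow> L v = 0"
  shows "\<exists>w\<in>span S. \<forall>v\<in>span S. s w v = L v"
  using assms
proof (induction S arbitrary: L rule: finite_induct)
  case empty
  then show ?case
    by (auto simp: symmetric_psd_bilinear_on_def) (metis (no_types) mult_zero_left scaleR_zero_left add.right_neutral)
next
  case (insert a S)
  let ?V = "span (insert a S)"
  have sub: "span S \<subseteq> ?V" by (rule span_mono) auto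
  note sV = insert.prems(1)
  have sS: "symmetric_psd_bilinear_on (span S) s" by (rule psd_form_mono[OF sV sub])
  have aV: "a \<in> ?V" by (simp add: span_base)
  obtain a' where a': "a' \<in> span S" "\<And>v. v \<in> span S \<Longrightarrow> s a' v = s a v"
    using insert.IH[OF sS, of "s a"] psd_form_lincomb_right[OF subspace_span sV] psd_form_kernel[OF subspace_span sV] sub aV
    by (metis (no_types, lifting) subsetD)
  obtain w' where w': "w' \<in> span S" "\<And>v. v \<in> span S \<Longrightarrow> s w' v = L v"
    using insert.IH[OF sS, of L] insert.prems(2,3) sub by blast
  define e where "e = a - a'"
  have eV: "e \<in> ?V" using aV a'(1) sub unfolding e_def by (intro span_diff) auto
  have e0: "s e v = 0" if "v \<in> span S" for v
    using psd_form_diff_left[OF subspace_span sV aV, of a' v] a' that sub unfolding e_def by auto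
  have e0': "s v e = 0" if "v \<in> span S" for v
    using e0[OF that] psd_form_sym[OF sV, of v e] that sub eV by auto
  define w where "w = w' + (if s e e = 0 then 0 else (L e / s e e)) *\<^sub>R e"
  have wV: "w \<in> ?V" unfolding w_def using w'(1) sub eV by (intro span_add span_scale) auto
  have "s w v = L v" if v: "v \<in> ?V" for v
  proof -
    obtain c where "v - c *\<^sub>R a \<in> span S" using v by (auto simp: span_insert)
    then have v0: "v - c *\<^sub>R e \<in> span S"
      using span_add[of "v - c *\<^sub>R a" S "c *\<^sub>R a'"] a'(1) by (simp add: e_def algebra_simps span_scale)
    define v0 where "v0 = v - c *\<^sub>R e"
    have v0S: "v0 \<in> span S" using v0 v0_def by simp
    have v_eq: "v = 1 *\<^sub>R v0 + c *\<^sub>R e" by (simp add: v0_def)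
    have Lv: "L v = L v0 + c * L e"
      unfolding v_eq using insert.prems(2)[of v0 e 1 c] v0S sub eV by auto
    have w'V: "w' \<in> ?V" and v0V: "v0 \<in> ?V" using w'(1) v0S sub by auto
    have "s w v = s w v0 + c * s w e"
      unfolding v_eq using psd_form_lincomb_right[OF subspace_span sV v0V eV wV, of 1 c] by simp
    also have "s w v0 = L v0"
      unfolding w_def using w'V v0V eV w'(2)[OF v0S] e0[OF v0S]
      by (simp add: psd_form_add_left[OF subspace_span sV] psd_form_scale_left[OF subspace_span sV] span_scale span_zero)
    also have "s w e = L e"
      unfolding w_def using w'V v0V eV e0'[OF w'(1)] insert.prems(3)[OF eV]
      by (auto simp: psd_form_add_left[OF subspace_span sV] psd_form_scale_left[OF subspace_span sV] span_scale)
    finally show ?thesis using Lv by simp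
  qed
  then show ?case using wV by blast
qed

lemma pd_form_riesz_unique:
  assumes "finite S" and s: "symmetric_psd_bilinear_on (span S) s"
    and "\<And>u v a b. u \<in> span S \<Longrightarrow> v \<in> span S \<Longrightarrow> L (a *\<^sub>R u + b *\<^sub>R v) = a * L u + b * (L v :: real)"
    and pd: "\<And>v. v \<in> span S \<Longrightarrow> s v v = 0 \<Longrightarrow> v = 0"
  shows "\<exists>!w. w \<in> span S \<and> (\<forall>v\<in>span S. s w v = L v)"
proof -
  have "L 0 = 0" using assms(3)[of 0 0 0 0] by (simp add: span_zero)
  then obtain w where w: "w \<in> span S" "\<forall>v\<in>span S. s w v = L v"
    using psd_form_riesz[OF assms(1-3)] pd by metis
  moreover have "w' = w" if "w' \<in> span S" "\<forall>v\<in>span S. s w' v = L v" for w'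
  proof -
    have "s (w' - w) (w' - w) = 0"
      using that w by (simp add: psd_form_diff_left[OF subspace_span s] span_diff)
    then show ?thesis using pd[of "w' - w"] that w by (simp add: span_diff)
  qed
  ultimately show ?thesis by blast
qed


section \<open>Polynomials\<close>

lemma subspace_polys_in: "subspace (polys_in B m)"
  by (simp add: polys_in_def)

lemma polys_in_finite_span:
  assumes "finite B"
  shows "\<exists>S. finite S \<and> polys_in B m = span S"
proof -
  let ?mon = "\<lambda>\<alpha> (x::'a). \<Prod>b\<in>B. (x \<bullet> b) ^ \<alpha> b"
  have "{?mon \<alpha> | \<alpha>. (\<Sum>b\<in>B. \<alpha> b) \<le> m} \<subseteq> ?mon ` (PiE B (\<lambda>_. {..m}))"
  proof clarify
    fix \<alpha> :: "'a \<Rightarrow> nat" assume le: "(\<Sum>b\<in>B. \<alpha> b) \<le> m"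
    have "\<alpha> b \<le> m" if "b \<in> B" for b
      using member_le_sum[of b B \<alpha>] that assms le by simp
    then have "restrict \<alpha> B \<in> PiE B (\<lambda>_. {..m})" by auto
    moreover have "?mon \<alpha> = ?mon (restrict \<alpha> B)" by (intro ext prod.cong) auto
    ultimately show "?mon \<alpha> \<in> ?mon ` (PiE B (\<lambda>_. {..m}))" by blast
  qed
  moreover have "finite (?mon ` (PiE B (\<lambda>_. {..m})))"
    using assms by (intro finite_imageI finite_PiE) auto
  ultimately show ?thesis
    unfolding polys_in_def using finite_subset by blast
qed

lemma polys_in_induct [consumes 1, case_names zero add scale monomial]:
  assumes "f \<in> polys_in B m"
    and "P (\<lambda>x. 0)" and "\<And>f g. P f \<Longrightarrow> P g \<Longrightarrow> P (\<lambda>x. f x + g x)" and "\<And>c f. P f \<Longrightarrow> P (\<lambda>x. c * f x)"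
    and "\<And>\<alpha>. (\<Sum>b\<in>B. \<alpha> b) \<le> m \<Longrightarrow> P (\<lambda>x. \<Prod>b\<in>B. (x \<bullet> b) ^ \<alpha> b)"
  shows "P f"
proof -
  have "subspace {f. P f}"
    using assms(2-4) by (simp add: subspace_def zero_fun_def plus_fun_def scaleR_fun_def)
  then show ?thesis
    using assms(1,5) unfolding polys_in_def by (auto elim: span_induct)
qed

lemma monomial_in_polys_in: "(\<Sum>b\<in>B. \<alpha> b) \<le> m \<Longrightarrow> (\<lambda>x. \<Prod>b\<in>B. (x \<bullet> b) ^ \<alpha> b) \<in> polys_in B m"
  unfolding polys_in_def by (intro span_base) auto

lemma zero_in_polys_in: "(\<lambda>x. 0) \<in> polys_in B m"
  using subspace_0[OF subspace_polys_in] by (simp add: zero_fun_def)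

lemma polys_in_add: "f \<in> polys_in B m \<Longrightarrow> g \<in> polys_in B m \<Longrightarrow> (\<lambda>x. f x + g x) \<in> polys_in B m"
  using subspace_add[OF subspace_polys_in] by (simp add: plus_fun_def)

lemma polys_in_cmult: "f \<in> polys_in B m \<Longrightarrow> (\<lambda>x. c * f x) \<in> polys_in B m"
  using subspace_scale[OF subspace_polys_in, of f B m c] by (simp add: scaleR_fun_def)

lemma polys_in_diff: "f \<in> polys_in B m \<Longrightarrow> g \<in> polys_in B m \<Longrightarrow> (\<lambda>x. f x - g x) \<in> polys_in B m"
  using polys_in_add[OF _ polys_in_cmult[of g B m "-1"]] by simp

lemma const_in_polys_in: "(\<lambda>x. c) \<in> polys_in B m"
  using polys_in_cmult[OF monomial_in_polys_in[of "\<lambda>_. 0" B m], of c] by simp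

lemma continuous_on_polys_in: "f \<in> polys_in B m \<Longrightarrow> continuous_on S f"
  by (induction rule: polys_in_induct) (auto intro!: continuous_intros)

lemma polys_in_cong_coordinates:
  "f \<in> polys_in B m \<Longrightarrow> (\<And>b. b \<in> B \<Longrightarrow> x \<bullet> b = y \<bullet> b) \<Longrightarrow> f x = f y"
  by (induction rule: polys_in_induct) auto

lemma polys_in_on_line:
  assumes "f \<in> polys_in B m" "finite B"
  shows "\<exists>q. degree q \<le> m \<and> (\<forall>t. f (x + t *\<^sub>R v) = poly q t)"
  using assms(1)
proof (induction rule: polys_in_induct)
  case zero
  then show ?case by (intro exI[of _ 0]) simp
next
  case (add f g)
  then obtain p q where "degree p \<le> m" "\<forall>t. f (x + t *\<^sub>R v) = poly p t" "degree q \<le> m" "\<forall>t. g (x + t *\<^sub>R v) = poly q t"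
    by blast
  then show ?case by (intro exI[of _ "p + q"]) (simp add: degree_add_le)
next
  case (scale c f)
  then obtain p where "degree p \<le> m" "\<forall>t. f (x + t *\<^sub>R v) = poly p t" by blast
  then show ?case by (intro exI[of _ "Polynomial.smult c p"]) (use degree_smult_le order_trans in auto)
next
  case (monomial \<alpha>)
  let ?q = "\<Prod>b\<in>B. [:x \<bullet> b, v \<bullet> b:] ^ \<alpha> b"
  have "degree ?q \<le> (\<Sum>b\<in>B. degree ([:x \<bullet> b, v \<bullet> b:] ^ \<alpha> b))"
    using degree_prod_sum_le[OF assms(2)] by (simp add: o_def)
  also have "\<dots> \<le> (\<Sum>b\<in>B. \<alpha> b)"
    proof (intro sum_mono)
    fix b
    have "degree ([:x \<bullet> b, v \<bullet> b:] ^ \<alpha> b) \<le> degree [:x \<bullet> b, v \<bullet> b:] * \<alpha> b" by (rule degree_power_le)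
    also have "\<dots> \<le> 1 * \<alpha> b" by (intro mult_right_mono) auto
    finally show "degree ([:x \<bullet> b, v \<bullet> b:] ^ \<alpha> b) \<le> \<alpha> b" by simp
  qed
  finally show ?case
    using monomial by (intro exI[of _ ?q]) (auto simp: poly_prod inner_add_left algebra_simps)
qed

text \<open>On the segment from a point where it vanishes locally to any other point, a polynomial restricts to
  a univariate polynomial with infinitely many zeros.\<close>

lemma polys_in_eq_zero_of_segment:
  assumes "f \<in> polys_in B m" "finite B" "0 < e" "\<And>t. 0 < t \<Longrightarrow> t < e \<Longrightarrow> f (x + t *\<^sub>R (y - x)) = 0"
  shows "f y = 0"
proof -
  obtain q where q: "\<And>t. f (x + t *\<^sub>R (y - x)) = poly q t"
    using polys_in_on_line[OF assms(1,2)] by blast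
  have "q = 0"
  proof (rule ccontr)
    assume "q \<noteq> 0"
    moreover have "{0<..<e} \<subseteq> {t. poly q t = 0}" using assms(4) q by auto
    ultimately have "finite {0<..<e}" using poly_roots_finite finite_subset by blast
    then show False using infinite_Ioo[of 0 e] assms(3) by auto
  qed
  then show ?thesis using q[of 1] by simp
qed

lemma polys_in_eq_zero_of_open:
  fixes f :: "'a::euclidean_space \<Rightarrow> real"
  assumes "f \<in> polys_in B m" "finite B" "open U" "x \<in> U" "\<And>z. z \<in> U \<Longrightarrow> f z = 0"
  shows "f y = 0"
proof -
  obtain e where e: "e > 0" "ball x e \<subseteq> U" using assms(3,4) openE by blast
  define \<delta> where "\<delta> = e / (norm (y - x) + 1)"
  have "\<delta> > 0" using e by (simp add: \<delta>_def add_nonneg_pos)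
  moreover have "f (x + t *\<^sub>R (y - x)) = 0" if "0 < t" "t < \<delta>" for t
  proof (rule assms(5))
    have "t * norm (y - x) \<le> t * (norm (y - x) + 1)" using that by simp
    also have "\<dots> < \<delta> * (norm (y - x) + 1)" using that by (intro mult_strict_right_mono) (auto simp: add_nonneg_pos)
    also have "\<dots> = e" by (simp add: \<delta>_def add_nonneg_eq_0_iff)
    finally have "x + t *\<^sub>R (y - x) \<in> ball x e"
      using that by (simp add: dist_norm)
    then show "x + t *\<^sub>R (y - x) \<in> U" using e by blast
  qed
  ultimately show ?thesis using polys_in_eq_zero_of_segment[OF assms(1,2)] by blast
qed

lemma GDERIV_unique: "GDERIV f x :> D \<Longrightarrow> GDERIV f x :> E \<Longrightarrow> D = E"
  unfolding gderiv_def using has_derivative_unique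
  by (metis inner_commute vector_eq_rdot)

lemma grad_eqI: "GDERIV f x :> D \<Longrightarrow> grad f x = D"
  unfolding grad_def using GDERIV_unique by blast

lemma elem_polys_has_grad:
  assumes "(f :: 'a::euclidean_space \<Rightarrow> real) \<in> elem_polys m"
  shows "\<exists>g. (\<forall>b\<in>Basis. (\<lambda>x. g x \<bullet> b) \<in> elem_polys (m - 1)) \<and> (\<forall>x. GDERIV f x :> g x)"
  using assms unfolding elem_polys_def
proof (induction rule: polys_in_induct)
  case zero
  show ?case by (rule exI[of _ "\<lambda>x. 0"]) (auto simp: zero_in_polys_in GDERIV_const)
next
  case (add f g)
  then obtain f' g' where "(\<forall>b\<in>Basis. (\<lambda>x. f' x \<bullet> b) \<in> polys_in Basis (m - 1)) \<and> (\<forall>x. GDERIV f x :> f' x)"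
    "(\<forall>b\<in>Basis. (\<lambda>x. g' x \<bullet> b) \<in> polys_in Basis (m - 1)) \<and> (\<forall>x. GDERIV g x :> g' x)" by blast
  then show ?case by (intro exI[of _ "\<lambda>x. f' x + g' x"]) (auto simp: inner_add_left intro: polys_in_add GDERIV_add)
next
  case (scale c f)
  then obtain f' where f': "(\<forall>b\<in>Basis. (\<lambda>x. f' x \<bullet> b) \<in> polys_in Basis (m - 1)) \<and> (\<forall>x. GDERIV f x :> f' x)" by blast
  then show ?case
    using GDERIV_mult[OF GDERIV_const[of c]]
    by (intro exI[of _ "\<lambda>x. c *\<^sub>R f' x"]) (fastforce intro: polys_in_cmult)
next
  case (monomial \<alpha>)
  define mon where "mon \<beta> x = (\<Prod>b\<in>Basis. (x \<bullet> b) ^ \<beta> b)" for \<beta> :: "'a \<Rightarrow> nat" and x :: 'a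
  define g where "g x = (\<Sum>i\<in>Basis. (\<alpha> i * mon (\<alpha>(i := \<alpha> i - 1)) x) *\<^sub>R i)" for x
  have split: "mon \<beta> x = (x \<bullet> i) ^ \<beta> i * (\<Prod>b\<in>Basis - {i}. (x \<bullet> b) ^ \<beta> b)" if "i \<in> Basis" for i \<beta> x
    unfolding mon_def using that by (simp add: prod.remove)
  have mon': "mon (\<alpha>(i := n)) x = (x \<bullet> i) ^ n * (\<Prod>b\<in>Basis - {i}. (x \<bullet> b) ^ \<alpha> b)" if "i \<in> Basis" for i n x
    using split[OF that, of "\<alpha>(i := n)" x] by simp
  have "GDERIV (mon \<alpha>) x :> g x" for x
  proof -
    have "(mon \<alpha> has_derivative (\<lambda>h. \<Sum>i\<in>Basis. (\<alpha> i * (h \<bullet> i) * (x \<bullet> i) ^ (\<alpha> i - 1)) * (\<Prod>b\<in>Basis - {i}. (x \<bullet> b) ^ \<alpha> b))) (at x)"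
      unfolding mon_def by (rule has_derivative_prod) (auto intro!: derivative_eq_intros)
    also have "(\<lambda>h. \<Sum>i\<in>Basis. (\<alpha> i * (h \<bullet> i) * (x \<bullet> i) ^ (\<alpha> i - 1)) * (\<Prod>b\<in>Basis - {i}. (x \<bullet> b) ^ \<alpha> b)) = (\<lambda>h. h \<bullet> g x)"
      unfolding g_def inner_sum_right by (intro ext sum.cong refl) (simp add: mon')
    finally show ?thesis unfolding gderiv_def .
  qed
  moreover have "(\<lambda>x. g x \<bullet> b) \<in> polys_in Basis (m - 1)" if b: "b \<in> Basis" for b
  proof -
    have "(\<lambda>x. g x \<bullet> b) = (\<lambda>x. \<alpha> b * mon (\<alpha>(b := \<alpha> b - 1)) x)"
      unfolding g_def using b by (auto simp: inner_sum_left inner_Basis if_distrib sum.delta cong: if_cong)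
    moreover have "(\<lambda>x. \<alpha> b * mon (\<alpha>(b := \<alpha> b - 1)) x) \<in> polys_in Basis (m - 1)"
    proof (cases "\<alpha> b = 0")
      case True
      then show ?thesis by (simp add: zero_in_polys_in)
    next
      case False
      have "(\<Sum>i\<in>Basis. \<alpha> i) = \<alpha> b + (\<Sum>i\<in>Basis - {b}. \<alpha> i)"
        using b by (simp add: sum.remove)
      moreover have "(\<Sum>i\<in>Basis. (\<alpha>(b := \<alpha> b - 1)) i) = \<alpha> b - 1 + (\<Sum>i\<in>Basis - {b}. \<alpha> i)"
        using b by (subst sum.remove[of _ b]) auto
      ultimately have "(\<Sum>i\<in>Basis. (\<alpha>(b := \<alpha> b - 1)) i) \<le> m - 1"
        using monomial False by linarith
      then show ?thesis
        unfolding mon_def by (intro polys_in_cmult monomial_in_polys_in)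
    qed
    ultimately show ?thesis by simp
  qed
  ultimately show ?case unfolding mon_def by blast
qed

context
  fixes f :: "'a::euclidean_space \<Rightarrow> real" and m
  assumes f: "f \<in> elem_polys m"
begin

lemma elem_polys_GDERIV: "GDERIV f x :> grad f x"
  using elem_polys_has_grad[OF f] grad_eqI by metis

lemma elem_polys_grad_component: "b \<in> Basis \<Longrightarrow> (\<lambda>x. grad f x \<bullet> b) \<in> elem_polys (m - 1)"
proof -
  obtain g where "\<forall>b\<in>Basis. (\<lambda>x. g x \<bullet> b) \<in> elem_polys (m - 1)" "\<And>x. GDERIV f x :> g x"
    using elem_polys_has_grad[OF f] by blast
  moreover from this have "grad f = g" using grad_eqI by blast
  ultimately show "b \<in> Basis \<Longrightarrow> ?thesis" by simp
qed

lemma continuous_on_grad: "continuous_on S (grad f)"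
proof -
  have "continuous_on S (\<lambda>x. \<Sum>b\<in>Basis. (grad f x \<bullet> b) *\<^sub>R b)"
    using elem_polys_grad_component continuous_on_polys_in unfolding elem_polys_def
    by (intro continuous_on_sum continuous_on_scaleR continuous_on_const) blast
  then show ?thesis by (simp add: euclidean_representation)
qed

lemma continuous_on_elem_polys: "continuous_on S f"
  using f continuous_on_polys_in unfolding elem_polys_def by blast

lemma continuous_on_laplacian: "continuous_on S (laplacian f)"
proof -
  have "continuous_on S (\<lambda>x. \<Sum>b\<in>Basis. grad (\<lambda>y. grad f y \<bullet> b) x \<bullet> b)"
  proof (intro continuous_on_sum)
    fix b :: 'a assume "b \<in> Basis"
    from elem_polys_has_grad[OF elem_polys_grad_component[OF this]]
    obtain g where g: "\<forall>c\<in>Basis. (\<lambda>x. g x \<bullet> c) \<in> elem_polys (m - 1 - 1)" "\<And>x. GDERIV (\<lambda>y. grad f y \<bullet> b) x :> g x"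
      by blast
    then have "grad (\<lambda>y. grad f y \<bullet> b) = g" using grad_eqI by blast
    then show "continuous_on S (\<lambda>x. grad (\<lambda>y. grad f y \<bullet> b) x \<bullet> b)"
      using g(1) \<open>b \<in> Basis\<close> unfolding elem_polys_def by (blast intro: continuous_on_polys_in)
  qed
  then show ?thesis unfolding laplacian_def .
qed

lemma elem_polys_derivative_on_line:
  "((\<lambda>t. f (x + t *\<^sub>R v)) has_real_derivative (grad f (x + t *\<^sub>R v) \<bullet> v)) (at t)"
proof -
  have "((\<lambda>t. x + t *\<^sub>R v) has_derivative (\<lambda>h. h *\<^sub>R v)) (at t)"
    by (auto intro!: derivative_eq_intros)
  from has_derivative_compose[OF this, of f "\<lambda>h. h \<bullet> grad f (x + t *\<^sub>R v)"]
  have "((\<lambda>t. f (x + t *\<^sub>R v)) has_derivative (\<lambda>h. (h *\<^sub>R v) \<bullet> grad f (x + t *\<^sub>R v))) (at t)"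
    using elem_polys_GDERIV[of "x + t *\<^sub>R v"] unfolding gderiv_def by simp
  moreover have "(\<lambda>h. (h *\<^sub>R v) \<bullet> grad f (x + t *\<^sub>R v)) = (*) (grad f (x + t *\<^sub>R v) \<bullet> v)"
    by (rule ext) (simp add: inner_commute[of v])
  ultimately show ?thesis
    by (simp add: has_field_derivative_def)
qed

end

lemma elem_polys_add: "f \<in> elem_polys m \<Longrightarrow> g \<in> elem_polys m \<Longrightarrow> (\<lambda>x. f x + g x) \<in> elem_polys m"
  unfolding elem_polys_def by (rule polys_in_add)

lemma const_in_elem_polys: "(\<lambda>x. c) \<in> elem_polys m"
  unfolding elem_polys_def by (rule const_in_polys_in)

lemma grad_lincomb:
  assumes "f \<in> elem_polys m" "g \<in> elem_polys m"
  shows "grad (\<lambda>x. a * f x + b * g x) x = a *\<^sub>R grad f x + b *\<^sub>R grad g x"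
  using GDERIV_add[OF GDERIV_mult[OF GDERIV_const[of a x] elem_polys_GDERIV[OF assms(1)]]
      GDERIV_mult[OF GDERIV_const[of b x] elem_polys_GDERIV[OF assms(2)]]]
  by (intro grad_eqI) simp

lemma grad_const: "grad (\<lambda>x. c) x = 0"
  by (intro grad_eqI GDERIV_const)

lemma laplacian_lincomb:
  assumes "f \<in> elem_polys m" "g \<in> elem_polys m"
  shows "laplacian (\<lambda>x. a * f x + b * g x) x = a * laplacian f x + b * laplacian g x"
proof -
  have "grad (\<lambda>y. grad (\<lambda>x. a * f x + b * g x) y \<bullet> c) x \<bullet> c =
      a * (grad (\<lambda>y. grad f y \<bullet> c) x \<bullet> c) + b * (grad (\<lambda>y. grad g y \<bullet> c) x \<bullet> c)" if "c \<in> Basis" for c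
    using grad_lincomb[OF elem_polys_grad_component[OF assms(1) that] elem_polys_grad_component[OF assms(2) that], of a b x]
    by (simp add: grad_lincomb[OF assms] inner_add_left)
  then show ?thesis
    by (simp add: laplacian_def sum.distrib sum_distrib_left)
qed

lemma constant_of_grad_eq_zero:
  assumes "f \<in> elem_polys m" "\<And>x. grad f x = 0"
  shows "f x = f y"
proof -
  have "DERIV (\<lambda>t. f (y + t *\<^sub>R (x - y))) t :> 0" for t
    using elem_polys_derivative_on_line[OF assms(1), of y "x - y" t] assms(2) by simp
  then show ?thesis
    using DERIV_isconst_all[of "\<lambda>t. f (y + t *\<^sub>R (x - y))" 1 0] by simp
qed

lemma grad_eq_zero_of_open:
  assumes "f \<in> elem_polys m" "open U" "x \<in> U" "\<And>z. z \<in> U \<Longrightarrow> grad f z = 0"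
  shows "grad f y = 0"
proof (rule euclidean_eqI)
  fix b :: 'a assume "b \<in> Basis"
  then show "grad f y \<bullet> b = 0 \<bullet> b"
    using polys_in_eq_zero_of_open[OF elem_polys_grad_component[OF assms(1) \<open>b \<in> Basis\<close>, unfolded elem_polys_def]
        finite_Basis assms(2,3), of y] assms(4) by simp
qed


section \<open>Lebesgue measure and the surface measures of hyperplanes\<close>

lemma nn_integral_lborel_affine:
  fixes f :: "'a::euclidean_space \<Rightarrow> ennreal"
  assumes [measurable]: "f \<in> borel_measurable borel" and "0 < r"
  shows "(\<integral>\<^sup>+x. f x \<partial>lborel) = ennreal (r ^ DIM('a)) * (\<integral>\<^sup>+x. f (w + r *\<^sub>R x) \<partial>lborel)"
  using assms(2)
  by (subst lborel_affine[of r w]) (auto simp: nn_integral_density nn_integral_distr nn_integral_cmult)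

lemma nn_integral_lborel_translate:
  fixes f :: "'a::euclidean_space \<Rightarrow> ennreal"
  assumes "f \<in> borel_measurable borel"
  shows "(\<integral>\<^sup>+x. f (w + x) \<partial>lborel) = (\<integral>\<^sup>+x. f x \<partial>lborel)"
  using nn_integral_lborel_affine[OF assms, of 1 w] by simp

text \<open>Two translation invariant measures \<open>\<mu>\<close>, \<open>\<lambda>\<close> satisfy \<open>\<mu> A * \<lambda> B = \<lambda> A * \<mu> (- B)\<close>, by shifting the two
  variables of a double integral in turn. Here \<open>\<mu>\<close> is the image of \<open>\<lambda>\<close> under the isometry, and the unit ball
  is a set \<open>B = - B\<close> to which both give the same measure.\<close>

lemma lborel_distr_isometry:
  fixes \<phi> :: "'a::euclidean_space \<Rightarrow> 'a"
  assumes "orthogonal_transformation \<phi>"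
  shows "distr lborel borel \<phi> = lborel"
proof -
  have lin: "linear \<phi>" using assms orthogonal_transformation_linear by blast
  then have "continuous_on UNIV \<phi>" by (simp add: linear_continuous_on linear_conv_bounded_linear)
  then have [measurable]: "\<phi> \<in> borel_measurable borel" by (rule borel_measurable_continuous_onI)
  have nrm: "norm (\<phi> x) = norm x" for x
    using assms orthogonal_transformation_norm by blast
  obtain \<psi> where \<psi>: "\<And>y. \<phi> (\<psi> y) = y"
    using orthogonal_transformation_surj[OF assms] by (metis surjD)
  define \<beta> where "\<beta> = emeasure lborel (ball 0 1 :: 'a set)"
  have \<beta>: "\<beta> \<noteq> 0" "\<beta> \<noteq> \<infinity>"
    using emeasure_lborel_ball_finite[of "0::'a" 1] content_ball_pos[of 1 "0::'a"]
    by (auto simp: \<beta>_def emeasure_eq_ennreal_measure)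
  show ?thesis
  proof (rule measure_eqI)
    fix A :: "'a set" assume "A \<in> sets (distr lborel borel \<phi>)"
    then have [measurable]: "A \<in> sets borel" by simp
    have ball [measurable]: "(indicator (ball 0 1) :: 'a \<Rightarrow> ennreal) \<in> borel_measurable borel"
      by (intro borel_measurable_indicator borel_open) simp
    have "emeasure lborel (\<phi> -` A) * \<beta> = (\<integral>\<^sup>+x. indicator A (\<phi> x) * (\<integral>\<^sup>+y. indicator (ball 0 1) (y::'a) \<partial>lborel) \<partial>lborel)"
    proof -
      have indicator_vimage: "indicator (\<phi> -` A) = (\<lambda>x. indicator A (\<phi> x) :: ennreal)"
        by (auto simp: indicator_def)
      have "(\<integral>\<^sup>+x. indicator A (\<phi> x) * \<beta> \<partial>lborel) = (\<integral>\<^sup>+x. indicator (\<phi> -` A) x \<partial>lborel) * \<beta>"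
        by (subst nn_integral_multc) (simp_all flip: indicator_vimage)
      also have "(\<integral>\<^sup>+x. indicator (\<phi> -` A) x \<partial>lborel) = emeasure lborel (\<phi> -` A)"
        by (intro nn_integral_indicator) (use measurable_sets_borel[of \<phi> borel A] in simp)
      finally show ?thesis by (simp add: \<beta>_def)
    qed
    also have "\<dots> = (\<integral>\<^sup>+x. indicator A (\<phi> x) * (\<integral>\<^sup>+y. indicator (ball 0 1) (- \<phi> x + y) \<partial>lborel) \<partial>lborel)"
      by (subst nn_integral_lborel_translate[OF ball]) auto
    also have "\<dots> = (\<integral>\<^sup>+x. \<integral>\<^sup>+y. indicator A (\<phi> x) * indicator (ball 0 1) (- \<phi> x + y) \<partial>lborel \<partial>lborel)"
      by (subst nn_integral_cmult) auto
    also have "\<dots> = (\<integral>\<^sup>+y. \<integral>\<^sup>+x. indicator A (\<phi> x) * indicator (ball 0 1) (- \<phi> x + y) \<partial>lborel \<partial>lborel)"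
      by (rule lborel_pair.Fubini') measurable
    also have "\<dots> = (\<integral>\<^sup>+y. \<integral>\<^sup>+x. indicator A (\<phi> (\<psi> y + x)) * indicator (ball 0 1) (- \<phi> (\<psi> y + x) + y) \<partial>lborel \<partial>lborel)"
      by (intro nn_integral_cong nn_integral_lborel_translate[symmetric]) measurable
    also have "\<dots> = (\<integral>\<^sup>+y. \<integral>\<^sup>+x. indicator A (\<phi> x + y) * indicator (ball 0 1) (- \<phi> x) \<partial>lborel \<partial>lborel)"
      by (simp add: linear_add[OF lin] \<psi> add.commute)
    also have "\<dots> = (\<integral>\<^sup>+x. \<integral>\<^sup>+y. indicator A (\<phi> x + y) * indicator (ball 0 1) (- \<phi> x) \<partial>lborel \<partial>lborel)"
      by (rule lborel_pair.Fubini') measurable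
    also have "\<dots> = (\<integral>\<^sup>+x. (\<integral>\<^sup>+y. indicator A (\<phi> x + y) \<partial>lborel) * indicator (ball 0 1) (- \<phi> x) \<partial>lborel)"
      by (subst nn_integral_multc) auto
    also have "\<dots> = (\<integral>\<^sup>+x. emeasure lborel A * indicator (ball 0 1) (x::'a) \<partial>lborel)"
      by (subst nn_integral_lborel_translate) (auto simp: indicator_def nrm)
    also have "\<dots> = emeasure lborel A * \<beta>"
      by (simp add: nn_integral_cmult \<beta>_def)
    finally have eq: "emeasure lborel (\<phi> -` A) * \<beta> = emeasure lborel A * \<beta>" .
    have cancel: "x * \<beta> / \<beta> = x" for x
      using \<beta> by (intro mult_divide_eq_ennreal) auto
    have "emeasure lborel (\<phi> -` A) = emeasure lborel A"
      using arg_cong[OF eq, of "\<lambda>x. x / \<beta>"] unfolding cancel .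
    then show "emeasure (distr lborel borel \<phi>) A = emeasure lborel A"
      by (simp add: emeasure_distr)
  qed auto
qed

text \<open>The surface measure of a face refers to an arbitrary orthonormal basis of its directions. Together
  with the normal this is an orthonormal basis of the space, whose choice does not affect Lebesgue
  measure.\<close>

lemma lborel_eq_orthonormal_basis:
  fixes B :: "'a::euclidean_space set"
  assumes orth: "pairwise Linear_Algebra.orthogonal B" and unit: "\<And>b. b \<in> B \<Longrightarrow> norm b = 1"
    and card: "card B = DIM('a)"
  shows "lborel = distr (\<Pi>\<^sub>M b\<in>B. lborel) borel (\<lambda>c. \<Sum>b\<in>B. c b *\<^sub>R b)"
proof -
  have finB: "finite B" using card DIM_positive card.infinite by fastforce
  then obtain \<beta> where \<beta>: "bij_betw \<beta> (Basis :: 'a set) B"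
    using card finite_same_card_bij[OF finite_Basis finB] by metis
  define \<gamma> where "\<gamma> = inv_into Basis \<beta>"
  have \<gamma>: "bij_betw \<gamma> B (Basis :: 'a set)" unfolding \<gamma>_def using \<beta> by (rule bij_betw_inv_into)
  have \<gamma>\<beta>: "\<gamma> (\<beta> i) = i" if "i \<in> Basis" for i
    unfolding \<gamma>_def using \<beta> that by (simp add: bij_betw_def)
  have \<beta>\<gamma>: "\<beta> (\<gamma> b) = b" if "b \<in> B" for b
    unfolding \<gamma>_def using \<beta> that by (metis bij_betw_inv_into_right)
  interpret product_sigma_finite "\<lambda>_::'a. lborel :: real measure" by standard
  let ?re = "\<lambda>g. \<lambda>b\<in>B. g (\<gamma> b) :: real"
  have re_meas [measurable]: "?re \<in> measurable (\<Pi>\<^sub>M i\<in>Basis. lborel) (\<Pi>\<^sub>M b\<in>B. lborel)"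
    using \<gamma> by (intro measurable_restrict measurable_component_singleton) (auto simp: bij_betw_def)
  have re: "distr (\<Pi>\<^sub>M i\<in>Basis. lborel) (\<Pi>\<^sub>M b\<in>B. lborel) ?re = (\<Pi>\<^sub>M b\<in>B. lborel)"
  proof (rule PiM_eqI[OF finB])
    fix A :: "'a \<Rightarrow> real set" assume A: "\<And>i. i \<in> B \<Longrightarrow> A i \<in> sets lborel"
    have "emeasure (distr (\<Pi>\<^sub>M i\<in>Basis. lborel) (\<Pi>\<^sub>M b\<in>B. lborel) ?re) (Pi\<^sub>E B A) =
        emeasure (\<Pi>\<^sub>M i\<in>Basis. lborel) (?re -` Pi\<^sub>E B A \<inter> space (\<Pi>\<^sub>M i\<in>Basis. lborel))"
      using A finB by (intro emeasure_distr) (auto intro!: sets_PiM_I_finite)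
    also have "?re -` Pi\<^sub>E B A \<inter> space (\<Pi>\<^sub>M i\<in>Basis. lborel) = Pi\<^sub>E Basis (\<lambda>i. A (\<beta> i))"
    proof (intro Set.set_eqI iffI)
      fix g assume "g \<in> ?re -` Pi\<^sub>E B A \<inter> space (\<Pi>\<^sub>M i\<in>Basis. lborel)"
      then have 1: "?re g \<in> Pi\<^sub>E B A" and 2: "g \<in> extensional Basis" by (auto simp: space_PiM PiE_def)
      have "g i \<in> A (\<beta> i)" if "i \<in> Basis" for i
        using PiE_mem[OF 1, of "\<beta> i"] that \<gamma>\<beta>[OF that] \<beta> by (auto simp: bij_betw_def)
      then show "g \<in> Pi\<^sub>E Basis (\<lambda>i. A (\<beta> i))" using 2 by (auto simp: PiE_def)
    next
      fix g assume "g \<in> Pi\<^sub>E Basis (\<lambda>i. A (\<beta> i))"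
      moreover have "\<gamma> b \<in> Basis" if "b \<in> B" for b using \<gamma> that by (auto simp: bij_betw_def)
      ultimately show "g \<in> ?re -` Pi\<^sub>E B A \<inter> space (\<Pi>\<^sub>M i\<in>Basis. lborel)"
        using \<beta>\<gamma> by (auto simp: space_PiM PiE_def Pi_def) (metis \<beta>\<gamma>)
    qed
    also have "emeasure (\<Pi>\<^sub>M i\<in>Basis. lborel) (Pi\<^sub>E Basis (\<lambda>i. A (\<beta> i))) = (\<Prod>i\<in>Basis. emeasure lborel (A (\<beta> i)))"
      using A \<beta> by (intro emeasure_PiM) (auto simp: bij_betw_def)
    also have "\<dots> = (\<Prod>b\<in>B. emeasure lborel (A b))"
      using \<beta> by (rule prod.reindex_bij_betw)
    finally show "emeasure (distr (\<Pi>\<^sub>M i\<in>Basis. lborel) (\<Pi>\<^sub>M b\<in>B. lborel) ?re) (Pi\<^sub>E B A) = (\<Prod>b\<in>B. emeasure lborel (A b))" .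
  qed simp
  define \<phi> where "\<phi> x = (\<Sum>i\<in>Basis. (x \<bullet> i) *\<^sub>R \<beta> i)" for x :: 'a
  have inner_\<beta>: "\<beta> i \<bullet> \<beta> j = (if i = j then 1 else 0)" if "i \<in> Basis" "j \<in> Basis" for i j
  proof (cases "i = j")
    case True
    then show ?thesis using unit[of "\<beta> i"] \<beta> that by (auto simp: bij_betw_def norm_eq_1)
  next
    case False
    then have "\<beta> i \<noteq> \<beta> j" using \<beta> that by (auto simp: bij_betw_def inj_on_def)
    then show ?thesis using orth \<beta> that False
      by (auto simp: bij_betw_def pairwise_def Linear_Algebra.orthogonal_def)
  qed
  have "orthogonal_transformation \<phi>"
    unfolding orthogonal_transformation_def
  proof (intro conjI allI)
    show "linear \<phi>" unfolding \<phi>_def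
      by (intro linearI) (simp_all add: inner_add_left scaleR_add_left sum.distrib scaleR_sum_right)
    show "\<phi> v \<bullet> \<phi> w = v \<bullet> w" for v w
    proof -
      have *: "\<beta> i \<bullet> \<phi> w = w \<bullet> i" if "i \<in> Basis" for i
        unfolding \<phi>_def using that by (simp add: inner_sum_right inner_\<beta> if_distrib sum.delta cong: if_cong)
      have "\<phi> v \<bullet> \<phi> w = (\<Sum>i\<in>Basis. (v \<bullet> i) * (\<beta> i \<bullet> \<phi> w))"
        by (subst \<phi>_def) (simp add: inner_sum_left)
      also have "\<dots> = (\<Sum>i\<in>Basis. (v \<bullet> i) * (w \<bullet> i))"
        by (simp add: *)
      finally show ?thesis by (simp add: euclidean_inner[of v w])
    qed
  qed
  from lborel_distr_isometry[OF this]
  have "lborel = distr lborel borel \<phi>" by simp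
  also have "\<dots> = distr (distr (\<Pi>\<^sub>M b\<in>Basis. lborel) borel (\<lambda>f. \<Sum>b\<in>Basis. f b *\<^sub>R b)) borel \<phi>"
    by (subst lborel_eq) simp
  also have "\<dots> = distr (\<Pi>\<^sub>M b\<in>Basis. lborel) borel (\<lambda>f. \<Sum>i\<in>Basis. f i *\<^sub>R \<beta> i)"
  proof (subst distr_distr)
    show "\<phi> \<in> borel_measurable borel" unfolding \<phi>_def by measurable
    have "\<phi> (\<Sum>b\<in>Basis. f b *\<^sub>R b) = (\<Sum>i\<in>Basis. f i *\<^sub>R \<beta> i)" for f
      unfolding \<phi>_def by (intro sum.cong refl) simp
    then show "distr (\<Pi>\<^sub>M b\<in>Basis. lborel) borel (\<phi> \<circ> (\<lambda>f. \<Sum>b\<in>Basis. f b *\<^sub>R b)) = distr (\<Pi>\<^sub>M b\<in>Basis. lborel) borel (\<lambda>f. \<Sum>i\<in>Basis. f i *\<^sub>R \<beta> i)"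
      by (simp add: o_def)
  qed measurable
  also have "\<dots> = distr (distr (\<Pi>\<^sub>M i\<in>Basis. lborel) (\<Pi>\<^sub>M b\<in>B. lborel) ?re) borel (\<lambda>c. \<Sum>b\<in>B. c b *\<^sub>R b)"
  proof (subst distr_distr)
    have "(\<Sum>b\<in>B. ?re f b *\<^sub>R b) = (\<Sum>i\<in>Basis. f i *\<^sub>R \<beta> i)" for f
    proof -
      have "(\<Sum>b\<in>B. ?re f b *\<^sub>R b) = (\<Sum>i\<in>Basis. ?re f (\<beta> i) *\<^sub>R \<beta> i)"
        using sum.reindex_bij_betw[OF \<beta>, of "\<lambda>b. ?re f b *\<^sub>R b"] by simp
      also have "\<dots> = (\<Sum>i\<in>Basis. f i *\<^sub>R \<beta> i)"
        using \<beta> by (intro sum.cong refl) (auto simp: \<gamma>\<beta> bij_betw_def)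
      finally show ?thesis .
    qed
    then show "distr (\<Pi>\<^sub>M b\<in>Basis. lborel) borel (\<lambda>f. \<Sum>i\<in>Basis. f i *\<^sub>R \<beta> i) = distr (\<Pi>\<^sub>M i\<in>Basis. lborel) borel ((\<lambda>c. \<Sum>b\<in>B. c b *\<^sub>R b) \<circ> ?re)"
      by (simp add: o_def)
  qed measurable
  finally show ?thesis unfolding re .
qed

lemma face_dirs_orthonormal_basis:
  fixes F :: "'a::euclidean_space set"
  shows "pairwise Linear_Algebra.orthogonal (face_dirs F)" "b \<in> face_dirs F \<Longrightarrow> norm b = 1"
    "span (face_dirs F) = span {x - y | x y. x \<in> F \<and> y \<in> F}"
proof -
  let ?P = "\<lambda>B. pairwise Linear_Algebra.orthogonal B \<and> (\<forall>b\<in>B. norm b = 1) \<and> span B = span {x - y | x y. x \<in> F \<and> y \<in> F}"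
  have "\<exists>B. ?P B"
    by (rule orthonormal_basis_subspace[OF subspace_span[of "{x - y | x y. x \<in> F \<and> y \<in> F}"]]) blast
  then have "?P (face_dirs F)" unfolding face_dirs_def by (rule someI_ex)
  then show "pairwise Linear_Algebra.orthogonal (face_dirs F)" "b \<in> face_dirs F \<Longrightarrow> norm b = 1"
    "span (face_dirs F) = span {x - y | x y. x \<in> F \<and> y \<in> F}" by auto
qed

lemma independent_face_dirs: "independent (face_dirs F)"
  using face_dirs_orthonormal_basis by (intro pairwise_orthogonal_independent) (auto, fastforce)

lemma finite_face_dirs: "finite (face_dirs F)"
  using independent_face_dirs by (rule independent_imp_finite)

definition unit_normal :: "'a::euclidean_space set \<Rightarrow> 'a \<Rightarrow> bool" where
  "unit_normal F \<nu> \<longleftrightarrow> norm \<nu> = 1 \<and> (\<forall>x\<in>F. \<forall>y\<in>F. \<nu> \<bullet> (x - y) = 0)"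

lemma card_face_dirs:
  fixes F :: "'a::euclidean_space set"
  assumes "aff_dim F = int DIM('a) - 1"
  shows "card (face_dirs F) = DIM('a) - 1"
proof -
  have "F \<noteq> {}" using assms DIM_positive[where 'a='a] aff_dim_negative_iff[of F] by linarith
  then obtain a where a: "a \<in> F" by blast
  have "span {x - y | x y. x \<in> F \<and> y \<in> F} = span ((\<lambda>x. x - a) ` F)"
  proof (rule span_eq[THEN iffD2], intro conjI subsetI)
    fix v assume "v \<in> {x - y | x y. x \<in> F \<and> y \<in> F}"
    then obtain x y where "v = (x - a) - (y - a)" "x \<in> F" "y \<in> F" by force
    then show "v \<in> span ((\<lambda>x. x - a) ` F)" by (simp only:) (intro span_diff span_base imageI)
  next
    fix v assume "v \<in> (\<lambda>x. x - a) ` F"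
    then show "v \<in> span {x - y | x y. x \<in> F \<and> y \<in> F}" using a by (intro span_base) auto
  qed
  then have "dim (span (face_dirs F)) = dim ((\<lambda>x. x - a) ` F)"
    by (simp add: face_dirs_orthonormal_basis)
  moreover have "dim (span (face_dirs F)) = card (face_dirs F)"
    using dim_eq_card_independent[OF independent_face_dirs] by simp
  ultimately show ?thesis
    using aff_dim_eq_dim_subtract[of a F] a assms by (simp add: hull_inc)
qed

lemma unit_normal_face_dirs: "unit_normal F \<nu> \<Longrightarrow> b \<in> face_dirs F \<Longrightarrow> \<nu> \<bullet> b = 0"
proof -
  assume \<nu>: "unit_normal F \<nu>" and "b \<in> face_dirs F"
  then have "b \<in> span {x - y | x y. x \<in> F \<and> y \<in> F}"
    using face_dirs_orthonormal_basis(3)[of F] span_base by blast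
  then have "Linear_Algebra.orthogonal \<nu> b"
    by (rule orthogonal_to_span) (use \<nu> in \<open>auto simp: unit_normal_def Linear_Algebra.orthogonal_def\<close>)
  then show ?thesis by (simp add: Linear_Algebra.orthogonal_def)
qed

lemma unit_normal_exists:
  fixes F :: "'a::euclidean_space set"
  assumes "aff_dim F = int DIM('a) - 1"
  obtains \<nu> where "unit_normal F \<nu>"
proof -
  have "dim (face_dirs F) < DIM('a)"
    using card_face_dirs[OF assms] dim_eq_card_independent[OF independent_face_dirs[of F]] DIM_positive[where 'a='a]
    by simp
  then obtain n where n: "n \<noteq> 0" "\<And>y. y \<in> span (face_dirs F) \<Longrightarrow> Linear_Algebra.orthogonal n y"
    using orthogonal_to_subspace_exists[of "face_dirs F"] by metis
  have "unit_normal F (n /\<^sub>R norm n)"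
    unfolding unit_normal_def using n by (auto simp: face_dirs_orthonormal_basis Linear_Algebra.orthogonal_def intro!: span_base)
  then show ?thesis by (rule that)
qed

context
  fixes F :: "'a::euclidean_space set" and \<nu>
  assumes dimF: "aff_dim F = int DIM('a) - 1" and \<nu>: "unit_normal F \<nu>"
begin

lemma norm_unit_normal: "norm \<nu> = 1" "\<nu> \<bullet> \<nu> = 1"
  using \<nu> by (auto simp: unit_normal_def norm_eq_1)

lemma sets_face_measure: "sets (face_measure F) = sets borel"
  by (simp add: face_measure_def)

lemma nonempty_face: "F \<noteq> {}"
  using dimF DIM_positive[where 'a='a] aff_dim_negative_iff[of F] by linarith

text \<open>Fubini in the orthonormal basis formed by the directions of the face and its normal.\<close>

lemma nn_integral_lborel_slices:
  assumes [measurable]: "f \<in> borel_measurable borel"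
  shows "(\<integral>\<^sup>+x. f x \<partial>lborel) = (\<integral>\<^sup>+z. \<integral>\<^sup>+s. f (z + s *\<^sub>R \<nu>) \<partial>lborel \<partial>face_measure F)"
proof -
  define D where "D = face_dirs F"
  define a where "a = (SOME a. a \<in> F)"
  have finD: "finite D" by (simp add: D_def finite_face_dirs)
  have \<nu>D: "\<nu> \<notin> D" using unit_normal_face_dirs[OF \<nu>, of \<nu>] norm_unit_normal by (auto simp: D_def)
  have 1: "pairwise Linear_Algebra.orthogonal (insert \<nu> D)"
    using face_dirs_orthonormal_basis(1)[of F] unit_normal_face_dirs[OF \<nu>]
    by (auto simp: D_def pairwise_insert Linear_Algebra.orthogonal_def inner_commute)
  have 2: "norm b = 1" if "b \<in> insert \<nu> D" for b
    using that face_dirs_orthonormal_basis(2)[of _ F] norm_unit_normal by (auto simp: D_def)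
  have 3: "card (insert \<nu> D) = DIM('a)"
    using finD \<nu>D card_face_dirs[OF dimF] DIM_positive[where 'a='a] by (simp add: D_def)
  interpret product_sigma_finite "\<lambda>_::'a. lborel :: real measure" by standard
  interpret finite_product_sigma_finite "\<lambda>_::'a. lborel :: real measure" D by standard (rule finD)
  have [measurable]: "(\<lambda>c. a + (\<Sum>b\<in>D. c b *\<^sub>R b)) \<in> borel_measurable (\<Pi>\<^sub>M b\<in>D. lborel)"
    by measurable
  have "(\<integral>\<^sup>+x. f x \<partial>lborel) = (\<integral>\<^sup>+x. f (a + x) \<partial>lborel)"
    by (subst nn_integral_lborel_translate) auto
  also have "\<dots> = (\<integral>\<^sup>+c. f (a + (\<Sum>b\<in>insert \<nu> D. c b *\<^sub>R b)) \<partial>(\<Pi>\<^sub>M b\<in>insert \<nu> D. lborel))"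
    by (subst lborel_eq_orthonormal_basis[OF 1 2 3]) (auto simp: nn_integral_distr)
  also have "\<dots> = (\<integral>\<^sup>+c. \<integral>\<^sup>+s. f (a + (\<Sum>b\<in>insert \<nu> D. (c(\<nu> := s)) b *\<^sub>R b)) \<partial>lborel \<partial>(\<Pi>\<^sub>M b\<in>D. lborel))"
    using finD \<nu>D by (intro product_nn_integral_insert) auto
  also have "\<dots> = (\<integral>\<^sup>+c. \<integral>\<^sup>+s. f ((a + (\<Sum>b\<in>D. c b *\<^sub>R b)) + s *\<^sub>R \<nu>) \<partial>lborel \<partial>(\<Pi>\<^sub>M b\<in>D. lborel))"
  proof (intro nn_integral_cong)
    fix c s
    have "(\<Sum>b\<in>insert \<nu> D. (c(\<nu> := s)) b *\<^sub>R b) = s *\<^sub>R \<nu> + (\<Sum>b\<in>D. (c(\<nu> := s)) b *\<^sub>R b)"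
      using finD \<nu>D by simp
    also have "(\<Sum>b\<in>D. (c(\<nu> := s)) b *\<^sub>R b) = (\<Sum>b\<in>D. c b *\<^sub>R b)"
      using \<nu>D by (intro sum.cong) auto
    finally show "f (a + (\<Sum>b\<in>insert \<nu> D. (c(\<nu> := s)) b *\<^sub>R b)) = f ((a + (\<Sum>b\<in>D. c b *\<^sub>R b)) + s *\<^sub>R \<nu>)"
      by (simp add: algebra_simps)
  qed
  also have "\<dots> = (\<integral>\<^sup>+z. \<integral>\<^sup>+s. f (z + s *\<^sub>R \<nu>) \<partial>lborel \<partial>face_measure F)"
    unfolding face_measure_def D_def[symmetric] a_def[symmetric]
    by (subst nn_integral_distr) auto
  finally show ?thesis .
qed

lemma AE_face_measure_hyperplane:
  assumes "a \<in> F"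
  shows "AE z in face_measure F. (z - a) \<bullet> \<nu> = 0"
proof -
  have *: "((SOME a. a \<in> F) + (\<Sum>b\<in>face_dirs F. c b *\<^sub>R b) - a) \<bullet> \<nu> = 0" for c
  proof -
    have "(SOME a. a \<in> F) \<in> F" using assms by (rule someI)
    then have "\<nu> \<bullet> ((SOME a. a \<in> F) - a) = 0" using \<nu> assms by (simp add: unit_normal_def)
    moreover have "(\<Sum>b\<in>face_dirs F. c b *\<^sub>R b) \<bullet> \<nu> = 0"
      unfolding inner_sum_left by (intro sum.neutral) (simp add: inner_commute[of _ \<nu>] unit_normal_face_dirs[OF \<nu>])
    ultimately show ?thesis by (simp add: inner_commute inner_add_right inner_diff_right)
  qed
  have [measurable]: "(\<lambda>c. (SOME a. a \<in> F) + (\<Sum>b\<in>face_dirs F. c b *\<^sub>R b)) \<in> borel_measurable (\<Pi>\<^sub>M b\<in>face_dirs F. lborel)"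
    by measurable
  show ?thesis
    unfolding face_measure_def by (subst AE_distr_iff) (auto simp: *)
qed

text \<open>Spreading the integrand constantly over a slab of thickness one transfers the change of variables
  from the space to the hyperplane.\<close>

lemma nn_integral_face_slab:
  assumes [measurable]: "f \<in> borel_measurable borel" and "a \<in> F"
  shows "(\<integral>\<^sup>+z. f z \<partial>face_measure F) =
    (\<integral>\<^sup>+x. f (x - ((x - a) \<bullet> \<nu>) *\<^sub>R \<nu>) * indicator {0<..<1} ((x - a) \<bullet> \<nu>) \<partial>lborel)" (is "_ = (\<integral>\<^sup>+x. ?g x \<partial>lborel)")
proof -
  have "(\<integral>\<^sup>+x. ?g x \<partial>lborel) = (\<integral>\<^sup>+z. \<integral>\<^sup>+s. ?g (z + s *\<^sub>R \<nu>) \<partial>lborel \<partial>face_measure F)"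
    by (rule nn_integral_lborel_slices) measurable
  also have "\<dots> = (\<integral>\<^sup>+z. \<integral>\<^sup>+s. f z * indicator {0<..<1::real} s \<partial>lborel \<partial>face_measure F)"
  proof (rule nn_integral_cong_AE, use AE_face_measure_hyperplane[OF assms(2)] in eventually_elim)
    fix z assume "(z - a) \<bullet> \<nu> = 0"
    then have *: "(z + s *\<^sub>R \<nu> - a) \<bullet> \<nu> = s" for s
      using norm_unit_normal by (simp add: inner_add_left inner_diff_left)
    have "?g (z + s *\<^sub>R \<nu>) = f z * indicator {0<..<1::real} s" for s
      unfolding * by simp
    then show "(\<integral>\<^sup>+s. ?g (z + s *\<^sub>R \<nu>) \<partial>lborel) = (\<integral>\<^sup>+s. f z * indicator {0<..<1::real} s \<partial>lborel)"
      by (simp only:)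
  qed
  also have "\<dots> = (\<integral>\<^sup>+z. f z \<partial>face_measure F)"
    by (simp add: nn_integral_cmult)
  finally show ?thesis by simp
qed

text \<open>The assumption on \<open>w\<close> says that the affine map sends the hyperplane to itself. The exponent is one
  less than for volumes, since the map stretches the slab of thickness one to one of thickness \<open>r\<close>.\<close>

lemma nn_integral_face_affine:
  assumes [measurable]: "f \<in> borel_measurable borel" and "a \<in> F" and r: "0 < r"
    and w: "(w + r *\<^sub>R a - a) \<bullet> \<nu> = 0"
  shows "(\<integral>\<^sup>+z. f z \<partial>face_measure F) = ennreal (r ^ (DIM('a) - 1)) * (\<integral>\<^sup>+z. f (w + r *\<^sub>R z) \<partial>face_measure F)"
proof -
  let ?g = "\<lambda>x. f (x - ((x - a) \<bullet> \<nu>) *\<^sub>R \<nu>) * indicator {0<..<1} ((x - a) \<bullet> \<nu>)"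
  have "(\<integral>\<^sup>+z. f z \<partial>face_measure F) = (\<integral>\<^sup>+x. ?g x \<partial>lborel)"
    by (rule nn_integral_face_slab) fact+
  also have "\<dots> = ennreal (r ^ DIM('a)) * (\<integral>\<^sup>+x. ?g (w + r *\<^sub>R x) \<partial>lborel)"
    using r by (intro nn_integral_lborel_affine) measurable
  also have "(\<integral>\<^sup>+x. ?g (w + r *\<^sub>R x) \<partial>lborel) = (\<integral>\<^sup>+z. \<integral>\<^sup>+s. ?g (w + r *\<^sub>R (z + s *\<^sub>R \<nu>)) \<partial>lborel \<partial>face_measure F)"
    by (rule nn_integral_lborel_slices) measurable
  also have "\<dots> = (\<integral>\<^sup>+z. \<integral>\<^sup>+s. f (w + r *\<^sub>R z) * indicator {0<..<1/r} s \<partial>lborel \<partial>face_measure F)"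
  proof (rule nn_integral_cong_AE, use AE_face_measure_hyperplane[OF assms(2)] in eventually_elim)
    fix z assume z: "(z - a) \<bullet> \<nu> = 0"
    have *: "(w + r *\<^sub>R (z + s *\<^sub>R \<nu>) - a) \<bullet> \<nu> = r * s" for s
    proof -
      have "w + r *\<^sub>R (z + s *\<^sub>R \<nu>) - a = (w + r *\<^sub>R a - a) + r *\<^sub>R (z - a) + (r * s) *\<^sub>R \<nu>"
        by (simp add: algebra_simps)
      then have "(w + r *\<^sub>R (z + s *\<^sub>R \<nu>) - a) \<bullet> \<nu> = (w + r *\<^sub>R a - a) \<bullet> \<nu> + r * ((z - a) \<bullet> \<nu>) + r * s * (\<nu> \<bullet> \<nu>)"
        by (simp only: inner_add_left inner_scaleR_left)
      then show ?thesis by (simp only: z w norm_unit_normal mult_zero_right mult_1_right add_0_left)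
    qed
    have "?g (w + r *\<^sub>R (z + s *\<^sub>R \<nu>)) = f (w + r *\<^sub>R z) * indicator {0<..<1/r} s" for s
    proof -
      have "(r * s \<in> {0<..<1}) = (s \<in> {0<..<1/r})" using r by (auto simp: field_simps zero_less_mult_iff)
      moreover have "w + r *\<^sub>R (z + s *\<^sub>R \<nu>) - (r * s) *\<^sub>R \<nu> = w + r *\<^sub>R z" by (simp add: algebra_simps)
      ultimately show ?thesis unfolding * by (simp only: indicator_def)
    qed
    then show "(\<integral>\<^sup>+s. ?g (w + r *\<^sub>R (z + s *\<^sub>R \<nu>)) \<partial>lborel) = (\<integral>\<^sup>+s. f (w + r *\<^sub>R z) * indicator {0<..<1/r} s \<partial>lborel)"
      by (simp only:)
  qed
  also have "\<dots> = (\<integral>\<^sup>+z. f (w + r *\<^sub>R z) * ennreal (1/r) \<partial>face_measure F)"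
    using r by (simp add: nn_integral_cmult)
  also have "\<dots> = (\<integral>\<^sup>+z. f (w + r *\<^sub>R z) \<partial>face_measure F) * ennreal (1/r)"
    by (rule nn_integral_multc) (simp add: face_measure_def)
  finally show ?thesis
    using r DIM_positive[where 'a='a]
    by (cases "DIM('a)") (auto simp: mult.assoc mult.commute[of _ "ennreal (1/r)"] ennreal_mult[symmetric] simp flip: mult.assoc)
qed

end


section \<open>One-dimensional inequalities\<close>

lemma nn_integral_open_interval:
  fixes f :: "real \<Rightarrow> real"
  assumes "\<And>r. r \<in> {a<..<b} \<Longrightarrow> 0 \<le> f r" "(f has_integral I) {a..b}"
  shows "(\<integral>\<^sup>+r\<in>{a<..<b}. ennreal (f r) \<partial>lborel) = ennreal I"
  using assms by (intro nn_integral_has_integral_lebesgue') (auto simp: has_integral_Icc_iff_Ioo)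

text \<open>Pairing with the polynomial \<open>K\<close> with coefficients \<open>a\<close> in \<open>L\<^sup>2(0, 1)\<close> evaluates polynomials of degree
  at most \<open>k\<close> at \<open>0\<close>, and \<open>K 0 = a 0\<close> is the squared norm of \<open>K\<close>. Its
  coefficients form the first column of the inverse Hilbert matrix: they are the residues at
  \<open>-1, \<dots>, -(k+1)\<close> of the rational function \<open>(k+1) * (1-x) \<cdots> (k-x) / ((x+1) \<cdots> (x+k+1))\<close>, which vanishes at
  \<open>1, \<dots>, k\<close> and equals \<open>1\<close> at \<open>0\<close>.\<close>

lemma hilbert_kernel_coefficients:
  fixes k :: nat
  shows "\<exists>a::nat \<Rightarrow> real. a 0 = (real k + 1)\<^sup>2 \<and>
    (\<forall>m\<le>k. (\<Sum>i\<le>k. a i / real (m + i + 1)) = (if m = 0 then 1 else 0))"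
proof -
  define \<nu> where "\<nu> i = - real i - 1" for i
  define N :: "real poly" where "N = Polynomial.smult (real k + 1) (\<Prod>j\<in>{1..k}. [:real j, -1:])"
  define D where "D i = (\<Prod>j\<in>{..k}-{i}. \<nu> i - \<nu> j)" for i
  define a where "a i = poly N (\<nu> i) / D i" for i
  define L where "L = (\<Sum>i\<le>k. Polynomial.smult (a i) (\<Prod>j\<in>{..k}-{i}. [:- \<nu> j, 1:]))"
  have inj: "inj \<nu>" by (auto simp: inj_def \<nu>_def)
  have D0: "D i \<noteq> 0" for i
    using inj unfolding D_def by (auto simp: inj_def \<nu>_def)
  have "N = L"
  proof (rule poly_eqI_degree[of "\<nu> ` {..k}"])
    fix x assume "x \<in> \<nu> ` {..k}"
    then obtain i where i: "i \<le> k" "x = \<nu> i" by auto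
    have "poly L x = (\<Sum>l\<le>k. a l * (\<Prod>j\<in>{..k}-{l}. \<nu> i - \<nu> j))"
      by (simp add: L_def poly_sum poly_prod i)
    also have "\<dots> = (\<Sum>l\<le>k. if l = i then a i * D i else 0)"
      using i(1) by (intro sum.cong refl) (auto simp: D_def intro!: prod_zero)
    also have "\<dots> = poly N x"
      using i D0 by (simp add: a_def)
    finally show "poly N x = poly L x" by simp
  next
    have card: "card (\<nu> ` {..k}) = Suc k" using inj by (simp add: card_image inj_on_subset)
    have "degree N \<le> (\<Sum>j\<in>{1..k}. degree [:real j, -1:])"
      unfolding N_def using degree_smult_le degree_prod_sum_le[of "{1..k}" "\<lambda>j. [:real j, -1:]"]
      by (auto simp: o_def intro: order_trans)
    also have "\<dots> = k" by simp
    finally show "card (\<nu> ` {..k}) > degree N" using card by simp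
    have "degree (Polynomial.smult (a i) (\<Prod>j\<in>{..k}-{i}. [:- \<nu> j, 1:])) \<le> k" if "i \<le> k" for i
    proof -
      have "degree (\<Prod>j\<in>{..k}-{i}. [:- \<nu> j, 1:]) \<le> (\<Sum>j\<in>{..k}-{i}. degree [:- \<nu> j, 1:])"
        using degree_prod_sum_le[of "{..k}-{i}" "\<lambda>j. [:- \<nu> j, 1:]"] by (simp add: o_def)
      also have "\<dots> = k" using that by simp
      finally show ?thesis using degree_smult_le order_trans by blast
    qed
    then have "degree L \<le> k" unfolding L_def by (intro degree_sum_le) auto
    then show "card (\<nu> ` {..k}) > degree L" using card by simp
  qed
  have sum_eq: "(\<Sum>i\<le>k. a i / real (m + i + 1)) = poly N (real m) / (\<Prod>j\<le>k. real (m + j + 1))" for m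
  proof -
    have "poly N (real m) = (\<Sum>i\<le>k. a i * (\<Prod>j\<in>{..k}-{i}. real (m + j + 1)))"
      unfolding \<open>N = L\<close> by (simp add: L_def poly_sum poly_prod \<nu>_def add_ac)
    also have "\<dots> = (\<Sum>i\<le>k. a i / real (m + i + 1) * (\<Prod>j\<le>k. real (m + j + 1)))"
    proof (intro sum.cong refl)
      fix i assume "i \<in> {..k}"
      then have "(\<Prod>j\<le>k. real (m + j + 1)) = real (m + i + 1) * (\<Prod>j\<in>{..k}-{i}. real (m + j + 1))"
        by (intro prod.remove) auto
      then show "a i * (\<Prod>j\<in>{..k}-{i}. real (m + j + 1)) = a i / real (m + i + 1) * (\<Prod>j\<le>k. real (m + j + 1))"
        by simp
    qed
    finally have "poly N (real m) = (\<Sum>i\<le>k. a i / real (m + i + 1)) * (\<Prod>j\<le>k. real (m + j + 1))"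
      by (simp add: sum_distrib_right)
    moreover have "(\<Prod>j\<le>k. real (m + j + 1)) \<noteq> 0" by simp
    ultimately show ?thesis by (simp add: field_simps)
  qed
  have prod_Suc: "(\<Prod>j\<in>{1..k}. real j + 1) = (real k + 1) * (\<Prod>j\<in>{1..k}. real j)"
    by (induction k) (auto simp: algebra_simps)
  have pos: "(\<Prod>j\<in>{1..k}. real j) \<noteq> 0" by simp
  have "(\<Sum>i\<le>k. a i / real (m + i + 1)) = (if m = 0 then 1 else 0)" if "m \<le> k" for m
  proof (cases "m = 0")
    case True
    have "(\<Prod>j\<le>k. real (0 + j + 1)) = (\<Prod>j\<in>{1..k}. real j + 1)"
      by (simp add: atMost_atLeast0 prod.atLeast_Suc_atMost add.commute)
    then show ?thesis
      unfolding sum_eq using True prod_Suc pos by (simp add: N_def poly_prod)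
  next
    case False
    then have "poly N (real m) = 0" using that by (auto simp: N_def poly_prod intro!: prod_zero bexI[of _ m])
    then show ?thesis unfolding sum_eq using False by simp
  qed
  moreover have "a 0 = (real k + 1)\<^sup>2"
  proof -
    have "{..k} - {0} = {1..k}" by auto
    then have "D 0 = (\<Prod>j\<in>{1..k}. real j)" by (simp add: D_def \<nu>_def)
    moreover have "poly N (\<nu> 0) = (real k + 1) * (\<Prod>j\<in>{1..k}. real j + 1)"
      by (simp add: N_def poly_prod \<nu>_def)
    ultimately show ?thesis using prod_Suc pos by (simp add: a_def power2_eq_square)
  qed
  ultimately show ?thesis by blast
qed

text \<open>Cauchy-Schwarz for \<open>q 0 = \<integral> K q\<close>, as nonnegativity of the integral of \<open>(q - c K)\<^sup>2\<close> for the optimal \<open>c\<close>.\<close>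

lemma poly_endpoint_bound_0:
  fixes q :: "real poly"
  assumes "degree q \<le> k"
  shows "(poly q 0)\<^sup>2 \<le> (real k + 1)\<^sup>2 * integral {0..1} (\<lambda>x. (poly q x)\<^sup>2)"
proof -
  obtain a where a: "a 0 = (real k + 1)\<^sup>2" "\<And>m. m \<le> k \<Longrightarrow> (\<Sum>i\<le>k. a i / real (m + i + 1)) = (if m = 0 then 1 else 0)"
    using hilbert_kernel_coefficients by blast
  define K where "K = (\<Sum>i\<le>k. Polynomial.monom (a i) i)"
  have monom: "((\<lambda>x. x ^ n) has_integral 1 / real (n + 1)) {0..1::real}" for n
  proof -
    have "((\<lambda>x. x ^ Suc n / real (Suc n)) has_real_derivative x ^ n) (at x within {0..1})" for x :: real
      using DERIV_cdivide[OF DERIV_pow[of "Suc n" x "{0..1}"], of "real (Suc n)"] by (simp del: of_nat_Suc power_Suc)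
    then have "((\<lambda>x. x ^ n) has_integral (1 ^ Suc n / real (Suc n) - 0 ^ Suc n / real (Suc n))) {0..1::real}"
      by (intro fundamental_theorem_of_calculus)
        (auto simp: has_real_derivative_iff_has_vector_derivative[symmetric] simp del: power_Suc of_nat_Suc)
    then show ?thesis by (simp add: add.commute)
  qed
  have polyK: "poly K x = (\<Sum>i\<le>k. a i * x ^ i)" for x
    by (simp add: K_def poly_sum poly_monom)
  have pair_monom: "((\<lambda>x. poly K x * x ^ m) has_integral (if m = 0 then 1 else 0)) {0..1}" if "m \<le> k" for m
  proof -
    have "((\<lambda>x. \<Sum>i\<le>k. a i * x ^ (m + i)) has_integral (\<Sum>i\<le>k. a i * (1 / real (m + i + 1)))) {0..1}"
      by (intro has_integral_sum has_integral_mult_right monom) auto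
    moreover have "(\<Sum>i\<le>k. a i * (1 / real (m + i + 1))) = (if m = 0 then 1 else 0)"
      using a(2)[OF that] by simp
    moreover have "(\<Sum>i\<le>k. a i * x ^ (m + i)) = poly K x * x ^ m" for x
      unfolding polyK sum_distrib_right by (intro sum.cong refl) (simp add: power_add)
    ultimately show ?thesis by simp
  qed
  have pair: "((\<lambda>x. poly K x * poly p x) has_integral poly p 0) {0..1}" if p: "degree p \<le> k" for p
  proof -
    have "((\<lambda>x. \<Sum>i\<le>k. coeff p i * (poly K x * x ^ i)) has_integral (\<Sum>i\<le>k. coeff p i * (if i = 0 then 1 else 0))) {0..1}"
      by (intro has_integral_sum has_integral_mult_right pair_monom) auto
    moreover have "(\<Sum>i\<le>k. coeff p i * (if i = 0 then 1 else 0)) = poly p 0"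
      by (simp add: if_distrib sum.delta poly_0_coeff_0 cong: if_cong)
    moreover have "(\<Sum>i\<le>k. coeff p i * (poly K x * x ^ i)) = poly K x * poly p x" for x
    proof -
      have "poly p x = (\<Sum>i\<le>k. coeff p i * x ^ i)"
        unfolding poly_altdef using p by (intro sum.mono_neutral_left) (auto simp: coeff_eq_0)
      then show ?thesis by (simp add: sum_distrib_left mult_ac)
    qed
    ultimately show ?thesis by simp
  qed
  have "degree K \<le> k"
    unfolding K_def by (intro degree_sum_le) (auto intro: order_trans[OF degree_monom_le])
  moreover have "poly K 0 = (real k + 1)\<^sup>2"
    using a(1) by (simp add: polyK power_0_left if_distrib sum.delta cong: if_cong)
  ultimately have KK: "((\<lambda>x. poly K x * poly K x) has_integral (real k + 1)\<^sup>2) {0..1}"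
    using pair[of K] by simp
  define c where "c = poly q 0 / (real k + 1)\<^sup>2"
  have qq: "((\<lambda>x. (poly q x)\<^sup>2) has_integral integral {0..1} (\<lambda>x. (poly q x)\<^sup>2)) {0..1}"
    by (intro integrable_integral integrable_continuous_real continuous_intros)
  have expand: "(\<lambda>x. (poly q x)\<^sup>2 - 2 * c * (poly K x * poly q x) + c\<^sup>2 * (poly K x * poly K x)) = (\<lambda>x. (poly q x - c * poly K x)\<^sup>2)"
    by (rule ext) (simp add: power2_eq_square algebra_simps)
  have "((\<lambda>x. (poly q x)\<^sup>2 - 2 * c * (poly K x * poly q x) + c\<^sup>2 * (poly K x * poly K x)) has_integral
      integral {0..1} (\<lambda>x. (poly q x)\<^sup>2) - 2 * c * poly q 0 + c\<^sup>2 * (real k + 1)\<^sup>2) {0..1}"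
    by (intro has_integral_add has_integral_diff has_integral_mult_right qq pair[OF assms] KK)
  from has_integral_nonneg[OF this[unfolded expand]]
  have "0 \<le> integral {0..1} (\<lambda>x. (poly q x)\<^sup>2) - 2 * c * poly q 0 + c\<^sup>2 * (real k + 1)\<^sup>2"
    by simp
  also have "\<dots> = integral {0..1} (\<lambda>x. (poly q x)\<^sup>2) - (poly q 0)\<^sup>2 / (real k + 1)\<^sup>2"
  proof -
    have "c * (real k + 1)\<^sup>2 = poly q 0" by (simp add: c_def)
    then have "c\<^sup>2 * (real k + 1)\<^sup>2 = c * poly q 0" by (simp add: power2_eq_square[of c] mult.assoc)
    then show ?thesis by (simp add: c_def power2_eq_square[of "poly q 0"])
  qed
  finally have "(poly q 0)\<^sup>2 / (real k + 1)\<^sup>2 \<le> integral {0..1} (\<lambda>x. (poly q x)\<^sup>2)" by simp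
  moreover have "0 < (real k + 1)\<^sup>2" by simp
  ultimately show ?thesis by (simp only: pos_divide_le_eq mult.commute)
qed

lemma poly_endpoint_bound:
  fixes q :: "real poly"
  assumes "degree q \<le> k"
  shows "ennreal ((poly q 1)\<^sup>2) \<le> (\<integral>\<^sup>+r\<in>{1/2<..<1}. ennreal (2 * (real k + 1)\<^sup>2 * (poly q r)\<^sup>2) \<partial>lborel)"
proof -
  define p where "p = pcompose q [:1, -1/2:]"
  have p: "poly p x = poly q (1 - x / 2)" for x by (simp add: p_def poly_pcompose)
  have "degree p \<le> k"
    using degree_pcompose_le[of q "[:1, -1/2:]"] assms by (simp add: p_def)
  have "((\<lambda>r. (poly p r)\<^sup>2) has_integral integral {0..1} (\<lambda>x. (poly p x)\<^sup>2)) {0..1}"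
    by (intro integrable_integral integrable_continuous_real continuous_intros)
  moreover have image_eq: "(\<lambda>x. 1 - x / 2) ` {0..1} = {1/2..1::real}"
  proof (intro Set.set_eqI iffI)
    fix x :: real assume "x \<in> {1/2..1}"
    then have "x = 1 - (2 - 2 * x) / 2" "2 - 2 * x \<in> {0..1}" by (auto simp: diff_divide_distrib)
    then show "x \<in> (\<lambda>x. 1 - x / 2) ` {0..1}" by blast
  qed auto
  ultimately have "((\<lambda>r. (poly p ((-2) * r + 2))\<^sup>2) has_integral (1/2) * integral {0..1} (\<lambda>x. (poly p x)\<^sup>2)) {1/2..1}"
    using has_integral_affinity[of "\<lambda>r. (poly p r)\<^sup>2" "integral {0..1} (\<lambda>x. (poly p x)\<^sup>2)" 0 1 "-2" 2]
    by (simp add: image_eq field_simps)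
  then have "((\<lambda>r. 2 * (real k + 1)\<^sup>2 * (poly q r)\<^sup>2) has_integral 2 * (real k + 1)\<^sup>2 * ((1/2) * integral {0..1} (\<lambda>x. (poly p x)\<^sup>2))) {1/2..1}"
    by (intro has_integral_mult_right) (simp add: p diff_divide_distrib)
  then have "(\<integral>\<^sup>+r\<in>{1/2<..<1}. ennreal (2 * (real k + 1)\<^sup>2 * (poly q r)\<^sup>2) \<partial>lborel) =
      ennreal (2 * (real k + 1)\<^sup>2 * ((1/2) * integral {0..1} (\<lambda>x. (poly p x)\<^sup>2)))"
    by (intro nn_integral_open_interval) auto
  moreover have "(poly q 1)\<^sup>2 \<le> (real k + 1)\<^sup>2 * integral {0..1} (\<lambda>x. (poly p x)\<^sup>2)"
    using poly_endpoint_bound_0[OF \<open>degree p \<le> k\<close>] by (simp add: p)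
  ultimately show ?thesis by (simp add: ennreal_leI)
qed

text \<open>The primitive \<open>(2 r - 1) (f r)\<^sup>2\<close> vanishes at \<open>1/2\<close> and equals \<open>(f 1)\<^sup>2\<close> at \<open>1\<close>.\<close>

lemma endpoint_bound_by_derivative:
  fixes f f' :: "real \<Rightarrow> real"
  assumes der: "\<And>r. (f has_real_derivative f' r) (at r)" and cont: "continuous_on UNIV f'"
  shows "ennreal ((f 1)\<^sup>2) \<le> (\<integral>\<^sup>+r\<in>{1/2<..<1}. ennreal (3 * (f r)\<^sup>2 + (f' r)\<^sup>2) \<partial>lborel)"
proof -
  have contf: "continuous_on S f" for S
    using der by (meson DERIV_isCont continuous_at_imp_continuous_on)
  have cont': "continuous_on S f'" for S using cont continuous_on_subset by blast
  define g where "g r = 2 * (f r)\<^sup>2 + (2 * r - 1) * (2 * f r * f' r)" for r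
  have "(g has_integral ((\<lambda>r. (2 * r - 1) * (f r)\<^sup>2) 1 - (\<lambda>r. (2 * r - 1) * (f r)\<^sup>2) (1/2))) {1/2..1}"
    unfolding g_def
    by (intro fundamental_theorem_of_calculus)
      (auto simp: has_real_derivative_iff_has_vector_derivative[symmetric] power2_eq_square algebra_simps
         intro!: derivative_eq_intros DERIV_subset[OF der])
  then have g: "(g has_integral (f 1)\<^sup>2) {1/2..1}" by simp
  have "(\<lambda>r. 3 * (f r)\<^sup>2 + (f' r)\<^sup>2) integrable_on {1/2..1}"
    by (intro integrable_continuous_real continuous_intros contf cont')
  then have h: "((\<lambda>r. 3 * (f r)\<^sup>2 + (f' r)\<^sup>2) has_integral integral {1/2..1} (\<lambda>r. 3 * (f r)\<^sup>2 + (f' r)\<^sup>2)) {1/2..1}"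
    by (rule integrable_integral)
  have "(f 1)\<^sup>2 \<le> integral {1/2..1} (\<lambda>r. 3 * (f r)\<^sup>2 + (f' r)\<^sup>2)"
  proof (rule has_integral_le[OF g h])
    fix r :: real assume r: "r \<in> {1/2..1}"
    have "(2 * r - 1) * (2 * f r * f' r) \<le> \<bar>(2 * r - 1) * (2 * f r * f' r)\<bar>" by simp
    also have "\<dots> = (2 * r - 1) * \<bar>2 * f r * f' r\<bar>" using r by (simp add: abs_mult)
    also have "\<dots> \<le> 1 * \<bar>2 * f r * f' r\<bar>" using r by (intro mult_right_mono) auto
    also have "\<dots> \<le> (f r)\<^sup>2 + (f' r)\<^sup>2"
      using sum_squares_bound[of "\<bar>f r\<bar>" "\<bar>f' r\<bar>"] by (simp add: abs_mult)
    finally show "g r \<le> 3 * (f r)\<^sup>2 + (f' r)\<^sup>2" unfolding g_def by simp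
  qed
  then show ?thesis using nn_integral_open_interval[OF _ h] by (simp add: ennreal_leI)
qed

lemma increment_bound_by_derivative:
  fixes f f' :: "real \<Rightarrow> real"
  assumes der: "\<And>r. (f has_real_derivative f' r) (at r)" and cont: "continuous_on UNIV f'"
  shows "ennreal ((f 1 - f 0)\<^sup>2) \<le> (\<integral>\<^sup>+r\<in>{0<..<1}. ennreal ((f' r)\<^sup>2) \<partial>lborel)"
proof -
  have cont': "continuous_on S f'" for S using cont continuous_on_subset by blast
  define c where "c = f 1 - f 0"
  have f': "(f' has_integral c) {0..1}"
    unfolding c_def
    by (intro fundamental_theorem_of_calculus)
      (auto simp: has_real_derivative_iff_has_vector_derivative[symmetric] intro!: DERIV_subset[OF der])
  have h: "((\<lambda>r. (f' r)\<^sup>2) has_integral integral {0..1} (\<lambda>r. (f' r)\<^sup>2)) {0..1}"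
    by (intro integrable_integral integrable_continuous_real continuous_intros cont')
  have expand: "(\<lambda>r. (f' r)\<^sup>2 - 2 * c * f' r + c\<^sup>2) = (\<lambda>r. (f' r - c)\<^sup>2)"
    by (rule ext) (simp add: power2_eq_square algebra_simps)
  have "((\<lambda>_. c\<^sup>2) has_integral c\<^sup>2) {0..1::real}"
    using has_integral_const_real[of "c\<^sup>2" 0 1] by simp
  then have "((\<lambda>r. (f' r)\<^sup>2 - 2 * c * f' r + c\<^sup>2) has_integral integral {0..1} (\<lambda>r. (f' r)\<^sup>2) - 2 * c * c + c\<^sup>2) {0..1}"
    by (intro has_integral_add has_integral_diff has_integral_mult_right h f')
  from has_integral_nonneg[OF this[unfolded expand]]
  have "0 \<le> integral {0..1} (\<lambda>r. (f' r)\<^sup>2) - 2 * c * c + c\<^sup>2" by simp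
  then have "c\<^sup>2 \<le> integral {0..1} (\<lambda>r. (f' r)\<^sup>2)" by (simp add: power2_eq_square)
  then show ?thesis using nn_integral_open_interval[OF _ h] by (simp add: ennreal_leI c_def)
qed


section \<open>Flat faces\<close>

definition flat_face :: "'a::euclidean_space set \<Rightarrow> bool" where
  "flat_face F \<longleftrightarrow> aff_dim F = int DIM('a) - 1 \<and> openin (top_of_set (affine hull F)) F \<and> bounded F"

lemma affine_hull_eq_hyperplane:
  fixes F :: "'a::euclidean_space set"
  assumes "aff_dim F = int DIM('a) - 1" "unit_normal F \<nu>" "a \<in> F"
  shows "affine hull F = {x. (x - a) \<bullet> \<nu> = 0}"
proof -
  have eq: "{x. (x - a) \<bullet> \<nu> = 0} = {x. \<nu> \<bullet> x = \<nu> \<bullet> a}"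
    by (simp add: inner_diff_left inner_commute[of \<nu>])
  have "\<nu> \<noteq> 0" using assms(2) by (auto simp: unit_normal_def)
  have "F \<subseteq> {x. \<nu> \<bullet> x = \<nu> \<bullet> a}"
  proof
    fix x assume "x \<in> F"
    then have "\<nu> \<bullet> (x - a) = 0" using assms(2,3) by (auto simp: unit_normal_def)
    then show "x \<in> {x. \<nu> \<bullet> x = \<nu> \<bullet> a}" by (simp add: inner_diff_right)
  qed
  then have "affine hull F \<subseteq> {x. \<nu> \<bullet> x = \<nu> \<bullet> a}"
    by (intro hull_minimal affine_hyperplane)
  moreover have "aff_dim (affine hull F) = aff_dim {x. \<nu> \<bullet> x = \<nu> \<bullet> a}"
    using assms(1) \<open>\<nu> \<noteq> 0\<close> by simp
  ultimately show ?thesis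
    unfolding eq using assms(3) affine_dim_equal[OF affine_affine_hull[of F] affine_hyperplane[of \<nu> "\<nu> \<bullet> a"]] by auto
qed

lemma flat_face_borel: "flat_face F \<Longrightarrow> F \<in> sets borel"
proof -
  assume "flat_face F"
  then obtain U where "open U" "F = affine hull F \<inter> U"
    unfolding flat_face_def by (auto simp: openin_open)
  moreover have "affine hull F \<in> sets borel"
    by (intro borel_closed closed_affine_hull)
  ultimately show ?thesis by (metis borel_open sets.Int)
qed

lemma emeasure_face_measure_finite:
  fixes F :: "'a::euclidean_space set"
  assumes dimF: "aff_dim F = int DIM('a) - 1" and "bounded E" and [measurable]: "E \<in> sets borel"
  shows "emeasure (face_measure F) E < \<infinity>"
proof -
  obtain \<nu> where \<nu>: "unit_normal F \<nu>" using unit_normal_exists[OF dimF] .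
  obtain a where a: "a \<in> F" using nonempty_face[OF dimF \<nu>] by blast
  obtain R where R: "\<And>x. x \<in> E \<Longrightarrow> norm x \<le> R" using assms(2) by (auto simp: bounded_iff)
  have "emeasure (face_measure F) E = (\<integral>\<^sup>+z. indicator E z \<partial>face_measure F)"
    by (simp add: sets_face_measure[OF dimF \<nu>])
  also have "\<dots> = (\<integral>\<^sup>+x. indicator E (x - ((x - a) \<bullet> \<nu>) *\<^sub>R \<nu>) * indicator {0<..<1} ((x - a) \<bullet> \<nu>) \<partial>lborel)"
    by (rule nn_integral_face_slab[OF dimF \<nu> _ a]) simp
  also have "\<dots> \<le> (\<integral>\<^sup>+x. indicator (cball 0 (R + 1)) (x::'a) \<partial>lborel)"
  proof (intro nn_integral_mono)
    fix x :: 'a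
    define u where "u = (x - a) \<bullet> \<nu>"
    have "norm x \<le> norm (x - u *\<^sub>R \<nu>) + \<bar>u\<bar>"
      using norm_triangle_ineq[of "x - u *\<^sub>R \<nu>" "u *\<^sub>R \<nu>"] norm_unit_normal[OF dimF \<nu>] by simp
    then have "indicator E (x - u *\<^sub>R \<nu>) * indicator {0<..<1} u \<le> (indicator (cball 0 (R + 1)) x :: ennreal)"
      using R[of "x - u *\<^sub>R \<nu>"] by (cases "x - u *\<^sub>R \<nu> \<in> E") (auto simp: indicator_def)
    then show "indicator E (x - ((x - a) \<bullet> \<nu>) *\<^sub>R \<nu>) * indicator {0<..<1} ((x - a) \<bullet> \<nu>) \<le> (indicator (cball 0 (R + 1)) x :: ennreal)"
      unfolding u_def .
  qed
  also have "\<dots> < \<infinity>" using emeasure_lborel_cball_finite[of "0::'a" "R + 1"] by simp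
  finally show ?thesis .
qed

lemma sigma_finite_face_measure:
  fixes F :: "'a::euclidean_space set"
  assumes "aff_dim F = int DIM('a) - 1"
  shows "sigma_finite_measure (face_measure F)"
proof
  have "ball 0 (real n) \<in> sets (face_measure F)" for n by (simp add: face_measure_def)
  moreover have "(\<Union>n. ball 0 (real n)) = (UNIV :: 'a set)"
    using reals_Archimedean2 by (auto simp: dist_norm)
  moreover have "emeasure (face_measure F) (ball 0 (real n)) \<noteq> \<infinity>" for n
    using emeasure_face_measure_finite[OF assms, of "ball 0 (real n)"] by (metis borel_open bounded_ball open_ball less_irrefl)
  ultimately show "\<exists>A. countable A \<and> A \<subseteq> sets (face_measure F) \<and> \<Union> A = space (face_measure F) \<and> (\<forall>a\<in>A. emeasure (face_measure F) a \<noteq> \<infinity>)"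
    by (intro exI[of _ "range (\<lambda>n. ball 0 (real n))"]) (auto simp: face_measure_def)
qed

section \<open>Trace inequalities\<close>

text \<open>Integration in polar form: the slice of the cone at height \<open>r * \<delta>\<close> above the apex is the image
  of the base under the dilation with factor \<open>r\<close>, which is at least \<open>1/2\<close>.\<close>

lemma nn_integral_truncated_cone:
  fixes F :: "'a::euclidean_space set" and \<Phi> :: "'a \<Rightarrow> ennreal"
  assumes dimF: "aff_dim F = int DIM('a) - 1" and \<nu>: "unit_normal F \<nu>" and a: "a \<in> F"
    and \<delta>: "(a - c) \<bullet> \<nu> = \<delta>" "0 < \<delta>"
    and [measurable]: "E \<in> sets borel" "\<Phi> \<in> borel_measurable borel"
  defines "C \<equiv> {x. \<delta> / 2 < (x - c) \<bullet> \<nu> \<and> (x - c) \<bullet> \<nu> < \<delta> \<and> c + (\<delta> / ((x - c) \<bullet> \<nu>)) *\<^sub>R (x - c) \<in> E}"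
  shows "(\<integral>\<^sup>+z\<in>E. (\<integral>\<^sup>+r\<in>{1/2<..<1}. \<Phi> (c + r *\<^sub>R (z - c)) \<partial>lborel) \<partial>face_measure F)
    \<le> ennreal (2 ^ (DIM('a) - 1) / \<delta>) * (\<integral>\<^sup>+x\<in>C. \<Phi> x \<partial>lborel)"
proof -
  define n where "n = DIM('a) - 1"
  interpret sigma_finite_measure "face_measure F" by (rule sigma_finite_face_measure[OF dimF])
  interpret lf: pair_sigma_finite "lborel :: real measure" "face_measure F" ..
  note [measurable_cong] = sets_face_measure[OF dimF \<nu>]
  have C [measurable]: "C \<in> sets borel" unfolding C_def by measurable
  define g where "g x = \<Phi> x * indicator C x" for x
  have g [measurable]: "g \<in> borel_measurable borel" unfolding g_def by measurable
  have slice: "(\<integral>\<^sup>+z\<in>E. \<Phi> (c + r *\<^sub>R (z - c)) \<partial>face_measure F) \<le> ennreal (2 ^ n) * (\<integral>\<^sup>+z. g (z + (\<delta> * r - \<delta>) *\<^sub>R \<nu>) \<partial>face_measure F)"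
    if r: "1/2 < r" "r < 1" for r
  proof -
    define w where "w = (1 - r) *\<^sub>R (c + \<delta> *\<^sub>R \<nu>)"
    have rep: "w + r *\<^sub>R z + (\<delta> * r - \<delta>) *\<^sub>R \<nu> = c + r *\<^sub>R (z - c)" for z
      by (simp add: w_def algebra_simps)
    have "w + r *\<^sub>R a - a = (1 - r) *\<^sub>R (\<delta> *\<^sub>R \<nu> - (a - c))" by (simp add: w_def algebra_simps)
    then have "(w + r *\<^sub>R a - a) \<bullet> \<nu> = (1 - r) * (\<delta> * (\<nu> \<bullet> \<nu>) - (a - c) \<bullet> \<nu>)"
      by (simp only: inner_scaleR_left inner_diff_left)
    then have w: "(w + r *\<^sub>R a - a) \<bullet> \<nu> = 0" using norm_unit_normal[OF dimF \<nu>] \<delta> by simp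
    have "(\<integral>\<^sup>+z\<in>E. \<Phi> (c + r *\<^sub>R (z - c)) \<partial>face_measure F) = (\<integral>\<^sup>+z. g (c + r *\<^sub>R (z - c)) \<partial>face_measure F)"
    proof (rule nn_integral_cong_AE, use AE_face_measure_hyperplane[OF dimF \<nu> a] in eventually_elim)
      fix z assume "(z - a) \<bullet> \<nu> = 0"
      then have z: "(z - c) \<bullet> \<nu> = \<delta>" using \<delta>(1) by (simp add: inner_diff_left)
      have "\<delta> / 2 < r * \<delta>" "r * \<delta> < \<delta>" using r \<delta>(2) by (auto simp: field_simps)
      then have "c + r *\<^sub>R (z - c) \<in> C \<longleftrightarrow> c + (\<delta> / (r * \<delta>)) *\<^sub>R (r *\<^sub>R (z - c)) \<in> E"
        unfolding C_def by (simp add: z)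
      also have "c + (\<delta> / (r * \<delta>)) *\<^sub>R (r *\<^sub>R (z - c)) = z" using r \<delta>(2) by simp
      finally show "\<Phi> (c + r *\<^sub>R (z - c)) * indicator E z = g (c + r *\<^sub>R (z - c))"
        by (simp add: g_def indicator_def)
    qed
    also have "\<dots> = (\<integral>\<^sup>+z. g (w + r *\<^sub>R z + (\<delta> * r - \<delta>) *\<^sub>R \<nu>) \<partial>face_measure F)"
      unfolding rep ..
    also have "\<dots> \<le> ennreal ((2 * r) ^ n) * (\<integral>\<^sup>+z. g (w + r *\<^sub>R z + (\<delta> * r - \<delta>) *\<^sub>R \<nu>) \<partial>face_measure F)"
      using r one_le_power[of "2 * r" n] mult_right_mono[of 1 "ennreal ((2 * r) ^ n)"] by fastforce
    also have "\<dots> = ennreal (2 ^ n) * (ennreal (r ^ n) * (\<integral>\<^sup>+z. g (w + r *\<^sub>R z + (\<delta> * r - \<delta>) *\<^sub>R \<nu>) \<partial>face_measure F))"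
      using r by (simp add: power_mult_distrib ennreal_mult mult.assoc)
    also have "ennreal (r ^ n) * (\<integral>\<^sup>+z. g (w + r *\<^sub>R z + (\<delta> * r - \<delta>) *\<^sub>R \<nu>) \<partial>face_measure F) = (\<integral>\<^sup>+z. g (z + (\<delta> * r - \<delta>) *\<^sub>R \<nu>) \<partial>face_measure F)"
      unfolding n_def using r w by (intro nn_integral_face_affine[symmetric, OF dimF \<nu> _ a]) auto
    finally show ?thesis .
  qed
  have "(\<integral>\<^sup>+z\<in>E. (\<integral>\<^sup>+r\<in>{1/2<..<1}. \<Phi> (c + r *\<^sub>R (z - c)) \<partial>lborel) \<partial>face_measure F)
      = (\<integral>\<^sup>+z. \<integral>\<^sup>+r. \<Phi> (c + r *\<^sub>R (z - c)) * indicator {1/2<..<1} r * indicator E z \<partial>lborel \<partial>face_measure F)"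
    by (subst nn_integral_multc) auto
  also have "\<dots> = (\<integral>\<^sup>+r. \<integral>\<^sup>+z. \<Phi> (c + r *\<^sub>R (z - c)) * indicator {1/2<..<1} r * indicator E z \<partial>face_measure F \<partial>lborel)"
    by (rule lf.Fubini') measurable
  also have "\<dots> = (\<integral>\<^sup>+r. (\<integral>\<^sup>+z\<in>E. \<Phi> (c + r *\<^sub>R (z - c)) \<partial>face_measure F) * indicator {1/2<..<1} r \<partial>lborel)"
    by (subst nn_integral_multc[symmetric]) (auto simp: mult_ac)
  also have "\<dots> \<le> (\<integral>\<^sup>+r. ennreal (2 ^ n) * (\<integral>\<^sup>+z. g (z + (\<delta> * r - \<delta>) *\<^sub>R \<nu>) \<partial>face_measure F) \<partial>lborel)"
    using slice by (intro nn_integral_mono) (auto simp: indicator_def)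
  also have "\<dots> = ennreal (2 ^ n) * (\<integral>\<^sup>+r. (\<integral>\<^sup>+z. g (z + (\<delta> * r - \<delta>) *\<^sub>R \<nu>) \<partial>face_measure F) \<partial>lborel)"
    by (rule nn_integral_cmult) measurable
  also have "(\<integral>\<^sup>+r. (\<integral>\<^sup>+z. g (z + (\<delta> * r - \<delta>) *\<^sub>R \<nu>) \<partial>face_measure F) \<partial>lborel) = ennreal (1/\<delta>) * (\<integral>\<^sup>+s. (\<integral>\<^sup>+z. g (z + s *\<^sub>R \<nu>) \<partial>face_measure F) \<partial>lborel)"
  proof -
    have "(\<integral>\<^sup>+s. (\<integral>\<^sup>+z. g (z + s *\<^sub>R \<nu>) \<partial>face_measure F) \<partial>lborel) = \<bar>\<delta>\<bar> * (\<integral>\<^sup>+r. (\<integral>\<^sup>+z. g (z + (- \<delta> + \<delta> * r) *\<^sub>R \<nu>) \<partial>face_measure F) \<partial>lborel)"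
      using \<delta>(2) by (intro nn_integral_real_affine) auto
    then show ?thesis
      using \<delta>(2) by (simp add: mult.assoc[symmetric] ennreal_mult[symmetric])
  qed
  also have "(\<integral>\<^sup>+s. (\<integral>\<^sup>+z. g (z + s *\<^sub>R \<nu>) \<partial>face_measure F) \<partial>lborel) = (\<integral>\<^sup>+z. (\<integral>\<^sup>+s. g (z + s *\<^sub>R \<nu>) \<partial>lborel) \<partial>face_measure F)"
    by (rule lf.Fubini'[symmetric]) measurable
  also have "\<dots> = (\<integral>\<^sup>+x. g x \<partial>lborel)"
    by (rule nn_integral_lborel_slices[symmetric, OF dimF \<nu> g])
  finally show ?thesis
    using \<delta>(2) unfolding g_def n_def[symmetric]
    by (simp add: mult.assoc[symmetric] ennreal_mult[symmetric])
qed

lemma star_shaped_ballE: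
  assumes "star_shaped_ball r S"
  obtains c where "ball c r \<subseteq> S" "\<And>z t y. z \<in> closure S \<Longrightarrow> y \<in> ball c r \<Longrightarrow> 0 < t \<Longrightarrow> t \<le> 1 \<Longrightarrow> (1 - t) *\<^sub>R z + t *\<^sub>R y \<in> S"
proof -
  obtain c where c: "\<And>y. y \<in> ball c r \<Longrightarrow> y \<in> S" "\<And>y z. y \<in> ball c r \<Longrightarrow> z \<in> S \<Longrightarrow> closed_segment y z \<subseteq> S"
    using assms unfolding star_shaped_ball_def by blast
  have "(1 - t) *\<^sub>R z + t *\<^sub>R y \<in> S" if z: "z \<in> closure S" and y: "y \<in> ball c r" and t: "0 < t" "t \<le> 1" for z t y
  proof -
    obtain e where e: "e > 0" "ball y e \<subseteq> ball c r" using openE[OF open_ball y] by blast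
    obtain z' where z': "z' \<in> S" "dist z' z < e * t" using z e(1) t(1) unfolding closure_approachable by (meson mult_pos_pos)
    define y' where "y' = y + ((1 - t) / t) *\<^sub>R (z - z')"
    have "dist y y' = ((1 - t) / t) * dist z' z" using t by (simp add: y'_def dist_norm norm_minus_commute)
    also have "\<dots> \<le> 1 / t * dist z' z" using t by (intro mult_right_mono divide_right_mono) auto
    also have "\<dots> < e" using z' t by (simp add: field_simps)
    finally have "y' \<in> ball c r" using e by auto
    then have "closed_segment y' z' \<subseteq> S" using c(2) z'(1) by blast
    moreover have "(1 - t) *\<^sub>R z' + t *\<^sub>R y' \<in> closed_segment y' z'"
      using t by (auto simp: closed_segment_def intro!: exI[of _ "1 - t"])
    moreover have "(1 - t) *\<^sub>R z' + t *\<^sub>R y' = (1 - t) *\<^sub>R z + t *\<^sub>R y"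
    proof -
      have "t *\<^sub>R y' = t *\<^sub>R y + (1 - t) *\<^sub>R (z - z')" using t by (simp add: y'_def scaleR_add_right)
      then show ?thesis by (simp add: algebra_simps)
    qed
    ultimately show ?thesis by auto
  qed
  then show ?thesis using that[of c] c(1) by blast
qed

text \<open>If the hyperplane of the face met the ball, the segment from a point of the face to a point of the
  intersection would start inside the face and run in \<open>S\<close>.\<close>

lemma star_center_far_from_face:
  fixes F :: "'a::euclidean_space set"
  assumes F: "flat_face F" and \<nu>: "unit_normal F \<nu>" and a: "a \<in> F"
    and z: "z \<in> F" "z \<in> closure S" and disj: "F \<inter> S = {}"
    and star: "\<And>z t y. z \<in> closure S \<Longrightarrow> y \<in> ball c r \<Longrightarrow> 0 < t \<Longrightarrow> t \<le> 1 \<Longrightarrow> (1 - t) *\<^sub>R z + t *\<^sub>R y \<in> S"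
  shows "r \<le> \<bar>(a - c) \<bullet> \<nu>\<bar>"
proof (rule ccontr)
  assume less: "\<not> r \<le> \<bar>(a - c) \<bullet> \<nu>\<bar>"
  have dimF: "aff_dim F = int DIM('a) - 1" using F by (simp add: flat_face_def)
  define y where "y = c + ((a - c) \<bullet> \<nu>) *\<^sub>R \<nu>"
  have y: "y \<in> ball c r" using less norm_unit_normal[OF dimF \<nu>] by (simp add: y_def dist_norm)
  have hull: "affine hull F = {x. (x - a) \<bullet> \<nu> = 0}" by (rule affine_hull_eq_hyperplane[OF dimF \<nu> a])
  have yH: "(y - a) \<bullet> \<nu> = 0" using norm_unit_normal[OF dimF \<nu>] by (simp add: y_def inner_add_left inner_diff_left)
  have zH: "(z - a) \<bullet> \<nu> = 0" using z(1) hull hull_inc[of z F] by auto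
  obtain U where U: "open U" "F = affine hull F \<inter> U" using F by (auto simp: flat_face_def openin_open)
  then obtain e where e: "e > 0" "ball z e \<subseteq> U" using z(1) openE by blast
  define t where "t = min 1 (e / (2 * (norm (y - z) + 1)))"
  have np: "0 < norm (y - z) + 1" by (simp add: add_nonneg_pos)
  have t: "0 < t" "t \<le> 1" using e np by (auto simp: t_def)
  define p where "p = (1 - t) *\<^sub>R z + t *\<^sub>R y"
  have p_eq: "p - z = t *\<^sub>R (y - z)" by (simp add: p_def algebra_simps)
  have "t * norm (y - z) \<le> e / (2 * (norm (y - z) + 1)) * norm (y - z)"
    by (intro mult_right_mono) (auto simp: t_def)
  also have "\<dots> < e" using e np by (auto simp: field_simps intro!: add_pos_nonneg)
  finally have "dist z p < e" using t by (simp add: dist_norm norm_minus_commute[of z] p_eq)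
  then have "p \<in> U" using e by auto
  moreover have "p \<in> affine hull F"
  proof -
    have "p - a = (1 - t) *\<^sub>R (z - a) + t *\<^sub>R (y - a)" by (simp add: p_def algebra_simps)
    then have "(p - a) \<bullet> \<nu> = (1 - t) * ((z - a) \<bullet> \<nu>) + t * ((y - a) \<bullet> \<nu>)"
      by (simp only: inner_add_left inner_scaleR_left)
    then show ?thesis unfolding hull using yH zH by simp
  qed
  moreover have "p \<in> S" unfolding p_def using star[OF z(2) y t] .
  ultimately show False using U disj by blast
qed

lemma diameter_open_pos:
  fixes T :: "'a::euclidean_space set"
  assumes "open T" "bounded T" "T \<noteq> {}"
  shows "0 < diameter T"
proof -
  obtain x where x: "x \<in> T" using assms(3) by blast
  then obtain e where e: "e > 0" "cball x e \<subseteq> T" using assms(1) open_contains_cball by blast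
  obtain b :: 'a where b: "norm b = 1" using vector_choose_size[of 1] by auto
  have "x + e *\<^sub>R b \<in> T" using e b by (auto simp: subset_iff dist_norm)
  from diameter_bounded_bound[OF assms(2) x this] show ?thesis using e b by (simp add: dist_norm)
qed

lemma sum_indicator_disjoint_le:
  fixes x :: 'x and T :: "'x set"
  assumes "finite I" "\<And>i. i \<in> I \<Longrightarrow> A i \<subseteq> T" "\<And>i j. i \<in> I \<Longrightarrow> j \<in> I \<Longrightarrow> i \<noteq> j \<Longrightarrow> A i \<inter> A j = {}"
  shows "(\<Sum>i\<in>I. indicator (A i) x) \<le> (indicator T x :: ennreal)"
proof -
  have "disjoint_family_on A I" using assms(3) by (auto simp: disjoint_family_on_def)
  then have "(\<Sum>i\<in>I. indicator (A i) x) = (indicator (\<Union>i\<in>I. A i) x :: ennreal)"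
    by (simp add: indicator_UN_disjoint[OF assms(1)])
  also have "\<dots> \<le> indicator T x" using assms(2) by (auto simp: indicator_def)
  finally show ?thesis .
qed

text \<open>The cones from the center of one star-shaped piece over its share of the boundary lie in the piece.
  They do not overlap, because a ray from the center meets the frontier of the element at most once
  within the closure of the piece; and their heights are bounded below. Neither the number nor the size
  of the faces enters. The values of \<open>G\<close> on the faces are bounded by integrals over the outer halves of
  the rays only, where the Jacobian of polar coordinates is bounded below.\<close>

lemma star_shaped_trace:
  fixes T :: "'a::euclidean_space set" and \<Phi> G :: "'a \<Rightarrow> ennreal"
  assumes T: "open T" "bounded T" "T \<noteq> {}" and \<rho>: "0 < \<rho>" and conn: "connected_by_star_shaped \<rho> T"
    and \<G>: "finite \<G>" "disjoint \<G>" "\<And>F. F \<in> \<G> \<Longrightarrow> flat_face F \<and> F \<subseteq> frontier T"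
    and meas [measurable]: "\<Phi> \<in> borel_measurable borel" "G \<in> borel_measurable borel"
    and bound: "\<And>F z c. F \<in> \<G> \<Longrightarrow> z \<in> F \<Longrightarrow> c \<in> T \<Longrightarrow> G z \<le> (\<integral>\<^sup>+r\<in>{1/2<..<1}. \<Phi> (c + r *\<^sub>R (z - c)) \<partial>lborel)"
  shows "(\<Sum>F\<in>\<G>. \<integral>\<^sup>+z\<in>F. G z \<partial>face_measure F) \<le> ennreal (2 ^ (DIM('a) - 1) / (\<rho>\<^sup>2 * diameter T)) * (\<integral>\<^sup>+x\<in>T. \<Phi> x \<partial>lborel)"
proof -
  define h where "h = diameter T"
  have h: "0 < h" unfolding h_def using diameter_open_pos[OF T] .
  obtain \<S> where \<S>: "finite \<S>" "real (card \<S>) \<le> 1 / \<rho>" "T = \<Union>\<S>" "\<And>S. S \<in> \<S> \<Longrightarrow> star_shaped_ball (\<rho> * h) S"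
    using conn unfolding connected_by_star_shaped_def h_def by blast
  let ?K = "2 ^ (DIM('a) - 1) / (\<rho> * h)"
  let ?G = "\<lambda>F S. \<integral>\<^sup>+z\<in>F \<inter> closure S. G z \<partial>face_measure F" and ?\<Phi> = "\<lambda>C. \<integral>\<^sup>+x\<in>C. \<Phi> x \<partial>lborel"
  have piece: "(\<Sum>F\<in>\<G>. ?G F S) \<le> ennreal ?K * ?\<Phi> T" if S: "S \<in> \<S>" for S
  proof -
    obtain c where c: "ball c (\<rho> * h) \<subseteq> S" "\<And>z t y. z \<in> closure S \<Longrightarrow> y \<in> ball c (\<rho> * h) \<Longrightarrow> 0 < t \<Longrightarrow> t \<le> 1 \<Longrightarrow> (1 - t) *\<^sub>R z + t *\<^sub>R y \<in> S"
      using star_shaped_ballE[OF \<S>(4)[OF S]] by metis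
    have cball: "c \<in> ball c (\<rho> * h)" using \<rho> h by simp
    then have cT: "c \<in> T" using c(1) \<S>(3) S by blast
    have ST: "S \<subseteq> T" using \<S>(3) S by blast
    have inS: "c + r *\<^sub>R (z - c) \<in> S" if "z \<in> closure S" "0 \<le> r" "r < 1" for z r
      using c(2)[OF that(1) cball, of "1 - r"] that(2,3) by (simp add: algebra_simps)
    have FT: "F \<inter> T = {}" if "F \<in> \<G>" for F
      using \<G>(3)[OF that] T(1) by (auto simp: frontier_def interior_open)
    define P where "P F C \<longleftrightarrow> C \<in> sets borel \<and> (\<forall>x\<in>C. \<exists>z\<in>F \<inter> closure S. \<exists>r. 0 < r \<and> r < 1 \<and> x = c + r *\<^sub>R (z - c)) \<and>
        ?G F S \<le> ennreal ?K * ?\<Phi> C" for F C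
    have "\<exists>C. C \<in> sets borel \<and> (\<forall>x\<in>C. \<exists>z\<in>F \<inter> closure S. \<exists>r. 0 < r \<and> r < 1 \<and> x = c + r *\<^sub>R (z - c)) \<and>
        ?G F S \<le> ennreal ?K * ?\<Phi> C" if F: "F \<in> \<G>" for F
    proof (cases "F \<inter> closure S = {}")
      case True
      then show ?thesis by (intro exI[of _ "{}"]) simp
    next
      case False
      then obtain a where a: "a \<in> F" "a \<in> closure S" by blast
      have ff: "flat_face F" and dimF: "aff_dim F = int DIM('a) - 1" using \<G>(3)[OF F] by (auto simp: flat_face_def)
      obtain \<nu>0 where \<nu>0: "unit_normal F \<nu>0" using unit_normal_exists[OF dimF] .
      \<comment> \<open>The normal pointing away from the center, so that the height \<open>\<delta>\<close> of the cone is positive.\<close>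
      define \<nu> where "\<nu> = (if (a - c) \<bullet> \<nu>0 \<ge> 0 then \<nu>0 else - \<nu>0)"
      have \<nu>: "unit_normal F \<nu>" using \<nu>0 by (auto simp: \<nu>_def unit_normal_def)
      define \<delta> where "\<delta> = (a - c) \<bullet> \<nu>"
      have "\<delta> = \<bar>(a - c) \<bullet> \<nu>\<bar>" by (simp add: \<delta>_def \<nu>_def)
      then have \<delta>_ge: "\<rho> * h \<le> \<delta>"
        using star_center_far_from_face[OF ff \<nu> a(1) a(1,2) _ c(2)] FT[OF F] ST by auto
      have \<delta>: "0 < \<delta>" using \<delta>_ge \<rho> h by (meson less_le_trans mult_pos_pos)
      have E [measurable]: "F \<inter> closure S \<in> sets borel" using flat_face_borel[OF ff] by simp
      define C where "C = {x. \<delta> / 2 < (x - c) \<bullet> \<nu> \<and> (x - c) \<bullet> \<nu> < \<delta> \<and> c + (\<delta> / ((x - c) \<bullet> \<nu>)) *\<^sub>R (x - c) \<in> F \<inter> closure S}"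
      have C [measurable]: "C \<in> sets borel" unfolding C_def by measurable
      have "?G F S \<le> (\<integral>\<^sup>+z\<in>F \<inter> closure S. (\<integral>\<^sup>+r\<in>{1/2<..<1}. \<Phi> (c + r *\<^sub>R (z - c)) \<partial>lborel) \<partial>face_measure F)"
        using bound[OF F _ cT] by (intro nn_integral_mono) (auto simp: indicator_def)
      also have "\<dots> \<le> ennreal (2 ^ (DIM('a) - 1) / \<delta>) * ?\<Phi> C"
        unfolding C_def by (rule nn_integral_truncated_cone[OF dimF \<nu> a(1) _ \<delta> E]) (simp_all add: \<delta>_def)
      also have "\<dots> \<le> ennreal ?K * ?\<Phi> C"
        using \<rho> h \<delta> \<delta>_ge by (intro mult_right_mono ennreal_leI divide_left_mono) auto
      finally have "?G F S \<le> ennreal ?K * ?\<Phi> C" .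
      moreover have "\<exists>z\<in>F \<inter> closure S. \<exists>r. 0 < r \<and> r < 1 \<and> x = c + r *\<^sub>R (z - c)" if "x \<in> C" for x
      proof -
        have 1: "\<delta> / 2 < (x - c) \<bullet> \<nu>" "(x - c) \<bullet> \<nu> < \<delta>" using that by (auto simp: C_def)
        define z where "z = c + (\<delta> / ((x - c) \<bullet> \<nu>)) *\<^sub>R (x - c)"
        have "z \<in> F \<inter> closure S" using that by (simp add: C_def z_def)
        moreover have "x = c + ((x - c) \<bullet> \<nu> / \<delta>) *\<^sub>R (z - c)" using 1 \<delta> by (simp add: z_def)
        moreover have "0 < (x - c) \<bullet> \<nu> / \<delta>" "(x - c) \<bullet> \<nu> / \<delta> < 1" using 1 \<delta> by auto
        ultimately show ?thesis by blast
      qed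
      ultimately show ?thesis using C by blast
    qed
    then have "\<forall>F\<in>\<G>. \<exists>C. P F C" by (simp add: P_def)
    then obtain C where "\<forall>F\<in>\<G>. P F (C F)" using bchoice by metis
    then have C: "\<And>F. F \<in> \<G> \<Longrightarrow> C F \<in> sets borel"
      "\<And>F x. F \<in> \<G> \<Longrightarrow> x \<in> C F \<Longrightarrow> \<exists>z\<in>F \<inter> closure S. \<exists>r. 0 < r \<and> r < 1 \<and> x = c + r *\<^sub>R (z - c)"
      "\<And>F. F \<in> \<G> \<Longrightarrow> ?G F S \<le> ennreal ?K * ?\<Phi> (C F)"
      by (auto simp: P_def)
    have CT: "C F \<subseteq> T" if "F \<in> \<G>" for F using C(2)[OF that] inS ST by fastforce
    \<comment> \<open>Of two boundary points on one ray, the one nearer to the center would belong to \<open>S\<close>.\<close>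
    have Cdisj: "C F \<inter> C F' = {}" if F: "F \<in> \<G>" "F' \<in> \<G>" "F \<noteq> F'" for F F'
    proof -
      have no: False if "F1 \<in> \<G>" "F2 \<in> \<G>" "z1 \<in> F1 \<inter> closure S" "z2 \<in> F2 \<inter> closure S" "0 < r1" "r1 \<le> r2" "r2 < 1"
        "c + r1 *\<^sub>R (z1 - c) = c + r2 *\<^sub>R (z2 - c)" "z1 \<noteq> z2" for F1 F2 z1 z2 r1 r2
      proof -
        have "r1 < r2" using that by (cases "r1 = r2") auto
        have "z2 = c + (r1 / r2) *\<^sub>R (z1 - c)"
        proof -
          have "(r1 / r2) *\<^sub>R (z1 - c) = (1 / r2) *\<^sub>R (r1 *\<^sub>R (z1 - c))" by simp
          also have "\<dots> = (1 / r2) *\<^sub>R (r2 *\<^sub>R (z2 - c))" using that(8) by simp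
          also have "\<dots> = z2 - c" using that by simp
          finally show ?thesis by simp
        qed
        moreover have "0 \<le> r1 / r2" "r1 / r2 < 1" using that \<open>r1 < r2\<close> by auto
        ultimately have "z2 \<in> S" using inS[of z1 "r1 / r2"] that by auto
        then show False using FT[OF that(2)] ST that(4) by blast
      qed
      show ?thesis
      proof (rule ccontr)
        assume "C F \<inter> C F' \<noteq> {}"
        then obtain x where "x \<in> C F" "x \<in> C F'" by blast
        then obtain z r z' r' where *: "z \<in> F \<inter> closure S" "0 < r" "r < 1" "x = c + r *\<^sub>R (z - c)"
          "z' \<in> F' \<inter> closure S" "0 < r'" "r' < 1" "x = c + r' *\<^sub>R (z' - c)"
          using C(2) F by metis
        have "z \<noteq> z'" using \<G>(2) F * by (auto simp: disjoint_def)
        then show False using no[of F F' z z' r r'] no[of F' F z' z r' r] F * by (cases "r \<le> r'") auto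
      qed
    qed
    have "(\<Sum>F\<in>\<G>. ?G F S) \<le> (\<Sum>F\<in>\<G>. ennreal ?K * ?\<Phi> (C F))"
      by (intro sum_mono C(3))
    also have "\<dots> = ennreal ?K * (\<Sum>F\<in>\<G>. ?\<Phi> (C F))" by (simp add: sum_distrib_left)
    also have "(\<Sum>F\<in>\<G>. ?\<Phi> (C F)) = (\<integral>\<^sup>+x. (\<Sum>F\<in>\<G>. \<Phi> x * indicator (C F) x) \<partial>lborel)"
      using C(1) by (intro nn_integral_sum[symmetric]) auto
    also have "\<dots> \<le> ?\<Phi> T"
    proof (intro nn_integral_mono)
      fix x
      have "(\<Sum>F\<in>\<G>. \<Phi> x * indicator (C F) x) = \<Phi> x * (\<Sum>F\<in>\<G>. indicator (C F) x)" by (simp add: sum_distrib_left)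
      also have "\<dots> \<le> \<Phi> x * indicator T x"
        by (intro mult_left_mono sum_indicator_disjoint_le[OF \<G>(1) CT Cdisj]) auto
      finally show "(\<Sum>F\<in>\<G>. \<Phi> x * indicator (C F) x) \<le> \<Phi> x * indicator T x" .
    qed
    finally show ?thesis by (simp add: mult_left_mono)
  qed
  have "(\<Sum>F\<in>\<G>. \<integral>\<^sup>+z\<in>F. G z \<partial>face_measure F) \<le> (\<Sum>F\<in>\<G>. \<Sum>S\<in>\<S>. ?G F S)"
  proof (intro sum_mono)
    fix F assume F: "F \<in> \<G>"
    have ff: "flat_face F" and dimF: "aff_dim F = int DIM('a) - 1" using \<G>(3)[OF F] by (auto simp: flat_face_def)
    obtain \<nu> where \<nu>: "unit_normal F \<nu>" using unit_normal_exists[OF dimF] .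
    note [measurable_cong] = sets_face_measure[OF dimF \<nu>]
    have [measurable]: "F \<in> sets borel" using flat_face_borel[OF ff] .
    have [measurable]: "closure S \<in> sets borel" for S :: "'a set" by simp
    have "F \<subseteq> closure T" using \<G>(3)[OF F] by (auto simp: frontier_def)
    also have "closure T \<subseteq> (\<Union>S\<in>\<S>. closure S)"
      unfolding \<S>(3) using \<S>(1) closure_subset by (intro closure_minimal closed_UN) auto
    finally have cover: "F \<subseteq> (\<Union>S\<in>\<S>. closure S)" .
    have "(\<integral>\<^sup>+z\<in>F. G z \<partial>face_measure F) \<le> (\<integral>\<^sup>+z. (\<Sum>S\<in>\<S>. G z * indicator (F \<inter> closure S) z) \<partial>face_measure F)"
    proof (intro nn_integral_mono)
      fix z
      show "G z * indicator F z \<le> (\<Sum>S\<in>\<S>. G z * indicator (F \<inter> closure S) z)"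
      proof (cases "z \<in> F")
        case True
        then obtain S where S: "S \<in> \<S>" "z \<in> closure S" using cover by blast
        have "G z * indicator F z = G z * indicator (F \<inter> closure S) z" using S True by simp
        also have "\<dots> \<le> (\<Sum>S\<in>\<S>. G z * indicator (F \<inter> closure S) z)"
          using S(1) \<S>(1) by (intro member_le_sum) auto
        finally show ?thesis .
      qed simp
    qed
    also have "\<dots> = (\<Sum>S\<in>\<S>. ?G F S)"
      by (intro nn_integral_sum) measurable
    finally show "(\<integral>\<^sup>+z\<in>F. G z \<partial>face_measure F) \<le> (\<Sum>S\<in>\<S>. ?G F S)" .
  qed
  also have "\<dots> = (\<Sum>S\<in>\<S>. \<Sum>F\<in>\<G>. ?G F S)" by (rule sum.swap)
  also have "\<dots> \<le> (\<Sum>S\<in>\<S>. ennreal ?K * ?\<Phi> T)" by (intro sum_mono piece)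
  also have "\<dots> = ennreal (real (card \<S>)) * ennreal ?K * ?\<Phi> T"
    by (simp add: ennreal_of_nat_eq_real_of_nat mult.assoc)
  also have "\<dots> \<le> ennreal (1 / \<rho>) * ennreal ?K * ?\<Phi> T"
    using \<S>(2) by (intro mult_right_mono ennreal_leI) auto
  also have "ennreal (1 / \<rho>) * ennreal ?K = ennreal (2 ^ (DIM('a) - 1) / (\<rho>\<^sup>2 * h))"
    using \<rho> h by (subst ennreal_mult[symmetric]) (auto simp: power2_eq_square mult.assoc)
  finally show ?thesis unfolding h_def .
qed


section \<open>The Poincare inequality on sets connected by star-shaped sets\<close>

lemma AE_not_in_closed_negligible:
  fixes N :: "'a::euclidean_space set"
  assumes "closed N" "negligible N"
  shows "AE x in lborel. x \<notin> N"
proof -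
  have "N \<in> null_sets (completion lborel)"
    using assms(2) by (simp add: negligible_iff_null_sets)
  then have "N \<in> null_sets lborel"
    using assms(1) by (simp add: null_sets_completion_iff)
  then show ?thesis by (rule AE_not_in)
qed

lemma nn_integral_dilation_le:
  fixes f :: "'a::euclidean_space \<Rightarrow> ennreal"
  assumes [measurable]: "f \<in> borel_measurable borel" and r: "1/2 \<le> r"
  shows "(\<integral>\<^sup>+y. f (w + r *\<^sub>R y) \<partial>lborel) \<le> ennreal (2 ^ DIM('a)) * (\<integral>\<^sup>+x. f x \<partial>lborel)"
proof -
  let ?I = "\<integral>\<^sup>+y. f (w + r *\<^sub>R y) \<partial>lborel"
  have "?I \<le> ennreal ((2 * r) ^ DIM('a)) * ?I"
    using r one_le_power[of "2 * r" "DIM('a)"] mult_right_mono[of 1 "ennreal ((2 * r) ^ DIM('a))" ?I] by fastforce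
  also have "\<dots> = ennreal (2 ^ DIM('a)) * (ennreal (r ^ DIM('a)) * ?I)"
    using r by (simp add: power_mult_distrib ennreal_mult mult.assoc)
  also have "ennreal (r ^ DIM('a)) * ?I = (\<integral>\<^sup>+x. f x \<partial>lborel)"
    using r by (intro nn_integral_lborel_affine[symmetric]) auto
  finally show ?thesis .
qed

lemma emeasure_lborel_ball:
  fixes c :: "'a::euclidean_space"
  assumes "0 \<le> r"
  shows "emeasure lborel (ball c r) = ennreal (r ^ DIM('a) * measure lborel (ball (0::'a) 1))"
    and "emeasure lborel (cball c r) = ennreal (r ^ DIM('a) * measure lborel (ball (0::'a) 1))"
proof -
  have "emeasure lborel (ball c r) = ennreal (measure lborel (ball c r))"
    using emeasure_lborel_ball_finite[of c r] by (intro emeasure_eq_ennreal_measure) auto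
  moreover have "emeasure lborel (cball c r) = ennreal (measure lborel (cball c r))"
    using emeasure_lborel_cball_finite[of c r] by (intro emeasure_eq_ennreal_measure) auto
  ultimately show "emeasure lborel (ball c r) = ennreal (r ^ DIM('a) * measure lborel (ball (0::'a) 1))"
    "emeasure lborel (cball c r) = ennreal (r ^ DIM('a) * measure lborel (ball (0::'a) 1))"
    using content_ball_conv_unit_ball[OF assms, of c] by (simp_all add: content_cball_conv_ball)
qed

lemma elem_polys_increment_bound:
  fixes f :: "'a::euclidean_space \<Rightarrow> real"
  assumes f: "f \<in> elem_polys m" and xy: "norm (x - y) \<le> h"
  shows "ennreal ((f x - f y)\<^sup>2) \<le> (\<integral>\<^sup>+t\<in>{0<..<1}. ennreal (h\<^sup>2 * (norm (grad f (y + t *\<^sub>R (x - y))))\<^sup>2) \<partial>lborel)"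
proof -
  have "continuous_on UNIV (\<lambda>t. grad f (y + t *\<^sub>R (x - y)) \<bullet> (x - y))"
    by (intro continuous_on_inner continuous_on_compose2[OF continuous_on_grad[OF f]] continuous_intros) auto
  then have "ennreal ((f (y + 1 *\<^sub>R (x - y)) - f (y + 0 *\<^sub>R (x - y)))\<^sup>2) \<le>
      (\<integral>\<^sup>+t\<in>{0<..<1}. ennreal ((grad f (y + t *\<^sub>R (x - y)) \<bullet> (x - y))\<^sup>2) \<partial>lborel)"
    by (intro increment_bound_by_derivative elem_polys_derivative_on_line[OF f])
  also have "\<dots> \<le> (\<integral>\<^sup>+t\<in>{0<..<1}. ennreal (h\<^sup>2 * (norm (grad f (y + t *\<^sub>R (x - y))))\<^sup>2) \<partial>lborel)"
  proof (intro nn_integral_mono mult_right_mono ennreal_leI)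
    fix t
    have "(grad f (y + t *\<^sub>R (x - y)) \<bullet> (x - y))\<^sup>2 \<le> (norm (grad f (y + t *\<^sub>R (x - y))) * norm (x - y))\<^sup>2"
      by (intro abs_le_square_iff[THEN iffD1]) (simp add: Cauchy_Schwarz_ineq2)
    also have "\<dots> \<le> (norm (grad f (y + t *\<^sub>R (x - y))) * h)\<^sup>2"
      using xy by (intro power_mono mult_left_mono) auto
    finally show "(grad f (y + t *\<^sub>R (x - y)) \<bullet> (x - y))\<^sup>2 \<le> h\<^sup>2 * (norm (grad f (y + t *\<^sub>R (x - y))))\<^sup>2"
      by (simp add: power_mult_distrib mult.commute)
  qed simp
  finally show ?thesis by simp
qed

text \<open>A point \<open>(1 - t) y + t x\<close> of the segment is, for fixed \<open>x\<close>, a dilate of \<open>y\<close> by the factor \<open>1 - t\<close>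
  and, for fixed \<open>y\<close>, a dilate of \<open>x\<close> by the factor \<open>t\<close>; one of the factors is at least \<open>1/2\<close>, so that
  substituting in that variable costs no more than \<open>2^d\<close>.\<close>

lemma double_integral_increment_bound:
  fixes f :: "'a::euclidean_space \<Rightarrow> real"
  assumes f: "f \<in> elem_polys m" and V [measurable]: "V \<in> sets borel" and B [measurable]: "B \<in> sets borel" and BV: "B \<subseteq> V"
    and star: "\<And>x y t. x \<in> V \<Longrightarrow> y \<in> B \<Longrightarrow> 0 < t \<Longrightarrow> t < 1 \<Longrightarrow> y + t *\<^sub>R (x - y) \<in> V"
    and dist: "\<And>x y. x \<in> V \<Longrightarrow> y \<in> B \<Longrightarrow> norm (x - y) \<le> h"
  shows "(\<integral>\<^sup>+y\<in>B. (\<integral>\<^sup>+x\<in>V. ennreal ((f x - f y)\<^sup>2) \<partial>lborel) \<partial>lborel) \<le>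
    ennreal (2 ^ DIM('a)) * emeasure lborel V * (\<integral>\<^sup>+x\<in>V. ennreal (h\<^sup>2 * (norm (grad f x))\<^sup>2) \<partial>lborel)"
proof -
  have [measurable]: "f \<in> borel_measurable borel"
    using continuous_on_elem_polys[OF f] by (rule borel_measurable_continuous_onI)
  have [measurable]: "grad f \<in> borel_measurable borel"
    using continuous_on_grad[OF f] by (rule borel_measurable_continuous_onI)
  define g where "g x = ennreal (h\<^sup>2 * (norm (grad f x))\<^sup>2)" for x
  have g [measurable]: "g \<in> borel_measurable borel" unfolding g_def by measurable
  define J where "J = ennreal (2 ^ DIM('a)) * (\<integral>\<^sup>+x\<in>V. g x \<partial>lborel)"
  have slice: "(\<integral>\<^sup>+y\<in>B. (\<integral>\<^sup>+x\<in>V. g (y + t *\<^sub>R (x - y)) \<partial>lborel) \<partial>lborel) \<le> emeasure lborel V * J" if t: "0 < t" "t < 1" for t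
  proof (cases "t \<le> 1/2")
    case False
    have "(\<integral>\<^sup>+y\<in>B. (\<integral>\<^sup>+x\<in>V. g (y + t *\<^sub>R (x - y)) \<partial>lborel) \<partial>lborel) \<le> (\<integral>\<^sup>+y. J * indicator B y \<partial>lborel)"
    proof (intro nn_integral_mono)
      fix y
      have "(\<integral>\<^sup>+x\<in>V. g (y + t *\<^sub>R (x - y)) \<partial>lborel) \<le> J" if y: "y \<in> B"
      proof -
        have "(\<integral>\<^sup>+x\<in>V. g (y + t *\<^sub>R (x - y)) \<partial>lborel) \<le> (\<integral>\<^sup>+x. g ((1 - t) *\<^sub>R y + t *\<^sub>R x) * indicator V ((1 - t) *\<^sub>R y + t *\<^sub>R x) \<partial>lborel)"
        proof (intro nn_integral_mono)
          fix x
          have "(1 - t) *\<^sub>R y + t *\<^sub>R x = y + t *\<^sub>R (x - y)" by (simp add: algebra_simps)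
          then show "g (y + t *\<^sub>R (x - y)) * indicator V x \<le> g ((1 - t) *\<^sub>R y + t *\<^sub>R x) * indicator V ((1 - t) *\<^sub>R y + t *\<^sub>R x)"
            using star[OF _ y t, of x] by (auto simp: indicator_def)
        qed
        also have "\<dots> \<le> J"
          unfolding J_def using False by (intro nn_integral_dilation_le) auto
        finally show ?thesis .
      qed
      then show "(\<integral>\<^sup>+x\<in>V. g (y + t *\<^sub>R (x - y)) \<partial>lborel) * indicator B y \<le> J * indicator B y"
        by (auto simp: indicator_def)
    qed
    also have "\<dots> = emeasure lborel B * J" by (simp add: nn_integral_cmult_indicator mult.commute)
    also have "\<dots> \<le> emeasure lborel V * J" using BV by (intro mult_right_mono emeasure_mono) auto
    finally show ?thesis .
  next
    case True
    have "(\<integral>\<^sup>+y\<in>B. (\<integral>\<^sup>+x\<in>V. g (y + t *\<^sub>R (x - y)) \<partial>lborel) \<partial>lborel)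
        = (\<integral>\<^sup>+y. (\<integral>\<^sup>+x. g (y + t *\<^sub>R (x - y)) * indicator V x * indicator B y \<partial>lborel) \<partial>lborel)"
      by (subst nn_integral_multc) auto
    also have "\<dots> = (\<integral>\<^sup>+x. (\<integral>\<^sup>+y. g (y + t *\<^sub>R (x - y)) * indicator V x * indicator B y \<partial>lborel) \<partial>lborel)"
      by (rule lborel_pair.Fubini') measurable
    also have "\<dots> \<le> (\<integral>\<^sup>+x. J * indicator V x \<partial>lborel)"
    proof (intro nn_integral_mono)
      fix x
      show "(\<integral>\<^sup>+y. g (y + t *\<^sub>R (x - y)) * indicator V x * indicator B y \<partial>lborel) \<le> J * indicator V x"
      proof (cases "x \<in> V")
        case x: True
        have "(\<integral>\<^sup>+y. g (y + t *\<^sub>R (x - y)) * indicator V x * indicator B y \<partial>lborel) \<le> (\<integral>\<^sup>+y. g (t *\<^sub>R x + (1 - t) *\<^sub>R y) * indicator V (t *\<^sub>R x + (1 - t) *\<^sub>R y) \<partial>lborel)"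
        proof (intro nn_integral_mono)
          fix y
          have "t *\<^sub>R x + (1 - t) *\<^sub>R y = y + t *\<^sub>R (x - y)" by (simp add: algebra_simps)
          then show "g (y + t *\<^sub>R (x - y)) * indicator V x * indicator B y \<le> g (t *\<^sub>R x + (1 - t) *\<^sub>R y) * indicator V (t *\<^sub>R x + (1 - t) *\<^sub>R y)"
            using star[OF x _ t, of y] by (auto simp: indicator_def)
        qed
        also have "\<dots> \<le> J"
          unfolding J_def using True by (intro nn_integral_dilation_le) auto
        finally show ?thesis using x by simp
      qed simp
    qed
    also have "\<dots> = emeasure lborel V * J" by (simp add: nn_integral_cmult_indicator mult.commute)
    finally show ?thesis .
  qed
  have "(\<integral>\<^sup>+y\<in>B. (\<integral>\<^sup>+x\<in>V. ennreal ((f x - f y)\<^sup>2) \<partial>lborel) \<partial>lborel)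
      \<le> (\<integral>\<^sup>+y\<in>B. (\<integral>\<^sup>+x\<in>V. (\<integral>\<^sup>+t\<in>{0<..<1}. g (y + t *\<^sub>R (x - y)) \<partial>lborel) \<partial>lborel) \<partial>lborel)"
  proof (intro nn_integral_mono)
    fix y
    have "(\<integral>\<^sup>+x\<in>V. ennreal ((f x - f y)\<^sup>2) \<partial>lborel) \<le> (\<integral>\<^sup>+x\<in>V. (\<integral>\<^sup>+t\<in>{0<..<1}. g (y + t *\<^sub>R (x - y)) \<partial>lborel) \<partial>lborel)" if "y \<in> B"
      using elem_polys_increment_bound[OF f dist[OF _ that]] unfolding g_def
      by (intro nn_integral_mono) (auto simp: indicator_def)
    then show "(\<integral>\<^sup>+x\<in>V. ennreal ((f x - f y)\<^sup>2) \<partial>lborel) * indicator B y \<le> (\<integral>\<^sup>+x\<in>V. (\<integral>\<^sup>+t\<in>{0<..<1}. g (y + t *\<^sub>R (x - y)) \<partial>lborel) \<partial>lborel) * indicator B y"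
      by (auto simp: indicator_def)
  qed
  also have "\<dots> = (\<integral>\<^sup>+y. (\<integral>\<^sup>+x. (\<integral>\<^sup>+t. g (y + t *\<^sub>R (x - y)) * indicator {0<..<1} t * indicator V x * indicator B y \<partial>lborel) \<partial>lborel) \<partial>lborel)"
    by (simp add: nn_integral_multc)
  also have "\<dots> = (\<integral>\<^sup>+y. (\<integral>\<^sup>+t. (\<integral>\<^sup>+x. g (y + t *\<^sub>R (x - y)) * indicator {0<..<1} t * indicator V x * indicator B y \<partial>lborel) \<partial>lborel) \<partial>lborel)"
    by (intro nn_integral_cong lborel_pair.Fubini') measurable
  also have "\<dots> = (\<integral>\<^sup>+t. (\<integral>\<^sup>+y. (\<integral>\<^sup>+x. g (y + t *\<^sub>R (x - y)) * indicator {0<..<1} t * indicator V x * indicator B y \<partial>lborel) \<partial>lborel) \<partial>lborel)"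
    by (rule lborel_pair.Fubini') measurable
  also have "\<dots> \<le> (\<integral>\<^sup>+t. emeasure lborel V * J * indicator {0<..<1::real} t \<partial>lborel)"
  proof (intro nn_integral_mono)
    fix t :: real
    have "(\<integral>\<^sup>+y. (\<integral>\<^sup>+x. g (y + t *\<^sub>R (x - y)) * indicator {0<..<1} t * indicator V x * indicator B y \<partial>lborel) \<partial>lborel)
        = (\<integral>\<^sup>+y\<in>B. (\<integral>\<^sup>+x\<in>V. g (y + t *\<^sub>R (x - y)) \<partial>lborel) \<partial>lborel) * indicator {0<..<1} t"
      by (cases "t \<in> {0<..<1}") (simp_all add: nn_integral_multc)
    also have "\<dots> \<le> emeasure lborel V * J * indicator {0<..<1::real} t"
      using slice[of t] by (auto simp: indicator_def)
    finally show "(\<integral>\<^sup>+y. (\<integral>\<^sup>+x. g (y + t *\<^sub>R (x - y)) * indicator {0<..<1} t * indicator V x * indicator B y \<partial>lborel) \<partial>lborel)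
      \<le> emeasure lborel V * J * indicator {0<..<1::real} t" .
  qed
  also have "\<dots> = emeasure lborel V * J" by (simp add: nn_integral_cmult_indicator)
  finally show ?thesis unfolding J_def g_def by (simp add: mult_ac)
qed

lemma exists_le_average:
  fixes f :: "'a \<Rightarrow> ennreal"
  assumes [measurable]: "f \<in> borel_measurable M" "B \<in> sets M" and B: "emeasure M B = ennreal b" "0 < b"
    and le: "(\<integral>\<^sup>+x\<in>B. f x \<partial>M) \<le> ennreal b * ennreal K"
  shows "\<exists>x\<in>B. f x \<le> ennreal K"
proof (rule ccontr)
  assume "\<not> ?thesis"
  then have less: "\<And>x. x \<in> B \<Longrightarrow> ennreal K < f x" by (auto simp: not_le)
  have int: "(\<integral>\<^sup>+x. ennreal K * indicator B x \<partial>M) = ennreal b * ennreal K"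
    using B by (simp add: nn_integral_cmult_indicator mult.commute)
  have "(\<integral>\<^sup>+x. ennreal K * indicator B x \<partial>M) < (\<integral>\<^sup>+x. f x * indicator B x \<partial>M)"
  proof (rule nn_integral_less)
    show "(\<integral>\<^sup>+x. ennreal K * indicator B x \<partial>M) \<noteq> \<infinity>"
      unfolding int by (simp add: ennreal_mult_eq_top_iff)
    show "AE x in M. ennreal K * indicator B x \<le> f x * indicator B x"
      using less by (auto simp: indicator_def less_imp_le)
    show "\<not> (AE x in M. f x * indicator B x \<le> ennreal K * indicator B x)"
    proof
      assume "AE x in M. f x * indicator B x \<le> ennreal K * indicator B x"
      then have "AE x in M. x \<notin> B"
        by eventually_elim (use less in \<open>force simp: indicator_def not_le split: if_splits\<close>)
      then have "emeasure M B = 0"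
        using AE_iff_measurable[of B M "\<lambda>x. x \<notin> B"] sets.sets_into_space[OF assms(2)] by auto
      then show False using B by simp
    qed
  qed auto
  then show False using le unfolding int by simp
qed

lemma chain_increment_bound:
  fixes m :: "'b \<Rightarrow> real"
  assumes "(A, B) \<in> R ^^ n" "\<And>A B. (A, B) \<in> R \<Longrightarrow> \<bar>m A - m B\<bar> \<le> D"
  shows "\<bar>m A - m B\<bar> \<le> real n * D"
  using assms(1)
proof (induction n arbitrary: B)
  case (Suc n)
  then obtain C where "(A, C) \<in> R ^^ n" "(C, B) \<in> R" by auto
  then show ?case using Suc.IH[of C] assms(2)[of C B] by (simp add: algebra_simps)
qed simp

text \<open>The points reached from \<open>z\<close> for all \<open>y\<close> in the ball form a neighbourhood of the given one.\<close>

lemma star_shaped_interior: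
  fixes S :: "'a::euclidean_space set"
  assumes star: "\<And>z t y. z \<in> closure S \<Longrightarrow> y \<in> ball c r \<Longrightarrow> 0 < t \<Longrightarrow> t \<le> 1 \<Longrightarrow> (1 - t) *\<^sub>R z + t *\<^sub>R y \<in> S"
    and z: "z \<in> closure S" and y: "y \<in> ball c r" and t: "0 < t" "t \<le> 1"
  shows "(1 - t) *\<^sub>R z + t *\<^sub>R y \<in> interior S"
proof -
  let ?W = "(\<lambda>y. (1 - t) *\<^sub>R z + t *\<^sub>R y) ` ball c r"
  have "open ?W" using t by (intro open_affinity) auto
  moreover have "?W \<subseteq> S" using star[OF z _ t] by auto
  ultimately have "?W \<subseteq> interior S" by (rule interior_maximal[rotated])
  then show ?thesis using y by blast
qed

text \<open>Every ray from the center meets the frontier of the interior at most once, so this frontier is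
  negligible; and \<open>S\<close> is contained in the closure of its interior.\<close>

lemma AE_star_shaped_interior:
  fixes S :: "'a::euclidean_space set"
  assumes star: "\<And>z t y. z \<in> closure S \<Longrightarrow> y \<in> ball c r \<Longrightarrow> 0 < t \<Longrightarrow> t \<le> 1 \<Longrightarrow> (1 - t) *\<^sub>R z + t *\<^sub>R y \<in> S"
    and r: "0 < r"
  shows "AE x in lborel. x \<in> S \<longrightarrow> x \<in> interior S"
proof -
  have c: "c \<in> ball c r" using r by simp
  have inside: "c + k *\<^sub>R x \<in> interior S" if "c + x \<in> closure S" "0 \<le> k" "k < 1" for k x
    using star_shaped_interior[OF star that(1) c, of "1 - k"] that(2,3) by (simp add: algebra_simps)
  have sub: "closure (interior S) \<subseteq> closure S" by (simp add: closure_mono interior_subset)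
  have "negligible (frontier (interior S))"
  proof (rule starlike_negligible[of _ c])
    fix k x assume *: "c + k *\<^sub>R x \<in> frontier (interior S)" "0 \<le> k" "c + x \<in> frontier (interior S)"
    have f: "frontier (interior S) = closure (interior S) - interior S" by (simp add: frontier_def)
    show "k = 1"
    proof (rule ccontr)
      assume "k \<noteq> 1"
      then consider "k < 1" | "1 < k" by linarith
      then show False
      proof cases
        case 1
        then show False using inside[of x k] * sub unfolding f by auto
      next
        case 2
        then show False using inside[of "k *\<^sub>R x" "1 / k"] * sub unfolding f by auto
      qed
    qed
  qed (rule frontier_closed)
  then have "AE x in lborel. x \<notin> frontier (interior S)"
    by (intro AE_not_in_closed_negligible frontier_closed)
  moreover have "x \<in> closure (interior S)" if "x \<in> S" for x
    unfolding closure_approachable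
  proof (intro allI impI)
    fix e :: real assume e: "0 < e"
    have np: "0 < norm (c - x) + 1" by (simp add: add_nonneg_pos)
    define t where "t = min 1 (e / (norm (c - x) + 1))"
    have t: "0 < t" "t \<le> 1" using e np by (auto simp: t_def)
    have "t * norm (c - x) < t * (norm (c - x) + 1)" using t by simp
    also have "\<dots> \<le> e / (norm (c - x) + 1) * (norm (c - x) + 1)" using np by (intro mult_right_mono) (auto simp: t_def)
    also have "\<dots> = e" using np by simp
    finally have "dist ((1 - t) *\<^sub>R x + t *\<^sub>R c) x < e"
      using t by (simp add: dist_norm algebra_simps flip: scaleR_diff_right)
    moreover have "(1 - t) *\<^sub>R x + t *\<^sub>R c \<in> interior S"
      using star_shaped_interior[OF star _ c t] that closure_subset by blast
    ultimately show "\<exists>y\<in>interior S. dist y x < e" by blast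
  qed
  ultimately show ?thesis
    by (elim eventually_mono) (auto simp: frontier_def)
qed

lemma grad_square_integral_finite:
  fixes f :: "'a::euclidean_space \<Rightarrow> real"
  assumes "f \<in> elem_polys m" "bounded T"
  shows "(\<integral>\<^sup>+x\<in>T. ennreal ((norm (grad f x))\<^sup>2) \<partial>lborel) < \<infinity>"
proof -
  obtain R where "\<And>x. x \<in> T \<Longrightarrow> norm x \<le> R" using assms(2) by (auto simp: bounded_iff)
  then have R: "T \<subseteq> cball 0 R" by auto
  have "compact ((\<lambda>x. (norm (grad f x))\<^sup>2) ` cball 0 R)"
    by (intro compact_continuous_image continuous_intros continuous_on_grad[OF assms(1)]) auto
  then obtain M where M: "\<And>x. x \<in> cball 0 R \<Longrightarrow> (norm (grad f x))\<^sup>2 \<le> M"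
    using compact_imp_bounded bounded_iff by (metis (no_types, lifting) abs_le_D1 imageI real_norm_def)
  have "(\<integral>\<^sup>+x\<in>T. ennreal ((norm (grad f x))\<^sup>2) \<partial>lborel) \<le> (\<integral>\<^sup>+x. ennreal M * indicator (cball 0 R) (x::'a) \<partial>lborel)"
    using R M by (intro nn_integral_mono) (auto simp: indicator_def ennreal_leI)
  also have "\<dots> = ennreal M * emeasure lborel (cball (0::'a) R)" by (simp add: nn_integral_cmult_indicator)
  also have "\<dots> < \<infinity>" using emeasure_lborel_cball_finite[of "0::'a" R] by (simp add: ennreal_mult_less_top)
  finally show ?thesis .
qed

text \<open>The factor \<open>1 / \<rho>\<close> counts the pieces, \<open>(2 / \<rho>)^d\<close> comes from averaging over a ball of radius
  \<open>\<rho> h\<close>, and \<open>(1 / \<rho>)^4\<close> is the square of the length of a chain, which visits each of at most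
  \<open>(1 / \<rho>)^2\<close> links once.\<close>

definition poincare_const :: "real \<Rightarrow> nat \<Rightarrow> real" where
  "poincare_const \<rho> d = (1 / \<rho>) * (2 ^ d / \<rho> ^ d) * (2 + 8 * (1 / \<rho>) ^ 4 / \<rho> ^ d)"

lemma poincare_const_pos: "0 < \<rho> \<Longrightarrow> 0 < poincare_const \<rho> d"
  unfolding poincare_const_def by (intro mult_pos_pos add_pos_nonneg divide_pos_pos divide_nonneg_nonneg) auto

text \<open>On each piece, \<open>f\<close> is close to one of its values \<open>m S\<close>; the values of two pieces that share a ball
  differ little; and a chain of pieces without repetition of links has bounded length.\<close>

theorem poincare_connected_by_star_shaped:
  fixes f :: "'a::euclidean_space \<Rightarrow> real"
  assumes f: "f \<in> elem_polys p" and T: "open T" "bounded T" "T \<noteq> {}" and \<rho>: "0 < \<rho>"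
    and conn: "connected_by_star_shaped \<rho> T"
  shows "\<exists>m. (\<integral>\<^sup>+x\<in>T. ennreal ((f x - m)\<^sup>2) \<partial>lborel) \<le>
    ennreal (poincare_const \<rho> DIM('a) * (diameter T)\<^sup>2) * (\<integral>\<^sup>+x\<in>T. ennreal ((norm (grad f x))\<^sup>2) \<partial>lborel)"
proof -
  define d where "d = DIM('a)"
  define h where "h = diameter T"
  have h: "0 < h" unfolding h_def by (rule diameter_open_pos[OF T])
  define \<omega> where "\<omega> = measure lborel (ball (0::'a) 1)"
  have \<omega>: "0 < \<omega>" unfolding \<omega>_def by (rule content_ball_pos) simp
  have [measurable]: "f \<in> borel_measurable borel"
    using continuous_on_elem_polys[OF f] by (rule borel_measurable_continuous_onI)
  have [measurable]: "grad f \<in> borel_measurable borel"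
    using continuous_on_grad[OF f] by (rule borel_measurable_continuous_onI)
  let ?I = "\<lambda>V c. \<integral>\<^sup>+x\<in>V. ennreal ((f x - c)\<^sup>2) \<partial>lborel"
  obtain G where G: "0 \<le> G" "(\<integral>\<^sup>+x\<in>T. ennreal ((norm (grad f x))\<^sup>2) \<partial>lborel) = ennreal G"
    using grad_square_integral_finite[OF f T(2)] by (auto simp: less_top elim: ennreal_cases)
  define L where "L A B \<longleftrightarrow> (\<exists>c. ball c (\<rho> * h) \<subseteq> A \<inter> B)" for A B :: "'a set"
  obtain \<S> where \<S>: "finite \<S>" "real (card \<S>) \<le> 1 / \<rho>" "T = \<Union>\<S>" "\<And>S. S \<in> \<S> \<Longrightarrow> star_shaped_ball (\<rho> * h) S"
    "\<And>S S'. S \<in> \<S> \<Longrightarrow> S' \<in> \<S> \<Longrightarrow> (\<lambda>A B. A \<in> \<S> \<and> B \<in> \<S> \<and> L A B)\<^sup>*\<^sup>* S S'"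
    using conn unfolding connected_by_star_shaped_def h_def L_def by blast
  define K where "K = 2 ^ d / \<rho> ^ d"
  have K: "0 < K" using \<rho> by (simp add: K_def)
  have V_le: "emeasure lborel (interior S) \<le> ennreal (h ^ d * \<omega>)" if S: "S \<in> \<S>" for S
  proof -
    obtain c where "c \<in> S" using star_shaped_ballE[OF \<S>(4)[OF S]] \<rho> h by (metis centre_in_ball mult_pos_pos subsetD)
    have "interior S \<subseteq> cball c h"
    proof
      fix x assume "x \<in> interior S"
      then have "x \<in> T" "c \<in> T" using \<S>(3) S \<open>c \<in> S\<close> interior_subset by blast+
      then show "x \<in> cball c h" using diameter_bounded_bound[OF T(2)] by (simp add: h_def)
    qed
    then have "emeasure lborel (interior S) \<le> emeasure lborel (cball c h)" by (intro emeasure_mono) auto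
    then show ?thesis using emeasure_lborel_ball(2)[of h c] h by (simp add: d_def \<omega>_def)
  qed
  \<comment> \<open>A value of \<open>f\<close> in the ball that is no worse than the average is a good constant for the piece.\<close>
  have "\<exists>m. (AE x in lborel. x \<in> S \<longrightarrow> x \<in> interior S) \<and>
      ?I (interior S) m \<le> ennreal (K * h\<^sup>2 * G)" if S: "S \<in> \<S>" for S
  proof -
    obtain c where c: "ball c (\<rho> * h) \<subseteq> S" "\<And>z t y. z \<in> closure S \<Longrightarrow> y \<in> ball c (\<rho> * h) \<Longrightarrow> 0 < t \<Longrightarrow> t \<le> 1 \<Longrightarrow> (1 - t) *\<^sub>R z + t *\<^sub>R y \<in> S"
      using star_shaped_ballE[OF \<S>(4)[OF S]] by metis
    let ?V = "interior S" and ?B = "ball c (\<rho> * h)"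
    have [measurable]: "?V \<in> sets borel" "?B \<in> sets borel" by auto
    have VT: "?V \<subseteq> T" using \<S>(3) S interior_subset by blast
    have "(\<integral>\<^sup>+y\<in>?B. ?I ?V (f y) \<partial>lborel) \<le>
        ennreal (2 ^ DIM('a)) * emeasure lborel ?V * (\<integral>\<^sup>+x\<in>?V. ennreal (h\<^sup>2 * (norm (grad f x))\<^sup>2) \<partial>lborel)"
    proof (rule double_integral_increment_bound[OF f])
      show "?B \<subseteq> ?V" using c(1) by (simp add: interior_maximal)
      show "y + t *\<^sub>R (x - y) \<in> ?V" if "x \<in> ?V" "y \<in> ?B" "0 < t" "t < 1" for x y t
      proof -
        have "x \<in> closure S" using that(1) interior_subset closure_subset by blast
        then show ?thesis
          using star_shaped_interior[OF c(2), where z = x and y = y and t = "1 - t"] that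
          by (auto simp: algebra_simps)
      qed
      show "norm (x - y) \<le> h" if "x \<in> ?V" "y \<in> ?B" for x y
        using diameter_bounded_bound[OF T(2), of x y] that VT c(1) \<S>(3) S by (auto simp: h_def dist_norm subset_iff)
    qed auto
    also have "\<dots> \<le> ennreal (2 ^ d) * ennreal (h ^ d * \<omega>) * (ennreal (h\<^sup>2) * ennreal G)"
    proof (intro mult_mono V_le[OF S])
      have "(\<integral>\<^sup>+x\<in>?V. ennreal (h\<^sup>2 * (norm (grad f x))\<^sup>2) \<partial>lborel) = ennreal (h\<^sup>2) * (\<integral>\<^sup>+x\<in>?V. ennreal ((norm (grad f x))\<^sup>2) \<partial>lborel)"
        by (subst nn_integral_cmult[symmetric]) (auto simp: ennreal_mult mult.assoc)
      also have "(\<integral>\<^sup>+x\<in>?V. ennreal ((norm (grad f x))\<^sup>2) \<partial>lborel) \<le> ennreal G"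
        unfolding G(2)[symmetric] using VT by (intro nn_integral_mono) (auto simp: indicator_def)
      finally show "(\<integral>\<^sup>+x\<in>?V. ennreal (h\<^sup>2 * (norm (grad f x))\<^sup>2) \<partial>lborel) \<le> ennreal (h\<^sup>2) * ennreal G"
        by (simp add: mult_left_mono)
    qed (auto simp: d_def)
    also have "\<dots> = ennreal ((\<rho> * h) ^ d * \<omega>) * ennreal (K * h\<^sup>2 * G)"
      using \<rho> h \<omega> G(1) by (simp add: ennreal_mult[symmetric] K_def power_mult_distrib field_simps)
    finally have le: "(\<integral>\<^sup>+y\<in>?B. ?I ?V (f y) \<partial>lborel) \<le> ennreal ((\<rho> * h) ^ d * \<omega>) * ennreal (K * h\<^sup>2 * G)" .
    have "\<exists>y\<in>?B. ?I ?V (f y) \<le> ennreal (K * h\<^sup>2 * G)"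
    proof (rule exists_le_average[OF _ _ _ _ le])
      show "emeasure lborel ?B = ennreal ((\<rho> * h) ^ d * \<omega>)"
        using emeasure_lborel_ball(1)[of "\<rho> * h" c] \<rho> h by (simp add: d_def \<omega>_def)
      show "0 < (\<rho> * h) ^ d * \<omega>" using \<rho> h \<omega> by simp
      show "(\<lambda>y. \<integral>\<^sup>+x\<in>?V. ennreal ((f x - f y)\<^sup>2) \<partial>lborel) \<in> borel_measurable lborel" by measurable
    qed simp
    moreover have "AE x in lborel. x \<in> S \<longrightarrow> x \<in> ?V"
      using AE_star_shaped_interior[OF c(2)] \<rho> h by simp
    ultimately show ?thesis by blast
  qed
  then have "\<forall>S\<in>\<S>. \<exists>m. (AE x in lborel. x \<in> S \<longrightarrow> x \<in> interior S) \<and>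
      ?I (interior S) m \<le> ennreal (K * h\<^sup>2 * G)" by blast
  then obtain m where m: "\<forall>S\<in>\<S>. (AE x in lborel. x \<in> S \<longrightarrow> x \<in> interior S) \<and>
      ?I (interior S) (m S) \<le> ennreal (K * h\<^sup>2 * G)"
    using bchoice by meson
  define D where "D = sqrt (4 * K * h\<^sup>2 * G / ((\<rho> * h) ^ d * \<omega>))"
  have D2: "D\<^sup>2 = 4 * K * h\<^sup>2 * G / ((\<rho> * h) ^ d * \<omega>)"
    unfolding D_def using K G(1) \<rho> h \<omega> by (intro real_sqrt_pow2) auto
  have D0: "0 \<le> D" unfolding D_def using K G(1) \<rho> h \<omega> by (intro real_sqrt_ge_zero) auto
  have link: "\<bar>m A - m B\<bar> \<le> D" if AB: "A \<in> \<S>" "B \<in> \<S>" "L A B" for A B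
  proof -
    obtain c where c: "ball c (\<rho> * h) \<subseteq> A \<inter> B" using AB(3) by (auto simp: L_def)
    let ?B = "ball c (\<rho> * h)"
    have BA: "?B \<subseteq> interior A" "?B \<subseteq> interior B" using c by (simp_all add: interior_maximal)
    have "ennreal ((m A - m B)\<^sup>2) * emeasure lborel ?B = (\<integral>\<^sup>+x. ennreal ((m A - m B)\<^sup>2) * indicator ?B x \<partial>lborel)"
      by (simp add: nn_integral_cmult_indicator)
    also have "\<dots> \<le> (\<integral>\<^sup>+x. 2 * (ennreal ((f x - m A)\<^sup>2) * indicator (interior A) x) + 2 * (ennreal ((f x - m B)\<^sup>2) * indicator (interior B) x) \<partial>lborel)"
    proof (intro nn_integral_mono)
      fix x
      have "(m A - m B)\<^sup>2 \<le> 2 * (f x - m A)\<^sup>2 + 2 * (f x - m B)\<^sup>2"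
        using sum_squares_bound[of "f x - m A" "- (f x - m B)"] by (simp add: power2_eq_square algebra_simps)
      then have "ennreal ((m A - m B)\<^sup>2) \<le> ennreal (2 * (f x - m A)\<^sup>2 + 2 * (f x - m B)\<^sup>2)" by (rule ennreal_leI)
      then have "ennreal ((m A - m B)\<^sup>2) \<le> 2 * ennreal ((f x - m A)\<^sup>2) + 2 * ennreal ((f x - m B)\<^sup>2)"
        by (simp add: ennreal_mult)
      then show "ennreal ((m A - m B)\<^sup>2) * indicator ?B x \<le>
          2 * (ennreal ((f x - m A)\<^sup>2) * indicator (interior A) x) + 2 * (ennreal ((f x - m B)\<^sup>2) * indicator (interior B) x)"
        using BA by (auto simp: indicator_def)
    qed
    also have "\<dots> = 2 * ?I (interior A) (m A) + 2 * ?I (interior B) (m B)"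
      by (simp add: nn_integral_add nn_integral_cmult)
    also have "\<dots> \<le> 2 * ennreal (K * h\<^sup>2 * G) + 2 * ennreal (K * h\<^sup>2 * G)"
      using m AB by (intro add_mono mult_left_mono) auto
    also have "\<dots> = ennreal (4 * K * h\<^sup>2 * G)"
      using K G(1) by (simp add: ennreal_mult mult.assoc flip: distrib_right)
    finally have "ennreal ((m A - m B)\<^sup>2 * ((\<rho> * h) ^ d * \<omega>)) \<le> ennreal (4 * K * h\<^sup>2 * G)"
      using emeasure_lborel_ball(1)[of "\<rho> * h" c] \<rho> h \<omega> by (simp add: d_def[symmetric] \<omega>_def[symmetric] ennreal_mult[symmetric])
    then have "(m A - m B)\<^sup>2 * ((\<rho> * h) ^ d * \<omega>) \<le> 4 * K * h\<^sup>2 * G"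
      using K G(1) by (simp add: ennreal_le_iff)
    then have "(m A - m B)\<^sup>2 \<le> D\<^sup>2"
      unfolding D2 using \<rho> h \<omega> by (simp add: pos_le_divide_eq)
    then show ?thesis using D0 abs_le_square_iff[of "m A - m B" D] by simp
  qed
  define N where "N = real (card \<S>)"
  obtain S0 where S0: "S0 \<in> \<S>" using \<S>(3) T(3) by blast
  have chain: "\<bar>m S - m S0\<bar> \<le> N\<^sup>2 * D" if S: "S \<in> \<S>" for S
  proof -
    let ?R = "{(A, B). A \<in> \<S> \<and> B \<in> \<S> \<and> L A B}"
    have R: "finite ?R" "card ?R \<le> card \<S> * card \<S>"
      using \<S>(1) card_mono[of "\<S> \<times> \<S>" ?R] by (auto intro: finite_subset[of _ "\<S> \<times> \<S>"] simp: card_cartesian_product)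
    have "(S, S0) \<in> ?R\<^sup>*" using \<S>(5)[OF S S0] by (simp add: rtranclp_rtrancl_eq)
    then obtain n where "(S, S0) \<in> ?R ^^ n" by (auto simp: rtrancl_power)
    then obtain n where n: "(S, S0) \<in> ?R ^^ n" "n \<le> card ?R" using relpow_finite_bounded[OF R(1)] by blast
    have "\<bar>m S - m S0\<bar> \<le> real n * D" by (rule chain_increment_bound[OF n(1)]) (use link in auto)
    also have "\<dots> \<le> N\<^sup>2 * D"
      using n(2) R(2) D0 unfolding N_def power2_eq_square by (intro mult_right_mono) (simp_all flip: of_nat_mult)
    finally show ?thesis .
  qed
  \<comment> \<open>Error on one piece: the local one plus that of moving along the chain to the reference piece \<open>S0\<close>.\<close>
  define E where "E = 2 * (K * h\<^sup>2 * G) + 2 * ((N\<^sup>2 * D)\<^sup>2 * (h ^ d * \<omega>))"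
  have E0: "0 \<le> E" using K G(1) h \<omega> by (auto simp: E_def)
  have piece: "?I (interior S) (m S0) \<le> ennreal E" if S: "S \<in> \<S>" for S
  proof -
    have "?I (interior S) (m S0) \<le>
        (\<integral>\<^sup>+x. 2 * (ennreal ((f x - m S)\<^sup>2) * indicator (interior S) x) + 2 * (ennreal ((N\<^sup>2 * D)\<^sup>2) * indicator (interior S) x) \<partial>lborel)"
    proof (intro nn_integral_mono)
      fix x
      have "(m S - m S0)\<^sup>2 \<le> (N\<^sup>2 * D)\<^sup>2" using chain[OF S] D0 by (intro abs_le_square_iff[THEN iffD1]) auto
      moreover have "(f x - m S0)\<^sup>2 \<le> 2 * (f x - m S)\<^sup>2 + 2 * (m S - m S0)\<^sup>2"
        using sum_squares_bound[of "f x - m S" "m S - m S0"] by (simp add: power2_eq_square algebra_simps)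
      ultimately have "(f x - m S0)\<^sup>2 \<le> 2 * (f x - m S)\<^sup>2 + 2 * (N\<^sup>2 * D)\<^sup>2" by linarith
      then have "ennreal ((f x - m S0)\<^sup>2) \<le> ennreal (2 * (f x - m S)\<^sup>2 + 2 * (N\<^sup>2 * D)\<^sup>2)" by (rule ennreal_leI)
      also have "\<dots> = 2 * ennreal ((f x - m S)\<^sup>2) + 2 * ennreal ((N\<^sup>2 * D)\<^sup>2)"
        by (simp add: ennreal_mult del: power_mult_distrib)
      finally show "ennreal ((f x - m S0)\<^sup>2) * indicator (interior S) x \<le>
          2 * (ennreal ((f x - m S)\<^sup>2) * indicator (interior S) x) + 2 * (ennreal ((N\<^sup>2 * D)\<^sup>2) * indicator (interior S) x)"
        by (auto simp: indicator_def)
    qed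
    also have "\<dots> = 2 * ?I (interior S) (m S) + 2 * (ennreal ((N\<^sup>2 * D)\<^sup>2) * emeasure lborel (interior S))"
      by (simp add: nn_integral_add nn_integral_cmult nn_integral_cmult_indicator)
    also have "\<dots> \<le> 2 * ennreal (K * h\<^sup>2 * G) + 2 * (ennreal ((N\<^sup>2 * D)\<^sup>2) * ennreal (h ^ d * \<omega>))"
      using m S V_le[OF S] by (intro add_mono mult_left_mono) auto
    also have "\<dots> = ennreal E"
    proof -
      have "0 \<le> K * h\<^sup>2 * G" "0 \<le> h ^ d * \<omega>" using K G(1) h \<omega> by auto
      then show ?thesis unfolding E_def
        by (subst ennreal_plus) (auto simp: ennreal_mult simp del: power_mult_distrib)
    qed
    finally show ?thesis .
  qed
  have "AE x in lborel. \<forall>S\<in>\<S>. x \<in> S \<longrightarrow> x \<in> interior S"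
    using m \<S>(1) by (intro AE_finite_allI) auto
  then have "AE x in lborel. ennreal ((f x - m S0)\<^sup>2) * indicator T x \<le> (\<Sum>S\<in>\<S>. ennreal ((f x - m S0)\<^sup>2) * indicator (interior S) x)"
  proof eventually_elim
    case (elim x)
    show ?case
    proof (cases "x \<in> T")
      case True
      then obtain S where S: "S \<in> \<S>" "x \<in> interior S" using elim \<S>(3) by blast
      have "ennreal ((f x - m S0)\<^sup>2) * indicator T x = ennreal ((f x - m S0)\<^sup>2) * indicator (interior S) x" using True S by simp
      also have "\<dots> \<le> (\<Sum>S\<in>\<S>. ennreal ((f x - m S0)\<^sup>2) * indicator (interior S) x)"
        using S(1) \<S>(1) by (intro member_le_sum) auto
      finally show ?thesis .
    qed simp
  qed
  then have "?I T (m S0) \<le> (\<integral>\<^sup>+x. (\<Sum>S\<in>\<S>. ennreal ((f x - m S0)\<^sup>2) * indicator (interior S) x) \<partial>lborel)"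
    by (rule nn_integral_mono_AE)
  also have "\<dots> = (\<Sum>S\<in>\<S>. \<integral>\<^sup>+x\<in>interior S. ennreal ((f x - m S0)\<^sup>2) \<partial>lborel)"
    by (intro nn_integral_sum) auto
  also have "\<dots> \<le> (\<Sum>S\<in>\<S>. ennreal E)" by (intro sum_mono piece)
  also have "\<dots> = ennreal (N * E)"
    using E0 by (simp add: N_def ennreal_of_nat_eq_real_of_nat ennreal_mult)
  also have "\<dots> \<le> ennreal (poincare_const \<rho> d * h\<^sup>2 * G)"
  proof (rule ennreal_leI)
    have N: "0 \<le> N" "N \<le> 1 / \<rho>" using \<S>(2) by (auto simp: N_def)
    have "(N\<^sup>2 * D)\<^sup>2 * (h ^ d * \<omega>) = N ^ 4 * (4 * K * h\<^sup>2 * G / ((\<rho> * h) ^ d * \<omega>)) * (h ^ d * \<omega>)"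
      by (simp add: power_mult_distrib D2 power_mult[symmetric])
    also have "\<dots> = N ^ 4 * (4 * K * h\<^sup>2 * G / \<rho> ^ d)"
      using \<rho> h \<omega> by (simp add: power_mult_distrib field_simps)
    finally have "E = K * h\<^sup>2 * G * (2 + 8 * N ^ 4 / \<rho> ^ d)"
      unfolding E_def by (simp add: field_simps)
    also have "\<dots> \<le> K * h\<^sup>2 * G * (2 + 8 * (1 / \<rho>) ^ 4 / \<rho> ^ d)"
      using K G(1) \<rho> N by (intro mult_left_mono add_left_mono divide_right_mono power_mono) auto
    finally have "N * E \<le> (1 / \<rho>) * (K * h\<^sup>2 * G * (2 + 8 * (1 / \<rho>) ^ 4 / \<rho> ^ d))"
      using N E0 \<rho> by (intro mult_mono) auto
    also have "\<dots> = poincare_const \<rho> d * h\<^sup>2 * G" by (simp add: poincare_const_def K_def)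
    finally show "N * E \<le> poincare_const \<rho> d * h\<^sup>2 * G" .
  qed
  also have "\<dots> = ennreal (poincare_const \<rho> d * h\<^sup>2) * ennreal G"
    using G(1) poincare_const_pos[OF \<rho>, of d] by (simp add: ennreal_mult less_imp_le)
  finally show ?thesis unfolding G(2) h_def d_def by blast
qed


section \<open>Polytopal meshes as regions of a hyperplane arrangement\<close>

text \<open>A pair \<open>(a, b)\<close> stands for the hyperplane \<open>a \<bullet> x = b\<close>. A union of polytopes is a union of cells
  of the arrangement of the hyperplanes that bound the polytopes.\<close>

definition sign_determined :: "('a::euclidean_space \<times> real) set \<Rightarrow> 'a set \<Rightarrow> bool" where
  "sign_determined \<A> K \<longleftrightarrow> (\<forall>x y. (\<forall>(a, b)\<in>\<A>. sgn (a \<bullet> x - b) = sgn (a \<bullet> y - b)) \<longrightarrow> (x \<in> K \<longleftrightarrow> y \<in> K))"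

lemma sign_determined_mono: "sign_determined \<A> K \<Longrightarrow> \<A> \<subseteq> \<B> \<Longrightarrow> sign_determined \<B> K"
  unfolding sign_determined_def by blast

lemma sign_determined_polytope:
  fixes P :: "'a::euclidean_space set"
  assumes "polytope P"
  shows "\<exists>\<A>. finite \<A> \<and> (\<forall>(a, b)\<in>\<A>. a \<noteq> 0) \<and> sign_determined \<A> P"
proof -
  obtain \<H> where \<H>: "finite \<H>" "P = \<Inter>\<H>" "\<forall>H\<in>\<H>. \<exists>p. fst p \<noteq> 0 \<and> H = {x. fst p \<bullet> x \<le> (snd p :: real)}"
    using polytope_imp_polyhedron[OF assms] unfolding polyhedron_def by auto
  then obtain p where p: "\<forall>H\<in>\<H>. fst (p H) \<noteq> 0 \<and> H = {x. fst (p H) \<bullet> x \<le> snd (p H)}"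
    using bchoice[OF \<H>(3)] by blast
  have le_iff: "u \<le> v \<longleftrightarrow> sgn (u - v) \<noteq> (1::real)" for u v :: real by (auto simp: sgn_if)
  have "sign_determined (p ` \<H>) P"
    unfolding sign_determined_def
  proof (intro allI impI)
    fix x y assume "\<forall>(a, b)\<in>p ` \<H>. sgn (a \<bullet> x - b) = sgn (a \<bullet> y - b)"
    then have eq: "sgn (fst (p H) \<bullet> x - snd (p H)) = sgn (fst (p H) \<bullet> y - snd (p H))" if "H \<in> \<H>" for H
      using that by (auto simp: case_prod_beta)
    have "x \<in> H \<longleftrightarrow> y \<in> H" if "H \<in> \<H>" for H
      using p that eq[OF that] by (metis (no_types, lifting) le_iff mem_Collect_eq)
    then show "x \<in> P \<longleftrightarrow> y \<in> P" unfolding \<H>(2) by blast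
  qed
  moreover have "finite (p ` \<H>)" "\<forall>(a, b)\<in>p ` \<H>. a \<noteq> 0" using \<H>(1) p by auto
  ultimately show ?thesis by blast
qed

lemma sign_determined_Union:
  fixes \<P> :: "'a::euclidean_space set set"
  assumes "finite \<P>" "\<And>P. P \<in> \<P> \<Longrightarrow> \<exists>\<A>. finite \<A> \<and> (\<forall>(a, b)\<in>\<A>. a \<noteq> 0) \<and> sign_determined \<A> P"
  shows "\<exists>\<A>. finite \<A> \<and> (\<forall>(a, b)\<in>\<A>. a \<noteq> 0) \<and> (\<forall>P\<in>\<P>. sign_determined \<A> P)"
proof -
  have "\<forall>P\<in>\<P>. \<exists>\<A>. finite \<A> \<and> (\<forall>(a, b)\<in>\<A>. a \<noteq> 0) \<and> sign_determined \<A> P" using assms(2) by blast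
  from bchoice[OF this] obtain \<A> where \<A>: "\<forall>P\<in>\<P>. finite (\<A> P) \<and> (\<forall>(a, b)\<in>\<A> P. a \<noteq> 0) \<and> sign_determined (\<A> P) P" ..
  have "finite (\<Union>(\<A> ` \<P>))" using assms(1) \<A> by blast
  moreover have "\<forall>(a, b)\<in>\<Union>(\<A> ` \<P>). a \<noteq> 0" using \<A> by blast
  moreover have "\<forall>P\<in>\<P>. sign_determined (\<Union>(\<A> ` \<P>)) P" using \<A> by (blast intro: sign_determined_mono)
  ultimately show ?thesis by blast
qed

lemma polytopal_setE:
  assumes "polytopal_set m X"
  obtains K \<A> where "compact K" "finite \<A>" "\<forall>(a, b)\<in>\<A>. a \<noteq> 0" "sign_determined \<A> K" "X = rel_interior K" "aff_dim X = m"
proof -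
  obtain \<P> where \<P>: "finite \<P>" "\<forall>P\<in>\<P>. polytope P" "X = rel_interior (\<Union>\<P>)" "aff_dim X = m"
    using assms unfolding polytopal_set_def by blast
  obtain \<A> where \<A>: "finite \<A>" "\<forall>(a, b)\<in>\<A>. a \<noteq> 0" "\<forall>P\<in>\<P>. sign_determined \<A> P"
    using sign_determined_Union[OF \<P>(1)] sign_determined_polytope \<P>(2) by metis
  have "sign_determined \<A> (\<Union>\<P>)" using \<A>(3) unfolding sign_determined_def by blast
  moreover have "compact (\<Union>\<P>)" using \<P> by (intro compact_Union) (auto simp: polytope_imp_compact)
  ultimately show ?thesis using that \<A> \<P> by blast
qed

definition open_region :: "('a::euclidean_space \<times> real) set \<Rightarrow> 'a set \<Rightarrow> bool" where
  "open_region \<A> X \<longleftrightarrow> (\<exists>K. compact K \<and> sign_determined \<A> K \<and> X = interior K)"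

definition flat_region :: "('a::euclidean_space \<times> real) set \<Rightarrow> 'a set \<Rightarrow> bool" where
  "flat_region \<A> F \<longleftrightarrow> flat_face F \<and> (\<exists>a b. (a, b) \<in> \<A> \<and> affine hull F = {x. a \<bullet> x = b}) \<and>
     (\<exists>K. compact K \<and> sign_determined \<A> K \<and> F = rel_interior K \<and> affine hull K = affine hull F)"

lemma open_region_mono: "open_region \<A> X \<Longrightarrow> \<A> \<subseteq> \<B> \<Longrightarrow> open_region \<B> X"
  unfolding open_region_def using sign_determined_mono by blast

lemma flat_region_mono: "flat_region \<A> X \<Longrightarrow> \<A> \<subseteq> \<B> \<Longrightarrow> flat_region \<B> X"
  unfolding flat_region_def using sign_determined_mono by blast

lemma polytopal_set_open_region:
  fixes X :: "'a::euclidean_space set"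
  assumes "polytopal_set (int DIM('a)) X"
  shows "\<exists>\<A>. finite \<A> \<and> (\<forall>(a, b)\<in>\<A>. a \<noteq> 0) \<and> open_region \<A> X" "X \<noteq> {}"
proof -
  obtain K \<A> where *: "compact K" "finite \<A>" "\<forall>(a, b)\<in>\<A>. a \<noteq> 0" "sign_determined \<A> K" "X = rel_interior K" "aff_dim X = int DIM('a)"
    using polytopal_setE[OF assms] .
  have "aff_dim K = int DIM('a)"
    using aff_dim_subset[OF rel_interior_subset[of K]] aff_dim_le_DIM[of K] * by simp
  then have "X = interior K" using *(5) by (simp add: aff_dim_eq_full rel_interior_interior)
  then show "\<exists>\<A>. finite \<A> \<and> (\<forall>(a, b)\<in>\<A>. a \<noteq> 0) \<and> open_region \<A> X"
    using * unfolding open_region_def by blast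
  show "X \<noteq> {}" using *(6) by (auto simp: aff_dim_empty)
qed

lemma polytopal_set_flat_region:
  fixes F :: "'a::euclidean_space set"
  assumes "polytopal_set (int DIM('a) - 1) F"
  shows "\<exists>\<A>. finite \<A> \<and> (\<forall>(a, b)\<in>\<A>. a \<noteq> 0) \<and> flat_region \<A> F"
proof -
  obtain K \<A> where *: "compact K" "finite \<A>" "\<forall>(a, b)\<in>\<A>. a \<noteq> 0" "sign_determined \<A> K" "F = rel_interior K" "aff_dim F = int DIM('a) - 1"
    using polytopal_setE[OF assms] .
  obtain \<nu> where \<nu>: "unit_normal F \<nu>" using unit_normal_exists[OF *(6)] .
  obtain c where c: "c \<in> F" using nonempty_face[OF *(6) \<nu>] by blast
  have FK: "F \<subseteq> K" using rel_interior_subset[of K] *(5) by simp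
  have "aff_dim K \<noteq> int DIM('a)"
  proof
    assume full: "aff_dim K = int DIM('a)"
    then have "F = interior K" using *(5) by (simp add: aff_dim_eq_full rel_interior_interior)
    then have "aff_dim F = int DIM('a)" using c by (intro aff_dim_open) auto
    then show False using *(6) by simp
  qed
  then have "aff_dim K = int DIM('a) - 1"
    using aff_dim_subset[OF FK] aff_dim_le_DIM[of K] *(6) by linarith
  then have hullK: "affine hull K = affine hull F"
    using affine_dim_equal[of "affine hull F" "affine hull K"] hull_mono[OF FK, of affine] c *(6) by auto
  have hullF: "affine hull F = {x. \<nu> \<bullet> x = \<nu> \<bullet> c}"
    using affine_hull_eq_hyperplane[OF *(6) \<nu> c] by (auto simp: inner_diff_left inner_commute[of \<nu>])
  have "openin (top_of_set (affine hull F)) F"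
    using openin_rel_interior[of K] hullK *(5) by simp
  moreover have "bounded F" using *(1) FK bounded_subset compact_imp_bounded by blast
  ultimately have "flat_face F" using *(6) by (simp add: flat_face_def)
  then have "flat_region (insert (\<nu>, \<nu> \<bullet> c) \<A>) F"
    unfolding flat_region_def using hullF hullK *(1,4,5) sign_determined_mono[OF *(4), of "insert (\<nu>, \<nu> \<bullet> c) \<A>"] by blast
  moreover have "\<nu> \<noteq> 0" using \<nu> by (auto simp: unit_normal_def)
  ultimately show ?thesis using *(2,3) by (intro exI[of _ "insert (\<nu>, \<nu> \<bullet> c) \<A>"]) auto
qed

text \<open>A generic point lies on at most one hyperplane of the arrangement, which may occur in it
  several times in the form of proportional pairs.\<close>

definition generic :: "('a::euclidean_space \<times> real) set \<Rightarrow> 'a \<Rightarrow> bool" where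
  "generic \<A> z \<longleftrightarrow> (\<forall>(a, b)\<in>\<A>. \<forall>(a', b')\<in>\<A>. a \<bullet> z = b \<and> a' \<bullet> z = b' \<longrightarrow> (\<exists>c. c \<noteq> 0 \<and> a' = c *\<^sub>R a \<and> b' = c * b))"

definition half_ball :: "'a::euclidean_space \<Rightarrow> real \<Rightarrow> 'a \<Rightarrow> real \<Rightarrow> real \<Rightarrow> 'a set" where
  "half_ball a b z e \<sigma> = {x \<in> ball z e. 0 < \<sigma> * (a \<bullet> x - b)}"

text \<open>In a small ball around \<open>z\<close> all hyperplanes not containing \<open>z\<close> keep their sign, and those containing
  \<open>z\<close> are multiples of the given one.\<close>

lemma generic_ball:
  fixes z :: "'a::euclidean_space"
  assumes fin: "finite \<A>" and gen: "generic \<A> z" and ab: "(a, b) \<in> \<A>" "a \<bullet> z = b"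
  obtains e where "0 < e" "\<And>K x y. sign_determined \<A> K \<Longrightarrow> x \<in> ball z e \<Longrightarrow> y \<in> ball z e \<Longrightarrow>
      sgn (a \<bullet> x - b) = sgn (a \<bullet> y - b) \<Longrightarrow> x \<in> K \<Longrightarrow> y \<in> K"
proof -
  have "\<forall>\<^sub>F x in nhds z. \<forall>p\<in>\<A>. fst p \<bullet> z \<noteq> snd p \<longrightarrow> sgn (fst p \<bullet> x - snd p) = sgn (fst p \<bullet> z - snd p)"
  proof (rule eventually_ball_finite[OF fin], intro ballI)
    fix p assume "p \<in> \<A>"
    have lim: "((\<lambda>x. fst p \<bullet> x - snd p) \<longlongrightarrow> fst p \<bullet> z - snd p) (nhds z)"
      by (intro tendsto_intros filterlim_ident)
    consider "fst p \<bullet> z - snd p = 0" | "0 < fst p \<bullet> z - snd p" | "fst p \<bullet> z - snd p < 0" by linarith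
    then show "\<forall>\<^sub>F x in nhds z. fst p \<bullet> z \<noteq> snd p \<longrightarrow> sgn (fst p \<bullet> x - snd p) = sgn (fst p \<bullet> z - snd p)"
    proof cases
      case 2
      then show ?thesis using order_tendstoD(1)[OF lim 2] by (auto elim!: eventually_mono)
    next
      case 3
      then show ?thesis using order_tendstoD(2)[OF lim 3] by (auto elim!: eventually_mono)
    qed simp
  qed
  then obtain e where e: "0 < e" "\<And>x p. x \<in> ball z e \<Longrightarrow> p \<in> \<A> \<Longrightarrow> fst p \<bullet> z \<noteq> snd p \<Longrightarrow> sgn (fst p \<bullet> x - snd p) = sgn (fst p \<bullet> z - snd p)"
    unfolding eventually_nhds_metric by (metis dist_commute mem_ball)
  show ?thesis
  proof (rule that[OF e(1)])
    fix K x y assume K: "sign_determined \<A> K" and xy: "x \<in> ball z e" "y \<in> ball z e" and sgn: "sgn (a \<bullet> x - b) = sgn (a \<bullet> y - b)" and x: "x \<in> K"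
    have "sgn (a' \<bullet> x - b') = sgn (a' \<bullet> y - b')" if p: "(a', b') \<in> \<A>" for a' b'
    proof (cases "a' \<bullet> z = b'")
      case True
      then obtain c where c: "a' = c *\<^sub>R a" "b' = c * b" using gen ab p unfolding generic_def by fast
      have "sgn (a' \<bullet> w - b') = sgn c * sgn (a \<bullet> w - b)" for w
        by (simp add: c sgn_mult[symmetric] right_diff_distrib)
      then show ?thesis using sgn by simp
    next
      case False
      then show ?thesis using e(2)[OF xy(1) p] e(2)[OF xy(2) p] by simp
    qed
    then show "y \<in> K" using K x unfolding sign_determined_def by blast
  qed
qed

context
  fixes a z :: "'a::euclidean_space" and b e :: real
  assumes a: "a \<noteq> 0" and e: "0 < e" and zb: "a \<bullet> z = b"
begin

lemma half_ball_nonempty: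
  assumes "\<sigma> = 1 \<or> \<sigma> = -1"
  shows "half_ball a b z e \<sigma> \<noteq> {}"
proof -
  define x where "x = z + (\<sigma> * (e / (2 * norm a))) *\<^sub>R a"
  have "dist z x = e / 2" using assms a e by (auto simp: x_def dist_norm)
  moreover have "a \<bullet> x - b = \<sigma> * (e / (2 * norm a) * (a \<bullet> a))" by (simp add: x_def inner_add_right zb)
  then have "\<sigma> * (a \<bullet> x - b) = e / (2 * norm a) * (a \<bullet> a)" using assms by auto
  moreover have "0 < e / (2 * norm a) * (a \<bullet> a)" using a e by simp
  ultimately have "x \<in> half_ball a b z e \<sigma>" using e by (simp add: half_ball_def)
  then show ?thesis by blast
qed

lemma open_half_ball: "open (half_ball a b z e \<sigma>)"
proof -
  have "half_ball a b z e \<sigma> = ball z e \<inter> {x. 0 < \<sigma> * (a \<bullet> x - b)}" by (auto simp: half_ball_def)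
  moreover have "open {x. 0 < \<sigma> * (a \<bullet> x - b)}" by (intro open_Collect_less continuous_intros)
  ultimately show ?thesis by (simp add: open_Int)
qed

lemma open_meets_half_ball:
  assumes "open W" "W \<inter> ball z e \<noteq> {}"
  shows "W \<inter> half_ball a b z e 1 \<noteq> {} \<or> W \<inter> half_ball a b z e (-1) \<noteq> {}"
proof -
  obtain x where x: "x \<in> W \<inter> ball z e" using assms(2) by blast
  have "open (W \<inter> ball z e)" using assms(1) by (simp add: open_Int)
  then obtain \<delta> where \<delta>: "\<delta> > 0" "ball x \<delta> \<subseteq> W \<inter> ball z e" using x openE by blast
  show ?thesis
  proof (cases "a \<bullet> x = b")
    case True
    define y where "y = x + (\<delta> / (2 * norm a)) *\<^sub>R a"
    have "dist x y = \<delta> / 2" using a \<delta> by (simp add: y_def dist_norm)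
    then have "y \<in> W \<inter> ball z e" using \<delta> by (intro subsetD[OF \<delta>(2)]) simp
    moreover have "0 < a \<bullet> y - b" using True a \<delta>(1) by (simp add: y_def inner_add_right)
    ultimately show ?thesis by (auto simp: half_ball_def)
  next
    case False
    then show ?thesis using x by (auto simp: half_ball_def neq_iff)
  qed
qed

text \<open>If both half-balls belonged to \<open>K\<close>, then \<open>z\<close> would be interior; if neither did, \<open>z\<close> would not be in
  the closure of the interior.\<close>

lemma frontier_one_side:
  assumes K: "closed K" and z: "z \<in> frontier (interior K)"
    and det: "\<And>x y. x \<in> ball z e \<Longrightarrow> y \<in> ball z e \<Longrightarrow> sgn (a \<bullet> x - b) = sgn (a \<bullet> y - b) \<Longrightarrow> x \<in> K \<Longrightarrow> y \<in> K"
  shows "\<exists>\<sigma>. (\<sigma> = 1 \<or> \<sigma> = -1) \<and> half_ball a b z e \<sigma> \<subseteq> interior K \<and> half_ball a b z e (- \<sigma>) \<inter> K = {}"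
proof -
  have z': "z \<in> closure (interior K)" "z \<notin> interior K" using z by (auto simp: frontier_def)
  have half: "half_ball a b z e \<sigma> \<subseteq> interior K \<or> half_ball a b z e \<sigma> \<inter> K = {}" if \<sigma>: "\<sigma> = 1 \<or> \<sigma> = -1" for \<sigma>
  proof (cases "half_ball a b z e \<sigma> \<inter> K = {}")
    case False
    then obtain x where x: "x \<in> half_ball a b z e \<sigma>" "x \<in> K" by blast
    have "half_ball a b z e \<sigma> \<subseteq> K"
    proof
      fix y assume y: "y \<in> half_ball a b z e \<sigma>"
      have "sgn (a \<bullet> x - b) = sgn (a \<bullet> y - b)" using x(1) y \<sigma> by (auto simp: half_ball_def)
      then show "y \<in> K" using det[of x y] x y by (auto simp: half_ball_def)
    qed
    then show ?thesis using open_half_ball interior_maximal by blast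
  qed simp
  have "\<not> (half_ball a b z e 1 \<inter> K = {} \<and> half_ball a b z e (-1) \<inter> K = {})"
  proof
    assume none: "half_ball a b z e 1 \<inter> K = {} \<and> half_ball a b z e (-1) \<inter> K = {}"
    have "interior K \<inter> ball z e \<noteq> {}" using z'(1) e by (metis centre_in_ball closure_iff_nhds_not_empty inf_commute open_ball subset_refl)
    then show False using open_meets_half_ball[of "interior K"] none interior_subset[of K] by auto
  qed
  moreover have "\<not> (half_ball a b z e 1 \<subseteq> interior K \<and> half_ball a b z e (-1) \<subseteq> interior K)"
  proof
    assume both: "half_ball a b z e 1 \<subseteq> interior K \<and> half_ball a b z e (-1) \<subseteq> interior K"
    have "(- K) \<inter> ball z e = {}"
      using open_meets_half_ball[of "- K"] both interior_subset[of K] K by (auto simp: open_Compl)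
    then have "z \<in> interior K" using e by (intro interiorI[of "ball z e"]) auto
    then show False using z'(2) by simp
  qed
  ultimately have "half_ball a b z e 1 \<subseteq> interior K \<and> half_ball a b z e (-1) \<inter> K = {} \<or>
      half_ball a b z e (-1) \<subseteq> interior K \<and> half_ball a b z e 1 \<inter> K = {}"
    using half[of 1] half[of "-1"] by auto
  then show ?thesis
  proof
    assume "half_ball a b z e (-1) \<subseteq> interior K \<and> half_ball a b z e 1 \<inter> K = {}"
    then show ?thesis by (intro exI[of _ "-1"]) simp
  qed (intro exI[of _ 1], simp)
qed

end

text \<open>A single arrangement for the domain, all elements and all faces allows one to move points within any of
  them by looking at the same finitely many signs.\<close>

locale arranged_mesh =
  fixes \<Omega> :: "'a::euclidean_space set" and \<T> \<F> :: "'a set set" and \<A> :: "('a \<times> real) set"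
  assumes finite_arrangement: "finite \<A>" and normal_nonzero: "(a, b) \<in> \<A> \<Longrightarrow> a \<noteq> 0"
    and domain_region: "open_region \<A> \<Omega>"
    and finite_elements: "finite \<T>" and disjoint_elements: "disjoint \<T>"
    and element_region: "T \<in> \<T> \<Longrightarrow> open_region \<A> T" and element_nonempty: "T \<in> \<T> \<Longrightarrow> T \<noteq> {}"
    and closure_domain: "closure \<Omega> = (\<Union>T\<in>\<T>. closure T)"
    and finite_faces: "finite \<F>" and disjoint_faces: "disjoint \<F>"
    and face_region: "F \<in> \<F> \<Longrightarrow> flat_region \<A> F"
    and skeleton: "(\<Union>T\<in>\<T>. frontier T) = (\<Union>F\<in>\<F>. closure F)"
    and face_cases: "\<F> = interior_faces \<T> \<F> \<union> boundary_faces \<Omega> \<T> \<F>"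

lemma polytopal_mesh_arranged:
  fixes \<Omega> :: "'a::euclidean_space set"
  assumes "polytopal_domain \<Omega>" "polytopal_mesh \<Omega> h \<T> \<F>"
  obtains \<A> where "arranged_mesh \<Omega> \<T> \<F> \<A>"
proof -
  note m = assms(2)[unfolded polytopal_mesh_def]
  define R where "R X \<A> \<longleftrightarrow> (X = \<Omega> \<or> X \<in> \<T> \<longrightarrow> open_region \<A> X) \<and> (X \<in> \<F> \<longrightarrow> flat_region \<A> X)" for X and \<A> :: "('a \<times> real) set"
  have R_mono: "R X \<A> \<Longrightarrow> \<A> \<subseteq> \<B> \<Longrightarrow> R X \<B>" for X \<A> \<B>
    unfolding R_def using open_region_mono flat_region_mono by blast
  have ex: "\<exists>\<A>. finite \<A> \<and> (\<forall>(a, b)\<in>\<A>. a \<noteq> 0) \<and> R X \<A>" for X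
  proof -
    have "\<exists>\<A>. finite \<A> \<and> (\<forall>(a, b)\<in>\<A>. a \<noteq> 0) \<and> (X = \<Omega> \<or> X \<in> \<T> \<longrightarrow> open_region \<A> X)"
    proof (cases "X = \<Omega> \<or> X \<in> \<T>")
      case True
      then have "polytopal_set (int DIM('a)) X" using assms(1) m unfolding polytopal_domain_def by metis
      from polytopal_set_open_region(1)[OF this] show ?thesis by meson
    next
      case False
      then show ?thesis by (intro exI[of _ "{}"]) simp
    qed
    then obtain \<A>1 where A1: "finite \<A>1" "\<forall>(a, b)\<in>\<A>1. a \<noteq> 0" "X = \<Omega> \<or> X \<in> \<T> \<longrightarrow> open_region \<A>1 X" by blast
    have "\<exists>\<A>. finite \<A> \<and> (\<forall>(a, b)\<in>\<A>. a \<noteq> 0) \<and> (X \<in> \<F> \<longrightarrow> flat_region \<A> X)"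
    proof (cases "X \<in> \<F>")
      case True
      then have "polytopal_set (int DIM('a) - 1) X" using m by metis
      from polytopal_set_flat_region[OF this] show ?thesis by meson
    next
      case False
      then show ?thesis by (intro exI[of _ "{}"]) simp
    qed
    then obtain \<A>2 where A2: "finite \<A>2" "\<forall>(a, b)\<in>\<A>2. a \<noteq> 0" "X \<in> \<F> \<longrightarrow> flat_region \<A>2 X" by blast
    have "R X (\<A>1 \<union> \<A>2)" unfolding R_def
      using A1(3) A2(3) open_region_mono[OF _ Un_upper1] flat_region_mono[OF _ Un_upper2] by metis
    then show ?thesis using A1(1,2) A2(1,2) by (intro exI[of _ "\<A>1 \<union> \<A>2"]) auto
  qed
  then have "\<forall>X. \<exists>\<A>. finite \<A> \<and> (\<forall>(a, b)\<in>\<A>. a \<noteq> 0) \<and> R X \<A>" ..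
  from choice[OF this] obtain \<B> where \<B>: "\<forall>X. finite (\<B> X) \<and> (\<forall>(a, b)\<in>\<B> X. a \<noteq> 0) \<and> R X (\<B> X)" ..
  define \<A> where "\<A> = (\<Union>X\<in>insert \<Omega> (\<T> \<union> \<F>). \<B> X)"
  have R\<A>: "R X \<A>" if "X \<in> insert \<Omega> (\<T> \<union> \<F>)" for X
    using R_mono[of X "\<B> X" \<A>] \<B> that unfolding \<A>_def by blast
  have "arranged_mesh \<Omega> \<T> \<F> \<A>"
  proof
    show "finite \<A>" unfolding \<A>_def using \<B> m by auto
    show "a \<noteq> 0" if "(a, b) \<in> \<A>" for a b using \<B> that unfolding \<A>_def by blast
    show "open_region \<A> \<Omega>" using R\<A>[of \<Omega>] by (simp add: R_def)
    show "open_region \<A> T" if "T \<in> \<T>" for T using R\<A>[of T] that by (simp add: R_def)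
    show "flat_region \<A> F" if "F \<in> \<F>" for F using R\<A>[of F] that by (simp add: R_def)
    show "T \<noteq> {}" if "T \<in> \<T>" for T using polytopal_set_open_region(2)[of T] m that by metis
    show "finite \<T>" using m by (elim conjE)
    show "disjoint \<T>" using m by (elim conjE)
    show "closure \<Omega> = (\<Union>T\<in>\<T>. closure T)" using m by (elim conjE)
    show "finite \<F>" using m by (elim conjE)
    show "disjoint \<F>" using m by (elim conjE)
    show "(\<Union>T\<in>\<T>. frontier T) = (\<Union>F\<in>\<F>. closure F)" using m by (elim conjE)
    show "\<F> = interior_faces \<T> \<F> \<union> boundary_faces \<Omega> \<T> \<F>" using m by (elim conjE)
  qed
  then show ?thesis by (rule that)
qed

context arranged_mesh
begin

abbreviation sides :: "'a set \<Rightarrow> 'a set set" where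
  "sides F \<equiv> {T \<in> \<T>. F \<subseteq> frontier T}"

lemma element_open: "T \<in> \<T> \<Longrightarrow> open T"
  using element_region unfolding open_region_def by auto

lemma element_bounded: "T \<in> \<T> \<Longrightarrow> bounded T"
  using element_region by (auto simp: open_region_def intro: bounded_subset[OF compact_imp_bounded interior_subset])

lemma domain_bounded: "bounded \<Omega>"
  using domain_region by (auto simp: open_region_def intro: bounded_subset[OF compact_imp_bounded interior_subset])

lemma face_flat: "F \<in> \<F> \<Longrightarrow> flat_face F"
  using face_region unfolding flat_region_def by blast

lemma face_hyperplane:
  assumes "F \<in> \<F>"
  obtains a b where "(a, b) \<in> \<A>" "affine hull F = {x. a \<bullet> x = b}"
  using face_region[OF assms] unfolding flat_region_def by blast

lemma closure_face_hyperplane: "affine hull (F :: 'a set) = {x. a \<bullet> x = b} \<Longrightarrow> z \<in> closure F \<Longrightarrow> a \<bullet> z = b"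
  using closure_minimal[OF hull_subset closed_affine_hull, of F] by blast

text \<open>Near a generic point, the hyperplane of the face is not divided by the arrangement, so a
  point of the closure has a neighbourhood in that hyperplane inside the face.\<close>

lemma generic_in_closure_face:
  assumes F: "F \<in> \<F>" and gen: "generic \<A> z" and z: "z \<in> closure F"
  shows "z \<in> F"
proof -
  obtain a b where ab: "(a, b) \<in> \<A>" "affine hull F = {x. a \<bullet> x = b}" using face_hyperplane[OF F] .
  obtain K where K: "compact K" "sign_determined \<A> K" "F = rel_interior K" "affine hull K = affine hull F"
    using face_region[OF F] unfolding flat_region_def by blast
  have zb: "a \<bullet> z = b" by (rule closure_face_hyperplane[OF ab(2) z])
  have zK: "z \<in> K"
    using z K(1,3) closure_minimal[of F K] rel_interior_subset compact_imp_closed by blast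
  obtain e where e: "0 < e" "\<And>K x y. sign_determined \<A> K \<Longrightarrow> x \<in> ball z e \<Longrightarrow> y \<in> ball z e \<Longrightarrow>
      sgn (a \<bullet> x - b) = sgn (a \<bullet> y - b) \<Longrightarrow> x \<in> K \<Longrightarrow> y \<in> K"
    using generic_ball[OF finite_arrangement gen ab(1) zb] by blast
  have "ball z e \<inter> affine hull K \<subseteq> K"
  proof
    fix y assume y: "y \<in> ball z e \<inter> affine hull K"
    then have "a \<bullet> y = b" using ab(2) K(4) by auto
    then show "y \<in> K" using e(2)[OF K(2), of z y] e(1) zK y zb by simp
  qed
  then show ?thesis unfolding K(3) mem_rel_interior_ball using zK e(1) by blast
qed

text \<open>Near a generic point only the hyperplane of the face is present, so membership in a region is
  constant on each of the two half-balls.\<close>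

lemma generic_face_sides:
  assumes gen: "generic \<A> z" and F: "F \<in> \<F>" and z: "z \<in> F"
  obtains a b e where "(a, b) \<in> \<A>" "affine hull F = {x. a \<bullet> x = b}" "a \<bullet> z = b" "0 < e"
    "\<forall>X. open_region \<A> X \<longrightarrow> z \<in> frontier X \<longrightarrow>
      (\<exists>\<sigma>. (\<sigma> = 1 \<or> \<sigma> = -1) \<and> half_ball a b z e \<sigma> \<subseteq> X \<and> half_ball a b z e (- \<sigma>) \<inter> closure X = {})"
proof -
  obtain a b where ab: "(a, b) \<in> \<A>" "affine hull F = {x. a \<bullet> x = b}" using face_hyperplane[OF F] .
  have zb: "a \<bullet> z = b" by (rule closure_face_hyperplane[OF ab(2)]) (use z closure_subset in blast)
  obtain e where e: "0 < e" "\<And>K x y. sign_determined \<A> K \<Longrightarrow> x \<in> ball z e \<Longrightarrow> y \<in> ball z e \<Longrightarrow>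
      sgn (a \<bullet> x - b) = sgn (a \<bullet> y - b) \<Longrightarrow> x \<in> K \<Longrightarrow> y \<in> K"
    using generic_ball[OF finite_arrangement gen ab(1) zb] by blast
  have side: "\<exists>\<sigma>. (\<sigma> = 1 \<or> \<sigma> = -1) \<and> half_ball a b z e \<sigma> \<subseteq> X \<and> half_ball a b z e (- \<sigma>) \<inter> closure X = {}"
    if X: "open_region \<A> X" "z \<in> frontier X" for X
  proof -
    obtain K where K: "compact K" "sign_determined \<A> K" "X = interior K" using X(1) unfolding open_region_def by blast
    have sub: "closure X \<subseteq> K" using K(1,3) closure_minimal[OF interior_subset] compact_imp_closed by blast
    have det: "y \<in> K" if "x \<in> ball z e" "y \<in> ball z e" "sgn (a \<bullet> x - b) = sgn (a \<bullet> y - b)" "x \<in> K" for x y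
      using e(2)[OF K(2) that] .
    have "\<exists>\<sigma>. (\<sigma> = 1 \<or> \<sigma> = -1) \<and> half_ball a b z e \<sigma> \<subseteq> interior K \<and> half_ball a b z e (- \<sigma>) \<inter> K = {}"
      by (rule frontier_one_side[OF normal_nonzero[OF ab(1)] e(1) zb compact_imp_closed[OF K(1)] X(2)[unfolded K(3)] det])
    then obtain \<sigma> where \<sigma>: "\<sigma> = 1 \<or> \<sigma> = -1" "half_ball a b z e \<sigma> \<subseteq> interior K" "half_ball a b z e (- \<sigma>) \<inter> K = {}"
      by (elim exE conjE)
    have "half_ball a b z e (- \<sigma>) \<inter> closure X = {}" using \<sigma>(3) sub by blast
    then show ?thesis using \<sigma>(1,2) unfolding K(3)[symmetric] by (intro exI[of _ \<sigma>] conjI)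
  qed
  show ?thesis using that[OF ab zb e(1)] side by blast
qed

lemma generic_two_sides:
  assumes gen: "generic \<A> z" and F: "F \<in> \<F>" and z: "z \<in> F"
    and T: "T1 \<in> \<T>" "T2 \<in> \<T>" "T1 \<noteq> T2" "z \<in> frontier T1" "z \<in> frontier T2"
  obtains a b e where "(a, b) \<in> \<A>" "affine hull F = {x. a \<bullet> x = b}" "a \<bullet> z = b" "0 < e"
    "half_ball a b z e 1 \<subseteq> T1 \<and> half_ball a b z e (-1) \<subseteq> T2 \<or> half_ball a b z e (-1) \<subseteq> T1 \<and> half_ball a b z e 1 \<subseteq> T2"
    "\<forall>X. open_region \<A> X \<longrightarrow> z \<in> frontier X \<longrightarrow>
      (\<exists>\<sigma>. (\<sigma> = 1 \<or> \<sigma> = -1) \<and> half_ball a b z e \<sigma> \<subseteq> X \<and> half_ball a b z e (- \<sigma>) \<inter> closure X = {})"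
proof -
  obtain a b e where abe: "(a, b) \<in> \<A>" "affine hull F = {x. a \<bullet> x = b}" "a \<bullet> z = b" "0 < e"
    "\<forall>X. open_region \<A> X \<longrightarrow> z \<in> frontier X \<longrightarrow>
      (\<exists>\<sigma>. (\<sigma> = 1 \<or> \<sigma> = -1) \<and> half_ball a b z e \<sigma> \<subseteq> X \<and> half_ball a b z e (- \<sigma>) \<inter> closure X = {})"
    by (rule generic_face_sides[OF gen F z])
  obtain \<sigma>1 where 1: "\<sigma>1 = 1 \<or> \<sigma>1 = -1" "half_ball a b z e \<sigma>1 \<subseteq> T1"
    using abe(5)[rule_format, OF element_region[OF T(1)] T(4)] by blast
  obtain \<sigma>2 where 2: "\<sigma>2 = 1 \<or> \<sigma>2 = -1" "half_ball a b z e \<sigma>2 \<subseteq> T2"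
    using abe(5)[rule_format, OF element_region[OF T(2)] T(5)] by blast
  have "T1 \<inter> T2 = {}" using disjoint_elements T(1-3) by (auto simp: disjoint_def)
  then have "\<sigma>1 \<noteq> \<sigma>2"
    using 1 2 half_ball_nonempty[OF normal_nonzero[OF abe(1)] abe(4,3) 1(1)] by blast
  then show ?thesis using that[OF abe(1-4) _ abe(5)] 1 2 by auto
qed

lemma generic_at_most_two_elements:
  assumes gen: "generic \<A> z" and F: "F \<in> \<F>" and z: "z \<in> F"
    and T: "T1 \<in> \<T>" "T2 \<in> \<T>" "T1 \<noteq> T2" "z \<in> frontier T1" "z \<in> frontier T2" and T3: "T \<in> \<T>" "z \<in> frontier T"
  shows "T = T1 \<or> T = T2"
proof -
  obtain a b e where abe: "(a, b) \<in> \<A>" "affine hull F = {x. a \<bullet> x = b}" "a \<bullet> z = b" "0 < e"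
    "half_ball a b z e 1 \<subseteq> T1 \<and> half_ball a b z e (-1) \<subseteq> T2 \<or> half_ball a b z e (-1) \<subseteq> T1 \<and> half_ball a b z e 1 \<subseteq> T2"
    "\<forall>X. open_region \<A> X \<longrightarrow> z \<in> frontier X \<longrightarrow>
      (\<exists>\<sigma>. (\<sigma> = 1 \<or> \<sigma> = -1) \<and> half_ball a b z e \<sigma> \<subseteq> X \<and> half_ball a b z e (- \<sigma>) \<inter> closure X = {})"
    by (rule generic_two_sides[OF assms(1-8)])
  obtain \<sigma> where \<sigma>: "\<sigma> = 1 \<or> \<sigma> = -1" "half_ball a b z e \<sigma> \<subseteq> T"
    using abe(6)[rule_format, OF element_region[OF T3(1)] T3(2)] by blast
  have "half_ball a b z e \<sigma> \<noteq> {}" by (rule half_ball_nonempty[OF normal_nonzero[OF abe(1)] abe(4,3) \<sigma>(1)])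
  then have "T \<inter> T1 \<noteq> {} \<or> T \<inter> T2 \<noteq> {}" using abe(5) \<sigma> by auto
  then show ?thesis using disjoint_elements T(1,2) T3(1) by (auto simp: disjoint_def)
qed

lemma element_subset_closure_domain: "T \<in> \<T> \<Longrightarrow> T \<subseteq> closure \<Omega>"
  unfolding closure_domain using closure_subset by blast

text \<open>Two elements would fill both half-balls, but one of these lies outside the domain.\<close>

lemma generic_boundary_one_element:
  assumes gen: "generic \<A> z" and F: "F \<in> \<F>" and z: "z \<in> F" "z \<in> frontier \<Omega>"
    and T: "T1 \<in> \<T>" "T2 \<in> \<T>" "z \<in> frontier T1" "z \<in> frontier T2"
  shows "T1 = T2"
proof (rule ccontr)
  assume ne: "T1 \<noteq> T2"
  obtain a b e where abe: "(a, b) \<in> \<A>" "affine hull F = {x. a \<bullet> x = b}" "a \<bullet> z = b" "0 < e"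
    "half_ball a b z e 1 \<subseteq> T1 \<and> half_ball a b z e (-1) \<subseteq> T2 \<or> half_ball a b z e (-1) \<subseteq> T1 \<and> half_ball a b z e 1 \<subseteq> T2"
    "\<forall>X. open_region \<A> X \<longrightarrow> z \<in> frontier X \<longrightarrow>
      (\<exists>\<sigma>. (\<sigma> = 1 \<or> \<sigma> = -1) \<and> half_ball a b z e \<sigma> \<subseteq> X \<and> half_ball a b z e (- \<sigma>) \<inter> closure X = {})"
    by (rule generic_two_sides[OF gen F z(1) T(1,2) ne T(3,4)])
  obtain \<sigma> where \<sigma>: "\<sigma> = 1 \<or> \<sigma> = -1" "half_ball a b z e (- \<sigma>) \<inter> closure \<Omega> = {}"
    using abe(6)[rule_format, OF domain_region z(2)] by blast
  have "half_ball a b z e (- \<sigma>) \<noteq> {}"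
    by (rule half_ball_nonempty[OF normal_nonzero[OF abe(1)] abe(4,3)]) (use \<sigma> in auto)
  moreover have "half_ball a b z e (- \<sigma>) \<subseteq> T1 \<union> T2" using abe(5) \<sigma>(1) by auto
  ultimately show False using \<sigma>(2) element_subset_closure_domain T(1,2) by blast
qed

text \<open>A mesh only requires each face to lie in the frontiers of some elements. At a generic point these are
  all elements that have the point on their frontier, by the bounds on their number.\<close>

lemma generic_frontier_face_subset:
  assumes gen: "generic \<A> z" and F: "F \<in> \<F>" and z: "z \<in> F" and T: "T \<in> \<T>" "z \<in> frontier T"
  shows "F \<subseteq> frontier T"
proof -
  consider "F \<in> interior_faces \<T> \<F>" | "F \<in> boundary_faces \<Omega> \<T> \<F>" using face_cases F by blast
  then show ?thesis
  proof cases
    case 1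
    then obtain T1 T2 where "T1 \<in> \<T>" "T2 \<in> \<T>" "T1 \<noteq> T2" "F \<subseteq> frontier T1" "F \<subseteq> frontier T2"
      unfolding interior_faces_def by blast
    then show ?thesis using generic_at_most_two_elements[OF gen F z, of T1 T2 T] z T by blast
  next
    case 2
    then obtain T1 where "T1 \<in> \<T>" "F \<subseteq> frontier T1" "F \<subseteq> frontier \<Omega>"
      unfolding boundary_faces_def by blast
    then show ?thesis using generic_boundary_one_element[OF gen F z, of T1 T] z T by blast
  qed
qed

lemma generic_frontier_face:
  assumes gen: "generic \<A> z" and T: "T \<in> \<T>" "z \<in> frontier T"
  obtains F where "F \<in> \<F>" "z \<in> F" "F \<subseteq> frontier T"
proof -
  obtain F where F: "F \<in> \<F>" "z \<in> closure F" using skeleton T by blast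
  then have "z \<in> F" using generic_in_closure_face gen by blast
  then show ?thesis using that F generic_frontier_face_subset[OF gen F(1) _ T] by blast
qed

end

definition transversal :: "('a::euclidean_space \<times> real) set \<Rightarrow> 'a \<Rightarrow> bool" where
  "transversal \<A> \<eta> \<longleftrightarrow> norm \<eta> = 1 \<and> (\<forall>(a, b)\<in>\<A>. a \<bullet> \<eta> \<noteq> 0)"

context arranged_mesh
begin

lemma transversal_exists: "\<exists>\<eta>. transversal \<A> \<eta>"
proof -
  have "negligible (\<Union>p\<in>\<A>. {x. fst p \<bullet> x = 0})"
    using finite_arrangement normal_nonzero by (intro negligible_Union) (auto intro!: negligible_hyperplane)
  then have "\<exists>x. x \<notin> (\<Union>p\<in>\<A>. {x. fst p \<bullet> x = 0}) \<union> {0}"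
    using non_negligible_UNIV negligible_Un[OF _ negligible_sing[of 0]] by (metis UNIV_eq_I)
  then obtain x where x: "x \<noteq> 0" "\<And>p. p \<in> \<A> \<Longrightarrow> fst p \<bullet> x \<noteq> 0" by blast
  then have "transversal \<A> (x /\<^sub>R norm x)" unfolding transversal_def by fastforce
  then show ?thesis by blast
qed

text \<open>A line in direction \<open>\<eta>\<close> that meets two distinct hyperplanes at the same point lies in the
  hyperplane spanned by their intersection and \<open>\<eta>\<close>, and there are finitely many of these.\<close>

lemma AE_generic_line:
  assumes \<eta>: "transversal \<A> \<eta>"
  shows "AE x in lborel. \<forall>t. generic \<A> (x + t *\<^sub>R \<eta>)"
proof -
  have "AE x in lborel. \<forall>t. fst p \<bullet> (x + t *\<^sub>R \<eta>) = snd p \<and> fst q \<bullet> (x + t *\<^sub>R \<eta>) = snd q \<longrightarrow>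
      (\<exists>c. c \<noteq> 0 \<and> fst q = c *\<^sub>R fst p \<and> snd q = c * snd p)" if pq: "p \<in> \<A>" "q \<in> \<A>" for p q
  proof -
    define c where "c = (fst q \<bullet> \<eta>) / (fst p \<bullet> \<eta>)"
    have nz: "fst p \<bullet> \<eta> \<noteq> 0" "fst q \<bullet> \<eta> \<noteq> 0" using \<eta> pq by (auto simp: transversal_def)
    have c: "c \<noteq> 0" "fst q \<bullet> \<eta> = c * (fst p \<bullet> \<eta>)" using nz by (auto simp: c_def)
    have on: "(fst q - c *\<^sub>R fst p) \<bullet> x = snd q - c * snd p"
      if "fst p \<bullet> (x + t *\<^sub>R \<eta>) = snd p" "fst q \<bullet> (x + t *\<^sub>R \<eta>) = snd q" for x t
    proof -
      have "snd q - c * snd p = fst q \<bullet> (x + t *\<^sub>R \<eta>) - c * (fst p \<bullet> (x + t *\<^sub>R \<eta>))" using that by simp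
      also have "\<dots> = (fst q - c *\<^sub>R fst p) \<bullet> x" using c(2) by (simp add: inner_add_right inner_diff_left algebra_simps)
      finally show ?thesis by simp
    qed
    show ?thesis
    proof (cases "fst q - c *\<^sub>R fst p = 0")
      case True
      then have "snd q = c * snd p" if "fst p \<bullet> (x + t *\<^sub>R \<eta>) = snd p" "fst q \<bullet> (x + t *\<^sub>R \<eta>) = snd q" for x t
        using on[OF that] by simp
      then show ?thesis using True c(1) by (intro AE_I2) auto
    next
      case False
      then have "AE x in lborel. x \<notin> {x. (fst q - c *\<^sub>R fst p) \<bullet> x = snd q - c * snd p}"
        by (intro AE_not_in_closed_negligible closed_hyperplane negligible_hyperplane) simp
      then show ?thesis by eventually_elim (use on in auto)
    qed
  qed
  then have "AE x in lborel. \<forall>p\<in>\<A>. \<forall>q\<in>\<A>. \<forall>t. fst p \<bullet> (x + t *\<^sub>R \<eta>) = snd p \<and> fst q \<bullet> (x + t *\<^sub>R \<eta>) = snd q \<longrightarrow>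
      (\<exists>c. c \<noteq> 0 \<and> fst q = c *\<^sub>R fst p \<and> snd q = c * snd p)"
    using finite_arrangement by (intro AE_finite_allI) auto
  then show ?thesis by eventually_elim (simp only: generic_def case_prod_unfold, blast)
qed

lemma open_has_generic_line:
  assumes \<eta>: "transversal \<A> \<eta>" and U: "open U" "U \<noteq> {}"
  obtains x where "x \<in> U" "\<And>t. generic \<A> (x + t *\<^sub>R \<eta>)"
proof -
  have "\<exists>x\<in>U. \<forall>t. generic \<A> (x + t *\<^sub>R \<eta>)"
  proof (rule ccontr)
    assume "\<not> ?thesis"
    then have "AE x in lborel. x \<notin> U"
      by (intro AE_mp[OF AE_generic_line[OF \<eta>] AE_I2]) blast
    then have "emeasure lborel U = 0"
      using AE_iff_measurable[of U lborel "\<lambda>x. x \<notin> U"] U(1) by simp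
    moreover obtain x e where "e > 0" "ball x e \<subseteq> U" using U openE by blast
    then have "emeasure lborel (ball x e) \<le> emeasure lborel U" using U(1) by (intro emeasure_mono) auto
    ultimately have "measure lborel (ball x e) = 0" by (simp add: measure_def)
    then show False using content_ball_pos[OF \<open>e > 0\<close>, of x] by simp
  qed
  then show ?thesis using that by blast
qed

text \<open>Projecting along a transversal direction, the points of the face correspond to an open set of lines.\<close>

lemma face_has_generic_point:
  assumes F: "F \<in> \<F>"
  obtains z where "z \<in> F" "generic \<A> z"
proof -
  obtain \<eta> where \<eta>: "transversal \<A> \<eta>" using transversal_exists by blast
  obtain a b where ab: "(a, b) \<in> \<A>" "affine hull F = {x. a \<bullet> x = b}" using face_hyperplane[OF F] .
  have nz: "a \<bullet> \<eta> \<noteq> 0" using \<eta> ab(1) by (auto simp: transversal_def)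
  obtain U where U: "open U" "F = affine hull F \<inter> U" using face_flat[OF F] by (auto simp: flat_face_def openin_open)
  have "F \<noteq> {}" using face_flat[OF F] by (metis unit_normal_exists flat_face_def nonempty_face)
  then obtain z0 where z0: "z0 \<in> F" by blast
  define p where "p x = x + ((b - a \<bullet> x) / (a \<bullet> \<eta>)) *\<^sub>R \<eta>" for x
  have "continuous_on UNIV p" unfolding p_def by (intro continuous_intros) (use nz in auto)
  then have "open (p -` U)" using U(1) by (simp add: continuous_on_open_vimage)
  moreover have "a \<bullet> z0 = b" using z0 ab(2) hull_subset[of F affine] by blast
  then have "p z0 = z0" by (simp add: p_def)
  then have "p -` U \<noteq> {}" using z0 U(2) by auto
  ultimately obtain x where x: "x \<in> p -` U" "\<And>t. generic \<A> (x + t *\<^sub>R \<eta>)"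
    using open_has_generic_line[OF \<eta>] by blast
  have "a \<bullet> p x = b" using nz by (simp add: p_def inner_add_right)
  then have "p x \<in> F" using x(1) U(2) ab(2) by auto
  moreover have "generic \<A> (p x)" using x(2) by (simp add: p_def)
  ultimately show ?thesis by (rule that)
qed

lemma interior_face_elements:
  assumes "F \<in> interior_faces \<T> \<F>"
  obtains T1 T2 where "T1 \<in> \<T>" "T2 \<in> \<T>" "T1 \<noteq> T2" "F \<subseteq> frontier T1" "F \<subseteq> frontier T2" "sides F = {T1, T2}"
proof -
  obtain T1 T2 where T: "T1 \<in> \<T>" "T2 \<in> \<T>" "T1 \<noteq> T2" "F \<subseteq> frontier T1" "F \<subseteq> frontier T2" and F: "F \<in> \<F>"
    using assms unfolding interior_faces_def by blast
  obtain z where z: "z \<in> F" "generic \<A> z" using face_has_generic_point[OF F] .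
  have "T = T1 \<or> T = T2" if "T \<in> \<T>" "F \<subseteq> frontier T" for T
    using generic_at_most_two_elements[OF z(2) F z(1) T(1-3)] T that z(1) by blast
  then have "sides F = {T1, T2}" using T by blast
  then show ?thesis using that T by blast
qed

end


section \<open>A Poincare inequality for piecewise smooth functions\<close>

text \<open>Since \<open>\<theta>\<close> is a step function with jumps \<open>\<epsilon>\<close>, it is the sum of its initial value and Heaviside
  functions, for each of which the formula is the fundamental theorem of calculus.\<close>

lemma step_function_integration_by_parts:
  fixes q q' \<theta> \<epsilon> :: "real \<Rightarrow> real"
  assumes L: "0 < L" and X: "finite X" "0 \<notin> X" "L \<notin> X"
    and const: "\<And>t. t \<notin> X \<Longrightarrow> \<exists>\<delta>>0. \<forall>s. \<bar>s - t\<bar> < \<delta> \<longrightarrow> \<theta> s = \<theta> t"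
    and jump: "\<And>t. t \<in> X \<Longrightarrow> \<exists>\<delta>>0. \<exists>c. \<forall>s. 0 < s \<and> s < \<delta> \<longrightarrow> \<theta> (t - s) = c \<and> \<theta> (t + s) = c + \<epsilon> t"
    and der: "\<And>t. (q has_real_derivative q' t) (at t)" and cont: "continuous_on UNIV q'"
    and end0: "\<theta> L = 0" and range: "\<And>t. \<bar>\<theta> t\<bar> \<le> 1"
  shows "ennreal \<bar>\<theta> 0 * q 0 + (\<Sum>t\<in>X \<inter> {0<..<L}. \<epsilon> t * q t)\<bar> \<le> (\<integral>\<^sup>+t\<in>{0<..<L}. ennreal (\<bar>\<theta> t\<bar> * \<bar>q' t\<bar>) \<partial>lborel)"
proof -
  define Y where "Y = X \<inter> {0<..<L}"
  have finY: "finite Y" using X(1) by (simp add: Y_def)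
  define lim where "lim t = (SOME c. \<exists>\<delta>>0. \<forall>s. 0 < s \<and> s < \<delta> \<longrightarrow> \<theta> (t - s) = c \<and> \<theta> (t + s) = c + \<epsilon> t)" for t
  have lim: "\<exists>\<delta>>0. \<forall>s. 0 < s \<and> s < \<delta> \<longrightarrow> \<theta> (t - s) = lim t \<and> \<theta> (t + s) = lim t + \<epsilon> t" if "t \<in> X" for t
    unfolding lim_def by (rule someI_ex) (use jump[OF that] in blast)
  \<comment> \<open>The step function with the same jumps. The difference to \<open>\<theta>\<close>, with the values at jumps corrected,
    is locally constant, hence constant.\<close>
  define H where "H t = (\<Sum>s\<in>X. if s < t then \<epsilon> s else 0)" for t
  define \<psi> where "\<psi> t = (if t \<in> X then lim t else \<theta> t) - H t" for t
  have loc: "\<forall>\<^sub>F s in at t within UNIV. \<psi> t = \<psi> s" for t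
  proof -
    obtain \<delta>1 where \<delta>1: "\<delta>1 > 0" "\<And>s. s \<in> X \<Longrightarrow> s \<noteq> t \<Longrightarrow> \<delta>1 \<le> \<bar>s - t\<bar>"
      using finite_set_avoid[OF X(1), of t] by (auto simp: dist_real_def abs_minus_commute)
    have "\<exists>\<delta>>0. \<forall>s. s \<noteq> t \<and> \<bar>s - t\<bar> < \<delta> \<longrightarrow> \<psi> t = \<psi> s"
    proof (cases "t \<in> X")
      case False
      then obtain \<delta> where \<delta>: "\<delta> > 0" "\<And>s. \<bar>s - t\<bar> < \<delta> \<Longrightarrow> \<theta> s = \<theta> t" using const by blast
      have "\<psi> t = \<psi> s" if s: "s \<noteq> t" "\<bar>s - t\<bar> < min \<delta> \<delta>1" for s
      proof -
        have "s \<notin> X" using \<delta>1(2)[of s] s by auto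
        moreover have "H s = H t"
          unfolding H_def
        proof (intro sum.cong refl)
          fix r assume "r \<in> X"
          then have "\<delta>1 \<le> \<bar>r - t\<bar>" using \<delta>1(2) False by blast
          then show "(if r < s then \<epsilon> r else 0) = (if r < t then \<epsilon> r else 0)" using s by auto
        qed
        ultimately show ?thesis using False \<delta>(2)[of s] s by (simp add: \<psi>_def)
      qed
      then show ?thesis using \<delta>(1) \<delta>1(1) by (intro exI[of _ "min \<delta> \<delta>1"]) auto
    next
      case True
      obtain \<delta> where \<delta>: "\<delta> > 0" "\<And>s. 0 < s \<Longrightarrow> s < \<delta> \<Longrightarrow> \<theta> (t - s) = lim t \<and> \<theta> (t + s) = lim t + \<epsilon> t"
        using lim[OF True] by blast
      have "\<psi> t = \<psi> s" if s: "s \<noteq> t" "\<bar>s - t\<bar> < min \<delta> \<delta>1" for s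
      proof -
        have sX: "s \<notin> X" using \<delta>1(2)[of s] s by auto
        have "H s = H t + (if t < s then \<epsilon> t else 0)"
        proof -
          have "H s = (\<Sum>r\<in>X. (if r < t then \<epsilon> r else 0) + (if r = t then (if t < s then \<epsilon> t else 0) else 0))"
            unfolding H_def
          proof (intro sum.cong refl)
            fix r assume "r \<in> X"
            then have "r \<noteq> t \<Longrightarrow> \<delta>1 \<le> \<bar>r - t\<bar>" using \<delta>1(2) by blast
            then show "(if r < s then \<epsilon> r else 0) = (if r < t then \<epsilon> r else 0) + (if r = t then (if t < s then \<epsilon> t else 0) else 0)"
              using s by (cases "r = t") auto
          qed
          also have "\<dots> = H t + (if t < s then \<epsilon> t else 0)"
            using X(1) True by (simp add: sum.distrib H_def)
          finally show ?thesis .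
        qed
        moreover have "\<theta> s = lim t + (if t < s then \<epsilon> t else 0)"
          using \<delta>(2)[of "\<bar>s - t\<bar>"] s by (cases "t < s") auto
        ultimately show ?thesis using True sX by (simp add: \<psi>_def)
      qed
      then show ?thesis using \<delta>(1) \<delta>1(1) by (intro exI[of _ "min \<delta> \<delta>1"]) auto
    qed
    then show ?thesis by (auto simp: eventually_at dist_real_def)
  qed
  have "\<psi> t = \<psi> 0" for t
    using connected_local_const[OF connected_UNIV, of t 0 \<psi>] loc by blast
  then have \<theta>_eq: "\<theta> t = \<theta> 0 + (\<Sum>s\<in>Y. if s < t then \<epsilon> s else 0)" if "t \<notin> X" "0 \<le> t" "t \<le> L" for t
  proof -
    have "\<theta> t - H t = \<theta> 0 - H 0" using \<open>\<And>t. \<psi> t = \<psi> 0\<close>[of t] that X by (simp add: \<psi>_def)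
    moreover have "H t - H 0 = (\<Sum>s\<in>X. if s \<in> {0<..<L} then (if s < t then \<epsilon> s else 0) else 0)"
      unfolding H_def sum_subtractf[symmetric] using that X by (intro sum.cong refl) force
    moreover have "\<dots> = (\<Sum>s\<in>Y. if s < t then \<epsilon> s else 0)"
      unfolding Y_def using X(1) by (simp add: sum.inter_restrict)
    ultimately show ?thesis by simp
  qed
  have bound: "s < L" "0 < s" if "s \<in> Y" for s using that by (auto simp: Y_def)
  have FTC: "has_bochner_integral lborel (\<lambda>t. q' t * indicator {s..L} t) (q L - q s)" if "s \<le> L" for s
    using that der cont by (intro has_bochner_integral_FTC_Icc_real) (auto simp: continuous_on_eq_continuous_at)
  define h where "h t = \<theta> 0 * (q' t * indicator {0..L} t) + (\<Sum>s\<in>Y. \<epsilon> s * (q' t * indicator {s..L} t))" for t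
  have "has_bochner_integral lborel h (\<theta> 0 * (q L - q 0) + (\<Sum>s\<in>Y. \<epsilon> s * (q L - q s)))"
    unfolding h_def
    by (intro has_bochner_integral_add has_bochner_integral_sum has_bochner_integral_mult_right FTC) (use L bound in \<open>auto simp: less_imp_le\<close>)
  moreover have "\<theta> 0 * (q L - q 0) + (\<Sum>s\<in>Y. \<epsilon> s * (q L - q s)) = - (\<theta> 0 * q 0 + (\<Sum>t\<in>Y. \<epsilon> t * q t))"
  proof -
    have "\<theta> 0 + (\<Sum>s\<in>Y. \<epsilon> s) = 0"
      using \<theta>_eq[OF X(3)] L end0 bound(1) by simp
    then have "(\<theta> 0 + (\<Sum>s\<in>Y. \<epsilon> s)) * q L = 0" by simp
    then show ?thesis by (simp add: algebra_simps sum_subtractf sum_distrib_left sum_distrib_right)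
  qed
  ultimately have hint: "integrable lborel h" "integral\<^sup>L lborel h = - (\<theta> 0 * q 0 + (\<Sum>t\<in>Y. \<epsilon> t * q t))"
    by (auto simp: has_bochner_integral_iff)
  have "ennreal \<bar>\<theta> 0 * q 0 + (\<Sum>t\<in>Y. \<epsilon> t * q t)\<bar> \<le> (\<integral>\<^sup>+t. ennreal \<bar>h t\<bar> \<partial>lborel)"
    using integral_norm_bound_ennreal[OF hint(1)] unfolding hint(2) real_norm_def abs_minus_cancel .
  also have "\<dots> \<le> (\<integral>\<^sup>+t\<in>{0<..<L}. ennreal (\<bar>\<theta> t\<bar> * \<bar>q' t\<bar>) \<partial>lborel)"
  proof (rule nn_integral_mono_AE)
    have "AE t in lborel. t \<notin> X \<union> {0, L}"
      using X(1) by (intro AE_not_in finite_imp_null_set_lborel) auto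
    then show "AE t in lborel. ennreal \<bar>h t\<bar> \<le> ennreal (\<bar>\<theta> t\<bar> * \<bar>q' t\<bar>) * indicator {0<..<L} t"
    proof eventually_elim
      case (elim t)
      show ?case
      proof (cases "t \<in> {0<..<L}")
        case True
        have "h t = \<theta> t * q' t"
        proof -
          have "(\<Sum>s\<in>Y. \<epsilon> s * (q' t * indicator {s..L} t)) = (\<Sum>s\<in>Y. (if s < t then \<epsilon> s else 0) * q' t)"
            using elim True by (intro sum.cong refl) (auto simp: indicator_def Y_def)
          also have "\<dots> = (\<Sum>s\<in>Y. if s < t then \<epsilon> s else 0) * q' t" by (rule sum_distrib_right[symmetric])
          finally show ?thesis using \<theta>_eq[of t] elim True by (simp add: h_def distrib_right)
        qed
        then show ?thesis using True by (simp add: abs_mult)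
      next
        case False
        then have "t \<notin> {0..L}" using elim by auto
        then have "h t = 0" using bound by (auto simp: h_def indicator_def intro!: sum.neutral) (meson less_imp_le order_trans)
        then show ?thesis by simp
      qed
    qed
  qed
  finally show ?thesis unfolding Y_def .
qed

text \<open>The points whose ray meets the face within distance \<open>L\<close> form a prism over the face of height at
  most \<open>L\<close>.\<close>

lemma nn_integral_prism:
  fixes F :: "'a::euclidean_space set" and \<phi> :: "'a \<Rightarrow> ennreal"
  assumes F: "flat_face F" and \<nu>: "unit_normal F \<nu>" and a: "a \<in> F" and \<eta>: "norm \<eta> = 1" "\<eta> \<bullet> \<nu> \<noteq> 0" and L: "0 < L"
    and [measurable]: "\<phi> \<in> borel_measurable borel"
  defines "\<tau> \<equiv> \<lambda>x. ((a - x) \<bullet> \<nu>) / (\<eta> \<bullet> \<nu>)"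
  shows "(\<integral>\<^sup>+x. \<phi> (x + \<tau> x *\<^sub>R \<eta>) * indicator F (x + \<tau> x *\<^sub>R \<eta>) * indicator {0<..<L} (\<tau> x) \<partial>lborel) \<le> ennreal L * (\<integral>\<^sup>+z\<in>F. \<phi> z \<partial>face_measure F)"
proof -
  have dimF: "aff_dim F = int DIM('a) - 1" using F by (simp add: flat_face_def)
  interpret sigma_finite_measure "face_measure F" by (rule sigma_finite_face_measure[OF dimF])
  interpret lf: pair_sigma_finite "lborel :: real measure" "face_measure F" ..
  note [measurable_cong] = sets_face_measure[OF dimF \<nu>]
  have [measurable]: "F \<in> sets borel" by (rule flat_face_borel[OF F])
  define c where "c = \<eta> \<bullet> \<nu>"
  have c: "c \<noteq> 0" "\<bar>c\<bar> \<le> 1"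
    using \<eta> Cauchy_Schwarz_ineq2[of \<eta> \<nu>] norm_unit_normal[OF dimF \<nu>] by (auto simp: c_def)
  define w where "w = \<nu> - (1 / c) *\<^sub>R \<eta>"
  have w: "w \<bullet> \<nu> = 0" using norm_unit_normal[OF dimF \<nu>] c by (simp add: w_def inner_diff_left c_def)
  define g where "g z = \<phi> z * indicator F z" for z
  have [measurable]: "g \<in> borel_measurable borel" unfolding g_def by measurable
  have "(\<integral>\<^sup>+x. \<phi> (x + \<tau> x *\<^sub>R \<eta>) * indicator F (x + \<tau> x *\<^sub>R \<eta>) * indicator {0<..<L} (\<tau> x) \<partial>lborel)
      = (\<integral>\<^sup>+x. g (x + \<tau> x *\<^sub>R \<eta>) * indicator {0<..<L} (\<tau> x) \<partial>lborel)" by (simp add: g_def)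
  also have "\<dots> = (\<integral>\<^sup>+z. \<integral>\<^sup>+s. g (z + s *\<^sub>R \<nu> + \<tau> (z + s *\<^sub>R \<nu>) *\<^sub>R \<eta>) * indicator {0<..<L} (\<tau> (z + s *\<^sub>R \<nu>)) \<partial>lborel \<partial>face_measure F)"
    unfolding \<tau>_def by (rule nn_integral_lborel_slices[OF dimF \<nu>]) measurable
  also have "\<dots> = (\<integral>\<^sup>+z. \<integral>\<^sup>+s. g (s *\<^sub>R w + 1 *\<^sub>R z) * indicator {0<..<L} (- s / c) \<partial>lborel \<partial>face_measure F)"
  proof (rule nn_integral_cong_AE, use AE_face_measure_hyperplane[OF dimF \<nu> a] in eventually_elim)
    fix z assume z: "(z - a) \<bullet> \<nu> = 0"
    have \<tau>z: "\<tau> (z + s *\<^sub>R \<nu>) = - s / c" for s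
    proof -
      have "a - (z + s *\<^sub>R \<nu>) = - (z - a) - s *\<^sub>R \<nu>" by simp
      then have "(a - (z + s *\<^sub>R \<nu>)) \<bullet> \<nu> = - ((z - a) \<bullet> \<nu>) - s * (\<nu> \<bullet> \<nu>)"
        by (simp only: inner_diff_left inner_minus_left inner_scaleR_left)
      then show ?thesis using z norm_unit_normal[OF dimF \<nu>] by (simp add: \<tau>_def c_def)
    qed
    have line: "z + s *\<^sub>R \<nu> + (- s / c) *\<^sub>R \<eta> = s *\<^sub>R w + 1 *\<^sub>R z" for s
      by (simp add: w_def algebra_simps)
    show "(\<integral>\<^sup>+s. g (z + s *\<^sub>R \<nu> + \<tau> (z + s *\<^sub>R \<nu>) *\<^sub>R \<eta>) * indicator {0<..<L} (\<tau> (z + s *\<^sub>R \<nu>)) \<partial>lborel) =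
        (\<integral>\<^sup>+s. g (s *\<^sub>R w + 1 *\<^sub>R z) * indicator {0<..<L} (- s / c) \<partial>lborel)"
      by (simp only: \<tau>z line)
  qed
  also have "\<dots> = (\<integral>\<^sup>+s. \<integral>\<^sup>+z. g (s *\<^sub>R w + 1 *\<^sub>R z) * indicator {0<..<L} (- s / c) \<partial>face_measure F \<partial>lborel)"
    by (rule lf.Fubini') measurable
  also have "\<dots> = (\<integral>\<^sup>+s. (\<integral>\<^sup>+z. g z \<partial>face_measure F) * indicator {0<..<L} (- s / c) \<partial>lborel)"
  proof (intro nn_integral_cong)
    fix s
    have "(\<integral>\<^sup>+z. g z \<partial>face_measure F) = ennreal (1 ^ (DIM('a) - 1)) * (\<integral>\<^sup>+z. g (s *\<^sub>R w + 1 *\<^sub>R z) \<partial>face_measure F)"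
      using w by (intro nn_integral_face_affine[OF dimF \<nu> _ a]) auto
    then show "(\<integral>\<^sup>+z. g (s *\<^sub>R w + 1 *\<^sub>R z) * indicator {0<..<L} (- s / c) \<partial>face_measure F) = (\<integral>\<^sup>+z. g z \<partial>face_measure F) * indicator {0<..<L} (- s / c)"
      by (subst nn_integral_multc) auto
  qed
  also have "\<dots> = (\<integral>\<^sup>+z. g z \<partial>face_measure F) * (\<integral>\<^sup>+s. indicator {0<..<L} (- s / c) \<partial>lborel)"
    by (rule nn_integral_cmult) measurable
  also have "(\<integral>\<^sup>+s. indicator {0<..<L} (- s / c) \<partial>lborel) = \<bar>- c\<bar> * (\<integral>\<^sup>+s. indicator {0<..<L} (- (0 + - c * s) / c) \<partial>lborel)"
    using c by (intro nn_integral_real_affine) auto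
  also have "(\<integral>\<^sup>+s. indicator {0<..<L} (- (0 + - c * s) / c) \<partial>lborel) = ennreal L"
    using c L by simp
  also have "(\<integral>\<^sup>+z. g z \<partial>face_measure F) * (\<bar>- c\<bar> * ennreal L) \<le> (\<integral>\<^sup>+z. g z \<partial>face_measure F) * (1 * ennreal L)"
    using c by (intro mult_left_mono mult_right_mono) (auto simp: ennreal_le_1)
  finally show ?thesis unfolding g_def by (simp add: mult.commute)
qed

context arranged_mesh
begin

text \<open>Near the crossing point, the two parts of the line lie in the two half-balls at the face.\<close>

lemma frontier_line_sides:
  assumes \<eta>: "transversal \<A> \<eta>" and gen: "generic \<A> (x + t *\<^sub>R \<eta>)" and T: "T \<in> \<T>" "x + t *\<^sub>R \<eta> \<in> frontier T"
  shows "\<exists>\<sigma>::real. (\<sigma> = 1 \<or> \<sigma> = -1) \<and> (\<exists>\<delta>>0. \<forall>s. 0 < s \<and> s < \<delta> \<longrightarrow> x + (t + \<sigma> * s) *\<^sub>R \<eta> \<in> T \<and> x + (t - \<sigma> * s) *\<^sub>R \<eta> \<notin> T)"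
proof -
  obtain F where F: "F \<in> \<F>" "x + t *\<^sub>R \<eta> \<in> F" using generic_frontier_face[OF gen T] by metis
  obtain a b e where abe: "(a, b) \<in> \<A>" "affine hull F = {x. a \<bullet> x = b}" "a \<bullet> (x + t *\<^sub>R \<eta>) = b" "0 < e"
    "\<forall>X. open_region \<A> X \<longrightarrow> x + t *\<^sub>R \<eta> \<in> frontier X \<longrightarrow>
      (\<exists>\<sigma>. (\<sigma> = 1 \<or> \<sigma> = -1) \<and> half_ball a b (x + t *\<^sub>R \<eta>) e \<sigma> \<subseteq> X \<and> half_ball a b (x + t *\<^sub>R \<eta>) e (- \<sigma>) \<inter> closure X = {})"
    by (rule generic_face_sides[OF gen F])
  obtain \<sigma> where \<sigma>: "\<sigma> = 1 \<or> \<sigma> = -1" "half_ball a b (x + t *\<^sub>R \<eta>) e \<sigma> \<subseteq> T" "half_ball a b (x + t *\<^sub>R \<eta>) e (- \<sigma>) \<inter> closure T = {}"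
    using abe(5)[rule_format, OF element_region[OF T(1)] T(2)] by blast
  have nz: "a \<bullet> \<eta> \<noteq> 0" "norm \<eta> = 1" using \<eta> abe(1) by (auto simp: transversal_def)
  define \<sigma>' where "\<sigma>' = \<sigma> * sgn (a \<bullet> \<eta>)"
  have \<sigma>': "\<sigma>' = 1 \<or> \<sigma>' = -1" using \<sigma>(1) nz by (auto simp: \<sigma>'_def sgn_if)
  have in_half: "x + (t + \<tau> * \<sigma>' * s) *\<^sub>R \<eta> \<in> half_ball a b (x + t *\<^sub>R \<eta>) e (\<tau> * \<sigma>)"
    if "0 < s" "s < e" "\<tau> = 1 \<or> \<tau> = -1" for s \<tau>
  proof -
    have "dist (x + t *\<^sub>R \<eta>) (x + (t + \<tau> * \<sigma>' * s) *\<^sub>R \<eta>) = \<bar>\<tau> * \<sigma>' * s\<bar>"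
      using nz by (simp add: dist_norm scaleR_add_left)
    also have "\<dots> = s" using that \<sigma>' by auto
    finally have near: "x + (t + \<tau> * \<sigma>' * s) *\<^sub>R \<eta> \<in> ball (x + t *\<^sub>R \<eta>) e" using that by simp
    have val: "a \<bullet> (x + (t + \<tau> * \<sigma>' * s) *\<^sub>R \<eta>) - b = \<tau> * \<sigma>' * s * (a \<bullet> \<eta>)"
      using abe(3) by (simp add: inner_add_right scaleR_add_left)
    have "\<tau> * \<sigma> * (\<tau> * \<sigma>' * s * (a \<bullet> \<eta>)) = (\<tau> * \<tau>) * (\<sigma> * \<sigma>) * (s * (sgn (a \<bullet> \<eta>) * (a \<bullet> \<eta>)))"
      by (simp add: \<sigma>'_def)
    also have "\<dots> = s * \<bar>a \<bullet> \<eta>\<bar>" using that(3) \<sigma>(1) by (auto simp: abs_sgn mult.commute)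
    also have "\<dots> > 0" using that nz by simp
    finally have "0 < \<tau> * \<sigma> * (a \<bullet> (x + (t + \<tau> * \<sigma>' * s) *\<^sub>R \<eta>) - b)" unfolding val .
    then show ?thesis using near by (simp only: half_ball_def mem_Collect_eq)
  qed
  have "x + (t + \<sigma>' * s) *\<^sub>R \<eta> \<in> T \<and> x + (t - \<sigma>' * s) *\<^sub>R \<eta> \<notin> T" if s: "0 < s" "s < e" for s
    using in_half[of s 1] in_half[of s "-1"] s \<sigma>(2,3) closure_subset[of T] by auto
  then show ?thesis using \<sigma>' abe(4) by blast
qed

lemma skeleton_on_hyperplanes: "T \<in> \<T> \<Longrightarrow> z \<in> frontier T \<Longrightarrow> \<exists>p\<in>\<A>. fst p \<bullet> z = snd p"
proof -
  assume "T \<in> \<T>" "z \<in> frontier T"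
  then obtain F where F: "F \<in> \<F>" "z \<in> closure F" using skeleton by blast
  obtain a b where "(a, b) \<in> \<A>" "affine hull F = {x. a \<bullet> x = b}" using face_hyperplane[OF F(1)] .
  then show ?thesis using closure_face_hyperplane[OF _ F(2), of a b] by (intro bexI[of _ "(a, b)"]) auto
qed

lemma finite_hyperplane_hits:
  assumes "transversal \<A> \<eta>"
  shows "finite {t. \<exists>p\<in>\<A>. fst p \<bullet> (x + t *\<^sub>R \<eta>) = snd p}"
proof -
  have "{t. \<exists>p\<in>\<A>. fst p \<bullet> (x + t *\<^sub>R \<eta>) = snd p} \<subseteq> (\<lambda>p. (snd p - fst p \<bullet> x) / (fst p \<bullet> \<eta>)) ` \<A>"
  proof clarify
    fix t p assume p: "p \<in> \<A>" "fst p \<bullet> (x + t *\<^sub>R \<eta>) = snd p"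
    then have "fst p \<bullet> \<eta> \<noteq> 0" using assms by (auto simp: transversal_def)
    then have "t = (snd p - fst p \<bullet> x) / (fst p \<bullet> \<eta>)" using p(2) by (simp add: inner_add_right field_simps)
    then show "t \<in> (\<lambda>p. (snd p - fst p \<bullet> x) / (fst p \<bullet> \<eta>)) ` \<A>" using p(1) by blast
  qed
  then show ?thesis using finite_arrangement finite_subset by blast
qed

text \<open>Summing over the elements the contributions of the crossings of a ray, those of an interior
  face enter with opposite signs, so that the value \<open>v F\<close> can be subtracted from both; at a face of
  a single element, \<open>v F\<close> is zero.\<close>

lemma piecewise_ray_bound:
  fixes q q' :: "'a set \<Rightarrow> 'a \<Rightarrow> real" and v :: "'a set \<Rightarrow> 'a \<Rightarrow> real"
  assumes \<eta>: "transversal \<A> \<eta>" and gen: "\<And>t. generic \<A> (x + t *\<^sub>R \<eta>)" and x: "\<And>T. T \<in> \<T> \<Longrightarrow> x \<notin> frontier T"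
    and L: "0 < L" "\<And>T. T \<in> \<T> \<Longrightarrow> x + L *\<^sub>R \<eta> \<notin> closure T"
    and der: "\<And>T t. T \<in> \<T> \<Longrightarrow> ((\<lambda>t. q T (x + t *\<^sub>R \<eta>)) has_real_derivative q' T (x + t *\<^sub>R \<eta>)) (at t)"
    and cont: "\<And>T. T \<in> \<T> \<Longrightarrow> continuous_on UNIV (q' T)"
    and v: "\<And>F. F \<in> \<F> \<Longrightarrow> F \<notin> interior_faces \<T> \<F> \<Longrightarrow> v F = (\<lambda>_. 0)"
  shows "ennreal (\<Sum>T\<in>\<T>. indicator T x * q T x) \<le>
    (\<Sum>T\<in>\<T>. \<integral>\<^sup>+t\<in>{0<..<L}. ennreal \<bar>q' T (x + t *\<^sub>R \<eta>)\<bar> * indicator T (x + t *\<^sub>R \<eta>) \<partial>lborel) +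
    (\<Sum>F\<in>\<F>. \<Sum>t | t \<in> {0<..<L} \<and> x + t *\<^sub>R \<eta> \<in> F. ennreal (\<Sum>T\<in>sides F. \<bar>q T (x + t *\<^sub>R \<eta>) - v F (x + t *\<^sub>R \<eta>)\<bar>))"
proof -
  define y where "y t = x + t *\<^sub>R \<eta>" for t
  define X where "X = {t. \<exists>T\<in>\<T>. y t \<in> frontier T}"
  have "X \<subseteq> {t. \<exists>p\<in>\<A>. fst p \<bullet> (x + t *\<^sub>R \<eta>) = snd p}"
    unfolding X_def y_def using skeleton_on_hyperplanes by blast
  then have finX: "finite X" using finite_hyperplane_hits[OF \<eta>] finite_subset by blast
  define P where "P T t \<sigma> \<longleftrightarrow> (\<sigma> = 1 \<or> \<sigma> = -1) \<and> (\<exists>\<delta>>0. \<forall>s. 0 < s \<and> s < \<delta> \<longrightarrow> y (t + \<sigma> * s) \<in> T \<and> y (t - \<sigma> * s) \<notin> T)"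
    for T t and \<sigma> :: real
  \<comment> \<open>The sign of a crossing: \<open>1\<close> if the ray enters the element, \<open>-1\<close> if it leaves it.\<close>
  define \<sigma> where "\<sigma> T t = (SOME \<sigma>. P T t \<sigma>)" for T t
  have P\<sigma>: "P T t (\<sigma> T t)" if "T \<in> \<T>" "y t \<in> frontier T" for T t
    unfolding \<sigma>_def by (rule someI_ex) (use frontier_line_sides[OF \<eta> gen that(1)] that(2) in \<open>simp add: P_def y_def\<close>)
  have \<sigma>: "\<And>T t. T \<in> \<T> \<Longrightarrow> y t \<in> frontier T \<Longrightarrow> \<sigma> T t = 1 \<or> \<sigma> T t = -1"
    "\<And>T t. T \<in> \<T> \<Longrightarrow> y t \<in> frontier T \<Longrightarrow> \<exists>\<delta>>0. \<forall>s. 0 < s \<and> s < \<delta> \<longrightarrow> y (t + \<sigma> T t * s) \<in> T \<and> y (t - \<sigma> T t * s) \<notin> T"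
    using P\<sigma> unfolding P_def by blast+
  define \<epsilon> where "\<epsilon> T t = (if y t \<in> frontier T then \<sigma> T t else 0)" for T t
  have conty: "continuous_on UNIV y" unfolding y_def by (intro continuous_intros)
  have loc_const: "\<exists>\<delta>>0. \<forall>s. \<bar>s - t\<bar> < \<delta> \<longrightarrow> indicator T (y s) = (indicator T (y t) :: real)"
    if T: "T \<in> \<T>" and t: "y t \<notin> frontier T" for T t
  proof -
    define U where "U = (if y t \<in> T then T else - closure T)"
    have "open U" using element_open[OF T] by (simp add: U_def open_Compl)
    moreover have "y t \<in> U" using t element_open[OF T] by (auto simp: U_def frontier_def interior_open)
    ultimately have "open (y -` U)" "t \<in> y -` U" using continuous_on_open_vimage[OF open_UNIV] conty by auto
    then obtain \<delta> where "\<delta> > 0" "\<And>s. \<bar>s - t\<bar> < \<delta> \<Longrightarrow> y s \<in> U" unfolding open_dist dist_real_def by blast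
    moreover have "indicator T z = (indicator T (y t) :: real)" if "z \<in> U" for z
      using that closure_subset[of T] by (auto simp: U_def indicator_def split: if_splits)
    ultimately show ?thesis by blast
  qed
  let ?jumps = "\<lambda>T. \<Sum>t\<in>X \<inter> {0<..<L}. \<epsilon> T t * q T (y t)" and ?jump = "\<lambda>t. \<Sum>T\<in>\<T>. \<epsilon> T t * q T (y t)"
  have part: "ennreal \<bar>indicator T x * q T x + ?jumps T\<bar> \<le>
      (\<integral>\<^sup>+t\<in>{0<..<L}. ennreal \<bar>q' T (y t)\<bar> * indicator T (y t) \<partial>lborel)" if T: "T \<in> \<T>" for T
  proof -
    define \<theta> where "\<theta> t = (indicator T (y t) :: real)" for t
    have "ennreal \<bar>\<theta> 0 * q T (y 0) + (\<Sum>t\<in>{t. y t \<in> frontier T} \<inter> {0<..<L}. \<epsilon> T t * q T (y t))\<bar> \<le> (\<integral>\<^sup>+t\<in>{0<..<L}. ennreal (\<bar>\<theta> t\<bar> * \<bar>q' T (y t)\<bar>) \<partial>lborel)"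
    proof (rule step_function_integration_by_parts[OF L(1)])
      show "finite {t. y t \<in> frontier T}" using T by (intro finite_subset[OF _ finX]) (auto simp: X_def)
      show "0 \<notin> {t. y t \<in> frontier T}" using x[OF T] by (simp add: y_def)
      show "L \<notin> {t. y t \<in> frontier T}" using L(2)[OF T] by (simp add: y_def frontier_def)
      show "\<exists>\<delta>>0. \<forall>s. \<bar>s - t\<bar> < \<delta> \<longrightarrow> \<theta> s = \<theta> t" if "t \<notin> {t. y t \<in> frontier T}" for t
        using loc_const[OF T] that by (simp add: \<theta>_def)
      show "\<exists>\<delta>>0. \<exists>c. \<forall>s. 0 < s \<and> s < \<delta> \<longrightarrow> \<theta> (t - s) = c \<and> \<theta> (t + s) = c + \<epsilon> T t" if t: "t \<in> {t. y t \<in> frontier T}" for t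
      proof -
        have yt: "y t \<in> frontier T" using t by simp
        obtain \<delta> where \<delta>: "\<delta> > 0" "\<And>s. 0 < s \<Longrightarrow> s < \<delta> \<Longrightarrow> y (t + \<sigma> T t * s) \<in> T \<and> y (t - \<sigma> T t * s) \<notin> T"
          using \<sigma>(2)[OF T yt] by blast
        have "\<theta> (t - s) = (1 - \<sigma> T t) / 2 \<and> \<theta> (t + s) = (1 - \<sigma> T t) / 2 + \<epsilon> T t" if "0 < s \<and> s < \<delta>" for s
          using \<sigma>(1)[OF T yt] \<delta>(2)[of s] that yt by (auto simp: \<theta>_def \<epsilon>_def)
        then show ?thesis using \<delta>(1) by blast
      qed
      show "((\<lambda>t. q T (y t)) has_real_derivative q' T (y t)) (at t)" for t using der[OF T] by (simp add: y_def)
      show "continuous_on UNIV (\<lambda>t. q' T (y t))"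
        by (rule continuous_on_compose2[OF cont[OF T] conty]) simp
      show "\<theta> L = 0" using L(2)[OF T] closure_subset[of T] by (auto simp: \<theta>_def y_def indicator_def)
      show "\<bar>\<theta> t\<bar> \<le> 1" for t by (simp add: \<theta>_def indicator_def)
    qed
    moreover have "(\<Sum>t\<in>{t. y t \<in> frontier T} \<inter> {0<..<L}. \<epsilon> T t * q T (y t)) = ?jumps T"
      using finX T by (intro sum.mono_neutral_left) (auto simp: X_def \<epsilon>_def)
    moreover have "ennreal (\<bar>\<theta> t\<bar> * \<bar>q' T (y t)\<bar>) = ennreal \<bar>q' T (y t)\<bar> * indicator T (y t)" for t
      by (simp add: \<theta>_def indicator_def)
    ultimately show ?thesis by (simp add: \<theta>_def y_def)
  qed
  define \<phi> where "\<phi> F z = (\<Sum>T\<in>sides F. \<bar>q T z - v F z\<bar>)" for F z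
  have \<phi>0: "0 \<le> \<phi> F z" for F z unfolding \<phi>_def by (intro sum_nonneg) auto
  have jump: "\<exists>F\<in>\<F>. y t \<in> F \<and> \<bar>?jump t\<bar> \<le> \<phi> F (y t)" if t: "t \<in> X" for t
  proof -
    obtain T1 where T1: "T1 \<in> \<T>" "y t \<in> frontier T1" using t by (auto simp: X_def)
    have gent: "generic \<A> (y t)" using gen by (simp add: y_def)
    obtain F where F: "F \<in> \<F>" "y t \<in> F" "F \<subseteq> frontier T1" using generic_frontier_face[OF gent T1] .
    have S_eq: "sides F = {T \<in> \<T>. y t \<in> frontier T}"
      using generic_frontier_face_subset[OF gent F(1,2)] F(2) by blast
    have sum_eq: "(\<Sum>T\<in>\<T>. \<epsilon> T t * q T (y t)) = (\<Sum>T | T \<in> \<T> \<and> y t \<in> frontier T. \<sigma> T t * q T (y t))"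
      using finite_elements by (intro sum.mono_neutral_cong_right) (auto simp: \<epsilon>_def)
    show ?thesis
    proof (cases "\<exists>T2\<in>\<T>. T2 \<noteq> T1 \<and> y t \<in> frontier T2")
      case True
      then obtain T2 where T2: "T2 \<in> \<T>" "T2 \<noteq> T1" "y t \<in> frontier T2" by blast
      have two: "{T \<in> \<T>. y t \<in> frontier T} = {T1, T2}"
        using generic_at_most_two_elements[OF gent F(1,2) T1(1) T2(1) T2(2)[symmetric] T1(2) T2(3)] T1 T2 by blast
      have "\<sigma> T1 t \<noteq> \<sigma> T2 t"
      proof
        assume eq: "\<sigma> T1 t = \<sigma> T2 t"
        obtain \<delta>1 where \<delta>1: "\<delta>1 > 0" "\<And>s. 0 < s \<Longrightarrow> s < \<delta>1 \<Longrightarrow> y (t + \<sigma> T1 t * s) \<in> T1" using \<sigma>(2)[OF T1] by blast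
        obtain \<delta>2 where \<delta>2: "\<delta>2 > 0" "\<And>s. 0 < s \<Longrightarrow> s < \<delta>2 \<Longrightarrow> y (t + \<sigma> T2 t * s) \<in> T2" using \<sigma>(2)[OF T2(1,3)] by blast
        define s where "s = min \<delta>1 \<delta>2 / 2"
        have s: "0 < s" "s < \<delta>1" "s < \<delta>2" using \<delta>1(1) \<delta>2(1) by (auto simp: s_def)
        have "y (t + \<sigma> T1 t * s) \<in> T1 \<inter> T2" using \<delta>1(2)[OF s(1,2)] \<delta>2(2)[OF s(1,3)] eq by simp
        then show False using disjoint_elements T1(1) T2(1,2) by (auto simp: disjoint_def)
      qed
      then have "\<sigma> T1 t = 1 \<and> \<sigma> T2 t = -1 \<or> \<sigma> T1 t = -1 \<and> \<sigma> T2 t = 1"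
        using \<sigma>(1)[OF T1] \<sigma>(1)[OF T2(1,3)] by auto
      then have "\<bar>?jump t\<bar> = \<bar>q T1 (y t) - q T2 (y t)\<bar>"
        unfolding sum_eq two using T2(2) by auto
      also have "\<dots> \<le> \<phi> F (y t)" unfolding \<phi>_def S_eq two using T2(2) by auto
      finally show ?thesis using F(1,2) by blast
    next
      case False
      then have one: "{T \<in> \<T>. y t \<in> frontier T} = {T1}" using T1 by blast
      have "F \<notin> interior_faces \<T> \<F>"
      proof
        assume "F \<in> interior_faces \<T> \<F>"
        then obtain T T' where "T \<in> \<T>" "T' \<in> \<T>" "T \<noteq> T'" "F \<subseteq> frontier T \<inter> frontier T'" by (auto simp: interior_faces_def)
        then have "T \<in> {T1}" "T' \<in> {T1}" "T \<noteq> T'" unfolding one[symmetric] using F(2) by blast+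
        then show False by simp
      qed
      then have "v F = (\<lambda>_. 0)" using v F(1) by blast
      then have "\<bar>?jump t\<bar> \<le> \<phi> F (y t)"
        unfolding sum_eq \<phi>_def S_eq one using \<sigma>(1)[OF T1] by auto
      then show ?thesis using F(1,2) by blast
    qed
  qed
  have finF: "finite {t. t \<in> {0<..<L} \<and> y t \<in> F}" if "F \<in> \<F>" for F
  proof -
    obtain a b where ab: "(a, b) \<in> \<A>" "affine hull F = {x. a \<bullet> x = b}" using face_hyperplane[OF \<open>F \<in> \<F>\<close>] .
    then have on: "fst (a, b) \<bullet> z = snd (a, b)" if "z \<in> F" for z using hull_subset[of F affine] that by auto
    have "{t. t \<in> {0<..<L} \<and> y t \<in> F} \<subseteq> {t. \<exists>p\<in>\<A>. fst p \<bullet> (x + t *\<^sub>R \<eta>) = snd p}"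
      unfolding y_def using on ab(1) by blast
    then show ?thesis using finite_hyperplane_hits[OF \<eta>] finite_subset by blast
  qed
  have jumps: "ennreal (\<Sum>t\<in>X \<inter> {0<..<L}. \<bar>?jump t\<bar>) \<le> (\<Sum>F\<in>\<F>. \<Sum>t | t \<in> {0<..<L} \<and> y t \<in> F. ennreal (\<phi> F (y t)))"
  proof -
    have "ennreal (\<Sum>t\<in>X \<inter> {0<..<L}. \<bar>?jump t\<bar>) = (\<Sum>t\<in>X \<inter> {0<..<L}. ennreal \<bar>?jump t\<bar>)"
      by (intro sum_ennreal[symmetric]) auto
    also have "\<dots> \<le> (\<Sum>t\<in>X \<inter> {0<..<L}. \<Sum>F\<in>\<F>. if y t \<in> F then ennreal (\<phi> F (y t)) else 0)"
    proof (intro sum_mono)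
      fix t assume "t \<in> X \<inter> {0<..<L}"
      then obtain F where F: "F \<in> \<F>" "y t \<in> F" "\<bar>?jump t\<bar> \<le> \<phi> F (y t)" using jump by blast
      have "ennreal \<bar>?jump t\<bar> \<le> (if y t \<in> F then ennreal (\<phi> F (y t)) else 0)"
        using F by (simp add: ennreal_leI)
      also have "\<dots> \<le> (\<Sum>F\<in>\<F>. if y t \<in> F then ennreal (\<phi> F (y t)) else 0)"
        using F(1) finite_faces by (intro member_le_sum) auto
      finally show "ennreal \<bar>?jump t\<bar> \<le> (\<Sum>F\<in>\<F>. if y t \<in> F then ennreal (\<phi> F (y t)) else 0)" .
    qed
    also have "\<dots> = (\<Sum>F\<in>\<F>. \<Sum>t\<in>X \<inter> {0<..<L}. if y t \<in> F then ennreal (\<phi> F (y t)) else 0)" by (rule sum.swap)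
    also have "\<dots> \<le> (\<Sum>F\<in>\<F>. \<Sum>t | t \<in> {0<..<L} \<and> y t \<in> F. ennreal (\<phi> F (y t)))"
    proof (intro sum_mono)
      fix F assume F: "F \<in> \<F>"
      have "(\<Sum>t\<in>X \<inter> {0<..<L}. if y t \<in> F then ennreal (\<phi> F (y t)) else 0) = (\<Sum>t | t \<in> X \<inter> {0<..<L} \<and> y t \<in> F. ennreal (\<phi> F (y t)))"
        using finX by (intro sum.inter_filter[symmetric]) simp
      also have "\<dots> \<le> (\<Sum>t | t \<in> {0<..<L} \<and> y t \<in> F. ennreal (\<phi> F (y t)))"
        by (intro sum_mono2 finF[OF F]) auto
      finally show "(\<Sum>t\<in>X \<inter> {0<..<L}. if y t \<in> F then ennreal (\<phi> F (y t)) else 0) \<le> (\<Sum>t | t \<in> {0<..<L} \<and> y t \<in> F. ennreal (\<phi> F (y t)))" .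
    qed
    finally show ?thesis .
  qed
  have total: "ennreal (\<Sum>T\<in>\<T>. indicator T x * q T x) \<le>
      (\<Sum>T\<in>\<T>. ennreal \<bar>indicator T x * q T x + ?jumps T\<bar>) + ennreal (\<Sum>t\<in>X \<inter> {0<..<L}. \<bar>?jump t\<bar>)"
  proof -
    have "(\<Sum>T\<in>\<T>. indicator T x * q T x) = (\<Sum>T\<in>\<T>. indicator T x * q T x + ?jumps T) - (\<Sum>t\<in>X \<inter> {0<..<L}. \<Sum>T\<in>\<T>. \<epsilon> T t * q T (y t))"
      by (subst sum.swap[of _ \<T>]) (simp add: sum.distrib)
    also have "\<dots> \<le> (\<Sum>T\<in>\<T>. \<bar>indicator T x * q T x + ?jumps T\<bar>) + (\<Sum>t\<in>X \<inter> {0<..<L}. \<bar>?jump t\<bar>)"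
      using sum_abs[of "\<lambda>T. indicator T x * q T x + ?jumps T" \<T>]
        sum_abs[of "\<lambda>t. \<Sum>T\<in>\<T>. \<epsilon> T t * q T (y t)" "X \<inter> {0<..<L}"] by linarith
    finally have "ennreal (\<Sum>T\<in>\<T>. indicator T x * q T x) \<le> ennreal ((\<Sum>T\<in>\<T>. \<bar>indicator T x * q T x + ?jumps T\<bar>) + (\<Sum>t\<in>X \<inter> {0<..<L}. \<bar>?jump t\<bar>))"
      by (rule ennreal_leI)
    also have "\<dots> = ennreal (\<Sum>T\<in>\<T>. \<bar>indicator T x * q T x + ?jumps T\<bar>) + ennreal (\<Sum>t\<in>X \<inter> {0<..<L}. \<bar>?jump t\<bar>)"
      by (intro ennreal_plus sum_nonneg) auto
    also have "ennreal (\<Sum>T\<in>\<T>. \<bar>indicator T x * q T x + ?jumps T\<bar>) = (\<Sum>T\<in>\<T>. ennreal \<bar>indicator T x * q T x + ?jumps T\<bar>)"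
      by (intro sum_ennreal[symmetric]) auto
    finally show ?thesis .
  qed
  have parts: "(\<Sum>T\<in>\<T>. ennreal \<bar>indicator T x * q T x + ?jumps T\<bar>) \<le>
      (\<Sum>T\<in>\<T>. \<integral>\<^sup>+t\<in>{0<..<L}. ennreal \<bar>q' T (y t)\<bar> * indicator T (y t) \<partial>lborel)"
    by (intro sum_mono part)
  show ?thesis
    using order_trans[OF total add_mono[OF parts jumps]] unfolding y_def \<phi>_def .
qed

text \<open>Integration of the ray bound over all starting points: the integrals along the rays become volume
  integrals by translation, and the crossings of a face are integrated over its prism.\<close>

theorem broken_poincare:
  fixes q q' :: "'a set \<Rightarrow> 'a \<Rightarrow> real" and v :: "'a set \<Rightarrow> 'a \<Rightarrow> real"
  assumes \<eta>: "transversal \<A> \<eta>" and L: "0 < L" "\<And>x. x \<in> closure \<Omega> \<Longrightarrow> x + L *\<^sub>R \<eta> \<notin> closure \<Omega>"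
    and der: "\<And>T x t. T \<in> \<T> \<Longrightarrow> ((\<lambda>t. q T (x + t *\<^sub>R \<eta>)) has_real_derivative q' T (x + t *\<^sub>R \<eta>)) (at t)"
    and cont: "\<And>T. T \<in> \<T> \<Longrightarrow> continuous_on UNIV (q T)" "\<And>T. T \<in> \<T> \<Longrightarrow> continuous_on UNIV (q' T)" "\<And>F. F \<in> \<F> \<Longrightarrow> continuous_on UNIV (v F)"
    and nonneg: "\<And>T x. T \<in> \<T> \<Longrightarrow> 0 \<le> q T x"
    and v: "\<And>F. F \<in> \<F> \<Longrightarrow> F \<notin> interior_faces \<T> \<F> \<Longrightarrow> v F = (\<lambda>_. 0)"
  shows "(\<Sum>T\<in>\<T>. \<integral>\<^sup>+x\<in>T. ennreal (q T x) \<partial>lborel) \<le>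
    ennreal L * ((\<Sum>T\<in>\<T>. \<integral>\<^sup>+x\<in>T. ennreal \<bar>q' T x\<bar> \<partial>lborel) +
      (\<Sum>F\<in>\<F>. \<Sum>T\<in>sides F. \<integral>\<^sup>+z\<in>F. ennreal \<bar>q T z - v F z\<bar> \<partial>face_measure F))"
proof -
  have [measurable]: "q T \<in> borel_measurable borel" if "T \<in> \<T>" for T
    using cont(1)[OF that] by (rule borel_measurable_continuous_onI)
  have [measurable]: "q' T \<in> borel_measurable borel" if "T \<in> \<T>" for T
    using cont(2)[OF that] by (rule borel_measurable_continuous_onI)
  have [measurable]: "v F \<in> borel_measurable borel" if "F \<in> \<F>" for F
    using cont(3)[OF that] by (rule borel_measurable_continuous_onI)
  have [measurable]: "T \<in> sets borel" if "T \<in> \<T>" for T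
    using element_open[OF that] by (rule borel_open)
  define \<phi> where "\<phi> F z = (\<Sum>T\<in>sides F. \<bar>q T z - v F z\<bar>)" for F z
  have \<phi> [measurable]: "\<phi> F \<in> borel_measurable borel" if "F \<in> \<F>" for F
    unfolding \<phi>_def using that by (intro borel_measurable_sum) auto
  define I where "I T x = (\<integral>\<^sup>+t\<in>{0<..<L}. ennreal \<bar>q' T (x + t *\<^sub>R \<eta>)\<bar> * indicator T (x + t *\<^sub>R \<eta>) \<partial>lborel)" for T x
  define J where "J F x = (\<Sum>t | t \<in> {0<..<L} \<and> x + t *\<^sub>R \<eta> \<in> F. ennreal (\<phi> F (x + t *\<^sub>R \<eta>)))" for F x
  have I_meas [measurable]: "I T \<in> borel_measurable borel" if [measurable]: "T \<in> \<T>" for T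
    unfolding I_def by measurable
  have int_I: "(\<integral>\<^sup>+x. I T x \<partial>lborel) = ennreal L * (\<integral>\<^sup>+x\<in>T. ennreal \<bar>q' T x\<bar> \<partial>lborel)" if T [measurable]: "T \<in> \<T>" for T
  proof -
    define g where "g x = ennreal \<bar>q' T x\<bar> * indicator T x" for x
    have [measurable]: "g \<in> borel_measurable borel" unfolding g_def by measurable
    have "(\<integral>\<^sup>+x. I T x \<partial>lborel) = (\<integral>\<^sup>+x. \<integral>\<^sup>+t. g (x + t *\<^sub>R \<eta>) * indicator {0<..<L} t \<partial>lborel \<partial>lborel)"
      by (simp add: I_def g_def)
    also have "\<dots> = (\<integral>\<^sup>+t. \<integral>\<^sup>+x. g (x + t *\<^sub>R \<eta>) * indicator {0<..<L} t \<partial>lborel \<partial>lborel)"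
      by (rule lborel_pair.Fubini') measurable
    also have "\<dots> = (\<integral>\<^sup>+t. (\<integral>\<^sup>+x. g x \<partial>lborel) * indicator {0<..<L} t \<partial>lborel)"
    proof (intro nn_integral_cong)
      fix t
      show "(\<integral>\<^sup>+x. g (x + t *\<^sub>R \<eta>) * indicator {0<..<L} t \<partial>lborel) = (\<integral>\<^sup>+x. g x \<partial>lborel) * indicator {0<..<L} t"
        using nn_integral_lborel_translate[of g "t *\<^sub>R \<eta>"] by (simp add: nn_integral_multc add.commute)
    qed
    also have "\<dots> = (\<integral>\<^sup>+x. g x \<partial>lborel) * ennreal L"
      using L(1) by (simp add: nn_integral_cmult_indicator)
    finally show ?thesis by (simp add: g_def mult.commute)
  qed
  have J_meas: "J F \<in> borel_measurable borel \<and> (\<integral>\<^sup>+x. J F x \<partial>lborel) \<le> ennreal L * (\<integral>\<^sup>+z\<in>F. ennreal (\<phi> F z) \<partial>face_measure F)" if F: "F \<in> \<F>" for F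
  proof -
    have ff: "flat_face F" and dimF: "aff_dim F = int DIM('a) - 1" using face_flat[OF F] by (auto simp: flat_face_def)
    have [measurable]: "F \<in> sets borel" by (rule flat_face_borel[OF ff])
    obtain \<nu> where \<nu>: "unit_normal F \<nu>" using unit_normal_exists[OF dimF] .
    obtain a where a: "a \<in> F" using nonempty_face[OF dimF \<nu>] by blast
    have hull: "affine hull F = {x. (x - a) \<bullet> \<nu> = 0}" by (rule affine_hull_eq_hyperplane[OF dimF \<nu> a])
    obtain n b where nb: "(n, b) \<in> \<A>" "affine hull F = {x. n \<bullet> x = b}" using face_hyperplane[OF F] .
    have nz: "\<eta> \<bullet> \<nu> \<noteq> 0"
    proof
      assume "\<eta> \<bullet> \<nu> = 0"
      then have "a + \<eta> \<in> affine hull F" unfolding hull by simp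
      then have "n \<bullet> \<eta> = 0" using nb(2) hull_inc[OF a, of affine] by (simp add: inner_add_right)
      then show False using \<eta> nb(1) by (auto simp: transversal_def)
    qed
    have \<eta>1: "norm \<eta> = 1" using \<eta> by (simp add: transversal_def)
    define \<tau> where "\<tau> x = ((a - x) \<bullet> \<nu>) / (\<eta> \<bullet> \<nu>)" for x
    have J_eq: "J F x = ennreal (\<phi> F (x + \<tau> x *\<^sub>R \<eta>)) * indicator F (x + \<tau> x *\<^sub>R \<eta>) * indicator {0<..<L} (\<tau> x)" for x
    proof -
      have only: "t = \<tau> x" if "x + t *\<^sub>R \<eta> \<in> F" for t
      proof -
        have "(x + t *\<^sub>R \<eta> - a) \<bullet> \<nu> = 0" using that hull hull_inc[of _ F affine] by blast
        then show ?thesis using nz by (simp add: \<tau>_def inner_diff_left inner_add_left field_simps)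
      qed
      show ?thesis
      proof (cases "x + \<tau> x *\<^sub>R \<eta> \<in> F \<and> \<tau> x \<in> {0<..<L}")
        case True
        then have "{t. t \<in> {0<..<L} \<and> x + t *\<^sub>R \<eta> \<in> F} = {\<tau> x}" using only by blast
        then show ?thesis using True by (simp add: J_def)
      next
        case False
        then have none: "{t. t \<in> {0<..<L} \<and> x + t *\<^sub>R \<eta> \<in> F} = {}" using only by blast
        show ?thesis using False unfolding J_def none by (cases "x + \<tau> x *\<^sub>R \<eta> \<in> F") auto
      qed
    qed
    have "J F \<in> borel_measurable borel"
      using F unfolding J_eq[abs_def] \<tau>_def by measurable
    moreover have "(\<integral>\<^sup>+x. J F x \<partial>lborel) \<le> ennreal L * (\<integral>\<^sup>+z\<in>F. ennreal (\<phi> F z) \<partial>face_measure F)"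
      unfolding J_eq \<tau>_def using F by (intro nn_integral_prism[OF ff \<nu> a \<eta>1 nz L(1)]) measurable
    ultimately show ?thesis ..
  qed
  have "AE x in lborel. \<forall>p\<in>\<A>. x \<notin> {x. fst p \<bullet> x = snd p}"
    using finite_arrangement normal_nonzero
    by (intro AE_finite_allI AE_not_in_closed_negligible closed_hyperplane negligible_hyperplane) auto
  then have AE_le: "AE x in lborel. ennreal (\<Sum>T\<in>\<T>. indicator T x * q T x) \<le> (\<Sum>T\<in>\<T>. I T x) + (\<Sum>F\<in>\<F>. J F x)"
    using AE_generic_line[OF \<eta>]
  proof eventually_elim
    case (elim x)
    show ?case
    proof (cases "x \<in> \<Union>\<T>")
      case True
      then have x: "x \<in> closure \<Omega>" using element_subset_closure_domain by blast
      show ?thesis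
        unfolding I_def J_def \<phi>_def
      proof (rule piecewise_ray_bound[OF \<eta> _ _ L(1) _ der cont(2) v])
        show "generic \<A> (x + t *\<^sub>R \<eta>)" for t using elim(2) by blast
        show "x \<notin> frontier T" if "T \<in> \<T>" for T using skeleton_on_hyperplanes[OF that] elim(1) by blast
        show "x + L *\<^sub>R \<eta> \<notin> closure T" if "T \<in> \<T>" for T using L(2)[OF x] closure_domain that by blast
      qed
    next
      case False
      then have "(\<Sum>T\<in>\<T>. indicator T x * q T x) = 0" by (intro sum.neutral) (auto simp: indicator_def)
      then show ?thesis by simp
    qed
  qed
  have "(\<Sum>T\<in>\<T>. \<integral>\<^sup>+x\<in>T. ennreal (q T x) \<partial>lborel) = (\<integral>\<^sup>+x. (\<Sum>T\<in>\<T>. ennreal (q T x) * indicator T x) \<partial>lborel)"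
    by (intro nn_integral_sum[symmetric]) measurable
  also have "\<dots> = (\<integral>\<^sup>+x. ennreal (\<Sum>T\<in>\<T>. indicator T x * q T x) \<partial>lborel)"
  proof (intro nn_integral_cong)
    fix x
    have "ennreal (\<Sum>T\<in>\<T>. indicator T x * q T x) = (\<Sum>T\<in>\<T>. ennreal (indicator T x * q T x))"
      using nonneg by (intro sum_ennreal[symmetric]) auto
    also have "\<dots> = (\<Sum>T\<in>\<T>. ennreal (q T x) * indicator T x)"
      by (intro sum.cong refl) (auto simp: indicator_def)
    finally show "(\<Sum>T\<in>\<T>. ennreal (q T x) * indicator T x) = ennreal (\<Sum>T\<in>\<T>. indicator T x * q T x)" ..
  qed
  also have "\<dots> \<le> (\<integral>\<^sup>+x. (\<Sum>T\<in>\<T>. I T x) + (\<Sum>F\<in>\<F>. J F x) \<partial>lborel)"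
    using AE_le by (rule nn_integral_mono_AE)
  also have "\<dots> = (\<integral>\<^sup>+x. (\<Sum>T\<in>\<T>. I T x) \<partial>lborel) + (\<integral>\<^sup>+x. (\<Sum>F\<in>\<F>. J F x) \<partial>lborel)"
    using J_meas I_meas by (intro nn_integral_add borel_measurable_sum) auto
  also have "(\<integral>\<^sup>+x. (\<Sum>T\<in>\<T>. I T x) \<partial>lborel) = (\<Sum>T\<in>\<T>. ennreal L * (\<integral>\<^sup>+x\<in>T. ennreal \<bar>q' T x\<bar> \<partial>lborel))"
    using I_meas by (subst nn_integral_sum) (auto simp: int_I)
  also have "(\<integral>\<^sup>+x. (\<Sum>F\<in>\<F>. J F x) \<partial>lborel) = (\<Sum>F\<in>\<F>. \<integral>\<^sup>+x. J F x \<partial>lborel)"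
    using J_meas by (intro nn_integral_sum) auto
  also have "\<dots> \<le> (\<Sum>F\<in>\<F>. ennreal L * (\<integral>\<^sup>+z\<in>F. ennreal (\<phi> F z) \<partial>face_measure F))"
    using J_meas by (intro sum_mono) auto
  also have "\<dots> = (\<Sum>F\<in>\<F>. ennreal L * (\<Sum>T\<in>sides F. \<integral>\<^sup>+z\<in>F. ennreal \<bar>q T z - v F z\<bar> \<partial>face_measure F))"
  proof (intro sum.cong refl arg_cong[where f = "\<lambda>u. ennreal L * u"])
    fix F assume F: "F \<in> \<F>"
    have ff: "flat_face F" using face_flat[OF F] .
    have [measurable]: "F \<in> sets borel" by (rule flat_face_borel[OF ff])
    have [measurable_cong]: "sets (face_measure F) = sets borel" by (simp add: face_measure_def)
    have "ennreal (\<phi> F z) * indicator F z = (\<Sum>T\<in>sides F. ennreal \<bar>q T z - v F z\<bar> * indicator F z)" for z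
      unfolding \<phi>_def sum_distrib_right[symmetric] by (subst sum_ennreal) auto
    then have "(\<integral>\<^sup>+z\<in>F. ennreal (\<phi> F z) \<partial>face_measure F) = (\<integral>\<^sup>+z. (\<Sum>T\<in>sides F. ennreal \<bar>q T z - v F z\<bar> * indicator F z) \<partial>face_measure F)"
      by simp
    also have "\<dots> = (\<Sum>T\<in>sides F. \<integral>\<^sup>+z\<in>F. ennreal \<bar>q T z - v F z\<bar> \<partial>face_measure F)"
      using F by (intro nn_integral_sum) auto
    finally show "(\<integral>\<^sup>+z\<in>F. ennreal (\<phi> F z) \<partial>face_measure F) = (\<Sum>T\<in>sides F. \<integral>\<^sup>+z\<in>F. ennreal \<bar>q T z - v F z\<bar> \<partial>face_measure F)" .
  qed
  finally show ?thesis by (simp add: sum_distrib_left distrib_left add_left_mono)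
qed

end


section \<open>Inner products on elements and faces\<close>

abbreviation elem_normsq :: "'a::euclidean_space set \<Rightarrow> ('a \<Rightarrow> 'b::real_inner) \<Rightarrow> real" where
  "elem_normsq T f \<equiv> elem_inner T f f"

abbreviation face_normsq :: "'a::euclidean_space set \<Rightarrow> ('a \<Rightarrow> real) \<Rightarrow> real" where
  "face_normsq F f \<equiv> face_inner F f f"

lemma set_integrable_bounded_measurable:
  fixes f :: "'a \<Rightarrow> real"
  assumes "A \<in> sets M" "emeasure M A < \<infinity>" "f \<in> borel_measurable M" "\<And>x. x \<in> A \<Longrightarrow> \<bar>f x\<bar> \<le> B"
  shows "set_integrable M A f"
  unfolding set_integrable_def
  using assms by (intro integrableI_bounded_set_indicator[where B = B]) (auto intro!: AE_I2)

lemma continuous_bounded_on_bounded: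
  fixes f :: "'a::euclidean_space \<Rightarrow> real"
  assumes "continuous_on UNIV f" "bounded A"
  shows "\<exists>B. \<forall>x\<in>A. \<bar>f x\<bar> \<le> B"
proof -
  have "compact (f ` closure A)"
    using assms by (intro compact_continuous_image) (auto intro: continuous_on_subset)
  then obtain B where "\<And>y. y \<in> f ` closure A \<Longrightarrow> norm y \<le> B"
    using compact_imp_bounded bounded_iff by metis
  then show ?thesis using closure_subset[of A] by (intro exI[of _ B]) auto
qed

lemma set_integrable_element:
  fixes f :: "'a::euclidean_space \<Rightarrow> real"
  assumes "open T" "bounded T" "continuous_on UNIV f"
  shows "set_integrable lborel T f"
proof -
  obtain B where "\<forall>x\<in>T. \<bar>f x\<bar> \<le> B" using continuous_bounded_on_bounded[OF assms(3,2)] ..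
  then show ?thesis
    using assms emeasure_bounded_finite[OF assms(2)] borel_measurable_continuous_onI[OF assms(3)]
    by (intro set_integrable_bounded_measurable) (auto simp: less_top)
qed

lemma set_integrable_face:
  fixes f :: "'a::euclidean_space \<Rightarrow> real"
  assumes F: "flat_face F" and f: "f \<in> borel_measurable borel" "\<And>x. x \<in> F \<Longrightarrow> \<bar>f x\<bar> \<le> B"
  shows "set_integrable (face_measure F) F f"
proof (rule set_integrable_bounded_measurable[OF _ _ _ f(2)])
  show "F \<in> sets (face_measure F)" using flat_face_borel[OF F] by (simp add: face_measure_def)
  show "emeasure (face_measure F) F < \<infinity>"
    using F flat_face_borel[OF F] by (intro emeasure_face_measure_finite) (auto simp: flat_face_def)
  show "f \<in> borel_measurable (face_measure F)" using f(1) by (simp add: face_measure_def)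
qed

lemma set_integrable_face_continuous:
  fixes f :: "'a::euclidean_space \<Rightarrow> real"
  assumes F: "flat_face F" and f: "continuous_on UNIV f"
  shows "set_integrable (face_measure F) F f"
proof -
  have "bounded F" using F by (simp add: flat_face_def)
  then obtain B where "\<forall>x\<in>F. \<bar>f x\<bar> \<le> B"
    using continuous_bounded_on_bounded[OF f] by blast
  then show ?thesis by (intro set_integrable_face[OF F] borel_measurable_continuous_onI[OF f]) blast
qed

lemma nn_set_integral_eq_set_integral:
  fixes f :: "'a \<Rightarrow> real"
  assumes "set_integrable M A f" "\<And>x. 0 \<le> f x"
  shows "(\<integral>\<^sup>+x\<in>A. ennreal (f x) \<partial>M) = ennreal (LINT x:A|M. f x)"
proof -
  have "(\<integral>\<^sup>+x\<in>A. ennreal (f x) \<partial>M) = (\<integral>\<^sup>+x. ennreal (indicator A x *\<^sub>R f x) \<partial>M)"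
    by (intro nn_integral_cong) (auto simp: indicator_def)
  also have "\<dots> = ennreal (LINT x:A|M. f x)"
    using assms unfolding set_lebesgue_integral_def set_integrable_def
    by (intro nn_integral_eq_integral) auto
  finally show ?thesis .
qed

lemma set_integral_mono_nonneg:
  fixes f :: "'a \<Rightarrow> real"
  assumes "set_integrable M A g" "\<And>x. x \<in> A \<Longrightarrow> 0 \<le> f x" "\<And>x. x \<in> A \<Longrightarrow> f x \<le> g x"
  shows "(LINT x:A|M. f x) \<le> (LINT x:A|M. g x)"
proof (cases "set_integrable M A f")
  case True
  then show ?thesis using assms by (intro set_integral_mono)
next
  case False
  then have "(LINT x:A|M. f x) = 0"
    unfolding set_integrable_def set_lebesgue_integral_def by (rule not_integrable_integral_eq)
  also have "0 \<le> (LINT x:A|M. g x)"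
    unfolding set_lebesgue_integral_def using assms
    by (intro integral_nonneg_AE AE_I2) (force simp: indicator_def intro: order_trans)
  finally show ?thesis .
qed

lemma set_integral_cmult:
  fixes f :: "'a \<Rightarrow> real"
  shows "(LINT x:A|M. c * f x) = c * (LINT x:A|M. f x)"
  by (simp add: set_lebesgue_integral_def mult.left_commute)

lemma elem_inner_lincomb_left:
  fixes f g k :: "'a::euclidean_space \<Rightarrow> 'b::real_inner"
  assumes "open T" "bounded T" "continuous_on UNIV f" "continuous_on UNIV g" "continuous_on UNIV k"
  shows "elem_inner T (\<lambda>x. a *\<^sub>R f x + b *\<^sub>R g x) k = a * elem_inner T f k + b * elem_inner T g k"
proof -
  have "set_integrable lborel T (\<lambda>x. a * (f x \<bullet> k x))" "set_integrable lborel T (\<lambda>x. b * (g x \<bullet> k x))"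
    using assms by (auto intro!: set_integrable_element continuous_intros)
  then show ?thesis
    unfolding elem_inner_def by (simp add: inner_add_left set_integral_add set_integral_cmult)
qed

lemma elem_inner_commute: "elem_inner T f g = elem_inner T g f"
  by (simp add: elem_inner_def inner_commute)

lemma elem_inner_nonneg: "0 \<le> elem_normsq T f"
  unfolding elem_inner_def set_lebesgue_integral_def by (intro integral_nonneg_AE) auto

lemma elem_norm_sq: "(elem_norm T f)\<^sup>2 = elem_normsq T f"
  by (simp add: elem_norm_def elem_inner_nonneg)

lemma elem_inner_eq_zero:
  fixes f :: "'a::euclidean_space \<Rightarrow> 'b::real_inner"
  assumes T: "open T" "bounded T" and f: "continuous_on UNIV f" and 0: "elem_normsq T f = 0" and x: "x \<in> T"
  shows "f x = 0"
proof (rule ccontr)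
  assume "f x \<noteq> 0"
  define U where "U = T \<inter> {y. 0 < f y \<bullet> f y}"
  have "open {y. 0 < f y \<bullet> f y}" using f by (intro open_Collect_less continuous_intros)
  then have U: "open U" "x \<in> U" using T(1) x \<open>f x \<noteq> 0\<close> by (auto simp: U_def)
  have [measurable]: "T \<in> sets borel" "(\<lambda>y. f y \<bullet> f y) \<in> borel_measurable borel"
    using T(1) f by (auto intro!: borel_measurable_continuous_onI continuous_intros)
  have int: "set_integrable lborel T (\<lambda>y. f y \<bullet> f y)"
    using f by (intro set_integrable_element[OF T] continuous_intros)
  have "(\<integral>\<^sup>+y\<in>T. ennreal (f y \<bullet> f y) \<partial>lborel) = 0"
    using 0 nn_set_integral_eq_set_integral[OF int] by (simp add: elem_inner_def)
  then have "AE y in lborel. ennreal (f y \<bullet> f y) * indicator T y = 0"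
    by (subst (asm) nn_integral_0_iff_AE) auto
  then have "AE y in lborel. y \<notin> U"
    by eventually_elim (auto simp: U_def indicator_def)
  then have "emeasure lborel U = 0" using AE_iff_measurable[of U lborel "\<lambda>y. y \<notin> U"] U(1) by simp
  obtain e where "e > 0" "ball x e \<subseteq> U" using U openE by blast
  then have "emeasure lborel (ball x e) \<le> emeasure lborel U" using U(1) by (intro emeasure_mono) auto
  then have "measure lborel (ball x e) = 0" using \<open>emeasure lborel U = 0\<close> by (simp add: measure_def)
  then show False using content_ball_pos[OF \<open>e > 0\<close>, of x] by simp
qed

lemma face_inner_lincomb_left:
  assumes "set_integrable (face_measure F) F (\<lambda>x. f x * k x)" "set_integrable (face_measure F) F (\<lambda>x. g x * k x)"
  shows "face_inner F (\<lambda>x. a * f x + b * g x) k = a * face_inner F f k + b * face_inner F g k"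
proof -
  have "set_integrable (face_measure F) F (\<lambda>x. a * (f x * k x))" "set_integrable (face_measure F) F (\<lambda>x. b * (g x * k x))"
    using assms by auto
  then show ?thesis
    unfolding face_inner_def by (simp add: distrib_right set_integral_add set_integral_cmult mult.assoc)
qed

lemma face_inner_lincomb_left_continuous:
  assumes "flat_face F" "continuous_on UNIV f" "continuous_on UNIV g" "continuous_on UNIV k"
  shows "face_inner F (\<lambda>x. a * f x + b * g x) k = a * face_inner F f k + b * face_inner F g k"
  by (rule face_inner_lincomb_left; intro set_integrable_face_continuous continuous_on_mult assms)

lemma face_inner_commute: "face_inner F f g = face_inner F g f"
  by (simp add: face_inner_def mult.commute)

lemma face_inner_nonneg: "0 \<le> face_normsq F f"
  unfolding face_inner_def set_lebesgue_integral_def by (intro integral_nonneg_AE) auto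

lemma bdry_norm_sq: "(bdry_norm \<G> v)\<^sup>2 = bdry_inner \<G> v v"
  unfolding bdry_norm_def bdry_inner_def by (intro real_sqrt_pow2 sum_nonneg face_inner_nonneg)

lemma face_inner_square_le:
  assumes F: "flat_face F" and g: "continuous_on UNIV g1" "continuous_on UNIV g2"
    and le: "\<And>x. x \<in> F \<Longrightarrow> (f x)\<^sup>2 \<le> a * (g1 x)\<^sup>2 + b * (g2 x)\<^sup>2"
  shows "face_normsq F f \<le> a * face_normsq F g1 + b * face_normsq F g2"
proof -
  have int: "set_integrable (face_measure F) F (\<lambda>x. a * (g1 x)\<^sup>2)" "set_integrable (face_measure F) F (\<lambda>x. b * (g2 x)\<^sup>2)"
    using g by (auto intro!: set_integrable_face_continuous[OF F] continuous_intros)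
  then have "set_integrable (face_measure F) F (\<lambda>x. a * (g1 x)\<^sup>2 + b * (g2 x)\<^sup>2)" by (rule set_integral_add)
  then have "(LINT x:F|face_measure F. (f x)\<^sup>2) \<le> (LINT x:F|face_measure F. a * (g1 x)\<^sup>2 + b * (g2 x)\<^sup>2)"
    using le by (intro set_integral_mono_nonneg) auto
  also have "\<dots> = a * (LINT x:F|face_measure F. (g1 x)\<^sup>2) + b * (LINT x:F|face_measure F. (g2 x)\<^sup>2)"
    using set_integral_add(2)[OF int] by (simp add: set_integral_cmult)
  finally show ?thesis by (simp add: face_inner_def power2_eq_square)
qed

text \<open>Otherwise the slab over a relatively open part of the face would be negligible.\<close>

lemma face_measure_open_pos:
  fixes F :: "'a::euclidean_space set"
  assumes F: "flat_face F" and z: "z \<in> F" and U: "open U" "z \<in> U"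
  shows "emeasure (face_measure F) (F \<inter> U) \<noteq> 0"
proof
  assume null: "emeasure (face_measure F) (F \<inter> U) = 0"
  have dimF: "aff_dim F = int DIM('a) - 1" using F by (simp add: flat_face_def)
  obtain \<nu> where \<nu>: "unit_normal F \<nu>" using unit_normal_exists[OF dimF] .
  have hull: "affine hull F = {x. (x - z) \<bullet> \<nu> = 0}" by (rule affine_hull_eq_hyperplane[OF dimF \<nu> z])
  obtain V where V: "open V" "F = affine hull F \<inter> V" using F by (auto simp: flat_face_def openin_open)
  define W where "W = V \<inter> U"
  have W: "open W" "z \<in> W" using V U z by (auto simp: W_def)
  note [measurable_cong] = sets_face_measure[OF dimF \<nu>]
  have [measurable]: "F \<in> sets borel" "U \<in> sets borel" "W \<in> sets borel" using flat_face_borel[OF F] U W by auto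
  have "(\<integral>\<^sup>+x. indicator W x \<partial>face_measure F) = (\<integral>\<^sup>+x. indicator (F \<inter> U) x \<partial>face_measure F)"
  proof (rule nn_integral_cong_AE, use AE_face_measure_hyperplane[OF dimF \<nu> z] in eventually_elim)
    fix x assume "(x - z) \<bullet> \<nu> = 0"
    then have "x \<in> affine hull F" using hull by simp
    then have "x \<in> W \<longleftrightarrow> x \<in> F \<inter> U" using V(2) by (auto simp: W_def)
    then show "indicator W x = (indicator (F \<inter> U) x :: ennreal)" by (simp add: indicator_def)
  qed
  also have "\<dots> = 0" using null by (subst nn_integral_indicator) (auto simp: sets_face_measure[OF dimF \<nu>])
  finally have "(\<integral>\<^sup>+x. indicator W (x - ((x - z) \<bullet> \<nu>) *\<^sub>R \<nu>) * indicator {0<..<1} ((x - z) \<bullet> \<nu>) \<partial>lborel) = 0"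
    using nn_integral_face_slab[OF dimF \<nu> _ z, of "indicator W"] by simp
  then have ae: "AE x in lborel. indicator W (x - ((x - z) \<bullet> \<nu>) *\<^sub>R \<nu>) * indicator {0<..<1} ((x - z) \<bullet> \<nu>) = (0::ennreal)"
    by (subst (asm) nn_integral_0_iff_AE) auto
  define S where "S = (\<lambda>x. x - ((x - z) \<bullet> \<nu>) *\<^sub>R \<nu>) -` W \<inter> {x. 0 < (x - z) \<bullet> \<nu>} \<inter> {x. (x - z) \<bullet> \<nu> < 1}"
  have "open ((\<lambda>x. x - ((x - z) \<bullet> \<nu>) *\<^sub>R \<nu>) -` W)"
    using W(1) by (intro continuous_on_open_vimage[THEN iffD1, rule_format, of UNIV, simplified] continuous_intros) auto
  moreover have "open {x. 0 < (x - z) \<bullet> \<nu>}" "open {x. (x - z) \<bullet> \<nu> < 1}"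
    by (intro open_Collect_less continuous_intros)+
  ultimately have S: "open S" by (auto simp: S_def)
  have "z + (1/2) *\<^sub>R \<nu> \<in> S" using W(2) norm_unit_normal[OF dimF \<nu>] by (simp add: S_def)
  then obtain e where e: "e > 0" "ball (z + (1/2) *\<^sub>R \<nu>) e \<subseteq> S" using S openE by blast
  have "AE x in lborel. x \<notin> S" using ae by eventually_elim (auto simp: S_def indicator_def)
  then have "emeasure lborel S = 0" using AE_iff_measurable[of S lborel "\<lambda>y. y \<notin> S"] S by simp
  moreover have "emeasure lborel (ball (z + (1/2) *\<^sub>R \<nu>) e) \<le> emeasure lborel S" using e(2) S by (intro emeasure_mono) auto
  ultimately have "measure lborel (ball (z + (1/2) *\<^sub>R \<nu>) e) = 0" by (simp add: measure_def)
  then show False using content_ball_pos[OF e(1), of "z + (1/2) *\<^sub>R \<nu>"] by simp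
qed

lemma face_inner_eq_zero:
  fixes F :: "'a::euclidean_space set"
  assumes F: "flat_face F" and f: "continuous_on UNIV f" and 0: "face_normsq F f = 0" and x: "x \<in> F"
  shows "f x = 0"
proof (rule ccontr)
  assume "f x \<noteq> 0"
  define U where "U = {y. 0 < f y * f y}"
  have U: "open U" unfolding U_def using f by (intro open_Collect_less continuous_intros)
  have xU: "x \<in> U" using \<open>f x \<noteq> 0\<close> by (auto simp: U_def zero_less_mult_iff)
  have int: "set_integrable (face_measure F) F (\<lambda>y. f y * f y)"
    using f by (intro set_integrable_face_continuous[OF F] continuous_intros)
  have [measurable]: "F \<in> sets borel" "f \<in> borel_measurable borel"
    using flat_face_borel[OF F] borel_measurable_continuous_onI[OF f] by auto
  have [measurable_cong]: "sets (face_measure F) = sets borel" by (simp add: face_measure_def)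
  have "(\<integral>\<^sup>+y\<in>F. ennreal (f y * f y) \<partial>face_measure F) = 0"
    using 0 nn_set_integral_eq_set_integral[OF int] by (simp add: face_inner_def)
  then have "AE y in face_measure F. ennreal (f y * f y) * indicator F y = 0"
    by (subst (asm) nn_integral_0_iff_AE) auto
  then have "AE y in face_measure F. y \<notin> F \<inter> U"
    by eventually_elim (auto simp: U_def indicator_def)
  moreover have "F \<inter> U \<in> sets (face_measure F)" using U by (simp add: face_measure_def)
  moreover have "{y \<in> space (face_measure F). \<not> y \<notin> F \<inter> U} = F \<inter> U" by (auto simp: face_measure_def)
  ultimately have "emeasure (face_measure F) (F \<inter> U) = 0"
    using AE_iff_measurable[of "F \<inter> U" "face_measure F" "\<lambda>y. y \<notin> F \<inter> U"] by blast
  then show False using face_measure_open_pos[OF F x U xU] by simp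
qed

section \<open>Polynomials and projections on faces\<close>

lemma continuous_on_face_polys: "f \<in> face_polys F k \<Longrightarrow> continuous_on S f"
  unfolding face_polys_def by (rule continuous_on_polys_in)

lemma subspace_face_polys: "subspace (face_polys F k)"
  unfolding face_polys_def by (rule subspace_polys_in)

text \<open>The value at any point is that at its projection to the hyperplane, which is joined by a segment to a
  point of the face.\<close>

lemma face_polys_eq_zero:
  fixes F :: "'a::euclidean_space set"
  assumes F: "flat_face F" and f: "f \<in> face_polys F k" and 0: "\<And>x. x \<in> F \<Longrightarrow> f x = 0"
  shows "f = 0"
proof
  fix y
  have dimF: "aff_dim F = int DIM('a) - 1" using F by (simp add: flat_face_def)
  obtain \<nu> where \<nu>: "unit_normal F \<nu>" using unit_normal_exists[OF dimF] .
  obtain z where z: "z \<in> F" using nonempty_face[OF dimF \<nu>] by blast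
  have hull: "affine hull F = {x. (x - z) \<bullet> \<nu> = 0}" by (rule affine_hull_eq_hyperplane[OF dimF \<nu> z])
  obtain V where V: "open V" "F = affine hull F \<inter> V" using F by (auto simp: flat_face_def openin_open)
  obtain e where e: "e > 0" "ball z e \<subseteq> V" using V z openE by blast
  define y' where "y' = y - ((y - z) \<bullet> \<nu>) *\<^sub>R \<nu>"
  have "(y' - z) \<bullet> \<nu> = ((y - z) - ((y - z) \<bullet> \<nu>) *\<^sub>R \<nu>) \<bullet> \<nu>" by (simp add: y'_def algebra_simps)
  also have "\<dots> = (y - z) \<bullet> \<nu> - ((y - z) \<bullet> \<nu>) * (\<nu> \<bullet> \<nu>)" by (simp only: inner_diff_left inner_scaleR_left)
  finally have y'H: "(y' - z) \<bullet> \<nu> = 0" using norm_unit_normal[OF dimF \<nu>] by simp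
  have coords: "y \<bullet> b = y' \<bullet> b" if "b \<in> face_dirs F" for b
    using unit_normal_face_dirs[OF \<nu> that] by (simp add: y'_def inner_diff_left)
  have "f y = f y'"
    by (rule polys_in_cong_coordinates[OF f[unfolded face_polys_def] coords])
  moreover have "f y' = 0"
  proof (rule polys_in_eq_zero_of_segment[OF f[unfolded face_polys_def] finite_face_dirs])
    show "0 < e / (norm (y' - z) + 1)" using e by (simp add: add_nonneg_pos)
    fix t assume t: "0 < t" "t < e / (norm (y' - z) + 1)"
    have np: "0 < norm (y' - z) + 1" by (simp add: add_nonneg_pos)
    have "t * norm (y' - z) \<le> t * (norm (y' - z) + 1)" using t by simp
    also have "\<dots> < e" using t np by (simp add: pos_less_divide_eq)
    finally have "z + t *\<^sub>R (y' - z) \<in> ball z e" using t by (simp add: dist_norm)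
    moreover have "z + t *\<^sub>R (y' - z) \<in> affine hull F" unfolding hull using y'H by simp
    ultimately show "f (z + t *\<^sub>R (y' - z)) = 0" using 0 V(2) e(2) by blast
  qed
  ultimately show "f y = 0 y" by simp
qed

lemma face_inner_psd:
  fixes F :: "'a::euclidean_space set"
  assumes F: "flat_face F"
  shows "symmetric_psd_bilinear_on (face_polys F k) (face_inner F)"
  unfolding symmetric_psd_bilinear_on_def
proof (intro conjI ballI allI)
  fix u v w a b assume "u \<in> face_polys F k" "v \<in> face_polys F k" "w \<in> face_polys F k"
  then show "face_inner F (a *\<^sub>R u + b *\<^sub>R v) w = a * face_inner F u w + b * face_inner F v w"
    unfolding plus_fun_def scaleR_fun_def real_scaleR_def
    by (intro face_inner_lincomb_left_continuous[OF F] continuous_on_face_polys)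
qed (auto simp: face_inner_nonneg intro: face_inner_commute)

lemma face_proj_unique:
  fixes F :: "'a::euclidean_space set"
  assumes F: "flat_face F" and g: "continuous_on UNIV g"
  shows "\<exists>!q. q \<in> face_polys F k \<and> (\<forall>r\<in>face_polys F k. face_inner F q r = face_inner F g r)"
proof -
  obtain S where S: "finite S" "face_polys F k = span S"
    using polys_in_finite_span[OF finite_face_dirs] unfolding face_polys_def by blast
  show ?thesis
    unfolding S(2)
  proof (rule pd_form_riesz_unique[OF S(1)])
    show "symmetric_psd_bilinear_on (span S) (face_inner F)" using face_inner_psd[OF F, of k] S(2) by simp
    fix u v a b assume "u \<in> span S" "v \<in> span S"
    then have uv: "u \<in> face_polys F k" "v \<in> face_polys F k" using S(2) by auto
    show "face_inner F g (a *\<^sub>R u + b *\<^sub>R v) = a * face_inner F g u + b * face_inner F g v"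
      unfolding plus_fun_def scaleR_fun_def real_scaleR_def face_inner_commute[of F g]
      by (rule face_inner_lincomb_left_continuous[OF F continuous_on_face_polys[OF uv(1)] continuous_on_face_polys[OF uv(2)] g])
  next
    fix v assume "v \<in> span S" "face_normsq F v = 0"
    then show "v = 0"
      using face_polys_eq_zero[OF F, of v k] face_inner_eq_zero[OF F continuous_on_face_polys[of v F k]] S(2) by auto
  qed
qed

context
  fixes F :: "'a::euclidean_space set" and k :: nat and g :: "'a \<Rightarrow> real"
  assumes F: "flat_face F" and g: "continuous_on UNIV g"
begin

lemma face_proj_props: "face_proj F k g \<in> face_polys F k"
  "r \<in> face_polys F k \<Longrightarrow> face_inner F (face_proj F k g) r = face_inner F g r"
  using theI'[OF face_proj_unique[OF F g]] unfolding face_proj_def by blast+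

lemma face_proj_pythagoras:
  assumes r: "r \<in> face_polys F k"
  shows "face_normsq F (\<lambda>x. g x - r x) =
    face_normsq F (\<lambda>x. g x - face_proj F k g x) +
    face_normsq F (\<lambda>x. face_proj F k g x - r x)"
proof -
  define p where "p = face_proj F k g"
  have p: "p \<in> face_polys F k" unfolding p_def by (rule face_proj_props)
  define d where "d x = p x - r x" for x
  have d: "d \<in> face_polys F k" unfolding d_def
    using p r polys_in_diff unfolding face_polys_def by blast
  note c = continuous_on_face_polys[OF p] continuous_on_face_polys[OF r] continuous_on_face_polys[OF d] g
  have int: "set_integrable (face_measure F) F f" if "continuous_on UNIV f" for f :: "'a \<Rightarrow> real"
    using set_integrable_face_continuous[OF F that] .
  have orth: "face_inner F (\<lambda>x. 1 * g x + (-1) * p x) d = 0"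
    using face_proj_props(2)[OF d] by (subst face_inner_lincomb_left) (auto simp: p_def[symmetric] intro!: int continuous_intros c)
  have "face_normsq F (\<lambda>x. g x - r x) = (LINT x:F|face_measure F. (g x - p x) * (g x - p x) + (2 * ((g x - p x) * d x) + d x * d x))"
    unfolding face_inner_def by (simp add: d_def algebra_simps)
  also have "\<dots> = (LINT x:F|face_measure F. (g x - p x) * (g x - p x)) + ((LINT x:F|face_measure F. 2 * ((g x - p x) * d x)) + (LINT x:F|face_measure F. d x * d x))"
    by (subst set_integral_add(2), (intro int continuous_intros c)+, subst set_integral_add(2), (intro int continuous_intros c)+, rule refl)
  also have "(LINT x:F|face_measure F. 2 * ((g x - p x) * d x)) = 0"
    using orth by (simp add: face_inner_def set_integral_cmult)
  finally show ?thesis by (simp add: face_inner_def p_def d_def)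
qed

lemma face_proj_best_approximation:
  "r \<in> face_polys F k \<Longrightarrow>
    face_normsq F (\<lambda>x. g x - face_proj F k g x) \<le> face_normsq F (\<lambda>x. g x - r x)"
  using face_proj_pythagoras face_inner_nonneg[of F "\<lambda>x. face_proj F k g x - r x"] by simp

lemma face_proj_contraction: "face_normsq F (face_proj F k g) \<le> face_normsq F g"
  using face_proj_pythagoras[of "\<lambda>x. 0"] face_inner_nonneg[of F "\<lambda>x. g x - face_proj F k g x"]
  by (simp add: face_polys_def zero_in_polys_in)

end

section \<open>The outer normal\<close>

text \<open>The part of \<open>n\<close> orthogonal to \<open>\<nu>\<close> is a direction of the hyperplane, hence also orthogonal to \<open>n\<close>.\<close>

lemma unit_normal_unique:
  fixes F :: "'a::euclidean_space set"
  assumes dimF: "aff_dim F = int DIM('a) - 1" and \<nu>: "unit_normal F \<nu>" and n: "unit_normal F n"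
  shows "n = \<nu> \<or> n = - \<nu>"
proof -
  obtain a where a: "a \<in> F" using nonempty_face[OF dimF \<nu>] by blast
  define w where "w = n - (n \<bullet> \<nu>) *\<^sub>R \<nu>"
  have "w \<bullet> \<nu> = 0" using norm_unit_normal[OF dimF \<nu>] by (simp add: w_def inner_diff_left)
  then have "a + w \<in> {x. (x - a) \<bullet> \<nu> = 0}" by (simp only: mem_Collect_eq add_diff_cancel_left')
  then have "a + w \<in> {x. (x - a) \<bullet> n = 0}"
    unfolding affine_hull_eq_hyperplane[OF dimF \<nu> a, symmetric] affine_hull_eq_hyperplane[OF dimF n a] .
  then have "w \<bullet> n = 0" by (simp only: mem_Collect_eq add_diff_cancel_left')
  then have "(n \<bullet> \<nu>) * (n \<bullet> \<nu>) = 1"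
    using norm_unit_normal[OF dimF n] by (simp add: w_def inner_diff_left inner_commute[of \<nu> n])
  then have "n \<bullet> \<nu> = 1 \<or> n \<bullet> \<nu> = -1" by (simp add: square_eq_1_iff)
  then show ?thesis
  proof
    assume "n \<bullet> \<nu> = 1"
    then have "(n - \<nu>) \<bullet> (n - \<nu>) = 0"
      using norm_unit_normal[OF dimF n] norm_unit_normal[OF dimF \<nu>] by (simp add: inner_diff_left inner_diff_right inner_commute[of \<nu> n])
    then show ?thesis by simp
  next
    assume "n \<bullet> \<nu> = -1"
    then have "(n + \<nu>) \<bullet> (n + \<nu>) = 0"
      using norm_unit_normal[OF dimF n] norm_unit_normal[OF dimF \<nu>] by (simp add: inner_add_left inner_add_right inner_commute[of \<nu> n])
    then show ?thesis by (simp add: add_eq_0_iff)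
  qed
qed

definition leaves_along :: "'a::euclidean_space set \<Rightarrow> 'a \<Rightarrow> 'a set" where
  "leaves_along T \<nu> = {x. \<exists>e>0. \<forall>t\<in>{0<..<e}. x - t *\<^sub>R \<nu> \<in> T \<and> x + t *\<^sub>R \<nu> \<notin> T}"

lemma outer_normal_eq:
  fixes F :: "'a::euclidean_space set"
  assumes dimF: "aff_dim F = int DIM('a) - 1" and \<nu>: "unit_normal F \<nu>"
  shows "outer_normal T F x = indicator (leaves_along T \<nu>) x *\<^sub>R \<nu> - indicator (leaves_along T (- \<nu>)) x *\<^sub>R \<nu>"
proof -
  have iff: "is_outer_normal T F x n \<longleftrightarrow> unit_normal F n \<and> x \<in> leaves_along T n" for n
    by (simp add: is_outer_normal_def unit_normal_def leaves_along_def)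
  have m\<nu>: "unit_normal F (- \<nu>)" using \<nu> by (auto simp: unit_normal_def)
  have not_both: "\<not> (x \<in> leaves_along T \<nu> \<and> x \<in> leaves_along T (- \<nu>))"
  proof
    assume "x \<in> leaves_along T \<nu> \<and> x \<in> leaves_along T (- \<nu>)"
    then obtain e e' where e: "e > 0" "\<forall>t\<in>{0<..<e}. x - t *\<^sub>R \<nu> \<in> T \<and> x + t *\<^sub>R \<nu> \<notin> T"
      "e' > 0" "\<forall>t\<in>{0<..<e'}. x - t *\<^sub>R (- \<nu>) \<in> T \<and> x + t *\<^sub>R (- \<nu>) \<notin> T" by (auto simp: leaves_along_def)
    define t where "t = min e e' / 2"
    have "t \<in> {0<..<e}" "t \<in> {0<..<e'}" using e(1,3) by (auto simp: t_def)
    then show False using e(2,4) by fastforce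
  qed
  have cases: "n = \<nu> \<or> n = - \<nu>" if "unit_normal F n" for n
    using unit_normal_unique[OF dimF \<nu> that] .
  consider "x \<in> leaves_along T \<nu>" "x \<notin> leaves_along T (- \<nu>)" | "x \<notin> leaves_along T \<nu>" "x \<in> leaves_along T (- \<nu>)"
    | "x \<notin> leaves_along T \<nu>" "x \<notin> leaves_along T (- \<nu>)" using not_both by blast
  then show ?thesis
  proof cases
    case 1
    then have "is_outer_normal T F x = (\<lambda>n. n = \<nu>)" using iff cases \<nu> by (intro ext) blast
    then show ?thesis using 1 by (simp add: outer_normal_def)
  next
    case 2
    then have "is_outer_normal T F x = (\<lambda>n. n = - \<nu>)" using iff cases m\<nu> by (intro ext) blast
    then show ?thesis using 2 by (simp add: outer_normal_def)
  next
    case 3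
    then have "\<not> is_outer_normal T F x n" for n using iff cases by blast
    then show ?thesis using 3 by (simp add: outer_normal_def)
  qed
qed

text \<open>The condition on the exterior side is closed for fixed \<open>e\<close>; the one on the interior side is a countable
  intersection of open conditions, obtained by restricting to compact parts of the open interval.\<close>

lemma leaves_along_borel:
  fixes T :: "'a::euclidean_space set"
  assumes T: "open T"
  shows "leaves_along T \<nu> \<in> sets borel"
proof -
  define P where "P e = {x. \<forall>t\<in>{0<..<e}. x - t *\<^sub>R \<nu> \<in> T}" for e :: real
  define Q where "Q e = {x. \<forall>t\<in>{0<..<e}. x + t *\<^sub>R \<nu> \<notin> T}" for e :: real
  have Q: "Q e \<in> sets borel" for e
  proof -
    have "open (\<Union>t\<in>{0<..<e}. (\<lambda>x. x + t *\<^sub>R \<nu>) -` T)"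
      using T by (intro open_UN ballI continuous_open_vimage) (auto intro!: continuous_intros)
    moreover have "Q e = - (\<Union>t\<in>{0<..<e}. (\<lambda>x. x + t *\<^sub>R \<nu>) -` T)" by (auto simp: Q_def)
    ultimately show ?thesis by (simp only: borel_comp borel_open)
  qed
  have P: "P e \<in> sets borel" for e
  proof -
    have op: "open {x. \<forall>t\<in>{a..b}. x - t *\<^sub>R \<nu> \<in> T}" for a b :: real
    proof -
      have "compact ((\<lambda>t. t *\<^sub>R \<nu>) ` {a..b})" by (intro compact_continuous_image continuous_intros) auto
      then have "closed (\<Union>x\<in>- T. \<Union>y\<in>(\<lambda>t. t *\<^sub>R \<nu>) ` {a..b}. {x + y})"
        using T by (intro closed_compact_sums) auto
      moreover have "{x. \<forall>t\<in>{a..b}. x - t *\<^sub>R \<nu> \<in> T} = - (\<Union>x\<in>- T. \<Union>y\<in>(\<lambda>t. t *\<^sub>R \<nu>) ` {a..b}. {x + y})"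
      proof (intro Set.set_eqI iffI)
        fix x assume "x \<in> - (\<Union>x\<in>- T. \<Union>y\<in>(\<lambda>t. t *\<^sub>R \<nu>) ` {a..b}. {x + y})"
        then show "x \<in> {x. \<forall>t\<in>{a..b}. x - t *\<^sub>R \<nu> \<in> T}" by auto (metis ComplI atLeastAtMost_iff diff_add_cancel)
      qed auto
      ultimately show ?thesis by (simp only: open_Compl)
    qed
    have "P e = (\<Inter>n::nat. {x. \<forall>t\<in>{1 / real (Suc n)..e - 1 / real (Suc n)}. x - t *\<^sub>R \<nu> \<in> T})"
    proof (intro Set.set_eqI iffI)
      fix x assume "x \<in> P e"
      moreover have "t \<in> {0<..<e}" if "t \<in> {1 / real (Suc n)..e - 1 / real (Suc n)}" for t and n :: nat
      proof -
        have "0 < 1 / real (Suc n)" by simp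
        then show ?thesis using that by (simp only: atLeastAtMost_iff greaterThanLessThan_iff) linarith
      qed
      ultimately show "x \<in> (\<Inter>n::nat. {x. \<forall>t\<in>{1 / real (Suc n)..e - 1 / real (Suc n)}. x - t *\<^sub>R \<nu> \<in> T})"
        unfolding P_def by blast
    next
      fix x assume x: "x \<in> (\<Inter>n::nat. {x. \<forall>t\<in>{1 / real (Suc n)..e - 1 / real (Suc n)}. x - t *\<^sub>R \<nu> \<in> T})"
      show "x \<in> P e"
        unfolding P_def
      proof (intro CollectI ballI)
        fix t assume t: "t \<in> {0<..<e}"
        then have "0 < min t (e - t)" by simp
        then obtain n where "1 / real (Suc n) < min t (e - t)" using nat_approx_posE by blast
        then have "t \<in> {1 / real (Suc n)..e - 1 / real (Suc n)}" by auto
        then show "x - t *\<^sub>R \<nu> \<in> T" using x by blast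
      qed
    qed
    then show ?thesis using op by auto
  qed
  have "leaves_along T \<nu> = (\<Union>n::nat. P (1 / real (Suc n)) \<inter> Q (1 / real (Suc n)))"
  proof (intro Set.set_eqI iffI)
    fix x assume "x \<in> leaves_along T \<nu>"
    then obtain e where e: "e > 0" "\<forall>t\<in>{0<..<e}. x - t *\<^sub>R \<nu> \<in> T \<and> x + t *\<^sub>R \<nu> \<notin> T" by (auto simp: leaves_along_def)
    obtain n where "1 / real (Suc n) < e" using nat_approx_posE[OF e(1)] by blast
    then have "x \<in> P (1 / real (Suc n)) \<inter> Q (1 / real (Suc n))" using e(2) by (auto simp: P_def Q_def)
    then show "x \<in> (\<Union>n::nat. P (1 / real (Suc n)) \<inter> Q (1 / real (Suc n)))" by blast
  next
    fix x assume "x \<in> (\<Union>n::nat. P (1 / real (Suc n)) \<inter> Q (1 / real (Suc n)))"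
    then obtain n :: nat where "x \<in> P (1 / real (Suc n)) \<inter> Q (1 / real (Suc n))" by blast
    then show "x \<in> leaves_along T \<nu>"
      unfolding leaves_along_def P_def Q_def by (intro CollectI exI[of _ "1 / real (Suc n)"]) auto
  qed
  then show ?thesis using P Q by auto
qed

lemma outer_normal_measurable:
  fixes F T :: "'a::euclidean_space set"
  assumes "aff_dim F = int DIM('a) - 1" "open T"
  shows "outer_normal T F \<in> borel_measurable borel" and "norm (outer_normal T F x) \<le> 1"
proof -
  obtain \<nu> where \<nu>: "unit_normal F \<nu>" using unit_normal_exists[OF assms(1)] .
  have [measurable]: "leaves_along T \<nu> \<in> sets borel" "leaves_along T (- \<nu>) \<in> sets borel"
    using leaves_along_borel[OF assms(2)] by auto
  have eq: "outer_normal T F = (\<lambda>x. indicator (leaves_along T \<nu>) x *\<^sub>R \<nu> - indicator (leaves_along T (- \<nu>)) x *\<^sub>R \<nu>)"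
    using outer_normal_eq[OF assms(1) \<nu>] by blast
  show "outer_normal T F \<in> borel_measurable borel" unfolding eq by measurable
  show "norm (outer_normal T F x) \<le> 1"
    unfolding eq using norm_unit_normal[OF assms(1) \<nu>] by (auto simp: indicator_def)
qed


section \<open>The potential reconstruction\<close>

definition potential_rhs :: "'a::euclidean_space set \<Rightarrow> 'a set set \<Rightarrow> 'a hybrid \<Rightarrow> ('a \<Rightarrow> real) \<Rightarrow> real" where
  "potential_rhs T \<G> v w = - elem_inner T (fst v) (laplacian w) +
     bdry_inner \<G> (snd v) (\<lambda>F x. grad w x \<bullet> outer_normal T F x)"

text \<open>Continuity makes all integrals in the definition of the potential finite, so that the potential is
  defined and linear on a space that contains the hybrid spaces of all degrees.\<close>

definition continuous_hybrid :: "'a::euclidean_space set set \<Rightarrow> 'a hybrid \<Rightarrow> bool" where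
  "continuous_hybrid \<G> v \<longleftrightarrow> continuous_on UNIV (fst v) \<and> (\<forall>F\<in>\<G>. continuous_on UNIV (snd v F))"

lemma hybrid_space_continuous:
  assumes "v \<in> hybrid_space \<G> k l"
  shows "continuous_hybrid \<G> v"
  unfolding continuous_hybrid_def
proof (intro conjI ballI)
  show "continuous_on UNIV (fst v)" using assms continuous_on_elem_polys[of "fst v" l] by (auto simp: hybrid_space_def)
  show "continuous_on UNIV (snd v F)" if "F \<in> \<G>" for F
    using assms that continuous_on_face_polys[of "snd v F" F k] by (auto simp: hybrid_space_def bdry_polys_def)
qed

lemma subspace_elem_polys: "subspace (elem_polys m)"
  unfolding elem_polys_def by (rule subspace_polys_in)

lemma subspace_bdry_polys: "subspace (bdry_polys \<G> k)"
  using subspace_face_polys[of _ k]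
  by (auto simp: subspace_def bdry_polys_def plus_fun_def scaleR_fun_def zero_fun_def)

lemma subspace_hybrid_space: "subspace (hybrid_space \<G> k l)"
  unfolding hybrid_space_def using subspace_elem_polys subspace_bdry_polys by (rule subspace_Times)

lemma hybrid_pair_mem:
  "w \<in> elem_polys l \<Longrightarrow> u \<in> bdry_polys \<G> k \<Longrightarrow> (w, u) \<in> hybrid_space \<G> k l"
  "w \<in> elem_polys l \<Longrightarrow> (w, 0) \<in> hybrid_space \<G> k l"
  "u \<in> bdry_polys \<G> k \<Longrightarrow> (0, u) \<in> hybrid_space \<G> k l"
  using subspace_0[OF subspace_elem_polys] subspace_0[OF subspace_bdry_polys] by (auto simp: hybrid_space_def)

locale mesh_element =
  fixes T :: "'a::euclidean_space set" and \<G> :: "'a set set"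
  assumes T_open: "open T" and T_bounded: "bounded T" and T_nonempty: "T \<noteq> {}"
    and faces_finite: "finite \<G>" and faces_disjoint: "disjoint \<G>" and faces_nonempty: "\<G> \<noteq> {}"
    and faces_flat: "F \<in> \<G> \<Longrightarrow> flat_face F" and faces_frontier: "F \<in> \<G> \<Longrightarrow> F \<subseteq> frontier T"
begin

lemma normal_integrable:
  fixes f :: "'a \<Rightarrow> real" and g :: "'a \<Rightarrow> 'a"
  assumes F: "F \<in> \<G>" and f: "continuous_on UNIV f" and g: "continuous_on UNIV g"
  shows "set_integrable (face_measure F) F (\<lambda>x. (g x \<bullet> outer_normal T F x) * f x)"
proof -
  have ff: "flat_face F" and dimF: "aff_dim F = int DIM('a) - 1" using faces_flat[OF F] by (auto simp: flat_face_def)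
  note n = outer_normal_measurable[OF dimF T_open]
  have [measurable]: "f \<in> borel_measurable borel" "g \<in> borel_measurable borel" "outer_normal T F \<in> borel_measurable borel"
    using f g n(1) by (auto intro: borel_measurable_continuous_onI)
  have "continuous_on UNIV (\<lambda>x. norm (g x) * f x)" using f g by (intro continuous_intros)
  then obtain B where B: "\<forall>x\<in>F. \<bar>norm (g x) * f x\<bar> \<le> B"
    using continuous_bounded_on_bounded[of "\<lambda>x. norm (g x) * f x" F] ff by (auto simp: flat_face_def)
  show ?thesis
  proof (rule set_integrable_face[OF ff])
    fix x assume x: "x \<in> F"
    have "\<bar>g x \<bullet> outer_normal T F x\<bar> \<le> norm (g x) * norm (outer_normal T F x)" by (rule Cauchy_Schwarz_ineq2)
    also have "\<dots> \<le> norm (g x) * 1" using n(2)[of x] by (intro mult_left_mono) auto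
    finally have "\<bar>(g x \<bullet> outer_normal T F x) * f x\<bar> \<le> norm (g x) * \<bar>f x\<bar>"
      unfolding abs_mult by (intro mult_right_mono) auto
    also have "\<dots> \<le> B" using B x by (simp add: abs_mult)
    finally show "\<bar>(g x \<bullet> outer_normal T F x) * f x\<bar> \<le> B" .
  qed measurable
qed

lemma potential_rhs_lincomb_right:
  assumes v: "continuous_hybrid \<G> v" and w: "w1 \<in> elem_polys m" "w2 \<in> elem_polys m"
  shows "potential_rhs T \<G> v (\<lambda>x. a * w1 x + b * w2 x) = a * potential_rhs T \<G> v w1 + b * potential_rhs T \<G> v w2"
proof -
  have "laplacian (\<lambda>x. a * w1 x + b * w2 x) = (\<lambda>x. a *\<^sub>R laplacian w1 x + b *\<^sub>R laplacian w2 x)"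
    using laplacian_lincomb[OF w] by auto
  then have 1: "elem_inner T (fst v) (laplacian (\<lambda>x. a * w1 x + b * w2 x)) = a * elem_inner T (fst v) (laplacian w1) + b * elem_inner T (fst v) (laplacian w2)"
    using elem_inner_lincomb_left[OF T_open T_bounded continuous_on_laplacian[OF w(1)] continuous_on_laplacian[OF w(2)], of "fst v" a b] v
    by (simp add: continuous_hybrid_def elem_inner_commute[of T "fst v"])
  have "face_inner F (snd v F) (\<lambda>x. grad (\<lambda>x. a * w1 x + b * w2 x) x \<bullet> outer_normal T F x) =
      a * face_inner F (snd v F) (\<lambda>x. grad w1 x \<bullet> outer_normal T F x) + b * face_inner F (snd v F) (\<lambda>x. grad w2 x \<bullet> outer_normal T F x)"
    if F: "F \<in> \<G>" for F
  proof -
    have "(\<lambda>x. grad (\<lambda>x. a * w1 x + b * w2 x) x \<bullet> outer_normal T F x) =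
        (\<lambda>x. a * (grad w1 x \<bullet> outer_normal T F x) + b * (grad w2 x \<bullet> outer_normal T F x))"
      by (simp add: grad_lincomb[OF w] inner_add_left)
    moreover have "continuous_on UNIV (snd v F)" using v F by (simp add: continuous_hybrid_def)
    ultimately show ?thesis
      unfolding face_inner_commute[of F "snd v F"]
      using face_inner_lincomb_left[OF normal_integrable[OF F _ continuous_on_grad[OF w(1)]] normal_integrable[OF F _ continuous_on_grad[OF w(2)]]]
      by simp
  qed
  then have "bdry_inner \<G> (snd v) (\<lambda>F x. grad (\<lambda>x. a * w1 x + b * w2 x) x \<bullet> outer_normal T F x) =
      a * bdry_inner \<G> (snd v) (\<lambda>F x. grad w1 x \<bullet> outer_normal T F x) + b * bdry_inner \<G> (snd v) (\<lambda>F x. grad w2 x \<bullet> outer_normal T F x)"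
    by (simp add: bdry_inner_def sum.distrib sum_distrib_left)
  then show ?thesis unfolding potential_rhs_def 1 by (simp add: algebra_simps)
qed

lemma potential_rhs_lincomb_left:
  assumes u: "continuous_hybrid \<G> u" and v: "continuous_hybrid \<G> v" and w: "w \<in> elem_polys m"
  shows "potential_rhs T \<G> (a *\<^sub>R u + b *\<^sub>R v) w = a * potential_rhs T \<G> u w + b * potential_rhs T \<G> v w"
proof -
  have 1: "elem_inner T (fst (a *\<^sub>R u + b *\<^sub>R v)) (laplacian w) = a * elem_inner T (fst u) (laplacian w) + b * elem_inner T (fst v) (laplacian w)"
    using elem_inner_lincomb_left[OF T_open T_bounded _ _ continuous_on_laplacian[OF w], of "fst u" "fst v" a b] u v
    by (simp add: continuous_hybrid_def plus_fun_def scaleR_fun_def)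
  have "face_inner F (snd (a *\<^sub>R u + b *\<^sub>R v) F) (\<lambda>x. grad w x \<bullet> outer_normal T F x) =
      a * face_inner F (snd u F) (\<lambda>x. grad w x \<bullet> outer_normal T F x) + b * face_inner F (snd v F) (\<lambda>x. grad w x \<bullet> outer_normal T F x)"
    if F: "F \<in> \<G>" for F
  proof -
    have "set_integrable (face_measure F) F (\<lambda>x. snd u F x * (grad w x \<bullet> outer_normal T F x))"
      "set_integrable (face_measure F) F (\<lambda>x. snd v F x * (grad w x \<bullet> outer_normal T F x))"
      using normal_integrable[OF F _ continuous_on_grad[OF w], of "snd u F"] normal_integrable[OF F _ continuous_on_grad[OF w], of "snd v F"] u v F
      by (auto simp: continuous_hybrid_def mult.commute)
    from face_inner_lincomb_left[OF this, of a b] show ?thesis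
      by (simp add: plus_fun_def scaleR_fun_def)
  qed
  then have "bdry_inner \<G> (snd (a *\<^sub>R u + b *\<^sub>R v)) (\<lambda>F x. grad w x \<bullet> outer_normal T F x) =
      a * bdry_inner \<G> (snd u) (\<lambda>F x. grad w x \<bullet> outer_normal T F x) + b * bdry_inner \<G> (snd v) (\<lambda>F x. grad w x \<bullet> outer_normal T F x)"
    unfolding bdry_inner_def sum_distrib_left sum.distrib[symmetric] by (intro sum.cong refl) auto
  then show ?thesis unfolding potential_rhs_def 1 by (simp add: algebra_simps)
qed

lemma grad_form_psd: "symmetric_psd_bilinear_on (elem_polys m) (\<lambda>p w. elem_inner T (grad p) (grad w))"
  unfolding symmetric_psd_bilinear_on_def
proof (intro conjI ballI allI)
  fix u v w :: "'a \<Rightarrow> real" and a b assume uvw: "u \<in> elem_polys m" "v \<in> elem_polys m" "w \<in> elem_polys m"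
  have "grad (a *\<^sub>R u + b *\<^sub>R v) = (\<lambda>x. a *\<^sub>R grad u x + b *\<^sub>R grad v x)"
    using grad_lincomb[OF uvw(1,2), of a b] by (simp add: plus_fun_def scaleR_fun_def fun_eq_iff)
  then show "elem_inner T (grad (a *\<^sub>R u + b *\<^sub>R v)) (grad w) = a * elem_inner T (grad u) (grad w) + b * elem_inner T (grad v) (grad w)"
    using elem_inner_lincomb_left[OF T_open T_bounded continuous_on_grad[OF uvw(1)] continuous_on_grad[OF uvw(2)] continuous_on_grad[OF uvw(3)]] by simp
qed (auto simp: elem_inner_nonneg intro: elem_inner_commute)

lemma grad_form_eq_zero:
  assumes "p \<in> elem_polys m" "elem_normsq T (grad p) = 0"
  shows "grad p x = 0"
proof -
  obtain z where "z \<in> T" using T_nonempty by blast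
  then show ?thesis
    using grad_eq_zero_of_open[OF assms(1) T_open] elem_inner_eq_zero[OF T_open T_bounded continuous_on_grad[OF assms(1)] assms(2)] by blast
qed

lemma elem_inner_one: "elem_inner T (\<lambda>x. c) (\<lambda>x. 1) = c * elem_inner T (\<lambda>x. 1) (\<lambda>x. 1::real)" "0 < elem_inner T (\<lambda>x. 1) (\<lambda>x. 1::real)"
proof -
  show "elem_inner T (\<lambda>x. c) (\<lambda>x. 1) = c * elem_inner T (\<lambda>x. 1) (\<lambda>x. 1::real)"
    using set_integral_cmult[of lborel T c "\<lambda>x. 1"] by (simp add: elem_inner_def)
  have "elem_inner T (\<lambda>x. 1) (\<lambda>x. 1::real) \<noteq> 0"
    using elem_inner_eq_zero[OF T_open T_bounded, of "\<lambda>x. 1::real"] T_nonempty by auto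
  then show "0 < elem_inner T (\<lambda>x. 1) (\<lambda>x. 1::real)"
    using elem_inner_nonneg[of T "\<lambda>x. 1::real"] by simp
qed

lemma elem_inner_diff_one:
  fixes f g :: "'a \<Rightarrow> real"
  assumes "continuous_on UNIV f" "continuous_on UNIV g"
  shows "elem_inner T (\<lambda>x. f x - g x) (\<lambda>x. 1) = elem_inner T f (\<lambda>x. 1) - elem_inner T g (\<lambda>x. 1::real)"
  using elem_inner_lincomb_left[OF T_open T_bounded assms, of "\<lambda>x. 1" 1 "-1"] by simp

definition is_potential :: "nat \<Rightarrow> 'a hybrid \<Rightarrow> ('a \<Rightarrow> real) \<Rightarrow> bool" where
  "is_potential k v p \<longleftrightarrow> p \<in> elem_polys (k + 1) \<and>
     (\<forall>w\<in>elem_polys (k + 1). elem_inner T (grad p) (grad w) = potential_rhs T \<G> v w) \<and>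
     elem_inner T (\<lambda>x. fst v x - p x) (\<lambda>x. 1) = 0"

text \<open>The right-hand side vanishes for \<open>w\<close> with zero gradient, so the semi-definite Riesz theorem gives a
  solution. Its gradient is unique, and the mean value fixes the constant.\<close>

lemma potential_exists_unique:
  assumes v: "continuous_hybrid \<G> v"
  shows "\<exists>!p. is_potential k v p"
proof (rule ex_ex1I)
  obtain S :: "('a \<Rightarrow> real) set" where S: "finite S" "elem_polys (k + 1) = span S"
    using polys_in_finite_span[OF finite_Basis] unfolding elem_polys_def by blast
  have "\<exists>p\<in>span S. \<forall>w\<in>span S. elem_inner T (grad p) (grad w) = potential_rhs T \<G> v w"
  proof (rule psd_form_riesz[OF S(1)])
    show "symmetric_psd_bilinear_on (span S) (\<lambda>p w. elem_inner T (grad p) (grad w))"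
      using grad_form_psd[of "k + 1"] S(2) by simp
    show "potential_rhs T \<G> v (a *\<^sub>R w1 + b *\<^sub>R w2) = a * potential_rhs T \<G> v w1 + b * potential_rhs T \<G> v w2"
      if "w1 \<in> span S" "w2 \<in> span S" for w1 w2 a b
      using potential_rhs_lincomb_right[OF v, of w1 "k + 1" w2 a b] that S(2) by (simp add: plus_fun_def scaleR_fun_def)
    show "potential_rhs T \<G> v w = 0" if w': "w \<in> span S" "elem_normsq T (grad w) = 0" for w
    proof -
      have w: "w \<in> elem_polys (k + 1)" using w'(1) S(2) by simp
      have g: "grad w x = 0" for x by (rule grad_form_eq_zero[OF w w'(2)])
      have "grad (\<lambda>y. grad w y \<bullet> b) x = 0" for b x using g by (simp add: grad_const)
      then have "laplacian w x = 0" for x by (simp add: laplacian_def)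
      then show ?thesis using g
        by (simp add: potential_rhs_def elem_inner_def bdry_inner_def face_inner_def set_lebesgue_integral_def)
    qed
  qed
  then obtain p where p: "p \<in> elem_polys (k + 1)" "\<forall>w\<in>elem_polys (k + 1). elem_inner T (grad p) (grad w) = potential_rhs T \<G> v w"
    unfolding S(2) by (rule bexE)
  define c where "c = elem_inner T (\<lambda>x. fst v x - p x) (\<lambda>x. 1) / elem_inner T (\<lambda>x. 1) (\<lambda>x. 1::real)"
  have p': "(\<lambda>x. p x + c) \<in> elem_polys (k + 1)" by (intro elem_polys_add p(1) const_in_elem_polys)
  have "grad (\<lambda>x. p x + c) = grad p"
    using grad_lincomb[OF p(1) const_in_elem_polys, of 1 1 c] by (auto simp: grad_const)
  moreover have "elem_inner T (\<lambda>x. fst v x - (p x + c)) (\<lambda>x. 1) = 0"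
  proof -
    have "elem_inner T (\<lambda>x. (fst v x - p x) - c) (\<lambda>x. 1) = elem_inner T (\<lambda>x. fst v x - p x) (\<lambda>x. 1) - elem_inner T (\<lambda>x. c) (\<lambda>x. 1)"
      using v continuous_on_elem_polys[OF p(1)] by (intro elem_inner_diff_one continuous_on_diff continuous_on_const) (simp_all add: continuous_hybrid_def)
    also have "\<dots> = 0" using elem_inner_one(2) by (subst elem_inner_one(1)) (simp add: c_def)
    finally show ?thesis by (simp add: algebra_simps)
  qed
  ultimately show "\<exists>p. is_potential k v p"
    unfolding is_potential_def using p(2) p' by (intro exI[of _ "\<lambda>x. p x + c"]) simp
next
  fix p q assume "is_potential k v p" "is_potential k v q"
  then have pq: "p \<in> elem_polys (k + 1)" "q \<in> elem_polys (k + 1)"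
    "\<And>w. w \<in> elem_polys (k + 1) \<Longrightarrow> elem_inner T (grad p) (grad w) = elem_inner T (grad q) (grad w)"
    "elem_inner T (\<lambda>x. fst v x - p x) (\<lambda>x. 1) = 0" "elem_inner T (\<lambda>x. fst v x - q x) (\<lambda>x. 1) = 0"
    by (auto simp: is_potential_def)
  define d where "d = p - q"
  have d: "d \<in> elem_polys (k + 1)" unfolding d_def by (rule subspace_diff[OF subspace_elem_polys pq(1,2)])
  have "elem_normsq T (grad d) = elem_inner T (grad p) (grad d) - elem_inner T (grad q) (grad d)"
    unfolding d_def using psd_form_diff_left[OF subspace_elem_polys grad_form_psd pq(1,2) d[unfolded d_def]] by blast
  then have "elem_normsq T (grad d) = 0" using pq(3)[OF d] by simp
  then have "grad d x = 0" for x by (rule grad_form_eq_zero[OF d])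
  then obtain c where c: "\<And>x. d x = c" using constant_of_grad_eq_zero[OF d] by metis
  have cont: "continuous_on UNIV (fst v)" "continuous_on UNIV p" "continuous_on UNIV q"
    using v continuous_on_elem_polys pq(1,2) by (auto simp: continuous_hybrid_def)
  have "c * elem_inner T (\<lambda>x. 1) (\<lambda>x. 1::real) = elem_inner T (\<lambda>x. p x - q x) (\<lambda>x. 1)"
    using c elem_inner_one(1)[of c] by (simp add: d_def)
  also have "\<dots> = 0"
    using pq(4,5) cont by (simp add: elem_inner_diff_one)
  finally have "c = 0" using elem_inner_one(2) by simp
  then show "p = q" using c by (auto simp: d_def fun_eq_iff)
qed

lemma potential_eq: "potential T \<G> k v = (THE p. is_potential k v p)"
  unfolding potential_def is_potential_def potential_rhs_def ..

lemma potential_is_potential: "continuous_hybrid \<G> v \<Longrightarrow> is_potential k v (potential T \<G> k v)"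
  unfolding potential_eq by (rule theI'[OF potential_exists_unique])

lemma potential_eqI: "continuous_hybrid \<G> v \<Longrightarrow> is_potential k v p \<Longrightarrow> potential T \<G> k v = p"
  using potential_exists_unique potential_is_potential by blast

lemma potential_in_elem_polys: "continuous_hybrid \<G> v \<Longrightarrow> potential T \<G> k v \<in> elem_polys (k + 1)"
  using potential_is_potential by (simp add: is_potential_def)

lemma potential_lincomb:
  assumes u: "continuous_hybrid \<G> u" and v: "continuous_hybrid \<G> v"
  shows "potential T \<G> k (a *\<^sub>R u + b *\<^sub>R v) = a *\<^sub>R potential T \<G> k u + b *\<^sub>R potential T \<G> k v"
proof (rule potential_eqI)
  let ?p = "potential T \<G> k u" and ?q = "potential T \<G> k v"
  have p: "?p \<in> elem_polys (k + 1)" "\<And>w. w \<in> elem_polys (k + 1) \<Longrightarrow> elem_inner T (grad ?p) (grad w) = potential_rhs T \<G> u w"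
    "elem_inner T (\<lambda>x. fst u x - ?p x) (\<lambda>x. 1) = 0"
    using potential_is_potential[OF u] by (auto simp: is_potential_def)
  have q: "?q \<in> elem_polys (k + 1)" "\<And>w. w \<in> elem_polys (k + 1) \<Longrightarrow> elem_inner T (grad ?q) (grad w) = potential_rhs T \<G> v w"
    "elem_inner T (\<lambda>x. fst v x - ?q x) (\<lambda>x. 1) = 0"
    using potential_is_potential[OF v] by (auto simp: is_potential_def)
  show "continuous_hybrid \<G> (a *\<^sub>R u + b *\<^sub>R v)"
    using u v by (auto simp: continuous_hybrid_def plus_fun_def scaleR_fun_def intro!: continuous_intros)
  have "elem_inner T (\<lambda>x. a *\<^sub>R (fst u x - ?p x) + b *\<^sub>R (fst v x - ?q x)) (\<lambda>x. 1) = 0"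
    using u v p(3) q(3) by (subst elem_inner_lincomb_left[OF T_open T_bounded])
      (auto simp: continuous_hybrid_def intro!: continuous_intros continuous_on_elem_polys[OF p(1)] continuous_on_elem_polys[OF q(1)])
  then have mean: "elem_inner T (\<lambda>x. fst (a *\<^sub>R u + b *\<^sub>R v) x - (a *\<^sub>R ?p + b *\<^sub>R ?q) x) (\<lambda>x. 1) = 0"
    by (simp add: plus_fun_def scaleR_fun_def algebra_simps)
  have mem: "a *\<^sub>R ?p + b *\<^sub>R ?q \<in> elem_polys (k + 1)"
    using p(1) q(1) subspace_elem_polys by (intro subspace_add subspace_scale)
  have "elem_inner T (grad (a *\<^sub>R ?p + b *\<^sub>R ?q)) (grad w) = potential_rhs T \<G> (a *\<^sub>R u + b *\<^sub>R v) w" if w: "w \<in> elem_polys (k + 1)" for w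
    using psd_form_lincomb_left[OF grad_form_psd p(1) q(1) w, of a b] p(2)[OF w] q(2)[OF w] potential_rhs_lincomb_left[OF u v w, of a b] by simp
  then show "is_potential k (a *\<^sub>R u + b *\<^sub>R v) (a *\<^sub>R ?p + b *\<^sub>R ?q)"
    unfolding is_potential_def using mem mean by blast
qed

section \<open>Local bilinear forms and static condensation\<close>

lemma local_form_psd:
  assumes s: "symmetric_psd_bilinear_on (hybrid_space \<G> k l) s"
  shows "symmetric_psd_bilinear_on (hybrid_space \<G> k l) (local_form T \<G> k s)"
  unfolding symmetric_psd_bilinear_on_def local_form_def
proof (intro conjI ballI allI)
  fix u v w a b assume uvw: "u \<in> hybrid_space \<G> k l" "v \<in> hybrid_space \<G> k l" "w \<in> hybrid_space \<G> k l"
  note c = uvw[THEN hybrid_space_continuous]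
  show "elem_inner T (grad (potential T \<G> k (a *\<^sub>R u + b *\<^sub>R v))) (grad (potential T \<G> k w)) + s (a *\<^sub>R u + b *\<^sub>R v) w =
      a * (elem_inner T (grad (potential T \<G> k u)) (grad (potential T \<G> k w)) + s u w) +
      b * (elem_inner T (grad (potential T \<G> k v)) (grad (potential T \<G> k w)) + s v w)"
    unfolding potential_lincomb[OF c(1,2)]
      psd_form_lincomb_left[OF grad_form_psd c(1,2,3)[THEN potential_in_elem_polys]] psd_form_lincomb_left[OF s uvw]
    by (simp add: algebra_simps)
next
  fix u v assume "u \<in> hybrid_space \<G> k l" "v \<in> hybrid_space \<G> k l"
  then show "elem_inner T (grad (potential T \<G> k u)) (grad (potential T \<G> k v)) + s u v =
      elem_inner T (grad (potential T \<G> k v)) (grad (potential T \<G> k u)) + s v u"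
    using psd_form_sym[OF s] by (simp add: elem_inner_commute[of T "grad (potential T \<G> k u)"])
next
  fix u assume "u \<in> hybrid_space \<G> k l"
  then show "0 \<le> elem_normsq T (grad (potential T \<G> k u)) + s u u"
    using psd_form_nonneg[OF s] elem_inner_nonneg[of T "grad (potential T \<G> k u)"] by (simp add: add_nonneg_nonneg)
qed

text \<open>The norm in (S1) controls the gradient of \<open>w\<close> and its values on the faces, of which there is at
  least one.\<close>

lemma elem_form_eq_zero:
  assumes S1: "stab_S1 Ca T \<G> k l s" and Ca: "0 < Ca" and w: "w \<in> elem_polys l"
    and 0: "local_form T \<G> k s (w, 0) (w, 0) = 0"
  shows "w = 0"
proof -
  have h: "0 < inverse (diameter T)" using diameter_open_pos[OF T_open T_bounded T_nonempty] by simp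
  have "inverse Ca * hybrid_norm_sq T \<G> (w, 0) \<le> 0"
    using S1 hybrid_pair_mem(2)[OF w] 0 unfolding stab_S1_def by metis
  then have "hybrid_norm_sq T \<G> (w, 0) \<le> 0" using Ca by (simp add: mult_le_0_iff)
  moreover have "hybrid_norm_sq T \<G> (w, 0) = elem_normsq T (grad w) + inverse (diameter T) * (\<Sum>F\<in>\<G>. face_normsq F w)"
    unfolding hybrid_norm_sq_def elem_norm_sq bdry_norm_sq by (simp add: bdry_inner_def face_inner_def)
  moreover have "0 \<le> elem_normsq T (grad w)" "0 \<le> (\<Sum>F\<in>\<G>. face_normsq F w)"
    by (auto intro: elem_inner_nonneg sum_nonneg face_inner_nonneg)
  ultimately have e0: "elem_normsq T (grad w) = 0" and "inverse (diameter T) * (\<Sum>F\<in>\<G>. face_normsq F w) = 0"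
    using h mult_nonneg_nonneg[of "inverse (diameter T)" "\<Sum>F\<in>\<G>. face_normsq F w"] by linarith+
  then have "(\<Sum>F\<in>\<G>. face_normsq F w) = 0" using h by simp
  then have f0: "face_normsq F w = 0" if "F \<in> \<G>" for F
    using that faces_finite by (simp add: sum_nonneg_eq_0_iff face_inner_nonneg)
  obtain F where F: "F \<in> \<G>" using faces_nonempty by blast
  have dimF: "aff_dim F = int DIM('a) - 1" using faces_flat[OF F] by (simp add: flat_face_def)
  obtain \<nu> where "unit_normal F \<nu>" using unit_normal_exists[OF dimF] .
  then obtain z where z: "z \<in> F" using nonempty_face[OF dimF] by blast
  have "w z = 0" by (rule face_inner_eq_zero[OF faces_flat[OF F] continuous_on_elem_polys[OF w] f0[OF F] z])
  then show "w = 0"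
    using constant_of_grad_eq_zero[OF w grad_form_eq_zero[OF w e0], of _ z] by (auto simp: fun_eq_iff)
qed

context
  fixes k l :: nat and s :: "'a hybrid \<Rightarrow> 'a hybrid \<Rightarrow> real" and Ca :: real
  assumes s: "symmetric_psd_bilinear_on (hybrid_space \<G> k l) s" and S1: "stab_S1 Ca T \<G> k l s" and Ca: "0 < Ca"
begin

abbreviation a_T :: "'a hybrid \<Rightarrow> 'a hybrid \<Rightarrow> real" where "a_T \<equiv> local_form T \<G> k s"

abbreviation condensed :: "('a set \<Rightarrow> 'a \<Rightarrow> real) \<Rightarrow> 'a hybrid" where
  "condensed u \<equiv> (condense T \<G> k l s u, u)"

lemma condense_exists_unique:
  assumes u: "u \<in> bdry_polys \<G> k"
  shows "\<exists>!w. w \<in> elem_polys l \<and> (\<forall>v\<in>elem_polys l. a_T (w, 0) (v, 0) = - a_T (0, u) (v, 0))"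
proof -
  obtain S :: "('a \<Rightarrow> real) set" where S: "finite S" "elem_polys l = span S"
    using polys_in_finite_span[OF finite_Basis] unfolding elem_polys_def by blast
  note psd = local_form_psd[OF s]
  have pair: "(a *\<^sub>R v + b *\<^sub>R w, 0) = a *\<^sub>R (v, 0) + b *\<^sub>R (w, 0)" for a b and v w :: "'a \<Rightarrow> real"
    by (simp add: prod_eq_iff)
  have mem: "(v, 0) \<in> hybrid_space \<G> k l" if "v \<in> span S" for v using hybrid_pair_mem(2) that S(2) by blast
  have psd': "symmetric_psd_bilinear_on (span S) (\<lambda>w v. a_T (w, 0) (v, 0))"
    unfolding symmetric_psd_bilinear_on_def pair
  proof (intro conjI ballI allI)
    show "a_T (a *\<^sub>R (u, 0) + b *\<^sub>R (v, 0)) (w, 0) = a * a_T (u, 0) (w, 0) + b * a_T (v, 0) (w, 0)"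
      if "u \<in> span S" "v \<in> span S" "w \<in> span S" for u v w a b
      by (rule psd_form_lincomb_left[OF psd mem[OF that(1)] mem[OF that(2)] mem[OF that(3)]])
    show "a_T (u, 0) (v, 0) = a_T (v, 0) (u, 0)" if "u \<in> span S" "v \<in> span S" for u v
      by (rule psd_form_sym[OF psd mem[OF that(1)] mem[OF that(2)]])
    show "0 \<le> a_T (u, 0) (u, 0)" if "u \<in> span S" for u
      by (rule psd_form_nonneg[OF psd mem[OF that]])
  qed
  show ?thesis
    unfolding S(2)
  proof (rule pd_form_riesz_unique[OF S(1) psd'])
    show "- a_T (0, u) (a *\<^sub>R v + b *\<^sub>R w, 0) = a * - a_T (0, u) (v, 0) + b * - a_T (0, u) (w, 0)"
      if "v \<in> span S" "w \<in> span S" for v w a b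
      unfolding pair psd_form_lincomb_right[OF subspace_hybrid_space psd mem[OF that(1)] mem[OF that(2)] hybrid_pair_mem(3)[OF u]]
      by (simp add: algebra_simps)
    show "v = 0" if "v \<in> span S" "a_T (v, 0) (v, 0) = 0" for v
      using elem_form_eq_zero[OF S1 Ca _ that(2)] that(1) S(2) by blast
  qed
qed

lemma condense_in_elem_polys: "u \<in> bdry_polys \<G> k \<Longrightarrow> condense T \<G> k l s u \<in> elem_polys l"
  using theI'[OF condense_exists_unique] unfolding condense_def by blast

lemma condensed_in_hybrid_space: "u \<in> bdry_polys \<G> k \<Longrightarrow> condensed u \<in> hybrid_space \<G> k l"
  by (simp add: hybrid_pair_mem(1) condense_in_elem_polys)

lemma condensed_orthogonal:
  assumes u: "u \<in> bdry_polys \<G> k" and v: "v \<in> elem_polys l"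
  shows "a_T (condensed u) (v, 0) = 0"
proof -
  let ?w = "condense T \<G> k l s u"
  have "a_T (?w, 0) (v, 0) = - a_T (0, u) (v, 0)"
    using theI'[OF condense_exists_unique[OF u]] v unfolding condense_def by blast
  moreover have "condensed u = (?w, 0) + (0, u)" by simp
  moreover have "a_T ((?w, 0) + (0, u)) (v, 0) = a_T (?w, 0) (v, 0) + a_T (0, u) (v, 0)"
    by (rule psd_form_add_left[OF subspace_hybrid_space local_form_psd[OF s]])
      (auto intro!: hybrid_pair_mem condense_in_elem_polys u v)
  ultimately show ?thesis by simp
qed

text \<open>The two test functions differ by an element function.\<close>

lemma condensed_form_eq:
  assumes u: "u \<in> bdry_polys \<G> k" and v: "v \<in> bdry_polys \<G> k"
  shows "a_T (condensed u) (0, v) = a_T (condensed u) (condensed v)"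
proof -
  let ?w = "condense T \<G> k l s v"
  have "condensed v = (?w, 0) + (0, v)" by simp
  then have "a_T (condensed u) (condensed v) = a_T (condensed u) (?w, 0) + a_T (condensed u) (0, v)"
    using psd_form_add_right[OF subspace_hybrid_space local_form_psd[OF s] hybrid_pair_mem(2)[OF condense_in_elem_polys[OF v]]
        hybrid_pair_mem(3)[OF v] condensed_in_hybrid_space[OF u]] by simp
  then show ?thesis using condensed_orthogonal[OF u condense_in_elem_polys[OF v]] by simp
qed

text \<open>The function \<open>(0, u)\<close> differs from the condensed one by an element function, and the condensed one is
  orthogonal to all element functions.\<close>

lemma condensed_energy_le:
  assumes u: "u \<in> bdry_polys \<G> k"
  shows "a_T (condensed u) (condensed u) \<le> a_T (0, u) (0, u)"
proof -
  define w :: "'a hybrid" where "w = (condense T \<G> k l s u, 0)"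
  define z :: "'a hybrid" where "z = (0, u)"
  define c :: "'a hybrid" where "c = condensed u"
  note psd = local_form_psd[OF s]
  have w: "w \<in> hybrid_space \<G> k l" unfolding w_def by (rule hybrid_pair_mem(2)[OF condense_in_elem_polys[OF u]])
  have z: "z \<in> hybrid_space \<G> k l" unfolding z_def by (rule hybrid_pair_mem(3)[OF u])
  have c: "c \<in> hybrid_space \<G> k l" unfolding c_def by (rule condensed_in_hybrid_space[OF u])
  have eq: "z = c - w" by (simp add: z_def c_def w_def)
  have "a_T z z = a_T c z - a_T w z"
    using psd_form_diff_left[OF subspace_hybrid_space psd c w z] unfolding eq .
  moreover have "a_T c z = a_T c c" unfolding c_def z_def by (rule condensed_form_eq[OF u u])
  moreover have "a_T w z = a_T w c - a_T w w"
    using psd_form_diff_right[OF subspace_hybrid_space psd c w w] unfolding eq .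
  moreover have "a_T w c = 0"
    using condensed_orthogonal[OF u condense_in_elem_polys[OF u]] psd_form_sym[OF psd w c] unfolding w_def c_def by simp
  moreover have "0 \<le> a_T w w" by (rule psd_form_nonneg[OF psd w])
  ultimately have "a_T c c \<le> a_T z z" by linarith
  then show ?thesis unfolding c_def z_def .
qed

end

end


section \<open>Local estimates\<close>

definition trace_const :: "real \<Rightarrow> nat \<Rightarrow> real" where
  "trace_const \<rho> d = 2 ^ (d - 1) / \<rho>\<^sup>2"

text \<open>The constant minus one, times the diameter, bounds the squared trace of a zero-mean polynomial by the
  squared norm of its gradient; the summand \<open>1\<close> accounts for the projected boundary difference.\<close>

definition potential_const :: "real \<Rightarrow> nat \<Rightarrow> real" where
  "potential_const \<rho> d = trace_const \<rho> d * (3 * poincare_const \<rho> d + 1) + 1"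

lemma trace_const_pos: "0 < \<rho> \<Longrightarrow> 0 < trace_const \<rho> d"
  by (simp add: trace_const_def)

lemma potential_const_ge_one: "0 < \<rho> \<Longrightarrow> 1 \<le> potential_const \<rho> d"
  using trace_const_pos[of \<rho> d] poincare_const_pos[of \<rho> d] by (simp add: potential_const_def)

lemma set_integral_norm_square:
  fixes g :: "'b \<Rightarrow> 'a::euclidean_space"
  assumes "\<And>b. b \<in> Basis \<Longrightarrow> set_integrable M A (\<lambda>x. (g x \<bullet> b)\<^sup>2)"
  shows "(LINT x:A|M. (norm (g x))\<^sup>2) = (\<Sum>b\<in>Basis. LINT x:A|M. (g x \<bullet> b)\<^sup>2)"
proof -
  have "(norm (g x))\<^sup>2 = (\<Sum>b\<in>Basis. (g x \<bullet> b)\<^sup>2)" for x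
    unfolding power2_norm_eq_inner by (subst euclidean_inner) (simp add: power2_eq_square)
  then have "indicator A x *\<^sub>R (norm (g x))\<^sup>2 = (\<Sum>b\<in>Basis. indicator A x *\<^sub>R (g x \<bullet> b)\<^sup>2)" for x
    by (simp only: scaleR_sum_right)
  then show ?thesis
    using assms unfolding set_lebesgue_integral_def set_integrable_def
    by (subst Bochner_Integration.integral_sum[symmetric]) simp_all
qed

locale star_shaped_element = mesh_element T \<G> for T :: "'a::euclidean_space set" and \<G> +
  fixes \<rho> :: real
  assumes \<rho>: "0 < \<rho>" and conn: "connected_by_star_shaped \<rho> T"
begin

lemma grad_form_eq_integral: "elem_normsq T (grad p) = (LINT x:T|lborel. (norm (grad p x))\<^sup>2)"
  by (simp add: elem_inner_def power2_norm_eq_inner)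

abbreviation "h \<equiv> diameter T"

lemma h_pos: "0 < h"
  by (rule diameter_open_pos[OF T_open T_bounded T_nonempty])

lemma trace_bound:
  fixes g \<phi> :: "'a \<Rightarrow> real"
  assumes cont: "continuous_on UNIV g" "continuous_on UNIV \<phi>" and nonneg: "\<And>x. 0 \<le> g x" "\<And>x. 0 \<le> \<phi> x"
    and bound: "\<And>F z c. F \<in> \<G> \<Longrightarrow> z \<in> F \<Longrightarrow> c \<in> T \<Longrightarrow> ennreal (g z) \<le> (\<integral>\<^sup>+r\<in>{1/2<..<1}. ennreal (\<phi> (c + r *\<^sub>R (z - c))) \<partial>lborel)"
  shows "(\<Sum>F\<in>\<G>. LINT z:F|face_measure F. g z) \<le> trace_const \<rho> DIM('a) / h * (LINT x:T|lborel. \<phi> x)"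
proof -
  have meas: "(\<lambda>x. ennreal (\<phi> x)) \<in> borel_measurable borel" "(\<lambda>x. ennreal (g x)) \<in> borel_measurable borel"
    using cont by (auto intro!: measurable_compose[OF borel_measurable_continuous_onI measurable_ennreal])
  have "(\<Sum>F\<in>\<G>. \<integral>\<^sup>+z\<in>F. ennreal (g z) \<partial>face_measure F) \<le> ennreal (2 ^ (DIM('a) - 1) / (\<rho>\<^sup>2 * h)) * (\<integral>\<^sup>+x\<in>T. ennreal (\<phi> x) \<partial>lborel)"
    by (rule star_shaped_trace[OF T_open T_bounded T_nonempty \<rho> conn faces_finite faces_disjoint _ meas bound])
      (simp_all add: faces_flat faces_frontier)
  also have "(\<integral>\<^sup>+x\<in>T. ennreal (\<phi> x) \<partial>lborel) = ennreal (LINT x:T|lborel. \<phi> x)"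
    by (rule nn_set_integral_eq_set_integral[OF set_integrable_element[OF T_open T_bounded cont(2)] nonneg(2)])
  also have "(\<Sum>F\<in>\<G>. \<integral>\<^sup>+z\<in>F. ennreal (g z) \<partial>face_measure F) = (\<Sum>F\<in>\<G>. ennreal (LINT z:F|face_measure F. g z))"
    by (intro sum.cong refl nn_set_integral_eq_set_integral[OF set_integrable_face_continuous[OF _ cont(1)] nonneg(1)] faces_flat)
  also have "\<dots> = ennreal (\<Sum>F\<in>\<G>. LINT z:F|face_measure F. g z)"
    using nonneg(1) by (intro sum_ennreal) (auto simp: set_lebesgue_integral_def intro!: integral_nonneg_AE)
  also have "ennreal (2 ^ (DIM('a) - 1) / (\<rho>\<^sup>2 * h)) * ennreal (LINT x:T|lborel. \<phi> x) =
      ennreal (2 ^ (DIM('a) - 1) / (\<rho>\<^sup>2 * h) * (LINT x:T|lborel. \<phi> x))"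
    using h_pos nonneg(2) by (intro ennreal_mult[symmetric]) (auto simp: set_lebesgue_integral_def intro!: integral_nonneg_AE)
  finally have "(\<Sum>F\<in>\<G>. LINT z:F|face_measure F. g z) \<le> 2 ^ (DIM('a) - 1) / (\<rho>\<^sup>2 * h) * (LINT x:T|lborel. \<phi> x)"
    by (rule ennreal_le_iff[THEN iffD1, rotated])
      (use h_pos nonneg(2) in \<open>auto simp: set_lebesgue_integral_def intro!: mult_nonneg_nonneg integral_nonneg_AE\<close>)
  then show ?thesis by (simp add: trace_const_def)
qed

text \<open>Along the rays, \<open>w\<close> is a univariate polynomial of degree at most \<open>m\<close>.\<close>

lemma polynomial_trace:
  assumes w: "w \<in> elem_polys m"
  shows "(\<Sum>F\<in>\<G>. LINT z:F|face_measure F. (w z)\<^sup>2) \<le> 2 * trace_const \<rho> DIM('a) * (real m + 1)\<^sup>2 / h * (LINT x:T|lborel. (w x)\<^sup>2)"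
proof -
  note cw = continuous_on_elem_polys[OF w]
  have "(\<Sum>F\<in>\<G>. LINT z:F|face_measure F. (w z)\<^sup>2) \<le> trace_const \<rho> DIM('a) / h * (LINT x:T|lborel. 2 * (real m + 1)\<^sup>2 * (w x)\<^sup>2)"
  proof (rule trace_bound)
    fix F z c assume "F \<in> \<G>" "z \<in> F" "c \<in> T"
    obtain q where q: "degree q \<le> m" "\<forall>t. w (c + t *\<^sub>R (z - c)) = poly q t"
      using polys_in_on_line[OF w[unfolded elem_polys_def] finite_Basis] by blast
    have "poly q 1 = w z" using q(2)[rule_format, of 1] by simp
    then show "ennreal ((w z)\<^sup>2) \<le> (\<integral>\<^sup>+r\<in>{1/2<..<1}. ennreal (2 * (real m + 1)\<^sup>2 * (w (c + r *\<^sub>R (z - c)))\<^sup>2) \<partial>lborel)"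
      using poly_endpoint_bound[OF q(1)] q(2) by simp
  qed (auto intro!: continuous_intros cw)
  also have "\<dots> = 2 * trace_const \<rho> DIM('a) * (real m + 1)\<^sup>2 / h * (LINT x:T|lborel. (w x)\<^sup>2)"
    by (simp only: set_integral_cmult) simp
  finally show ?thesis .
qed

text \<open>The partial derivatives have degree at most \<open>k\<close>, so the factor is that of degree \<open>k\<close> and not
  \<open>k + 1\<close>.\<close>

lemma gradient_trace:
  assumes p: "p \<in> elem_polys (k + 1)"
  shows "(\<Sum>F\<in>\<G>. LINT z:F|face_measure F. (norm (grad p z))\<^sup>2) \<le> 2 * trace_const \<rho> DIM('a) * (real k + 1)\<^sup>2 / h * elem_normsq T (grad p)"
proof -
  note cg = continuous_on_grad[OF p]
  have c: "continuous_on UNIV (\<lambda>x. (grad p x \<bullet> b)\<^sup>2)" for b by (intro continuous_intros cg)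
  have "(\<Sum>F\<in>\<G>. LINT z:F|face_measure F. (norm (grad p z))\<^sup>2) = (\<Sum>F\<in>\<G>. \<Sum>b\<in>Basis. LINT z:F|face_measure F. (grad p z \<bullet> b)\<^sup>2)"
    by (intro sum.cong refl set_integral_norm_square set_integrable_face_continuous[OF _ c] faces_flat)
  also have "\<dots> = (\<Sum>b\<in>Basis. \<Sum>F\<in>\<G>. LINT z:F|face_measure F. (grad p z \<bullet> b)\<^sup>2)"
    by (rule sum.swap)
  also have "\<dots> \<le> (\<Sum>b\<in>Basis. 2 * trace_const \<rho> DIM('a) * (real k + 1)\<^sup>2 / h * (LINT x:T|lborel. (grad p x \<bullet> b)\<^sup>2))"
  proof (rule sum_mono)
    fix b :: 'a assume "b \<in> Basis"
    from elem_polys_grad_component[OF p this] have "(\<lambda>x. grad p x \<bullet> b) \<in> elem_polys k" by simp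
    from polynomial_trace[OF this]
    show "(\<Sum>F\<in>\<G>. LINT z:F|face_measure F. (grad p z \<bullet> b)\<^sup>2) \<le> 2 * trace_const \<rho> DIM('a) * (real k + 1)\<^sup>2 / h * (LINT x:T|lborel. (grad p x \<bullet> b)\<^sup>2)" .
  qed
  also have "\<dots> = 2 * trace_const \<rho> DIM('a) * (real k + 1)\<^sup>2 / h * (LINT x:T|lborel. (norm (grad p x))\<^sup>2)"
    unfolding sum_distrib_left[symmetric]
    by (subst set_integral_norm_square) (auto intro: set_integrable_element[OF T_open T_bounded c])
  finally show ?thesis unfolding grad_form_eq_integral .
qed

lemma trace_inequality:
  assumes p: "p \<in> elem_polys m"
  shows "(\<Sum>F\<in>\<G>. face_normsq F p) \<le> trace_const \<rho> DIM('a) / h * (3 * elem_normsq T p + h\<^sup>2 * elem_normsq T (grad p))"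
proof -
  note cp = continuous_on_elem_polys[OF p] and cg = continuous_on_grad[OF p]
  have "(\<Sum>F\<in>\<G>. LINT z:F|face_measure F. (p z)\<^sup>2) \<le> trace_const \<rho> DIM('a) / h * (LINT x:T|lborel. 3 * (p x)\<^sup>2 + h\<^sup>2 * (norm (grad p x))\<^sup>2)"
  proof (rule trace_bound)
    fix F z c assume F: "F \<in> \<G>" and z: "z \<in> F" and c: "c \<in> T"
    have "z \<in> closure T" using faces_frontier[OF F] z by (auto simp: frontier_def)
    then have zc: "norm (z - c) \<le> h"
      using diameter_bounded_bound[of "closure T" z c] diameter_closure[OF T_bounded] T_bounded c closure_subset[of T]
      by (auto simp: dist_norm)
    let ?f = "\<lambda>r. p (c + r *\<^sub>R (z - c))" and ?f' = "\<lambda>r. grad p (c + r *\<^sub>R (z - c)) \<bullet> (z - c)"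
    have "continuous_on UNIV ?f'"
      by (intro continuous_intros continuous_on_compose2[OF cg]) auto
    from endpoint_bound_by_derivative[of ?f ?f', OF elem_polys_derivative_on_line[OF p] this]
    have "ennreal ((p z)\<^sup>2) \<le> (\<integral>\<^sup>+r\<in>{1/2<..<1}. ennreal (3 * (?f r)\<^sup>2 + (?f' r)\<^sup>2) \<partial>lborel)" by simp
    also have "\<dots> \<le> (\<integral>\<^sup>+r\<in>{1/2<..<1}. ennreal (3 * (?f r)\<^sup>2 + h\<^sup>2 * (norm (grad p (c + r *\<^sub>R (z - c))))\<^sup>2) \<partial>lborel)"
    proof (intro nn_integral_mono mult_right_mono ennreal_leI add_left_mono)
      fix r
      have "\<bar>?f' r\<bar> \<le> norm (grad p (c + r *\<^sub>R (z - c))) * norm (z - c)" by (rule Cauchy_Schwarz_ineq2)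
      also have "\<dots> \<le> norm (grad p (c + r *\<^sub>R (z - c))) * h" using zc by (intro mult_left_mono) auto
      finally have "\<bar>?f' r\<bar>\<^sup>2 \<le> (norm (grad p (c + r *\<^sub>R (z - c))) * h)\<^sup>2" by (intro power_mono) auto
      then show "(?f' r)\<^sup>2 \<le> h\<^sup>2 * (norm (grad p (c + r *\<^sub>R (z - c))))\<^sup>2" by (simp add: power_mult_distrib mult.commute)
    qed auto
    finally show "ennreal ((p z)\<^sup>2) \<le> (\<integral>\<^sup>+r\<in>{1/2<..<1}. ennreal (3 * (?f r)\<^sup>2 + h\<^sup>2 * (norm (grad p (c + r *\<^sub>R (z - c))))\<^sup>2) \<partial>lborel)" .
  qed (auto intro!: continuous_intros cp cg)
  also have "(LINT x:T|lborel. 3 * (p x)\<^sup>2 + h\<^sup>2 * (norm (grad p x))\<^sup>2) =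
      (LINT x:T|lborel. 3 * (p x)\<^sup>2) + (LINT x:T|lborel. h\<^sup>2 * (norm (grad p x))\<^sup>2)"
    by (intro set_integral_add set_integrable_element[OF T_open T_bounded] continuous_intros cp cg)
  also have "\<dots> = 3 * elem_normsq T p + h\<^sup>2 * elem_normsq T (grad p)"
    by (simp only: set_integral_cmult grad_form_eq_integral) (simp add: elem_inner_def power2_eq_square)
  finally show ?thesis by (simp add: face_inner_def power2_eq_square)
qed

lemma poincare_on_element:
  assumes p: "p \<in> elem_polys m"
  shows "\<exists>c. elem_normsq T (\<lambda>x. p x - c) \<le> poincare_const \<rho> DIM('a) * h\<^sup>2 * elem_normsq T (grad p)"
proof -
  obtain c where c: "(\<integral>\<^sup>+x\<in>T. ennreal ((p x - c)\<^sup>2) \<partial>lborel) \<le> ennreal (poincare_const \<rho> DIM('a) * h\<^sup>2) * (\<integral>\<^sup>+x\<in>T. ennreal ((norm (grad p x))\<^sup>2) \<partial>lborel)"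
    using poincare_connected_by_star_shaped[OF p T_open T_bounded T_nonempty \<rho> conn] by blast
  have "(\<integral>\<^sup>+x\<in>T. ennreal ((p x - c)\<^sup>2) \<partial>lborel) = ennreal (LINT x:T|lborel. (p x - c)\<^sup>2)"
    by (intro nn_set_integral_eq_set_integral set_integrable_element[OF T_open T_bounded] continuous_intros continuous_on_elem_polys[OF p]) simp
  moreover have "(\<integral>\<^sup>+x\<in>T. ennreal ((norm (grad p x))\<^sup>2) \<partial>lborel) = ennreal (LINT x:T|lborel. (norm (grad p x))\<^sup>2)"
    by (intro nn_set_integral_eq_set_integral set_integrable_element[OF T_open T_bounded] continuous_intros continuous_on_grad[OF p]) simp
  moreover have n: "0 \<le> poincare_const \<rho> DIM('a) * h\<^sup>2" "0 \<le> elem_normsq T (grad p)"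
    using poincare_const_pos[OF \<rho>, of "DIM('a)"] elem_inner_nonneg by auto
  ultimately have "ennreal (LINT x:T|lborel. (p x - c)\<^sup>2) \<le> ennreal (poincare_const \<rho> DIM('a) * h\<^sup>2 * elem_normsq T (grad p))"
    using c unfolding grad_form_eq_integral[symmetric] by (simp only: ennreal_mult[OF n])
  then have "(LINT x:T|lborel. (p x - c)\<^sup>2) \<le> poincare_const \<rho> DIM('a) * h\<^sup>2 * elem_normsq T (grad p)"
    by (rule ennreal_le_iff[THEN iffD1, rotated]) (rule mult_nonneg_nonneg[OF n])
  then show ?thesis by (intro exI[of _ c]) (simp add: elem_inner_def power2_eq_square)
qed

text \<open>Among all constants, the mean value is the best one.\<close>

lemma poincare_zero_mean:
  assumes p: "p \<in> elem_polys m" and mean: "elem_inner T p (\<lambda>x. 1) = 0"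
  shows "elem_normsq T p \<le> poincare_const \<rho> DIM('a) * h\<^sup>2 * elem_normsq T (grad p)"
proof -
  obtain c where c: "elem_normsq T (\<lambda>x. p x - c) \<le> poincare_const \<rho> DIM('a) * h\<^sup>2 * elem_normsq T (grad p)"
    using poincare_on_element[OF p] by blast
  note cp = continuous_on_elem_polys[OF p]
  have lin: "elem_inner T (\<lambda>x. p x - c) g = elem_inner T p g - c * elem_inner T (\<lambda>x. 1) g" if "continuous_on UNIV g" for g
    using elem_inner_lincomb_left[OF T_open T_bounded cp continuous_on_const that, of 1 "- c" 1] by simp
  have "elem_normsq T (\<lambda>x. p x - c) = elem_inner T p (\<lambda>x. p x - c) - c * elem_inner T (\<lambda>x. 1) (\<lambda>x. p x - c)"
    by (intro lin continuous_intros cp)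
  also have "\<dots> = elem_inner T (\<lambda>x. p x - c) p - c * elem_inner T (\<lambda>x. p x - c) (\<lambda>x. 1)"
    by (simp only: elem_inner_commute[of T p] elem_inner_commute[of T "\<lambda>x. 1"])
  also have "\<dots> = elem_normsq T p + c\<^sup>2 * elem_inner T (\<lambda>x. 1) (\<lambda>x. 1 :: real)"
    using mean elem_inner_commute[of T p "\<lambda>x. 1"] by (simp add: lin[OF cp] lin[OF continuous_on_const] power2_eq_square)
  finally show ?thesis using c mult_nonneg_nonneg[OF zero_le_power2[of c] elem_inner_nonneg[of T "\<lambda>x. 1::real"]] by linarith
qed

text \<open>Testing the definition of the potential with the potential itself and absorbing the normal
  derivative by the trace inequality for polynomials of degree \<open>k\<close>.\<close>

lemma boundary_potential_energy:
  assumes u: "u \<in> bdry_polys \<G> k"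
  defines "p \<equiv> potential T \<G> k (0, u)"
  shows "elem_normsq T (grad p) \<le> 2 * trace_const \<rho> DIM('a) * (real k + 1)\<^sup>2 / h * bdry_inner \<G> u u"
proof -
  let ?G = "elem_normsq T (grad p)"
  \<comment> \<open>Weight of Young's inequality, chosen such that half of the energy of \<open>p\<close> can be absorbed.\<close>
  define K where "K = 2 * trace_const \<rho> DIM('a) * (real k + 1)\<^sup>2 / h"
  have K: "0 < K" using trace_const_pos[OF \<rho>, of "DIM('a)"] h_pos by (auto simp: K_def intro!: divide_pos_pos mult_pos_pos)
  have ch: "continuous_hybrid \<G> (0, u)" using hybrid_space_continuous[OF hybrid_pair_mem(3)[OF u]] .
  have p: "p \<in> elem_polys (k + 1)" "?G = potential_rhs T \<G> (0, u) p"
    using potential_is_potential[OF ch, of k] by (auto simp: is_potential_def p_def)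
  note cg = continuous_on_grad[OF p(1)]
  have "?G = (\<Sum>F\<in>\<G>. face_inner F (u F) (\<lambda>x. grad p x \<bullet> outer_normal T F x))"
    using p(2) by (simp add: potential_rhs_def bdry_inner_def elem_inner_def set_lebesgue_integral_def)
  also have "\<dots> \<le> (\<Sum>F\<in>\<G>. K / 2 * face_normsq F (u F) + 1 / (2 * K) * (LINT z:F|face_measure F. (norm (grad p z))\<^sup>2))"
  proof (rule sum_mono)
    fix F assume F: "F \<in> \<G>"
    have cu: "continuous_on UNIV (u F)" using ch F by (simp add: continuous_hybrid_def)
    have dimF: "aff_dim F = int DIM('a) - 1" using faces_flat[OF F] by (simp add: flat_face_def)
    have int: "set_integrable (face_measure F) F (\<lambda>x. K / 2 * (u F x)\<^sup>2)" "set_integrable (face_measure F) F (\<lambda>x. 1 / (2 * K) * (norm (grad p x))\<^sup>2)"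
      by (intro set_integrable_face_continuous[OF faces_flat[OF F]] continuous_intros cu cg)+
    have "face_inner F (u F) (\<lambda>x. grad p x \<bullet> outer_normal T F x) = (LINT x:F|face_measure F. (grad p x \<bullet> outer_normal T F x) * u F x)"
      by (simp add: face_inner_def mult.commute)
    also have "\<dots> \<le> (LINT x:F|face_measure F. K / 2 * (u F x)\<^sup>2 + 1 / (2 * K) * (norm (grad p x))\<^sup>2)"
    proof (rule set_integral_mono[OF normal_integrable[OF F cu cg] set_integral_add(1)[OF int]])
      fix x
      have "\<bar>grad p x \<bullet> outer_normal T F x\<bar> \<le> norm (grad p x) * norm (outer_normal T F x)" by (rule Cauchy_Schwarz_ineq2)
      also have "\<dots> \<le> norm (grad p x) * 1" using outer_normal_measurable(2)[OF dimF T_open, of x] by (intro mult_left_mono) auto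
      finally have "(grad p x \<bullet> outer_normal T F x)\<^sup>2 \<le> (norm (grad p x))\<^sup>2" by (intro abs_le_square_iff[THEN iffD1]) simp
      moreover have "(grad p x \<bullet> outer_normal T F x) * u F x \<le> K / 2 * (u F x)\<^sup>2 + 1 / (2 * K) * (grad p x \<bullet> outer_normal T F x)\<^sup>2"
      proof -
        have "0 \<le> (K * u F x - (grad p x \<bullet> outer_normal T F x))\<^sup>2 / (2 * K)" using K by simp
        also have "\<dots> = K / 2 * (u F x)\<^sup>2 + 1 / (2 * K) * (grad p x \<bullet> outer_normal T F x)\<^sup>2 - (grad p x \<bullet> outer_normal T F x) * u F x"
          using K by (simp add: power2_eq_square field_simps)
        finally show ?thesis by simp
      qed
      moreover have "0 \<le> 1 / (2 * K)" using K by simp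
      ultimately show "(grad p x \<bullet> outer_normal T F x) * u F x \<le> K / 2 * (u F x)\<^sup>2 + 1 / (2 * K) * (norm (grad p x))\<^sup>2"
        using mult_left_mono[of "(grad p x \<bullet> outer_normal T F x)\<^sup>2" "(norm (grad p x))\<^sup>2" "1 / (2 * K)"] by linarith
    qed
    also have "\<dots> = K / 2 * face_normsq F (u F) + 1 / (2 * K) * (LINT z:F|face_measure F. (norm (grad p z))\<^sup>2)"
      unfolding set_integral_add(2)[OF int] set_integral_cmult by (simp add: face_inner_def power2_eq_square)
    finally show "face_inner F (u F) (\<lambda>x. grad p x \<bullet> outer_normal T F x) \<le>
        K / 2 * face_normsq F (u F) + 1 / (2 * K) * (LINT z:F|face_measure F. (norm (grad p z))\<^sup>2)" .
  qed
  also have "\<dots> = K / 2 * bdry_inner \<G> u u + 1 / (2 * K) * (\<Sum>F\<in>\<G>. LINT z:F|face_measure F. (norm (grad p z))\<^sup>2)"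
    by (simp add: bdry_inner_def sum.distrib sum_distrib_left)
  also have "\<dots> \<le> K / 2 * bdry_inner \<G> u u + 1 / (2 * K) * (K * ?G)"
    using gradient_trace[OF p(1)] K unfolding K_def[symmetric] by (intro add_left_mono mult_left_mono) auto
  finally have "?G \<le> K * bdry_inner \<G> u u" using K by simp
  then show ?thesis by (simp add: K_def)
qed

lemma zero_mean_trace:
  assumes p: "p \<in> elem_polys m" and *: "elem_normsq T (\<lambda>x. p x - c) \<le> poincare_const \<rho> DIM('a) * h\<^sup>2 * elem_normsq T (grad p)"
  shows "(\<Sum>F\<in>\<G>. face_normsq F (\<lambda>x. p x - c)) \<le> (potential_const \<rho> DIM('a) - 1) * h * elem_normsq T (grad p)"
proof -
  let ?p = "\<lambda>x. p x - c"
  have p': "?p \<in> elem_polys m" using elem_polys_add[OF p const_in_elem_polys[of "- c"]] by simp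
  have g: "grad ?p = grad p"
    using grad_lincomb[OF p const_in_elem_polys, of 1 1 "- c"] by (auto simp: grad_const)
  have "(\<Sum>F\<in>\<G>. face_normsq F ?p) \<le> trace_const \<rho> DIM('a) / h * (3 * elem_normsq T ?p + h\<^sup>2 * elem_normsq T (grad p))"
    using trace_inequality[OF p'] unfolding g .
  also have "\<dots> \<le> trace_const \<rho> DIM('a) / h * (3 * (poincare_const \<rho> DIM('a) * h\<^sup>2 * elem_normsq T (grad p)) + h\<^sup>2 * elem_normsq T (grad p))"
    using * trace_const_pos[OF \<rho>, of "DIM('a)"] h_pos by (intro mult_left_mono) auto
  also have "\<dots> = (potential_const \<rho> DIM('a) - 1) * h * elem_normsq T (grad p)"
    using h_pos by (simp add: potential_const_def field_simps power2_eq_square)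
  finally show ?thesis .
qed

text \<open>The potential of \<open>(0, u)\<close> has mean value zero, so its trace is bounded by its energy, and the boundary
  difference by its trace and \<open>u\<close>.\<close>

lemma boundary_energy_bound:
  assumes u: "u \<in> bdry_polys \<G> k" and S4: "stab_S4 Cs T \<G> k l s" and Cs: "0 < Cs"
  shows "local_form T \<G> k s (0, u) (0, u) \<le> Cs * (4 * potential_const \<rho> DIM('a) * trace_const \<rho> DIM('a) + 2) * (real k + 1)\<^sup>2 * inverse h * bdry_inner \<G> u u"
proof -
  define p where "p = potential T \<G> k (0, u)"
  define E where "E = elem_normsq T (grad p)"
  define N where "N = bdry_inner \<G> u u"
  have N: "0 \<le> N" unfolding N_def bdry_inner_def by (intro sum_nonneg face_inner_nonneg)
  have E0: "0 \<le> E" unfolding E_def by (rule elem_inner_nonneg)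
  have mem: "(0, u) \<in> hybrid_space \<G> k l" by (rule hybrid_pair_mem(3)[OF u])
  have ch: "continuous_hybrid \<G> (0, u)" by (rule hybrid_space_continuous[OF mem])
  have p: "p \<in> elem_polys (k + 1)" unfolding p_def by (rule potential_in_elem_polys[OF ch])
  have E: "E \<le> 2 * trace_const \<rho> DIM('a) * (real k + 1)\<^sup>2 / h * N" unfolding E_def N_def p_def by (rule boundary_potential_energy[OF u])
  have "elem_inner T (\<lambda>x. - p x) (\<lambda>x. 1) = 0"
    using potential_is_potential[OF ch, of k] by (simp add: is_potential_def p_def)
  then have mean: "elem_inner T p (\<lambda>x. 1) = 0" by (simp add: elem_inner_def set_lebesgue_integral_def)
  have tr: "(\<Sum>F\<in>\<G>. face_normsq F p) \<le> (potential_const \<rho> DIM('a) - 1) * h * E"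
    using zero_mean_trace[OF p, of 0] poincare_zero_mean[OF p mean] by (simp add: E_def)
  have "bdry_inner \<G> (bdry_difference T \<G> k (0, u)) (bdry_difference T \<G> k (0, u)) \<le> (\<Sum>F\<in>\<G>. 2 * face_normsq F p + 2 * face_normsq F (u F))"
    unfolding bdry_inner_def
  proof (rule sum_mono)
    fix F assume F: "F \<in> \<G>"
    have cu: "continuous_on UNIV (u F)" using ch F by (simp add: continuous_hybrid_def)
    have cpu: "continuous_on UNIV (\<lambda>x. p x - u F x)" by (intro continuous_on_diff cu continuous_on_elem_polys[OF p])
    have "face_normsq F (bdry_difference T \<G> k (0, u) F) \<le> face_normsq F (\<lambda>x. p x - u F x)"
      using face_proj_contraction[OF faces_flat[OF F] cpu] F by (simp add: bdry_difference_def bdry_proj_def p_def)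
    also have "\<dots> \<le> 2 * face_normsq F p + 2 * face_normsq F (u F)"
    proof (rule face_inner_square_le[OF faces_flat[OF F] continuous_on_elem_polys[OF p] cu])
      show "(p x - u F x)\<^sup>2 \<le> 2 * (p x)\<^sup>2 + 2 * (u F x)\<^sup>2" for x
        using zero_le_power2[of "p x + u F x"] by (simp add: power2_eq_square algebra_simps)
    qed
    finally show "face_normsq F (bdry_difference T \<G> k (0, u) F) \<le> 2 * face_normsq F p + 2 * face_normsq F (u F)" .
  qed
  also have "\<dots> = 2 * (\<Sum>F\<in>\<G>. face_normsq F p) + 2 * N"
    by (simp add: N_def bdry_inner_def sum.distrib sum_distrib_left)
  also have "\<dots> \<le> 2 * ((potential_const \<rho> DIM('a) - 1) * h * E) + 2 * N" using tr by simp
  finally have "(bdry_norm \<G> (bdry_difference T \<G> k (0, u)))\<^sup>2 \<le> 2 * ((potential_const \<rho> DIM('a) - 1) * h * E) + 2 * N"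
    unfolding bdry_norm_sq .
  then have "inverse h * (bdry_norm \<G> (bdry_difference T \<G> k (0, u)))\<^sup>2 \<le> inverse h * (2 * ((potential_const \<rho> DIM('a) - 1) * h * E) + 2 * N)"
    using h_pos by (intro mult_left_mono) auto
  also have "\<dots> = 2 * (potential_const \<rho> DIM('a) - 1) * E + 2 * inverse h * N" using h_pos by (simp add: field_simps)
  finally have "E + inverse h * (bdry_norm \<G> (bdry_difference T \<G> k (0, u)))\<^sup>2 \<le> 2 * potential_const \<rho> DIM('a) * E + 2 * inverse h * N"
    using E0 by (simp add: algebra_simps)
  also have "\<dots> \<le> 2 * potential_const \<rho> DIM('a) * (2 * trace_const \<rho> DIM('a) * (real k + 1)\<^sup>2 / h * N) + 2 * (real k + 1)\<^sup>2 * inverse h * N"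
  proof (rule add_mono)
    show "2 * potential_const \<rho> DIM('a) * E \<le> 2 * potential_const \<rho> DIM('a) * (2 * trace_const \<rho> DIM('a) * (real k + 1)\<^sup>2 / h * N)"
      using E potential_const_ge_one[OF \<rho>, of "DIM('a)"] by (intro mult_left_mono) auto
    have "1 \<le> (real k + 1)\<^sup>2" by (simp add: one_le_power)
    then have "inverse h * N \<le> (real k + 1)\<^sup>2 * (inverse h * N)"
      using N h_pos mult_right_mono[of 1 "(real k + 1)\<^sup>2" "inverse h * N"] by simp
    then show "2 * inverse h * N \<le> 2 * (real k + 1)\<^sup>2 * inverse h * N" by (simp add: mult.assoc)
  qed
  also have "\<dots> = (4 * potential_const \<rho> DIM('a) * trace_const \<rho> DIM('a) + 2) * (real k + 1)\<^sup>2 * inverse h * N"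
    by (simp add: algebra_simps divide_inverse)
  finally have "Cs * (E + inverse h * (bdry_norm \<G> (bdry_difference T \<G> k (0, u)))\<^sup>2) \<le> Cs * ((4 * potential_const \<rho> DIM('a) * trace_const \<rho> DIM('a) + 2) * (real k + 1)\<^sup>2 * inverse h * N)"
    using Cs by (intro mult_left_mono) auto
  moreover have "local_form T \<G> k s (0, u) (0, u) \<le> Cs * (E + inverse h * (bdry_norm \<G> (bdry_difference T \<G> k (0, u)))\<^sup>2)"
    using S4 mem unfolding stab_S4_def E_def p_def elem_norm_sq by simp
  ultimately show ?thesis by (simp add: N_def mult.assoc)
qed

text \<open>The boundary unknown and the constants are in the range of the projection, so the part of the
  difference that the projection loses is at most the trace of the potential minus a constant, which is bounded
  by the Poincare inequality.\<close>

lemma potential_boundary_gap: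
  assumes v: "v \<in> hybrid_space \<G> k l" and S3: "stab_S3 Cs T \<G> k l s"
  defines "p \<equiv> potential T \<G> k v"
  shows "elem_normsq T (grad p) + inverse h * (\<Sum>F\<in>\<G>. face_normsq F (\<lambda>x. p x - snd v F x))
    \<le> potential_const \<rho> DIM('a) * Cs * local_form T \<G> k s v v"
proof -
  define E where "E = elem_normsq T (grad p)"
  define N where "N = (\<Sum>F\<in>\<G>. face_normsq F (\<lambda>x. p x - snd v F x))"
  define D where "D = (bdry_norm \<G> (bdry_difference T \<G> k v))\<^sup>2"
  have CL: "1 \<le> potential_const \<rho> DIM('a)" by (rule potential_const_ge_one[OF \<rho>])
  have ch: "continuous_hybrid \<G> v" by (rule hybrid_space_continuous[OF v])
  have p: "p \<in> elem_polys (k + 1)" unfolding p_def by (rule potential_in_elem_polys[OF ch])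
  obtain c where c: "elem_normsq T (\<lambda>x. p x - c) \<le> poincare_const \<rho> DIM('a) * h\<^sup>2 * E"
    using poincare_on_element[OF p] unfolding E_def by blast
  have "N \<le> (\<Sum>F\<in>\<G>. face_normsq F (\<lambda>x. p x - c) + face_normsq F (bdry_difference T \<G> k v F))"
    unfolding N_def
  proof (rule sum_mono)
    fix F assume F: "F \<in> \<G>"
    let ?g = "\<lambda>x. p x - snd v F x"
    have u: "snd v F \<in> face_polys F k" using v F by (auto simp: hybrid_space_def bdry_polys_def)
    have cg: "continuous_on UNIV ?g" by (intro continuous_on_diff continuous_on_face_polys[OF u] continuous_on_elem_polys[OF p])
    have z: "(\<lambda>x. 0) \<in> face_polys F k" and r: "(\<lambda>x. c - snd v F x) \<in> face_polys F k"
      using u unfolding face_polys_def by (intro zero_in_polys_in polys_in_diff const_in_polys_in; assumption)+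
    have "face_normsq F ?g = face_normsq F (\<lambda>x. ?g x - face_proj F k ?g x) + face_normsq F (face_proj F k ?g)"
      using face_proj_pythagoras[OF faces_flat[OF F] cg z] by simp
    moreover have "face_normsq F (\<lambda>x. ?g x - face_proj F k ?g x) \<le> face_normsq F (\<lambda>x. p x - c)"
      using face_proj_best_approximation[OF faces_flat[OF F] cg r] by simp
    moreover have "bdry_difference T \<G> k v F = face_proj F k ?g"
      using F by (simp add: bdry_difference_def bdry_proj_def p_def)
    ultimately show "face_normsq F ?g \<le> face_normsq F (\<lambda>x. p x - c) + face_normsq F (bdry_difference T \<G> k v F)"
      by simp
  qed
  also have "\<dots> = (\<Sum>F\<in>\<G>. face_normsq F (\<lambda>x. p x - c)) + D"
    unfolding D_def bdry_norm_sq by (simp add: bdry_inner_def sum.distrib)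
  also have "\<dots> \<le> (potential_const \<rho> DIM('a) - 1) * h * E + D" using zero_mean_trace[OF p c[unfolded E_def]] by (simp add: E_def)
  finally have "inverse h * N \<le> inverse h * ((potential_const \<rho> DIM('a) - 1) * h * E + D)" using h_pos by (intro mult_left_mono) auto
  also have "\<dots> = (potential_const \<rho> DIM('a) - 1) * E + inverse h * D" using h_pos by (simp add: field_simps)
  finally have "E + inverse h * N \<le> potential_const \<rho> DIM('a) * E + inverse h * D" by (simp add: algebra_simps)
  also have "\<dots> \<le> potential_const \<rho> DIM('a) * (E + inverse h * D)"
    using CL h_pos mult_right_mono[of 1 "potential_const \<rho> DIM('a)" "inverse h * D"] by (simp add: distrib_left D_def)
  also have "\<dots> \<le> potential_const \<rho> DIM('a) * (Cs * local_form T \<G> k s v v)"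
    using S3 v CL unfolding stab_S3_def E_def D_def p_def elem_norm_sq by (intro mult_left_mono) auto
  finally show ?thesis unfolding E_def N_def by (simp add: mult.assoc)
qed

end


section \<open>Discrete Poincare inequality on the mesh\<close>

locale star_shaped_mesh = arranged_mesh +
  fixes \<rho> :: real
  assumes \<rho>: "0 < \<rho>" and star_shaped_elements: "T \<in> \<T> \<Longrightarrow> connected_by_star_shaped \<rho> T"
begin

text \<open>A generic line through the bounded element meets its frontier, and does so in a face.\<close>

lemma faces_of_nonempty:
  assumes T: "T \<in> \<T>"
  shows "faces_of \<F> T \<noteq> {}"
proof -
  obtain \<eta> where \<eta>: "transversal \<A> \<eta>" using transversal_exists by blast
  have "\<exists>x\<in>T. \<forall>t. generic \<A> (x + t *\<^sub>R \<eta>)"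
    by (rule open_has_generic_line[OF \<eta> element_open[OF T] element_nonempty[OF T]]) blast
  then obtain x where x: "x \<in> T" "\<And>t. generic \<A> (x + t *\<^sub>R \<eta>)" by blast
  obtain b where b: "0 < b" "\<And>y. y \<in> T \<Longrightarrow> norm y \<le> b" using element_bounded[OF T] by (auto simp: bounded_pos)
  have n: "norm \<eta> = 1" using \<eta> by (simp add: transversal_def)
  have "norm (x + (2 * b + 1) *\<^sub>R \<eta>) \<ge> norm ((2 * b + 1) *\<^sub>R \<eta>) - norm x"
    using norm_triangle_ineq2[of "(2 * b + 1) *\<^sub>R \<eta>" "- x"] by (simp add: add.commute)
  moreover have "norm ((2 * b + 1) *\<^sub>R \<eta>) = 2 * b + 1" using b(1) n by simp
  ultimately have out: "x + (2 * b + 1) *\<^sub>R \<eta> \<notin> T"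
    using b(2)[OF x(1)] b(2)[of "x + (2 * b + 1) *\<^sub>R \<eta>"] by linarith
  let ?S = "range (\<lambda>t. x + t *\<^sub>R \<eta>)"
  have "connected ?S" by (intro connected_continuous_image continuous_intros connected_UNIV)
  moreover have "?S \<inter> T \<noteq> {}" using x(1) rangeI[of "\<lambda>t. x + t *\<^sub>R \<eta>" 0] by auto
  moreover have "?S - T \<noteq> {}" using out by auto
  ultimately have "?S \<inter> frontier T \<noteq> {}" by (rule connected_Int_frontier)
  then obtain t where t: "x + t *\<^sub>R \<eta> \<in> frontier T" by blast
  obtain F where "F \<in> \<F>" "F \<subseteq> frontier T" using generic_frontier_face[OF x(2) T t] .
  then show ?thesis by (auto simp: faces_of_def)
qed

lemma star_shaped_element:
  assumes T: "T \<in> \<T>"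
  shows "star_shaped_element T (faces_of \<F> T) \<rho>"
proof
  show "disjoint (faces_of \<F> T)" using disjoint_faces by (rule pairwise_subset) (auto simp: faces_of_def)
qed (use T element_open element_bounded element_nonempty finite_faces faces_of_nonempty face_flat \<rho> star_shaped_elements
     in \<open>auto simp: faces_of_def\<close>)

lemma diameter_le_domain: "T \<in> \<T> \<Longrightarrow> diameter T \<le> diameter \<Omega>"
  using diameter_subset[OF element_subset_closure_domain bounded_closure[OF domain_bounded]] diameter_closure[OF domain_bounded] by simp

lemma diameter_pos: "T \<in> \<T> \<Longrightarrow> 0 < diameter T"
  using diameter_open_pos element_open element_bounded element_nonempty by blast

lemma sum_elements_faces: "(\<Sum>T\<in>\<T>. \<Sum>F\<in>faces_of \<F> T. g T F) = (\<Sum>F\<in>\<F>. \<Sum>T\<in>sides F. g T F)"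
  unfolding faces_of_def by (rule sum.swap_restrict[OF finite_elements finite_faces])

text \<open>The broken Poincare inequality for the squares \<open>p\<^sup>2\<close> and \<open>u\<^sup>2\<close>. The part of the right-hand side
  that contains \<open>p\<^sup>2\<close> itself gets the small factor \<open>\<epsilon>\<close> and is absorbed.\<close>

lemma broken_potential_bound:
  fixes p :: "'a set \<Rightarrow> 'a \<Rightarrow> real" and u :: "'a set \<Rightarrow> 'a \<Rightarrow> real"
  assumes p: "\<And>T. T \<in> \<T> \<Longrightarrow> p T \<in> elem_polys m" and u: "\<And>F. F \<in> \<F> \<Longrightarrow> continuous_on UNIV (u F)"
    and u0: "\<And>F. F \<in> \<F> \<Longrightarrow> F \<notin> interior_faces \<T> \<F> \<Longrightarrow> u F = 0"
  defines "Ct \<equiv> trace_const \<rho> DIM('a)" and "D \<equiv> diameter \<Omega>" and "L \<equiv> diameter \<Omega> + 1"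
  defines "\<epsilon> \<equiv> 1 / (2 * L * (1 + 3 * Ct))"
  defines "M \<equiv> 1 / \<epsilon> + \<epsilon> * Ct * D\<^sup>2 + D"
  shows "(\<Sum>T\<in>\<T>. elem_normsq T (p T)) \<le> 2 * L * M * (\<Sum>T\<in>\<T>. elem_normsq T (grad (p T)) +
    inverse (diameter T) * (\<Sum>F\<in>faces_of \<F> T. face_normsq F (\<lambda>x. p T x - u F x)))"
proof -
  obtain \<eta> where \<eta>: "transversal \<A> \<eta>" using transversal_exists by blast
  have n: "norm \<eta> = 1" using \<eta> by (simp add: transversal_def)
  have D0: "0 \<le> D" unfolding D_def by (rule diameter_ge_0[OF domain_bounded])
  have L0: "0 < L" using D0 by (simp add: L_def D_def)
  have Ct0: "0 < Ct" unfolding Ct_def by (rule trace_const_pos[OF \<rho>])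
  have e0: "0 < \<epsilon>" using L0 Ct0 by (simp add: \<epsilon>_def)
  have M0: "0 \<le> M" using e0 Ct0 D0 by (simp add: M_def)
  \<comment> \<open>A ray of this length leaves the domain.\<close>
  have out: "x + L *\<^sub>R \<eta> \<notin> closure \<Omega>" if "x \<in> closure \<Omega>" for x
  proof
    assume "x + L *\<^sub>R \<eta> \<in> closure \<Omega>"
    then have "dist (x + L *\<^sub>R \<eta>) x \<le> diameter (closure \<Omega>)"
      using diameter_bounded_bound[OF bounded_closure[OF domain_bounded]] that by blast
    then show False using L0 n diameter_closure[OF domain_bounded] by (simp add: dist_norm L_def)
  qed
  define P where "P T = elem_normsq T (p T)" for T
  define G where "G T = elem_normsq T (grad (p T))" for T
  define S where "S T = (\<Sum>F\<in>faces_of \<F> T. face_normsq F (p T))" for T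
  define N where "N T = (\<Sum>F\<in>faces_of \<F> T. face_normsq F (\<lambda>x. p T x - u F x))" for T
  define b where "b T F = \<epsilon> * diameter T * face_normsq F (p T) +
    (1 + 1 / (\<epsilon> * diameter T)) * face_normsq F (\<lambda>x. p T x - u F x)" for T F
  have nonneg: "0 \<le> P T" "0 \<le> G T" "0 \<le> S T" "0 \<le> N T" for T
    unfolding P_def G_def S_def N_def by (intro sum_nonneg elem_inner_nonneg face_inner_nonneg)+
  have b_nonneg: "0 \<le> b T F" if "T \<in> \<T>" for T F
    unfolding b_def using e0 diameter_pos[OF that] by (intro add_nonneg_nonneg mult_nonneg_nonneg face_inner_nonneg) auto
  have cp: "continuous_on UNIV (p T)" and cg: "continuous_on UNIV (grad (p T))" if "T \<in> \<T>" for T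
    using continuous_on_elem_polys[OF p[OF that]] continuous_on_grad[OF p[OF that]] by auto
  have I0: "(\<integral>\<^sup>+x\<in>T. ennreal ((p T x)\<^sup>2) \<partial>lborel) = ennreal (P T)" if T: "T \<in> \<T>" for T
    using nn_set_integral_eq_set_integral[OF set_integrable_element[OF element_open[OF T] element_bounded[OF T], of "\<lambda>x. (p T x)\<^sup>2"]] cp[OF T]
    by (simp add: P_def elem_inner_def power2_eq_square continuous_on_mult)
  have I1: "(\<integral>\<^sup>+x\<in>T. ennreal \<bar>2 * p T x * (grad (p T) x \<bullet> \<eta>)\<bar> \<partial>lborel) \<le> ennreal (\<epsilon> * P T + 1 / \<epsilon> * G T)" if T: "T \<in> \<T>" for T
  proof -
    note int = set_integrable_element[OF element_open[OF T] element_bounded[OF T]]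
    have i: "set_integrable lborel T (\<lambda>x. \<epsilon> * (p T x)\<^sup>2)" "set_integrable lborel T (\<lambda>x. 1 / \<epsilon> * (norm (grad (p T) x))\<^sup>2)"
      by (intro int continuous_intros cp[OF T] cg[OF T])+
    have "(\<integral>\<^sup>+x\<in>T. ennreal \<bar>2 * p T x * (grad (p T) x \<bullet> \<eta>)\<bar> \<partial>lborel) \<le> (\<integral>\<^sup>+x\<in>T. ennreal (\<epsilon> * (p T x)\<^sup>2 + 1 / \<epsilon> * (norm (grad (p T) x))\<^sup>2) \<partial>lborel)"
    proof (intro nn_integral_mono mult_right_mono ennreal_leI)
      fix x
      have g: "\<bar>grad (p T) x \<bullet> \<eta>\<bar> \<le> norm (grad (p T) x)" using Cauchy_Schwarz_ineq2[of "grad (p T) x" \<eta>] n by simp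
      have "\<bar>2 * p T x * (grad (p T) x \<bullet> \<eta>)\<bar> = 2 * \<bar>p T x\<bar> * \<bar>grad (p T) x \<bullet> \<eta>\<bar>" by (simp add: abs_mult)
      also have "\<dots> \<le> 2 * \<bar>p T x\<bar> * norm (grad (p T) x)" using g by (intro mult_left_mono) auto
      also have "\<dots> \<le> \<epsilon> * (p T x)\<^sup>2 + 1 / \<epsilon> * (norm (grad (p T) x))\<^sup>2"
      proof -
        have "0 \<le> (\<epsilon> * \<bar>p T x\<bar> - norm (grad (p T) x))\<^sup>2 / \<epsilon>" using e0 by simp
        also have "\<dots> = \<epsilon> * (p T x)\<^sup>2 + 1 / \<epsilon> * (norm (grad (p T) x))\<^sup>2 - 2 * \<bar>p T x\<bar> * norm (grad (p T) x)"
          using e0 by (simp add: power2_diff power_mult_distrib field_simps power2_eq_square)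
        finally show ?thesis by simp
      qed
      finally show "\<bar>2 * p T x * (grad (p T) x \<bullet> \<eta>)\<bar> \<le> \<epsilon> * (p T x)\<^sup>2 + 1 / \<epsilon> * (norm (grad (p T) x))\<^sup>2" .
    qed auto
    also have "\<dots> = ennreal (LINT x:T|lborel. \<epsilon> * (p T x)\<^sup>2 + 1 / \<epsilon> * (norm (grad (p T) x))\<^sup>2)"
      using e0 by (intro nn_set_integral_eq_set_integral set_integral_add(1)[OF i]) auto
    also have "(LINT x:T|lborel. \<epsilon> * (p T x)\<^sup>2 + 1 / \<epsilon> * (norm (grad (p T) x))\<^sup>2) = \<epsilon> * P T + 1 / \<epsilon> * G T"
      unfolding set_integral_add(2)[OF i] set_integral_cmult
      by (simp add: P_def G_def elem_inner_def power2_norm_eq_inner) (simp add: power2_eq_square)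
    finally show ?thesis .
  qed
  have I2: "(\<integral>\<^sup>+z\<in>F. ennreal \<bar>(p T z)\<^sup>2 - (u F z)\<^sup>2\<bar> \<partial>face_measure F) \<le> ennreal (b T F)" if T: "T \<in> \<T>" and F: "F \<in> \<F>" for T F
  proof -
    define \<beta> where "\<beta> = \<epsilon> * diameter T"
    have b0: "0 < \<beta>" using e0 diameter_pos[OF T] by (simp add: \<beta>_def)
    have i: "set_integrable (face_measure F) F (\<lambda>x. \<beta> * (p T x)\<^sup>2)" "set_integrable (face_measure F) F (\<lambda>x. (1 + 1 / \<beta>) * (p T x - u F x)\<^sup>2)"
      by (intro set_integrable_face_continuous[OF face_flat[OF F]] continuous_intros cp[OF T] u[OF F])+
    have "(\<integral>\<^sup>+z\<in>F. ennreal \<bar>(p T z)\<^sup>2 - (u F z)\<^sup>2\<bar> \<partial>face_measure F) \<le> (\<integral>\<^sup>+z\<in>F. ennreal (\<beta> * (p T z)\<^sup>2 + (1 + 1 / \<beta>) * (p T z - u F z)\<^sup>2) \<partial>face_measure F)"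
    proof (intro nn_integral_mono mult_right_mono ennreal_leI)
      fix z
      define x where "x = p T z"
      define d where "d = p T z - u F z"
      have "0 \<le> (\<beta> * \<bar>x\<bar> - \<bar>d\<bar>)\<^sup>2 / \<beta>" using b0 by simp
      also have "\<dots> = \<beta> * x\<^sup>2 + 1 / \<beta> * d\<^sup>2 - 2 * \<bar>x * d\<bar>"
        using b0 by (simp add: power2_diff power_mult_distrib field_simps power2_eq_square abs_mult)
      finally have "2 * \<bar>x * d\<bar> + d\<^sup>2 \<le> \<beta> * x\<^sup>2 + (1 + 1 / \<beta>) * d\<^sup>2" by (simp add: distrib_right)
      moreover have "(p T z)\<^sup>2 - (u F z)\<^sup>2 = 2 * (x * d) - d\<^sup>2" by (simp add: x_def d_def power2_eq_square algebra_simps)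
      then have "\<bar>(p T z)\<^sup>2 - (u F z)\<^sup>2\<bar> \<le> 2 * \<bar>x * d\<bar> + d\<^sup>2"
        using abs_triangle_ineq4[of "2 * (x * d)" "d\<^sup>2"] by (simp add: abs_mult)
      ultimately show "\<bar>(p T z)\<^sup>2 - (u F z)\<^sup>2\<bar> \<le> \<beta> * (p T z)\<^sup>2 + (1 + 1 / \<beta>) * (p T z - u F z)\<^sup>2" by (simp add: x_def d_def)
    qed auto
    also have "\<dots> = ennreal (LINT z:F|face_measure F. \<beta> * (p T z)\<^sup>2 + (1 + 1 / \<beta>) * (p T z - u F z)\<^sup>2)"
      using b0 by (intro nn_set_integral_eq_set_integral set_integral_add(1)[OF i]) auto
    also have "(LINT z:F|face_measure F. \<beta> * (p T z)\<^sup>2 + (1 + 1 / \<beta>) * (p T z - u F z)\<^sup>2) = b T F"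
      unfolding set_integral_add(2)[OF i] set_integral_cmult by (simp add: b_def \<beta>_def face_inner_def power2_eq_square)
    finally show ?thesis .
  qed
  have "ennreal (\<Sum>T\<in>\<T>. P T) = (\<Sum>T\<in>\<T>. \<integral>\<^sup>+x\<in>T. ennreal ((p T x)\<^sup>2) \<partial>lborel)"
    using nonneg(1) by (simp add: I0 sum_ennreal)
  also have "\<dots> \<le> ennreal L * ((\<Sum>T\<in>\<T>. \<integral>\<^sup>+x\<in>T. ennreal \<bar>2 * p T x * (grad (p T) x \<bullet> \<eta>)\<bar> \<partial>lborel) +
      (\<Sum>F\<in>\<F>. \<Sum>T\<in>sides F. \<integral>\<^sup>+z\<in>F. ennreal \<bar>(p T z)\<^sup>2 - (u F z)\<^sup>2\<bar> \<partial>face_measure F))"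
  proof (rule broken_poincare[OF \<eta> L0 out])
    show "((\<lambda>t. (p T (x + t *\<^sub>R \<eta>))\<^sup>2) has_real_derivative 2 * p T (x + t *\<^sub>R \<eta>) * (grad (p T) (x + t *\<^sub>R \<eta>) \<bullet> \<eta>)) (at t)" if "T \<in> \<T>" for T x t
      using DERIV_power[OF elem_polys_derivative_on_line[OF p[OF that], of x \<eta> t], of 2] by (simp add: mult_ac)
    show "(\<lambda>x. (u F x)\<^sup>2) = (\<lambda>_. 0)" if "F \<in> \<F>" "F \<notin> interior_faces \<T> \<F>" for F
      using u0[OF that] by simp
  qed (auto intro!: continuous_intros cp cg u)
  also have "\<dots> \<le> ennreal L * ((\<Sum>T\<in>\<T>. ennreal (\<epsilon> * P T + 1 / \<epsilon> * G T)) + (\<Sum>F\<in>\<F>. \<Sum>T\<in>sides F. ennreal (b T F)))"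
    by (intro mult_left_mono add_mono sum_mono I1 I2) auto
  also have "\<dots> = ennreal (L * ((\<Sum>T\<in>\<T>. \<epsilon> * P T + 1 / \<epsilon> * G T) + (\<Sum>F\<in>\<F>. \<Sum>T\<in>sides F. b T F)))"
  proof -
    have 1: "(\<Sum>T\<in>\<T>. ennreal (\<epsilon> * P T + 1 / \<epsilon> * G T)) = ennreal (\<Sum>T\<in>\<T>. \<epsilon> * P T + 1 / \<epsilon> * G T)"
      using e0 nonneg by (intro sum_ennreal) auto
    have 2: "(\<Sum>T\<in>sides F. ennreal (b T F)) = ennreal (\<Sum>T\<in>sides F. b T F)" for F
      using b_nonneg by (intro sum_ennreal) auto
    have 3: "(\<Sum>F\<in>\<F>. ennreal (\<Sum>T\<in>sides F. b T F)) = ennreal (\<Sum>F\<in>\<F>. \<Sum>T\<in>sides F. b T F)"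
      using b_nonneg by (intro sum_ennreal sum_nonneg) auto
    have n1: "0 \<le> (\<Sum>T\<in>\<T>. \<epsilon> * P T + 1 / \<epsilon> * G T)" using e0 nonneg by (intro sum_nonneg) auto
    have n2: "0 \<le> (\<Sum>F\<in>\<F>. \<Sum>T\<in>sides F. b T F)" using b_nonneg by (intro sum_nonneg) auto
    show ?thesis unfolding 1 2 3 using n1 n2 L0 by (simp add: ennreal_plus[symmetric] ennreal_mult del: ennreal_plus)
  qed
  finally have "(\<Sum>T\<in>\<T>. P T) \<le> L * ((\<Sum>T\<in>\<T>. \<epsilon> * P T + 1 / \<epsilon> * G T) + (\<Sum>F\<in>\<F>. \<Sum>T\<in>sides F. b T F))"
    by (rule ennreal_le_iff[THEN iffD1, rotated])
      (use e0 nonneg b_nonneg L0 in \<open>auto intro!: mult_nonneg_nonneg add_nonneg_nonneg sum_nonneg\<close>)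
  also have "(\<Sum>F\<in>\<F>. \<Sum>T\<in>sides F. b T F) = (\<Sum>T\<in>\<T>. \<Sum>F\<in>faces_of \<F> T. b T F)"
    by (rule sum_elements_faces[symmetric])
  also have "L * ((\<Sum>T\<in>\<T>. \<epsilon> * P T + 1 / \<epsilon> * G T) + (\<Sum>T\<in>\<T>. \<Sum>F\<in>faces_of \<F> T. b T F)) =
      (\<Sum>T\<in>\<T>. L * (\<epsilon> * P T + 1 / \<epsilon> * G T + (\<Sum>F\<in>faces_of \<F> T. b T F)))"
    by (simp only: sum.distrib[symmetric] sum_distrib_left)
  also have "\<dots> \<le> (\<Sum>T\<in>\<T>. 1 / 2 * P T + L * M * (G T + inverse (diameter T) * N T))"
  proof (rule sum_mono)
    fix T assume T: "T \<in> \<T>"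
    interpret E: star_shaped_element T "faces_of \<F> T" \<rho> by (rule star_shaped_element[OF T])
    define h where "h = diameter T"
    have h: "0 < h" "h \<le> D" using diameter_pos[OF T] diameter_le_domain[OF T] by (auto simp: h_def D_def)
    have S: "S T \<le> Ct / h * (3 * P T + h\<^sup>2 * G T)"
      unfolding S_def P_def G_def h_def Ct_def by (rule E.trace_inequality[OF p[OF T]])
    have "(\<Sum>F\<in>faces_of \<F> T. b T F) = \<epsilon> * h * S T + (1 + 1 / (\<epsilon> * h)) * N T"
      by (simp add: b_def S_def N_def h_def sum.distrib sum_distrib_left)
    moreover have "\<epsilon> * h * S T \<le> \<epsilon> * h * (Ct / h * (3 * P T + h\<^sup>2 * G T))" using S e0 h by (intro mult_left_mono) auto
    moreover have "\<epsilon> * h * (Ct / h * (3 * P T + h\<^sup>2 * G T)) = 3 * \<epsilon> * Ct * P T + \<epsilon> * Ct * h\<^sup>2 * G T"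
      using h by (simp add: field_simps)
    moreover have "(1 + 1 / (\<epsilon> * h)) * N T = (h + 1 / \<epsilon>) * (inverse h * N T)" using h e0 by (simp add: field_simps)
    moreover have "(h + 1 / \<epsilon>) * (inverse h * N T) \<le> M * (inverse h * N T)"
      using h nonneg(4)[of T] e0 Ct0 D0 by (intro mult_right_mono) (auto simp: M_def add_increasing)
    moreover have "1 / \<epsilon> * G T + \<epsilon> * Ct * h\<^sup>2 * G T \<le> M * G T"
    proof -
      have "\<epsilon> * Ct * h\<^sup>2 \<le> \<epsilon> * Ct * D\<^sup>2" using h e0 Ct0 by (intro mult_left_mono power_mono) auto
      then have "1 / \<epsilon> + \<epsilon> * Ct * h\<^sup>2 \<le> M" using D0 by (simp add: M_def)
      from mult_right_mono[OF this nonneg(2)[of T]] show ?thesis by (simp add: distrib_right)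
    qed
    ultimately have "\<epsilon> * P T + 1 / \<epsilon> * G T + (\<Sum>F\<in>faces_of \<F> T. b T F) \<le> \<epsilon> * (1 + 3 * Ct) * P T + M * (G T + inverse h * N T)"
      by (simp add: algebra_simps)
    then have "L * (\<epsilon> * P T + 1 / \<epsilon> * G T + (\<Sum>F\<in>faces_of \<F> T. b T F)) \<le> L * (\<epsilon> * (1 + 3 * Ct) * P T + M * (G T + inverse h * N T))"
      using L0 by (intro mult_left_mono) auto
    also have "\<dots> = (L * \<epsilon> * (1 + 3 * Ct)) * P T + L * M * (G T + inverse h * N T)" by (simp add: algebra_simps)
    also have "L * \<epsilon> * (1 + 3 * Ct) = 1 / 2"
    proof -
      have "L * (1 / (2 * L * X)) * X = 1 / 2" if "0 < X" for X using L0 that by (simp add: field_simps)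
      then show ?thesis unfolding \<epsilon>_def using Ct0 by simp
    qed
    finally show "L * (\<epsilon> * P T + 1 / \<epsilon> * G T + (\<Sum>F\<in>faces_of \<F> T. b T F)) \<le> 1 / 2 * P T + L * M * (G T + inverse (diameter T) * N T)"
      by (simp add: h_def)
  qed
  also have "\<dots> = 1 / 2 * (\<Sum>T\<in>\<T>. P T) + L * M * (\<Sum>T\<in>\<T>. G T + inverse (diameter T) * N T)"
    by (subst sum.distrib) (simp only: sum_distrib_left)
  finally show ?thesis unfolding P_def G_def N_def by simp
qed

text \<open>With the choice of \<open>\<epsilon>\<close>, half of the squared norm of the potentials is absorbed in the broken Poincare
  inequality. Only the domain, the dimension and \<open>\<rho>\<close> enter, not the mesh.\<close>

definition trace_energy_const :: real where
  "trace_energy_const = (let Ct = trace_const \<rho> DIM('a); D = diameter \<Omega>; L = D + 1; \<epsilon> = 1 / (2 * L * (1 + 3 * Ct)) in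
     2 * D\<^sup>2 * (1 + Ct) + 12 * Ct * L * (1 / \<epsilon> + \<epsilon> * Ct * D\<^sup>2 + D))"

lemma trace_energy_const_nonneg: "0 \<le> trace_energy_const"
proof -
  have "0 \<le> diameter \<Omega>" by (rule diameter_ge_0[OF domain_bounded])
  then show ?thesis using trace_const_pos[OF \<rho>, of "DIM('a)"] by (simp add: trace_energy_const_def Let_def)
qed

text \<open>Write \<open>u\<close> on a face as the trace of \<open>p T\<close> minus the gap, and use the trace inequality of the element for
  the former. The factor \<open>diameter T\<close> compensates that of the trace inequality.\<close>

lemma weighted_face_norm_bound:
  fixes p :: "'a set \<Rightarrow> 'a \<Rightarrow> real" and u :: "'a set \<Rightarrow> 'a \<Rightarrow> real"
  assumes p: "\<And>T. T \<in> \<T> \<Longrightarrow> p T \<in> elem_polys m" and u: "\<And>F. F \<in> \<F> \<Longrightarrow> continuous_on UNIV (u F)"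
    and u0: "\<And>F. F \<in> \<F> \<Longrightarrow> F \<notin> interior_faces \<T> \<F> \<Longrightarrow> u F = 0"
  shows "(\<Sum>T\<in>\<T>. diameter T * (\<Sum>F\<in>faces_of \<F> T. face_normsq F (u F))) \<le>
    trace_energy_const * (\<Sum>T\<in>\<T>. elem_normsq T (grad (p T)) +
      inverse (diameter T) * (\<Sum>F\<in>faces_of \<F> T. face_normsq F (\<lambda>x. p T x - u F x)))"
proof -
  define Ct where "Ct = trace_const \<rho> DIM('a)"
  define D where "D = diameter \<Omega>"
  define P where "P T = elem_normsq T (p T)" for T
  define G where "G T = elem_normsq T (grad (p T))" for T
  define N where "N T = (\<Sum>F\<in>faces_of \<F> T. face_normsq F (\<lambda>x. p T x - u F x))" for T
  define L where "L = D + 1"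
  define \<epsilon> where "\<epsilon> = 1 / (2 * L * (1 + 3 * Ct))"
  define M where "M = 1 / \<epsilon> + \<epsilon> * Ct * D\<^sup>2 + D"
  have Ct0: "0 < Ct" unfolding Ct_def by (rule trace_const_pos[OF \<rho>])
  have nonneg: "0 \<le> G T" "0 \<le> N T" for T
    unfolding G_def N_def by (intro sum_nonneg elem_inner_nonneg face_inner_nonneg)+
  have P: "(\<Sum>T\<in>\<T>. P T) \<le> 2 * L * M * (\<Sum>T\<in>\<T>. G T + inverse (diameter T) * N T)"
    using broken_potential_bound[OF p u u0] unfolding P_def G_def N_def L_def M_def \<epsilon>_def D_def Ct_def by simp
  have "(\<Sum>T\<in>\<T>. diameter T * (\<Sum>F\<in>faces_of \<F> T. face_normsq F (u F))) \<le>
      (\<Sum>T\<in>\<T>. 6 * Ct * P T + 2 * D\<^sup>2 * (1 + Ct) * (G T + inverse (diameter T) * N T))"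
  proof (rule sum_mono)
    fix T assume T: "T \<in> \<T>"
    interpret E: star_shaped_element T "faces_of \<F> T" \<rho> by (rule star_shaped_element[OF T])
    define h where "h = diameter T"
    have h: "0 < h" "h \<le> D" using diameter_pos[OF T] diameter_le_domain[OF T] by (auto simp: h_def D_def)
    have hD: "h\<^sup>2 \<le> D\<^sup>2" using h by (intro power_mono) auto
    have S: "(\<Sum>F\<in>faces_of \<F> T. face_normsq F (p T)) \<le> Ct / h * (3 * P T + h\<^sup>2 * G T)"
      unfolding P_def G_def h_def Ct_def by (rule E.trace_inequality[OF p[OF T]])
    have "(\<Sum>F\<in>faces_of \<F> T. face_normsq F (u F)) \<le> (\<Sum>F\<in>faces_of \<F> T. 2 * face_normsq F (p T) + 2 * face_normsq F (\<lambda>x. p T x - u F x))"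
    proof (rule sum_mono)
      fix F assume "F \<in> faces_of \<F> T"
      then have F: "F \<in> \<F>" by (simp add: faces_of_def)
      have c: "continuous_on UNIV (p T)" "continuous_on UNIV (\<lambda>x. p T x - u F x)"
        by (intro continuous_on_diff continuous_on_elem_polys[OF p[OF T]] u[OF F])+
      show "face_normsq F (u F) \<le> 2 * face_normsq F (p T) + 2 * face_normsq F (\<lambda>x. p T x - u F x)"
      proof (rule face_inner_square_le[OF face_flat[OF F] c])
        show "(u F x)\<^sup>2 \<le> 2 * (p T x)\<^sup>2 + 2 * (p T x - u F x)\<^sup>2" for x
          using zero_le_power2[of "2 * p T x - u F x"] by (simp add: power2_eq_square algebra_simps)
      qed
    qed
    also have "\<dots> = 2 * (\<Sum>F\<in>faces_of \<F> T. face_normsq F (p T)) + 2 * N T"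
      by (simp add: N_def sum.distrib sum_distrib_left)
    also have "\<dots> \<le> 2 * (Ct / h * (3 * P T + h\<^sup>2 * G T)) + 2 * N T" using S by simp
    finally have "h * (\<Sum>F\<in>faces_of \<F> T. face_normsq F (u F)) \<le> h * (2 * (Ct / h * (3 * P T + h\<^sup>2 * G T)) + 2 * N T)"
      using h by (intro mult_left_mono) auto
    also have "\<dots> = 6 * Ct * P T + 2 * Ct * h\<^sup>2 * G T + 2 * h\<^sup>2 * (inverse h * N T)"
      using h by (simp add: field_simps power2_eq_square)
    also have "\<dots> \<le> 6 * Ct * P T + 2 * D\<^sup>2 * (1 + Ct) * G T + 2 * D\<^sup>2 * (1 + Ct) * (inverse h * N T)"
    proof (intro add_mono order_refl mult_right_mono)
      have "Ct * h\<^sup>2 \<le> Ct * D\<^sup>2" using hD Ct0 by (intro mult_left_mono) auto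
      then show "2 * Ct * h\<^sup>2 \<le> 2 * D\<^sup>2 * (1 + Ct)" using zero_le_power2[of D] by (simp add: algebra_simps add_increasing)
      have "0 \<le> Ct * D\<^sup>2" using Ct0 by simp
      then show "2 * h\<^sup>2 \<le> 2 * D\<^sup>2 * (1 + Ct)" using hD by (simp add: algebra_simps add_increasing)
    qed (use nonneg h in auto)
    finally show "diameter T * (\<Sum>F\<in>faces_of \<F> T. face_normsq F (u F)) \<le> 6 * Ct * P T + 2 * D\<^sup>2 * (1 + Ct) * (G T + inverse (diameter T) * N T)"
      unfolding h_def by (simp add: distrib_left)
  qed
  also have "\<dots> = 6 * Ct * (\<Sum>T\<in>\<T>. P T) + 2 * D\<^sup>2 * (1 + Ct) * (\<Sum>T\<in>\<T>. G T + inverse (diameter T) * N T)"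
    by (subst sum.distrib) (simp only: sum_distrib_left)
  also have "\<dots> \<le> 6 * Ct * (2 * L * M * (\<Sum>T\<in>\<T>. G T + inverse (diameter T) * N T)) + 2 * D\<^sup>2 * (1 + Ct) * (\<Sum>T\<in>\<T>. G T + inverse (diameter T) * N T)"
    using P Ct0 by (intro add_right_mono mult_left_mono) auto
  also have "\<dots> = trace_energy_const * (\<Sum>T\<in>\<T>. G T + inverse (diameter T) * N T)"
    unfolding trace_energy_const_def Let_def Ct_def[symmetric] D_def[symmetric] L_def[symmetric] \<epsilon>_def[symmetric] M_def[symmetric]
    by (simp add: algebra_simps)
  finally show ?thesis unfolding G_def N_def .
qed

lemma characteristic_lengths_finite:
  "finite {f T T' | T T' F. F \<in> interior_faces \<T> \<F> \<and> T \<in> \<T> \<and> T' \<in> \<T> \<and> T \<noteq> T' \<and> F \<subseteq> frontier T \<inter> frontier T'}"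
  by (rule finite_subset[of _ "(\<lambda>(T, T'). f T T') ` (\<T> \<times> \<T>)"]) (use finite_elements in auto)

lemma H_min_le:
  "F \<in> interior_faces \<T> \<F> \<Longrightarrow> T \<in> \<T> \<Longrightarrow> T' \<in> \<T> \<Longrightarrow> T \<noteq> T' \<Longrightarrow> F \<subseteq> frontier T \<Longrightarrow> F \<subseteq> frontier T' \<Longrightarrow>
    H_min \<T> \<F> \<le> diameter T + diameter T'"
  unfolding H_min_def by (rule Min_le[OF characteristic_lengths_finite]) blast

lemma inverse_H_max_ge:
  "F \<in> interior_faces \<T> \<F> \<Longrightarrow> T \<in> \<T> \<Longrightarrow> T' \<in> \<T> \<Longrightarrow> T \<noteq> T' \<Longrightarrow> F \<subseteq> frontier T \<Longrightarrow> F \<subseteq> frontier T' \<Longrightarrow>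
    inverse (diameter T) + inverse (diameter T') \<le> inverse (H_max \<T> \<F>)"
  unfolding H_max_def inverse_inverse_eq by (rule Max_ge[OF characteristic_lengths_finite]) blast

lemma H_min_pos:
  assumes "interior_faces \<T> \<F> \<noteq> {}"
  shows "0 < H_min \<T> \<F>"
proof -
  let ?X = "{diameter T + diameter T' | T T' F. F \<in> interior_faces \<T> \<F> \<and> T \<in> \<T> \<and> T' \<in> \<T> \<and> T \<noteq> T' \<and> F \<subseteq> frontier T \<inter> frontier T'}"
  have "?X \<noteq> {}" using assms unfolding interior_faces_def by blast
  then have "Min ?X \<in> ?X" by (rule Min_in[OF characteristic_lengths_finite])
  then obtain T T' where "T \<in> \<T>" "T' \<in> \<T>" "Min ?X = diameter T + diameter T'" by blast
  then show ?thesis unfolding H_min_def using diameter_pos by (simp add: add_pos_pos)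
qed

lemma inverse_H_max_pos:
  assumes "interior_faces \<T> \<F> \<noteq> {}"
  shows "0 < inverse (H_max \<T> \<F>)"
proof -
  obtain F where F: "F \<in> interior_faces \<T> \<F>" using assms by blast
  obtain T T' where T: "T \<in> \<T>" "T' \<in> \<T>" "T \<noteq> T'" "F \<subseteq> frontier T" "F \<subseteq> frontier T'"
    using interior_face_elements[OF F] by metis
  have "0 < inverse (diameter T) + inverse (diameter T')" using diameter_pos[OF T(1)] diameter_pos[OF T(2)] by (simp add: add_pos_pos)
  then show ?thesis using inverse_H_max_ge[OF F T] by linarith
qed

text \<open>A face collects the weights of the elements next to it, of which an interior face has exactly two.\<close>

lemma sum_elements_interior_faces:
  assumes g: "\<And>F. F \<in> \<F> \<Longrightarrow> F \<notin> interior_faces \<T> \<F> \<Longrightarrow> g F = 0"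
  shows "(\<Sum>T\<in>\<T>. c T * (\<Sum>F\<in>faces_of \<F> T. g F)) = (\<Sum>F\<in>interior_faces \<T> \<F>. (\<Sum>T\<in>sides F. c T) * (g F :: real))"
proof -
  have "(\<Sum>T\<in>\<T>. c T * (\<Sum>F\<in>faces_of \<F> T. g F)) = (\<Sum>F\<in>\<F>. (\<Sum>T\<in>sides F. c T) * g F)"
    by (simp only: sum_distrib_left sum_elements_faces sum_distrib_right)
  also have "\<dots> = (\<Sum>F\<in>interior_faces \<T> \<F>. (\<Sum>T\<in>sides F. c T) * g F)"
    by (rule sum.mono_neutral_right[OF finite_faces]) (auto simp: interior_faces_def g[unfolded interior_faces_def])
  finally show ?thesis .
qed

lemma H_min_bound:
  assumes g: "\<And>F. F \<in> \<F> \<Longrightarrow> F \<notin> interior_faces \<T> \<F> \<Longrightarrow> g F = 0" and nonneg: "\<And>F. 0 \<le> (g F :: real)"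
  shows "H_min \<T> \<F> * (\<Sum>F\<in>interior_faces \<T> \<F>. g F) \<le> (\<Sum>T\<in>\<T>. diameter T * (\<Sum>F\<in>faces_of \<F> T. g F))"
proof -
  have "(\<Sum>T\<in>\<T>. diameter T * (\<Sum>F\<in>faces_of \<F> T. g F)) = (\<Sum>F\<in>interior_faces \<T> \<F>. (\<Sum>T\<in>sides F. diameter T) * g F)"
    by (rule sum_elements_interior_faces) (rule g)
  then show ?thesis unfolding sum_distrib_left[where A = "interior_faces \<T> \<F>"]
  proof (simp only:, intro sum_mono mult_right_mono nonneg)
    fix F assume F: "F \<in> interior_faces \<T> \<F>"
    obtain T1 T2 where T: "T1 \<in> \<T>" "T2 \<in> \<T>" "T1 \<noteq> T2" "F \<subseteq> frontier T1" "F \<subseteq> frontier T2" "sides F = {T1, T2}"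
      using interior_face_elements[OF F] .
    show "H_min \<T> \<F> \<le> (\<Sum>T\<in>sides F. diameter T)"
      using H_min_le[OF F T(1-5)] T(3) unfolding T(6) by simp
  qed
qed

lemma H_max_bound:
  assumes g: "\<And>F. F \<in> \<F> \<Longrightarrow> F \<notin> interior_faces \<T> \<F> \<Longrightarrow> g F = 0" and nonneg: "\<And>F. 0 \<le> (g F :: real)"
  shows "(\<Sum>T\<in>\<T>. inverse (diameter T) * (\<Sum>F\<in>faces_of \<F> T. g F)) \<le> inverse (H_max \<T> \<F>) * (\<Sum>F\<in>interior_faces \<T> \<F>. g F)"
proof -
  have "(\<Sum>T\<in>\<T>. inverse (diameter T) * (\<Sum>F\<in>faces_of \<F> T. g F)) = (\<Sum>F\<in>interior_faces \<T> \<F>. (\<Sum>T\<in>sides F. inverse (diameter T)) * g F)"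
    by (rule sum_elements_interior_faces) (rule g)
  then show ?thesis unfolding sum_distrib_left[where A = "interior_faces \<T> \<F>"]
  proof (simp only:, intro sum_mono mult_right_mono nonneg)
    fix F assume F: "F \<in> interior_faces \<T> \<F>"
    obtain T1 T2 where T: "T1 \<in> \<T>" "T2 \<in> \<T>" "T1 \<noteq> T2" "F \<subseteq> frontier T1" "F \<subseteq> frontier T2" "sides F = {T1, T2}"
      using interior_face_elements[OF F] .
    show "(\<Sum>T\<in>sides F. inverse (diameter T)) \<le> inverse (H_max \<T> \<F>)"
      using inverse_H_max_ge[OF F T(1-5)] T(3) unfolding T(6) by simp
  qed
qed

end


section \<open>Eigenvalues of the matrix of a form\<close>

lemma eigenvalue_coordinates:
  fixes A :: "'b::field Matrix.mat"
  assumes A: "A \<in> carrier_mat n n"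
  shows "eigenvalue A c \<longleftrightarrow> (\<exists>x. (\<exists>i<n. x i \<noteq> 0) \<and> (\<forall>i<n. (\<Sum>j<n. A $$ (i, j) * x j) = c * x i))"
proof
  assume "eigenvalue A c"
  then obtain v where v: "v \<in> carrier_vec n" "v \<noteq> 0\<^sub>v n" "A *\<^sub>v v = c \<cdot>\<^sub>v v"
    using A by (auto simp: eigenvalue_def eigenvector_def)
  have "(\<Sum>j<n. A $$ (i, j) * vec_index v j) = c * vec_index v i" if i: "i < n" for i
  proof -
    have "vec_index (A *\<^sub>v v) i = (\<Sum>j<n. A $$ (i, j) * vec_index v j)"
      using A v(1) i by (simp add: Matrix.scalar_prod_def atLeast0LessThan)
    then show ?thesis using v i by simp
  qed
  moreover have "\<exists>i<n. vec_index v i \<noteq> 0"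
  proof (rule ccontr)
    assume "\<not> ?thesis"
    then have "v = 0\<^sub>v n" using v(1) by (intro eq_vecI) auto
    then show False using v(2) by simp
  qed
  ultimately show "\<exists>x. (\<exists>i<n. x i \<noteq> 0) \<and> (\<forall>i<n. (\<Sum>j<n. A $$ (i, j) * x j) = c * x i)"
    by (intro exI[of _ "\<lambda>i. vec_index v i"]) blast
next
  assume "\<exists>x. (\<exists>i<n. x i \<noteq> 0) \<and> (\<forall>i<n. (\<Sum>j<n. A $$ (i, j) * x j) = c * x i)"
  then obtain x i0 where x: "i0 < n" "x i0 \<noteq> 0" "\<And>i. i < n \<Longrightarrow> (\<Sum>j<n. A $$ (i, j) * x j) = c * x i" by blast
  define v where "v = Matrix.vec n x"
  have "v \<noteq> 0\<^sub>v n" using x(1,2) by (metis v_def index_vec index_zero_vec(1))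
  moreover have "A *\<^sub>v v = c \<cdot>\<^sub>v v"
  proof (rule eq_vecI)
    show "dim_vec (A *\<^sub>v v) = dim_vec (c \<cdot>\<^sub>v v)" using A by (simp add: v_def)
    fix i assume "i < dim_vec (c \<cdot>\<^sub>v v)"
    then have i: "i < n" by (simp add: v_def)
    have "vec_index (A *\<^sub>v v) i = (\<Sum>j<n. A $$ (i, j) * x j)"
      using A i by (simp add: Matrix.scalar_prod_def v_def atLeast0LessThan)
    then show "vec_index (A *\<^sub>v v) i = vec_index (c \<cdot>\<^sub>v v) i" using x(3)[OF i] i by (simp add: v_def)
  qed
  ultimately have "eigenvector A v c" using A by (auto simp: eigenvector_def v_def)
  then show "eigenvalue A c" by (auto simp: eigenvalue_def)
qed

text \<open>A complex eigenvalue exists; testing the real part of the eigenvector with the imaginary part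
  shows that it is real.\<close>

lemma symmetric_matrix_has_eigenvalue:
  fixes A :: "real Matrix.mat"
  assumes A: "A \<in> carrier_mat n n" and n: "0 < n" and sym: "\<And>i j. i < n \<Longrightarrow> j < n \<Longrightarrow> A $$ (i, j) = A $$ (j, i)"
  shows "\<exists>c. eigenvalue A c"
proof -
  define B where "B = map_mat complex_of_real A"
  have B: "B \<in> carrier_mat n n" using A by (simp add: B_def)
  have "degree (char_poly B) = n" using degree_monic_char_poly[OF B] by simp
  then have "\<not> constant (poly (char_poly B))" using n by (simp add: constant_degree)
  then obtain z where "poly (char_poly B) z = 0" using fundamental_theorem_of_algebra by blast
  then have "eigenvalue B z" using eigenvalue_root_char_poly[OF B] by simp
  then obtain w i0 where w: "i0 < n" "w i0 \<noteq> 0" "\<And>i. i < n \<Longrightarrow> (\<Sum>j<n. B $$ (i, j) * w j) = z * w i"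
    unfolding eigenvalue_coordinates[OF B] by blast
  define x where "x i = Re (w i)" for i
  define y where "y i = Im (w i)" for i
  have Bij: "B $$ (i, j) = complex_of_real (A $$ (i, j))" if "i < n" "j < n" for i j using that A by (simp add: B_def)
  have eq: "(\<Sum>j<n. complex_of_real (A $$ (i, j)) * w j) = z * w i" if i: "i < n" for i
    using w(3)[OF i] Bij[OF i] by simp
  have X: "(\<Sum>j<n. A $$ (i, j) * x j) = Re z * x i - Im z * y i" if i: "i < n" for i
    using arg_cong[OF eq[OF i], of Re] by (simp add: x_def y_def)
  have Y: "(\<Sum>j<n. A $$ (i, j) * y j) = Re z * y i + Im z * x i" if i: "i < n" for i
    using arg_cong[OF eq[OF i], of Im] by (simp add: x_def y_def add.commute)
  have "(\<Sum>i<n. y i * (\<Sum>j<n. A $$ (i, j) * x j)) = (\<Sum>i<n. x i * (\<Sum>j<n. A $$ (i, j) * y j))"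
  proof -
    have "(\<Sum>i<n. y i * (\<Sum>j<n. A $$ (i, j) * x j)) = (\<Sum>i<n. \<Sum>j<n. y i * (A $$ (i, j) * x j))" by (simp add: sum_distrib_left)
    also have "\<dots> = (\<Sum>j<n. \<Sum>i<n. y i * (A $$ (i, j) * x j))" by (rule sum.swap)
    also have "\<dots> = (\<Sum>j<n. \<Sum>i<n. x j * (A $$ (j, i) * y i))" by (intro sum.cong refl) (use sym in auto)
    finally show ?thesis by (simp only: sum_distrib_left)
  qed
  then have "(\<Sum>i<n. y i * (Re z * x i - Im z * y i)) = (\<Sum>i<n. x i * (Re z * y i + Im z * x i))"
    using X Y by simp
  then have "(\<Sum>i<n. x i * (Re z * y i + Im z * x i) - y i * (Re z * x i - Im z * y i)) = 0" by (simp add: sum_subtractf)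
  moreover have "(\<Sum>i<n. x i * (Re z * y i + Im z * x i) - y i * (Re z * x i - Im z * y i)) = Im z * (\<Sum>i<n. (x i)\<^sup>2 + (y i)\<^sup>2)"
    unfolding sum_distrib_left by (intro sum.cong refl) (simp add: power2_eq_square algebra_simps)
  moreover have "(\<Sum>i<n. (x i)\<^sup>2 + (y i)\<^sup>2) \<noteq> 0"
  proof
    assume "(\<Sum>i<n. (x i)\<^sup>2 + (y i)\<^sup>2) = 0"
    then have "(x i0)\<^sup>2 + (y i0)\<^sup>2 = 0" using w(1) by (subst (asm) sum_nonneg_eq_0_iff) auto
    then show False using w(2) by (simp add: x_def y_def complex_eq_iff)
  qed
  ultimately have Im0: "Im z = 0" by simp
  have "x i0 \<noteq> 0 \<or> y i0 \<noteq> 0" using w(2) by (simp add: x_def y_def complex_eq_iff)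
  then have "eigenvalue A (Re z)"
    unfolding eigenvalue_coordinates[OF A] using X Y Im0 w(1)
    by (elim disjE) (auto intro: exI[of _ x] exI[of _ y])
  then show ?thesis by blast
qed

lemma psd_form_expand:
  fixes V :: "'v::real_vector set"
  assumes V: "subspace V" and s: "symmetric_psd_bilinear_on V s" and f: "\<And>i::nat. i < n \<Longrightarrow> f i \<in> V"
  shows "s (\<Sum>j<n. x j *\<^sub>R f j) (\<Sum>i<n. x i *\<^sub>R f i) = (\<Sum>i<n. x i * (\<Sum>j<n. s (f j) (f i) * x j))"
proof -
  have sc: "x i *\<^sub>R f i \<in> V" if "i < n" for i using subspace_scale[OF V f[OF that]] .
  have sm: "(\<Sum>j<n. x j *\<^sub>R f j) \<in> V" using sc by (intro subspace_sum[OF V]) auto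
  have "s (\<Sum>j<n. x j *\<^sub>R f j) (\<Sum>i<n. x i *\<^sub>R f i) = (\<Sum>i<n. s (\<Sum>j<n. x j *\<^sub>R f j) (x i *\<^sub>R f i))"
    using sc sm by (intro psd_form_sum_right[OF V s]) auto
  also have "\<dots> = (\<Sum>i<n. x i * s (\<Sum>j<n. x j *\<^sub>R f j) (f i))"
    using f sm by (intro sum.cong refl psd_form_scale_right[OF V s]) auto
  also have "\<dots> = (\<Sum>i<n. x i * (\<Sum>j<n. s (f j) (f i) * x j))"
  proof (intro sum.cong refl arg_cong2[of _ _ _ _ "(*)"])
    fix i assume "i \<in> {..<n}"
    then have i: "f i \<in> V" using f by simp
    have "s (\<Sum>j<n. x j *\<^sub>R f j) (f i) = (\<Sum>j<n. s (x j *\<^sub>R f j) (f i))"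
      using sc i by (intro psd_form_sum_left[OF V s]) auto
    also have "\<dots> = (\<Sum>j<n. s (f j) (f i) * x j)"
      using psd_form_scale_left[OF V s f i] by (intro sum.cong refl) (simp add: mult.commute)
    finally show "s (\<Sum>j<n. x j *\<^sub>R f j) (f i) = (\<Sum>j<n. s (f j) (f i) * x j)" .
  qed
  finally show ?thesis .
qed

text \<open>The Rayleigh quotient of an eigenvector is its eigenvalue. An eigenvalue has to exist for the minimum and
  the maximum to be meaningful.\<close>

lemma orthonormal_matrix_eigenvalue_bounds:
  fixes V :: "'v::real_vector set"
  assumes V: "subspace V" and a: "symmetric_psd_bilinear_on V a" and q: "symmetric_psd_bilinear_on V q"
    and bs: "set bs \<subseteq> V" "bs \<noteq> []"
    and orth: "\<And>i j. i < length bs \<Longrightarrow> j < length bs \<Longrightarrow> q (bs ! i) (bs ! j) = (if i = j then 1 else 0)"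
    and lower: "\<And>u. u \<in> V \<Longrightarrow> m * q u u \<le> a u u" and upper: "\<And>u. u \<in> V \<Longrightarrow> a u u \<le> M * q u u"
    and m: "0 < m"
  defines "A \<equiv> matrix_of_form a bs"
  shows "m \<le> lambda_min A" and "lambda_max A \<le> M" and "condition_number A \<le> M / m"
proof -
  define n where "n = length bs"
  have n: "0 < n" using bs(2) by (simp add: n_def)
  have mem: "bs ! i \<in> V" if "i < n" for i using bs(1) that by (auto simp: n_def)
  have A: "A \<in> carrier_mat n n" by (simp add: A_def matrix_of_form_def n_def)
  have Aij: "A $$ (i, j) = a (bs ! j) (bs ! i)" if "i < n" "j < n" for i j
    using that by (simp add: A_def matrix_of_form_def n_def)
  let ?E = "{c. eigenvalue A c}"
  have "char_poly A \<noteq> 0" using degree_monic_char_poly[OF A] by auto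
  then have fin: "finite ?E" using poly_roots_finite eigenvalue_root_char_poly[OF A] by simp
  have "\<exists>c. eigenvalue A c"
    using psd_form_sym[OF a] mem by (intro symmetric_matrix_has_eigenvalue[OF A n]) (simp add: Aij)
  then have ne: "?E \<noteq> {}" by blast
  have bounds: "m \<le> c \<and> c \<le> M" if "eigenvalue A c" for c
  proof -
    obtain x i0 where x: "i0 < n" "x i0 \<noteq> 0" "\<And>i. i < n \<Longrightarrow> (\<Sum>j<n. A $$ (i, j) * x j) = c * x i"
      using \<open>eigenvalue A c\<close> unfolding eigenvalue_coordinates[OF A] by blast
    define u where "u = (\<Sum>j<n. x j *\<^sub>R bs ! j)"
    define X where "X = (\<Sum>i<n. (x i)\<^sup>2)"
    have u: "u \<in> V" unfolding u_def using mem by (intro subspace_sum[OF V] subspace_scale[OF V]) auto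
    have "a u u = (\<Sum>i<n. x i * (\<Sum>j<n. a (bs ! j) (bs ! i) * x j))"
      unfolding u_def by (rule psd_form_expand[OF V a mem])
    also have "\<dots> = (\<Sum>i<n. x i * (c * x i))"
    proof (intro sum.cong refl)
      fix i assume "i \<in> {..<n}"
      then show "x i * (\<Sum>j<n. a (bs ! j) (bs ! i) * x j) = x i * (c * x i)" using x(3)[of i] Aij[of i] by simp
    qed
    also have "\<dots> = c * X" by (simp add: X_def sum_distrib_left power2_eq_square mult_ac)
    finally have au: "a u u = c * X" .
    have "q u u = (\<Sum>i<n. x i * (\<Sum>j<n. q (bs ! j) (bs ! i) * x j))"
      unfolding u_def by (rule psd_form_expand[OF V q mem])
    also have "\<dots> = X"
      unfolding X_def
    proof (intro sum.cong refl)
      fix i assume i: "i \<in> {..<n}"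
      have "(\<Sum>j<n. q (bs ! j) (bs ! i) * x j) = (\<Sum>j<n. if j = i then x j else 0)"
        using orth i by (intro sum.cong refl) (auto simp: n_def)
      then show "x i * (\<Sum>j<n. q (bs ! j) (bs ! i) * x j) = (x i)\<^sup>2" using i by (simp add: power2_eq_square)
    qed
    finally have qu: "q u u = X" .
    have "(x i0)\<^sup>2 \<le> X" unfolding X_def using x(1) by (intro member_le_sum) auto
    moreover have "0 < (x i0)\<^sup>2" using x(2) by simp
    ultimately have X: "0 < X" by linarith
    have "m * X \<le> c * X" "c * X \<le> M * X" using lower[OF u] upper[OF u] unfolding au qu by auto
    then show ?thesis using X by (simp add: mult_le_cancel_right)
  qed
  have min: "lambda_min A \<in> ?E" and max: "lambda_max A \<in> ?E"
    unfolding lambda_min_def lambda_max_def using Min_in[OF fin ne] Max_in[OF fin ne] by auto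
  show 1: "m \<le> lambda_min A" and 2: "lambda_max A \<le> M" using bounds min max by auto
  have "0 \<le> M" using bounds max m by fastforce
  then show "condition_number A \<le> M / m" unfolding condition_number_def using 1 2 m by (intro frac_le) auto
qed

section \<open>The statically condensed form\<close>

lemma restrict_faces_in_bdry_polys: "u \<in> bdry_polys \<F> k \<Longrightarrow> restrict_faces (faces_of \<F> T) u \<in> bdry_polys (faces_of \<F> T) k"
  by (auto simp: bdry_polys_def restrict_faces_def faces_of_def)

lemma restrict_faces_lincomb: "restrict_faces \<G> (a *\<^sub>R u + b *\<^sub>R v) = a *\<^sub>R restrict_faces \<G> u + b *\<^sub>R restrict_faces \<G> v"
  by (auto simp: restrict_faces_def plus_fun_def scaleR_fun_def fun_eq_iff)

text \<open>The span of the basis functions that index the matrix, for any choice of bases on the interior faces.\<close>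

definition interior_face_space :: "'a::euclidean_space set set \<Rightarrow> 'a set set \<Rightarrow> nat \<Rightarrow> ('a set \<Rightarrow> 'a \<Rightarrow> real) set" where
  "interior_face_space \<T> \<F> k = {u \<in> bdry_polys \<F> k. \<forall>F. F \<notin> interior_faces \<T> \<F> \<longrightarrow> u F = 0}"

lemma subspace_interior_face_space: "subspace (interior_face_space \<T> \<F> k)"
  using subspace_bdry_polys[of \<F> k]
  by (auto simp: subspace_def interior_face_space_def plus_fun_def scaleR_fun_def zero_fun_def)

locale stabilized_mesh = star_shaped_mesh +
  fixes k l :: nat and s :: "'a set \<Rightarrow> 'a hybrid \<Rightarrow> 'a hybrid \<Rightarrow> real" and Ca Cs :: real
  assumes Ca: "0 < Ca" and Cs: "0 < Cs"
    and s_psd: "T \<in> \<T> \<Longrightarrow> symmetric_psd_bilinear_on (hybrid_space (faces_of \<F> T) k l) (s T)"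
    and S1: "T \<in> \<T> \<Longrightarrow> stab_S1 Ca T (faces_of \<F> T) k l (s T)"
    and S3: "T \<in> \<T> \<Longrightarrow> stab_S3 Cs T (faces_of \<F> T) k l (s T)"
    and S4: "T \<in> \<T> \<Longrightarrow> stab_S4 Cs T (faces_of \<F> T) k l (s T)"
begin

definition condensed_function :: "('a set \<Rightarrow> 'a \<Rightarrow> real) \<Rightarrow> 'a set \<Rightarrow> 'a hybrid" where
  "condensed_function u T = (condense T (faces_of \<F> T) k l (s T) (restrict_faces (faces_of \<F> T) u), restrict_faces (faces_of \<F> T) u)"

lemma condensed_form_energy:
  assumes u: "u \<in> bdry_polys \<F> k" and v: "v \<in> bdry_polys \<F> k"
  shows "condensed_form \<T> \<F> k l s u v = (\<Sum>T\<in>\<T>. local_form T (faces_of \<F> T) k (s T) (condensed_function u T) (condensed_function v T))"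
  unfolding condensed_form_def Let_def
proof (rule sum.cong[OF refl])
  fix T assume T: "T \<in> \<T>"
  interpret E: star_shaped_element T "faces_of \<F> T" \<rho> by (rule star_shaped_element[OF T])
  show "local_form T (faces_of \<F> T) k (s T) (condense T (faces_of \<F> T) k l (s T) (restrict_faces (faces_of \<F> T) u), restrict_faces (faces_of \<F> T) u) (0, restrict_faces (faces_of \<F> T) v) =
      local_form T (faces_of \<F> T) k (s T) (condensed_function u T) (condensed_function v T)"
    unfolding condensed_function_def
    by (rule E.condensed_form_eq[OF s_psd[OF T] S1[OF T] Ca restrict_faces_in_bdry_polys[OF u] restrict_faces_in_bdry_polys[OF v]])
qed

lemma condensed_function_mem:
  assumes "T \<in> \<T>" "u \<in> bdry_polys \<F> k"
  shows "condensed_function u T \<in> hybrid_space (faces_of \<F> T) k l"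
proof -
  interpret E: star_shaped_element T "faces_of \<F> T" \<rho> by (rule star_shaped_element[OF assms(1)])
  show ?thesis
    unfolding condensed_function_def
    by (rule E.condensed_in_hybrid_space[OF s_psd[OF assms(1)] S1[OF assms(1)] Ca restrict_faces_in_bdry_polys[OF assms(2)]])
qed

lemma local_form_psd_element: "T \<in> \<T> \<Longrightarrow> symmetric_psd_bilinear_on (hybrid_space (faces_of \<F> T) k l) (local_form T (faces_of \<F> T) k (s T))"
  using star_shaped_element s_psd mesh_element.local_form_psd star_shaped_element.axioms(1) by blast

text \<open>Linearity in the second argument is immediate from the definition, and the first argument
  inherits it by symmetry.\<close>

lemma condensed_form_psd: "symmetric_psd_bilinear_on (bdry_polys \<F> k) (condensed_form \<T> \<F> k l s)"
proof -
  have sym: "condensed_form \<T> \<F> k l s u v = condensed_form \<T> \<F> k l s v u" if "u \<in> bdry_polys \<F> k" "v \<in> bdry_polys \<F> k" for u v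
    unfolding condensed_form_energy[OF that] condensed_form_energy[OF that(2,1)]
    using that by (intro sum.cong refl psd_form_sym[OF local_form_psd_element] condensed_function_mem)
  have lin: "condensed_form \<T> \<F> k l s w (a *\<^sub>R u + b *\<^sub>R v) = a * condensed_form \<T> \<F> k l s w u + b * condensed_form \<T> \<F> k l s w v"
    if m: "u \<in> bdry_polys \<F> k" "v \<in> bdry_polys \<F> k" "w \<in> bdry_polys \<F> k" for u v w a b
    unfolding condensed_form_def Let_def sum_distrib_left sum.distrib[symmetric]
  proof (rule sum.cong[OF refl])
    fix T assume T: "T \<in> \<T>"
    let ?r = "restrict_faces (faces_of \<F> T)"
    have pair: "(0, ?r (a *\<^sub>R u + b *\<^sub>R v)) = a *\<^sub>R (0, ?r u) + b *\<^sub>R (0 :: 'a \<Rightarrow> real, ?r v)"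
      by (simp add: restrict_faces_lincomb)
    show "local_form T (faces_of \<F> T) k (s T) (condense T (faces_of \<F> T) k l (s T) (?r w), ?r w) (0, ?r (a *\<^sub>R u + b *\<^sub>R v)) =
        a * local_form T (faces_of \<F> T) k (s T) (condense T (faces_of \<F> T) k l (s T) (?r w), ?r w) (0, ?r u) +
        b * local_form T (faces_of \<F> T) k (s T) (condense T (faces_of \<F> T) k l (s T) (?r w), ?r w) (0, ?r v)"
      unfolding pair
      by (rule psd_form_lincomb_right[OF subspace_hybrid_space local_form_psd_element[OF T]
          hybrid_pair_mem(3)[OF restrict_faces_in_bdry_polys[OF m(1)]] hybrid_pair_mem(3)[OF restrict_faces_in_bdry_polys[OF m(2)]]
          condensed_function_mem[OF T m(3), unfolded condensed_function_def]])
  qed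
  show ?thesis
    unfolding symmetric_psd_bilinear_on_def
  proof (intro conjI ballI allI)
    fix u v w a b assume m: "u \<in> bdry_polys \<F> k" "v \<in> bdry_polys \<F> k" "w \<in> bdry_polys \<F> k"
    have "a *\<^sub>R u + b *\<^sub>R v \<in> bdry_polys \<F> k" using m subspace_bdry_polys by (intro subspace_add subspace_scale)
    from sym[OF this m(3)] show "condensed_form \<T> \<F> k l s (a *\<^sub>R u + b *\<^sub>R v) w = a * condensed_form \<T> \<F> k l s u w + b * condensed_form \<T> \<F> k l s v w"
      using lin[OF m, of a b] sym[OF m(3,1)] sym[OF m(3,2)] by simp
  next
    fix u assume u: "u \<in> bdry_polys \<F> k"
    show "0 \<le> condensed_form \<T> \<F> k l s u u"
      unfolding condensed_form_energy[OF u u]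
      by (intro sum_nonneg psd_form_nonneg[OF local_form_psd_element] condensed_function_mem u)
  qed (rule sym)
qed

definition face_norm_form :: "('a set \<Rightarrow> 'a \<Rightarrow> real) \<Rightarrow> ('a set \<Rightarrow> 'a \<Rightarrow> real) \<Rightarrow> real" where
  "face_norm_form u v = (\<Sum>F\<in>interior_faces \<T> \<F>. face_inner F (u F) (v F))"

lemma face_norm_form_psd: "symmetric_psd_bilinear_on (bdry_polys \<F> k) face_norm_form"
  unfolding symmetric_psd_bilinear_on_def
proof (intro conjI ballI allI)
  fix u v w a b assume m: "u \<in> bdry_polys \<F> k" "v \<in> bdry_polys \<F> k" "w \<in> bdry_polys \<F> k"
  show "face_norm_form (a *\<^sub>R u + b *\<^sub>R v) w = a * face_norm_form u w + b * face_norm_form v w"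
    unfolding face_norm_form_def sum_distrib_left sum.distrib[symmetric]
  proof (rule sum.cong[OF refl])
    fix F assume "F \<in> interior_faces \<T> \<F>"
    then have F: "F \<in> \<F>" by (simp add: interior_faces_def)
    have "(a *\<^sub>R u + b *\<^sub>R v) F = a *\<^sub>R u F + b *\<^sub>R v F" by (simp add: plus_fun_def scaleR_fun_def)
    then show "face_inner F ((a *\<^sub>R u + b *\<^sub>R v) F) (w F) = a * face_inner F (u F) (w F) + b * face_inner F (v F) (w F)"
      using psd_form_lincomb_left[OF face_inner_psd[OF face_flat[OF F]], of "u F" k "v F" "w F" a b] m F by (simp add: bdry_polys_def)
  qed
next
  show "face_norm_form u v = face_norm_form v u" for u v
    unfolding face_norm_form_def by (intro sum.cong refl face_inner_commute)
  show "0 \<le> face_norm_form u u" for u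
    unfolding face_norm_form_def by (intro sum_nonneg face_inner_nonneg)
qed

lemma interior_face_space_mem:
  assumes "u \<in> interior_face_space \<T> \<F> k"
  shows "u \<in> bdry_polys \<F> k" "F \<in> \<F> \<Longrightarrow> continuous_on UNIV (u F)" "F \<notin> interior_faces \<T> \<F> \<Longrightarrow> u F = 0"
    "F \<notin> interior_faces \<T> \<F> \<Longrightarrow> face_normsq F (u F) = 0"
  using assms continuous_on_face_polys[of "u F" F k]
  by (auto simp: interior_face_space_def bdry_polys_def face_inner_def set_lebesgue_integral_def)

text \<open>The condensed functions have the boundary values \<open>u\<close>, so their potentials can be inserted in
  the bound for the weighted face norms.\<close>

lemma condensed_form_lower_bound:
  assumes u: "u \<in> interior_face_space \<T> \<F> k"
  shows "H_min \<T> \<F> * face_norm_form u u \<le> trace_energy_const * potential_const \<rho> DIM('a) * Cs * condensed_form \<T> \<F> k l s u u"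
proof -
  note u' = interior_face_space_mem[OF u]
  define p where "p T = potential T (faces_of \<F> T) k (condensed_function u T)" for T
  define R where "R T = elem_normsq T (grad (p T)) +
      inverse (diameter T) * (\<Sum>F\<in>faces_of \<F> T. face_normsq F (\<lambda>x. p T x - u F x))" for T
  have p: "p T \<in> elem_polys (k + 1)"
    and R: "R T \<le> potential_const \<rho> DIM('a) * Cs * local_form T (faces_of \<F> T) k (s T) (condensed_function u T) (condensed_function u T)"
    if T: "T \<in> \<T>" for T
  proof -
    interpret E: star_shaped_element T "faces_of \<F> T" \<rho> by (rule star_shaped_element[OF T])
    note mem = condensed_function_mem[OF T u'(1)]
    show "p T \<in> elem_polys (k + 1)" unfolding p_def by (rule E.potential_in_elem_polys[OF hybrid_space_continuous[OF mem]])
    have "snd (condensed_function u T) F = u F" if "F \<in> faces_of \<F> T" for F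
      using that by (simp add: condensed_function_def restrict_faces_def)
    then show "R T \<le> potential_const \<rho> DIM('a) * Cs * local_form T (faces_of \<F> T) k (s T) (condensed_function u T) (condensed_function u T)"
      using E.potential_boundary_gap[OF mem S3[OF T]] unfolding R_def p_def by simp
  qed
  have "H_min \<T> \<F> * face_norm_form u u \<le> (\<Sum>T\<in>\<T>. diameter T * (\<Sum>F\<in>faces_of \<F> T. face_normsq F (u F)))"
    unfolding face_norm_form_def by (rule H_min_bound[where g = "\<lambda>F. face_normsq F (u F)"]) (auto intro: u'(4) face_inner_nonneg)
  also have "\<dots> \<le> trace_energy_const * (\<Sum>T\<in>\<T>. R T)"
    unfolding R_def by (rule weighted_face_norm_bound[OF p u'(2,3)])
  also have "\<dots> \<le> trace_energy_const * (\<Sum>T\<in>\<T>. potential_const \<rho> DIM('a) * Cs * local_form T (faces_of \<F> T) k (s T) (condensed_function u T) (condensed_function u T))"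
    by (intro mult_left_mono sum_mono R trace_energy_const_nonneg)
  also have "\<dots> = trace_energy_const * potential_const \<rho> DIM('a) * Cs * condensed_form \<T> \<F> k l s u u"
    unfolding condensed_form_energy[OF u'(1) u'(1)] by (simp add: sum_distrib_left mult.assoc)
  finally show ?thesis .
qed

lemma condensed_form_upper_bound:
  assumes u: "u \<in> interior_face_space \<T> \<F> k"
  shows "condensed_form \<T> \<F> k l s u u \<le>
    Cs * (4 * potential_const \<rho> DIM('a) * trace_const \<rho> DIM('a) + 2) * (real k + 1)\<^sup>2 * inverse (H_max \<T> \<F>) * face_norm_form u u"
proof -
  note u' = interior_face_space_mem[OF u]
  define K where "K = Cs * (4 * potential_const \<rho> DIM('a) * trace_const \<rho> DIM('a) + 2) * (real k + 1)\<^sup>2"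
  have K: "0 \<le> K"
    using Cs trace_const_pos[OF \<rho>, of "DIM('a)"] potential_const_ge_one[OF \<rho>, of "DIM('a)"] by (simp add: K_def)
  have "condensed_form \<T> \<F> k l s u u \<le> (\<Sum>T\<in>\<T>. K * (inverse (diameter T) * (\<Sum>F\<in>faces_of \<F> T. face_normsq F (u F))))"
    unfolding condensed_form_energy[OF u'(1) u'(1)]
  proof (rule sum_mono)
    fix T assume T: "T \<in> \<T>"
    interpret E: star_shaped_element T "faces_of \<F> T" \<rho> by (rule star_shaped_element[OF T])
    let ?r = "restrict_faces (faces_of \<F> T) u"
    note r = restrict_faces_in_bdry_polys[OF u'(1), of T]
    have "local_form T (faces_of \<F> T) k (s T) (condensed_function u T) (condensed_function u T) \<le> local_form T (faces_of \<F> T) k (s T) (0, ?r) (0, ?r)"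
      unfolding condensed_function_def by (rule E.condensed_energy_le[OF s_psd[OF T] S1[OF T] Ca r])
    also have "\<dots> \<le> K * inverse (diameter T) * bdry_inner (faces_of \<F> T) ?r ?r"
      unfolding K_def by (rule E.boundary_energy_bound[OF r S4[OF T] Cs])
    also have "bdry_inner (faces_of \<F> T) ?r ?r = (\<Sum>F\<in>faces_of \<F> T. face_normsq F (u F))"
      unfolding bdry_inner_def by (intro sum.cong refl) (simp add: restrict_faces_def)
    finally show "local_form T (faces_of \<F> T) k (s T) (condensed_function u T) (condensed_function u T) \<le>
        K * (inverse (diameter T) * (\<Sum>F\<in>faces_of \<F> T. face_normsq F (u F)))" by (simp add: mult.assoc)
  qed
  also have "\<dots> = K * (\<Sum>T\<in>\<T>. inverse (diameter T) * (\<Sum>F\<in>faces_of \<F> T. face_normsq F (u F)))"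
    by (rule sum_distrib_left[symmetric])
  also have "\<dots> \<le> K * (inverse (H_max \<T> \<F>) * face_norm_form u u)"
    unfolding face_norm_form_def
    by (intro mult_left_mono K H_max_bound[where g = "\<lambda>F. face_normsq F (u F)"]) (auto intro: u'(4) face_inner_nonneg)
  finally show ?thesis by (simp add: K_def mult.assoc)
qed

lemma orthonormal_basis_enumeration:
  assumes ne: "interior_faces \<T> \<F> \<noteq> {}" and B: "\<forall>F\<in>interior_faces \<T> \<F>. orthonormal_face_basis F k (B F)"
    and bs: "enumerates_face_basis \<T> \<F> B bs"
  shows "set bs \<subseteq> interior_face_space \<T> \<F> k" and "bs \<noteq> []"
    and "i < length bs \<Longrightarrow> j < length bs \<Longrightarrow> face_norm_form (bs ! i) (bs ! j) = (if i = j then 1 else 0)"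
proof -
  let ?e = "\<lambda>F (b :: 'a \<Rightarrow> real) G. if G = F then b else 0"
  have set: "set bs = {?e F b | F b. F \<in> interior_faces \<T> \<F> \<and> b \<in> B F}" and dist: "distinct bs"
    using bs by (auto simp: enumerates_face_basis_def)
  have zero: "0 \<in> face_polys F k" for F :: "'a set" by (rule subspace_0[OF subspace_face_polys])
  show "set bs \<subseteq> interior_face_space \<T> \<F> k"
  proof
    fix e assume "e \<in> set bs"
    then obtain F b where F: "F \<in> interior_faces \<T> \<F>" and b: "b \<in> B F" and e: "e = ?e F b" using set by blast
    have "b \<in> face_polys F k" using B[rule_format, OF F] b span_base by (auto simp: orthonormal_face_basis_def)
    then show "e \<in> interior_face_space \<T> \<F> k" using F zero by (auto simp: e interior_face_space_def bdry_polys_def interior_faces_def)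
  qed
  obtain F where F: "F \<in> interior_faces \<T> \<F>" using ne by blast
  have "B F \<noteq> {}"
  proof
    assume "B F = {}"
    then have "face_polys F k = {0}" using B[rule_format, OF F] by (simp add: orthonormal_face_basis_def)
    moreover have "(\<lambda>x. 1) \<in> face_polys F k" unfolding face_polys_def by (rule const_in_polys_in)
    ultimately show False by (simp add: fun_eq_iff)
  qed
  then show "bs \<noteq> []" using set F by auto
  assume ij: "i < length bs" "j < length bs"
  obtain F b where F: "F \<in> interior_faces \<T> \<F>" and b: "b \<in> B F" and i: "bs ! i = ?e F b"
    using nth_mem[OF ij(1)] unfolding set by blast
  obtain G c where G: "G \<in> interior_faces \<T> \<F>" and c: "c \<in> B G" and j: "bs ! j = ?e G c"
    using nth_mem[OF ij(2)] unfolding set by blast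
  have "face_norm_form (bs ! i) (bs ! j) = (\<Sum>H\<in>interior_faces \<T> \<F>. if H = F then (if G = F then face_inner F b c else 0) else 0)"
    unfolding face_norm_form_def i j
    by (intro sum.cong refl) (auto simp: face_inner_def set_lebesgue_integral_def)
  also have "\<dots> = (if G = F then face_inner F b c else 0)"
    using F finite_faces by (subst sum.delta) (auto simp: interior_faces_def)
  also have "\<dots> = (if G = F \<and> b = c then 1 else 0)" using B[rule_format, OF F] b c by (auto simp: orthonormal_face_basis_def)
  also have "\<dots> = (if i = j then 1 else 0)"
  proof -
    have "i = j \<longleftrightarrow> ?e F b = ?e G c" using nth_eq_iff_index_eq[OF dist ij] i j by simp
    also have "\<dots> \<longleftrightarrow> G = F \<and> b = c"
    proof
      assume eq: "?e F b = ?e G c"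
      have "b \<noteq> 0"
      proof
        assume "b = 0"
        moreover have "face_normsq F b = 1" using B[rule_format, OF F] b by (simp add: orthonormal_face_basis_def)
        ultimately show False by (simp add: face_inner_def set_lebesgue_integral_def)
      qed
      then show "G = F \<and> b = c" using fun_cong[OF eq, of F] by (auto split: if_splits)
    qed auto
    finally show ?thesis by simp
  qed
  finally show "face_norm_form (bs ! i) (bs ! j) = (if i = j then 1 else 0)" .
qed

text \<open>As both constants are at least one, their product serves for all three estimates.\<close>

lemma condensed_matrix_bounds:
  assumes ne: "interior_faces \<T> \<F> \<noteq> {}" and B: "\<forall>F\<in>interior_faces \<T> \<F>. orthonormal_face_basis F k (B F)"
    and bs: "enumerates_face_basis \<T> \<F> B bs"
    and C1: "trace_energy_const * potential_const \<rho> DIM('a) * Cs \<le> C1" "1 \<le> C1"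
    and C2: "Cs * (4 * potential_const \<rho> DIM('a) * trace_const \<rho> DIM('a) + 2) \<le> C2" "1 \<le> C2"
  defines "A \<equiv> matrix_of_form (condensed_form \<T> \<F> k l s) bs"
  shows "inverse (C1 * C2) * H_min \<T> \<F> \<le> lambda_min A"
    and "lambda_max A \<le> C1 * C2 * (real k + 1)\<^sup>2 * inverse (H_max \<T> \<F>)"
    and "condition_number A \<le> C1 * C2 * (real k + 1)\<^sup>2 * inverse (H_max \<T> \<F>) * inverse (H_min \<T> \<F>)"
proof -
  let ?V = "interior_face_space \<T> \<F> k"
  define m where "m = H_min \<T> \<F> / C1"
  define M where "M = C2 * (real k + 1)\<^sup>2 * inverse (H_max \<T> \<F>)"
  have sub: "?V \<subseteq> bdry_polys \<F> k" by (auto simp: interior_face_space_def)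
  note a = psd_form_mono[OF condensed_form_psd sub] and q = psd_form_mono[OF face_norm_form_psd sub]
  have Hmin: "0 < H_min \<T> \<F>" and Hmax: "0 < inverse (H_max \<T> \<F>)" using H_min_pos[OF ne] inverse_H_max_pos[OF ne] .
  have m: "0 < m" using Hmin C1 by (simp add: m_def)
  have lower: "m * face_norm_form u u \<le> condensed_form \<T> \<F> k l s u u" if u: "u \<in> ?V" for u
  proof -
    have "H_min \<T> \<F> * face_norm_form u u \<le> C1 * condensed_form \<T> \<F> k l s u u"
      using condensed_form_lower_bound[OF u] mult_right_mono[OF C1(1) psd_form_nonneg[OF a u]] by linarith
    then show ?thesis using C1(2) by (simp add: m_def field_simps)
  qed
  have upper: "condensed_form \<T> \<F> k l s u u \<le> M * face_norm_form u u" if u: "u \<in> ?V" for u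
  proof -
    have "0 \<le> (real k + 1)\<^sup>2 * inverse (H_max \<T> \<F>) * face_norm_form u u"
      using Hmax psd_form_nonneg[OF q u] by (intro mult_nonneg_nonneg) auto
    from mult_right_mono[OF C2(1) this]
    have "Cs * (4 * potential_const \<rho> DIM('a) * trace_const \<rho> DIM('a) + 2) * (real k + 1)\<^sup>2 * inverse (H_max \<T> \<F>) * face_norm_form u u
        \<le> M * face_norm_form u u" by (simp only: M_def mult.assoc)
    with condensed_form_upper_bound[OF u] show ?thesis by (rule order_trans)
  qed
  note basis = orthonormal_basis_enumeration[OF ne B bs]
  have bounds: "m \<le> lambda_min A" "lambda_max A \<le> M" "condition_number A \<le> M / m"
    unfolding A_def
    by (rule orthonormal_matrix_eigenvalue_bounds[where V = ?V and q = face_norm_form and m = m and M = M];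
        fact subspace_interior_face_space a q basis lower upper m)+
  have "inverse (C1 * C2) * H_min \<T> \<F> \<le> inverse C1 * H_min \<T> \<F>"
    using C1 C2 Hmin by (intro mult_right_mono le_imp_inverse_le) (auto simp: mult_le_cancel_left1)
  then show "inverse (C1 * C2) * H_min \<T> \<F> \<le> lambda_min A" using bounds(1) by (simp add: m_def divide_inverse mult.commute)
  have "1 * M \<le> C1 * M" using C1(2) C2 Hmax by (intro mult_right_mono) (auto simp: M_def)
  then show "lambda_max A \<le> C1 * C2 * (real k + 1)\<^sup>2 * inverse (H_max \<T> \<F>)" using bounds(2) by (simp add: M_def mult.assoc)
  show "condition_number A \<le> C1 * C2 * (real k + 1)\<^sup>2 * inverse (H_max \<T> \<F>) * inverse (H_min \<T> \<F>)"
    using bounds(3) by (simp add: M_def m_def divide_inverse mult_ac)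
qed

end

theorem theorem1:
  fixes \<Omega> :: "'a::euclidean_space set" and \<rho> Cs :: real
  assumes "2 \<le> DIM('a)" and "polytopal_domain \<Omega>" and "0 < \<rho>" and "0 < Cs"
  shows "\<exists>C>0. \<forall>\<H> \<T> \<F> (k::nat) (l::nat) s Ca.
    polytopal_mesh_family \<Omega> \<rho> \<H> \<T> \<F> \<and>
    int l \<ge> int k - 1 \<and>
    0 < Ca \<and>
    (\<forall>h\<in>\<H>. \<forall>T\<in>\<T> h.
       symmetric_psd_bilinear_on (hybrid_space (faces_of (\<F> h) T) k l) (s h T) \<and>
       stab_S1 Ca T (faces_of (\<F> h) T) k l (s h T) \<and>
       stab_S2 T (faces_of (\<F> h) T) k l (s h T) \<and>
       stab_S3 Cs T (faces_of (\<F> h) T) k l (s h T) \<and>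
       stab_S4 Cs T (faces_of (\<F> h) T) k l (s h T))
    \<longrightarrow>
    (\<forall>h\<in>\<H>. \<forall>B bs.
       interior_faces (\<T> h) (\<F> h) \<noteq> {} \<and>
       (\<forall>F\<in>interior_faces (\<T> h) (\<F> h). orthonormal_face_basis F k (B F)) \<and>
       enumerates_face_basis (\<T> h) (\<F> h) B bs
       \<longrightarrow>
       (let A = matrix_of_form (condensed_form (\<T> h) (\<F> h) k l (s h)) bs;
            Hmin = H_min (\<T> h) (\<F> h);
            Hmax = H_max (\<T> h) (\<F> h)
        in lambda_min A \<ge> inverse C * Hmin \<and>
           lambda_max A \<le> C * (real k + 1)\<^sup>2 * inverse Hmax \<and>
           condition_number A \<le> C * (real k + 1)\<^sup>2 * inverse Hmax * inverse Hmin))"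
proof -
  define C1 where "C1 = max 1 (star_shaped_mesh.trace_energy_const \<Omega> \<rho> * potential_const \<rho> DIM('a) * Cs)"
  define C2 where "C2 = max 1 (Cs * (4 * potential_const \<rho> DIM('a) * trace_const \<rho> DIM('a) + 2))"
  show ?thesis
  proof (intro exI[of _ "C1 * C2"] conjI allI impI ballI)
    show "0 < C1 * C2" by (simp add: C1_def C2_def)
    fix \<H> \<T> \<F> h B bs and k l :: nat and s :: "real \<Rightarrow> 'a set \<Rightarrow> 'a hybrid \<Rightarrow> 'a hybrid \<Rightarrow> real" and Ca :: real
    assume hyp: "polytopal_mesh_family \<Omega> \<rho> \<H> \<T> \<F> \<and> int l \<ge> int k - 1 \<and> 0 < Ca \<and>
      (\<forall>h\<in>\<H>. \<forall>T\<in>\<T> h. symmetric_psd_bilinear_on (hybrid_space (faces_of (\<F> h) T) k l) (s h T) \<and>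
       stab_S1 Ca T (faces_of (\<F> h) T) k l (s h T) \<and> stab_S2 T (faces_of (\<F> h) T) k l (s h T) \<and>
       stab_S3 Cs T (faces_of (\<F> h) T) k l (s h T) \<and> stab_S4 Cs T (faces_of (\<F> h) T) k l (s h T))"
      and h: "h \<in> \<H>"
      and basis: "interior_faces (\<T> h) (\<F> h) \<noteq> {} \<and> (\<forall>F\<in>interior_faces (\<T> h) (\<F> h). orthonormal_face_basis F k (B F)) \<and>
        enumerates_face_basis (\<T> h) (\<F> h) B bs"
    have mesh: "polytopal_mesh \<Omega> h (\<T> h) (\<F> h)" and star: "\<And>T. T \<in> \<T> h \<Longrightarrow> connected_by_star_shaped \<rho> T"
      using hyp h by (auto simp: polytopal_mesh_family_def)
    obtain \<A> where "arranged_mesh \<Omega> (\<T> h) (\<F> h) \<A>" using polytopal_mesh_arranged[OF assms(2) mesh] .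
    then interpret arranged_mesh \<Omega> "\<T> h" "\<F> h" \<A> .
    interpret stabilized_mesh \<Omega> "\<T> h" "\<F> h" \<A> \<rho> k l "s h" Ca Cs
      by unfold_locales (use hyp h star assms in auto)
    have "trace_energy_const * potential_const \<rho> DIM('a) * Cs \<le> C1" "1 \<le> C1"
      "Cs * (4 * potential_const \<rho> DIM('a) * trace_const \<rho> DIM('a) + 2) \<le> C2" "1 \<le> C2"
      by (simp_all add: C1_def C2_def)
    from condensed_matrix_bounds[OF _ _ _ this, of B bs] basis
    show "let A = matrix_of_form (condensed_form (\<T> h) (\<F> h) k l (s h)) bs; Hmin = H_min (\<T> h) (\<F> h); Hmax = H_max (\<T> h) (\<F> h)
        in lambda_min A \<ge> inverse (C1 * C2) * Hmin \<and> lambda_max A \<le> C1 * C2 * (real k + 1)\<^sup>2 * inverse Hmax \<and>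
           condition_number A \<le> C1 * C2 * (real k + 1)\<^sup>2 * inverse Hmax * inverse Hmin"
      unfolding Let_def by blast
  qed
qed

end
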